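(* Let $m$ be fixed and let the $X_{i,j}$ ($1\leq j\leq m$, $1\leq i\leq n_j$) be i.i.d. with a common distribution satisfying condition $\mathcal{C}_2(\gamma,\rho,A)$ (stated in the context) with $\rho<0$. Suppose that, as $n\to\infty$, $n_1/n_j\to b_j\in(0,\infty)$ and $k_1/k_j\to c_j\in(0,\infty)$ for any $j\in\{1,\ldots,m\}$, and that $k=\sum_{j=1}^mk_j\to\infty$ with $k/n\to0$ and $\sqrt{k}A(n/k)\to\lambda\in\mathbb{R}$. Let $p=p(n)\to0$ be such that $k/(np)\to\infty$ and $\sqrt{k}/\log(k/(np))\to\infty$ as $n\to\infty$. Let $\boldsymbol{\omega}\in\mathbb{R}^m$ and random vectors $\widehat{\boldsymbol{\omega}}_n$ be such that $\widehat{\boldsymbol{\omega}}_n^\top\boldsymbol{1}=1$ and $\widehat{\boldsymbol{\omega}}_n\stackrel{\mathbb{P}}{\longrightarrow}\boldsymbol{\omega}$. Set $d_j=(c_j/b_j)\times(\sum_{i=1}^mc_i^{-1})/(\sum_{i=1}^mb_i^{-1})$. Then $$\frac{\sqrt{k}}{\log(k/(np))}\left(\frac{\widehat{q}_n^\star(1-p|\widehat{\boldsymbol{\omega}}_n)}{q(1-p)}-1\right)=\sqrt{k}(\widehat{\gamma}_n(\boldsymbol{\omega})-\gamma)+\operatorname{o}_{\mathbb{P}}(1)\stackrel{d}{\longrightarrow}\mathcal{N}\left(\frac{\lambda}{1-\rho}\sum_{j=1}^md_j^\rho\omega_j,\ \gamma^2\sum_{j=1}^m\frac1{c_j}\sum_{j=1}^mc_j\omega_j^2\right).$$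 If moreover $k_j/n_j=(k/n)(1+\operatorname{O}(1/\sqrt{k}))$ for any $j\in\{1,\ldots,m\}$, then, with $\widetilde{\boldsymbol{\omega}}_n^{(\mathrm{Var})}=(k_1/k,\ldots,k_m/k)^\top$, $\widehat{q}_n^\star(1-p|\widetilde{\boldsymbol{\omega}}_n^{(\mathrm{Var})})$ is $\sqrt{k}/\log(k/(np))$-asymptotically equivalent to $\widehat{q}_n^{\star,(\mathrm{Hill})}(1-p|k)$, i.e. $$\frac{\sqrt{k}}{\log(k/(np))}\left(\frac{\widehat{q}_n^\star(1-p|\widetilde{\boldsymbol{\omega}}_n^{(\mathrm{Var})})}{q(1-p)}-\frac{\widehat{q}_n^{\star,(\mathrm{Hill})}(1-p|k)}{q(1-p)}\right)=\operatorname{o}_{\mathbb{P}}(1).$$ Finally, suppose that the $b_j/c_j$ are not all equal to 1, that in addition $A(t)=\gamma\beta t^\rho$ and that, for all $j$, $\widehat{\beta}_j$ is a consistent estimator of $\beta$ and $(\widehat{\rho}_j-\rho)\log n_j=\operatorname{o}_{\mathbb{P}}(1)$. Then $\widehat{q}_n^\star(1-p|\widetilde{\boldsymbol{\omega}}_n^{(\mathrm{AMSE})})$ has a smaller AMSE than $\widehat{q}_n^{\star,(\mathrm{Hill})}(1-p|k)$ if and only if $|\lambda|>\lambda_0$, where $$\lambda_0=\gamma(1-\rho)\sqrt{\frac{S_\rho^2-S_0^2}{S_0S_{2\rho}-S_\rho^2}},\qquad S_\alpha=\sum_{j=1}^md_j^\alpha/c_j.$$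
   Context: Here $n_j=n_j(n)$, $n=\sum_{j=1}^mn_j$ is the total sample size, $k_j=k_j(n)\geq1$ are integers, and $\boldsymbol{1}$ is the vector of ones in $\mathbb{R}^m$. The common distribution function $F$ is continuous, with quantile function $q$ and tail quantile function $U(t)=\inf\{x\in\mathbb{R}:1/(1-F(x))\geq t\}$, so $q(1-p)=U(1/p)$. Condition $\mathcal{C}_2(\gamma,\rho,A)$: $\gamma>0$, $\rho\leq0$, $A$ has constant sign and converges to $0$ at infinity, and for all $x>0$, $\lim_{t\to\infty}\frac{1}{A(t)}\left[\frac{U(tx)}{U(t)}-x^\gamma\right]=x^\gamma\frac{x^\rho-1}{\rho}$ (read as $x^\gamma\log x$ if $\rho=0$). With $X_{1:n_j,j}\leq\cdots\leq X_{n_j:n_j,j}$ the order statistics of the $j$th subsample and $X_{1:n}\leq\cdots\leq X_{n:n}$ those of the combined sample of all $n$ observations, $\widehat{\gamma}_j(k_j)=k_j^{-1}\sum_{i=1}^{k_j}\log(X_{n_j-i+1:n_j,j}/X_{n_j-k_j:n_j,j})$, $\widehat{\gamma}_n(\boldsymbol{\omega})=\sum_{j=1}^m\omega_j\widehat{\gamma}_j(k_j)$, $\widehat{\gamma}_n^{(\mathrm{Hill})}(k)=k^{-1}\sum_{i=1}^k\log(X_{n-i+1:n}/X_{n-k:n})$, and $$\widehat{q}_n^\star(1-p|\boldsymbol{\omega})=\prod_{j=1}^m\left[\left(\frac{k_j}{n_jp}\right)^{\widehat{\gamma}_j(k_j)}X_{n_j-k_j:n_j,j}\right]^{\omega_j},\qquad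 \widehat{q}_n^{\star,(\mathrm{Hill})}(1-p|k)=\left(\frac{k}{np}\right)^{\widehat{\gamma}_n^{(\mathrm{Hill})}(k)}X_{n-k:n}.$$ AMSE of an estimator $\widehat{q}$ of $q(1-p)$ such that $\frac{\sqrt{k}}{\log(k/(np))}(\widehat{q}/q(1-p)-1)\stackrel{d}{\longrightarrow}\mathcal{N}(\mu,\sigma^2)$: it is $\frac{\log^2(k/(np))}{k}(\mu^2+\sigma^2)$ (asymptotic mean squared relative error). Estimated AMSE weights: $\widehat{\beta}_n(\boldsymbol{\omega})=\sum_{j=1}^m\omega_j\widehat{\beta}_j$, $\widehat{\rho}_n(\boldsymbol{\omega})=\sum_{j=1}^m\omega_j\widehat{\rho}_j$; $\widehat{\boldsymbol{\omega}}_\gamma,\widehat{\boldsymbol{\omega}}_\beta,\widehat{\boldsymbol{\omega}}_\rho$ are three possibly random weight vectors in $\mathbb{R}^m$, each with components summing to 1 and converging in probability to a nonrandom vector; $$\widetilde{\boldsymbol{B}}_{\boldsymbol{c}}=\sqrt{k}\,\frac{\widehat{\gamma}_n(\widehat{\boldsymbol{\omega}}_\gamma)\widehat{\beta}_n(\widehat{\boldsymbol{\omega}}_\beta)}{1-\widehat{\rho}_n(\widehat{\boldsymbol{\omega}}_\rho)}\left(\left(\frac{n_1}{k_1}\right)^{\widehat{\rho}_n(\widehat{\boldsymbol{\omega}}_\rho)},\ldots,\left(\frac{n_m}{k_m}\right)^{\widehat{\rho}_n(\widehat{\boldsymbol{\omega}}_\rho)}\right)^\top,\quad \widetilde{\mathbf{V}}_{\boldsymbol{c}}=k\,\widehat{\gamma}_n^2(\widehat{\boldsymbol{\omega}}_\gamma)\operatorname{diag}(1/k_1,\ldots,1/k_m),$$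 $$\widetilde{\boldsymbol{\omega}}_n^{(\mathrm{AMSE})}=\frac{(1+\widetilde{\boldsymbol{B}}_{\boldsymbol{c}}^\top\widetilde{\mathbf{V}}_{\boldsymbol{c}}^{-1}\widetilde{\boldsymbol{B}}_{\boldsymbol{c}})\widetilde{\mathbf{V}}_{\boldsymbol{c}}^{-1}\boldsymbol{1}-(\boldsymbol{1}^\top\widetilde{\mathbf{V}}_{\boldsymbol{c}}^{-1}\widetilde{\boldsymbol{B}}_{\boldsymbol{c}})\widetilde{\mathbf{V}}_{\boldsymbol{c}}^{-1}\widetilde{\boldsymbol{B}}_{\boldsymbol{c}}}{(1+\widetilde{\boldsymbol{B}}_{\boldsymbol{c}}^\top\widetilde{\mathbf{V}}_{\boldsymbol{c}}^{-1}\widetilde{\boldsymbol{B}}_{\boldsymbol{c}})(\boldsymbol{1}^\top\widetilde{\mathbf{V}}_{\boldsymbol{c}}^{-1}\boldsymbol{1})-(\boldsymbol{1}^\top\widetilde{\mathbf{V}}_{\boldsymbol{c}}^{-1}\widetilde{\boldsymbol{B}}_{\boldsymbol{c}})^2}.$$ *)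

theory Defs
  imports "HOL-Probability.Probability" "HOL-Library.Landau_Symbols" "HOL-Library.Multiset"
begin

section \<open>Convergence in probability and in distribution\<close>

text \<open>Measurability is part of both notions: the library assigns measure 0 to a non-measurable
  set, so the limits alone could hold for degenerate reasons.\<close>

definition tendsto_in_prob :: "'a measure \<Rightarrow> (nat \<Rightarrow> 'a \<Rightarrow> 'b::metric_space) \<Rightarrow> 'b \<Rightarrow> bool" where
  "tendsto_in_prob M Y c \<longleftrightarrow>
     (\<forall>n. Y n \<in> borel_measurable M) \<and>
     (\<forall>e>0. (\<lambda>n. measure M {w \<in> space M. dist (Y n w) c > e}) \<longlonglongrightarrow> 0)"

abbreviation little_o_prob :: "'a measure \<Rightarrow> (nat \<Rightarrow> 'a \<Rightarrow> real) \<Rightarrow> bool" where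
  "little_o_prob M Y \<equiv> tendsto_in_prob M Y 0"

definition tendsto_in_distr :: "'a measure \<Rightarrow> (nat \<Rightarrow> 'a \<Rightarrow> real) \<Rightarrow> real measure \<Rightarrow> bool" where
  "tendsto_in_distr M Y L \<longleftrightarrow>
     (\<forall>n. Y n \<in> borel_measurable M) \<and> weak_conv_m (\<lambda>n. distr M borel (Y n)) L"

text \<open>The second parameter is the variance, whereas \<^const>\<open>normal_density\<close> takes the standard
  deviation.\<close>

definition normal_distr :: "real \<Rightarrow> real \<Rightarrow> real measure" where
  "normal_distr \<mu> v = density lborel (normal_density \<mu> (sqrt v))"


section \<open>Quantiles and the second-order condition\<close>

definition quantile :: "(real \<Rightarrow> real) \<Rightarrow> real \<Rightarrow> real" where
  "quantile F u = Inf {x. u \<le> F x}"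

text \<open>The case \<open>F x = 1\<close> is the convention \<open>1 / 0 = \<infinity>\<close>.\<close>

definition tail_quantile :: "(real \<Rightarrow> real) \<Rightarrow> real \<Rightarrow> real" where
  "tail_quantile F t = Inf {x. F x = 1 \<or> 1 / (1 - F x) \<ge> t}"

lemma quantile_eq_tail_quantile:
  assumes "\<And>x. F x \<le> 1" "0 < p"
  shows "quantile F (1 - p) = tail_quantile F (1 / p)"
proof -
  have "1 - p \<le> F x \<longleftrightarrow> F x = 1 \<or> 1 / (1 - F x) \<ge> 1 / p" for x
    using assms(1)[of x] assms(2) by (cases "F x = 1") (auto simp: field_simps)
  then show ?thesis
    by (simp add: quantile_def tail_quantile_def)
qed

definition second_order_cond ::
    "(real \<Rightarrow> real) \<Rightarrow> real \<Rightarrow> real \<Rightarrow> (real \<Rightarrow> real) \<Rightarrow> bool" where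
  "second_order_cond F \<gamma> \<rho> A \<longleftrightarrow>
     \<gamma> > 0 \<and> \<rho> \<le> 0 \<and>
     (eventually (\<lambda>t. A t > 0) at_top \<or> eventually (\<lambda>t. A t < 0) at_top) \<and>
     (A \<longlongrightarrow> 0) at_top \<and>
     (\<forall>x>0. ((\<lambda>t. 1 / A t * (tail_quantile F (t * x) / tail_quantile F t - x powr \<gamma>))
              \<longlongrightarrow> x powr \<gamma> * (if \<rho> = 0 then ln x else (x powr \<rho> - 1) / \<rho>)) at_top)"


section \<open>Order statistics, Hill and Weissman estimators\<close>

text \<open>A finite sample is a family \<open>x\<close> over a finite index set \<open>I\<close>; \<open>order_stat I x i\<close> is the
  \<open>i\<close>-th smallest value, for \<open>1 \<le> i \<le> card I\<close>.\<close>

definition order_stat :: "'i set \<Rightarrow> ('i \<Rightarrow> real) \<Rightarrow> nat \<Rightarrow> real" where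
  "order_stat I x i = sorted_list_of_multiset (image_mset x (mset_set I)) ! (i - 1)"

definition hill :: "'i set \<Rightarrow> ('i \<Rightarrow> real) \<Rightarrow> nat \<Rightarrow> real" where
  "hill I x k =
     (\<Sum>i=1..k. ln (order_stat I x (card I - i + 1) / order_stat I x (card I - k))) / real k"

definition weissman :: "'i set \<Rightarrow> ('i \<Rightarrow> real) \<Rightarrow> nat \<Rightarrow> real \<Rightarrow> real" where
  "weissman I x k p =
     (real k / (real (card I) * p)) powr hill I x k * order_stat I x (card I - k)"

text \<open>The \<open>j\<close>-th subsample is \<open>x j i\<close> for \<open>i < ns j\<close>, and \<open>ks j\<close> is its effective sample size.\<close>

definition pooled_hill ::
    "('m::finite \<Rightarrow> nat) \<Rightarrow> ('m \<Rightarrow> nat) \<Rightarrow> ('m \<Rightarrow> nat \<Rightarrow> real) \<Rightarrow> real^'m \<Rightarrow> real" where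
  "pooled_hill ns ks x \<omega> = (\<Sum>j\<in>UNIV. \<omega> $ j * hill {..<ns j} (x j) (ks j))"

definition pooled_weissman ::
    "('m::finite \<Rightarrow> nat) \<Rightarrow> ('m \<Rightarrow> nat) \<Rightarrow> ('m \<Rightarrow> nat \<Rightarrow> real) \<Rightarrow> real \<Rightarrow> real^'m \<Rightarrow> real" where
  "pooled_weissman ns ks x p \<omega> =
     (\<Prod>j\<in>UNIV. weissman {..<ns j} (x j) (ks j) p powr (\<omega> $ j))"

definition combined_weissman ::
    "('m::finite \<Rightarrow> nat) \<Rightarrow> ('m \<Rightarrow> nat \<Rightarrow> real) \<Rightarrow> nat \<Rightarrow> real \<Rightarrow> real" where
  "combined_weissman ns x k p = weissman (SIGMA j:UNIV. {..<ns j}) (\<lambda>(j, i). x j i) k p"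


section \<open>Weights\<close>

definition var_weights :: "('m::finite \<Rightarrow> nat) \<Rightarrow> real^'m" where
  "var_weights ks = (\<chi> j. real (ks j) / real (\<Sum>i\<in>UNIV. ks i))"

definition diag_matrix :: "real^'m \<Rightarrow> real^'m^'m" where
  "diag_matrix d = (\<chi> i j. if i = j then d $ i else 0)"

definition bias_vector ::
    "('m::finite \<Rightarrow> nat) \<Rightarrow> ('m \<Rightarrow> nat) \<Rightarrow> real \<Rightarrow> real \<Rightarrow> real \<Rightarrow> real^'m" where
  "bias_vector ns ks g b r =
     (sqrt (real (\<Sum>i\<in>UNIV. ks i)) * (g * b / (1 - r))) *\<^sub>R
       (\<chi> j. (real (ns j) / real (ks j)) powr r)"

definition var_matrix :: "('m::finite \<Rightarrow> nat) \<Rightarrow> real \<Rightarrow> real^'m^'m" where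
  "var_matrix ks g =
     (real (\<Sum>i\<in>UNIV. ks i) * g\<^sup>2) *\<^sub>R diag_matrix (\<chi> j. 1 / real (ks j))"

definition amse_weights_of :: "real^'m \<Rightarrow> real^'m^'m \<Rightarrow> real^'m" where
  "amse_weights_of B V =
     (let W = matrix_inv V; one = vec 1 in
      (1 / ((1 + B \<bullet> (W *v B)) * (one \<bullet> (W *v one)) - (one \<bullet> (W *v B))\<^sup>2)) *\<^sub>R
      ((1 + B \<bullet> (W *v B)) *\<^sub>R (W *v one) - (one \<bullet> (W *v B)) *\<^sub>R (W *v B)))"

text \<open>\<open>\<omega>g\<close>, \<open>\<omega>b\<close>, \<open>\<omega>r\<close> pool the subsample estimators of the three parameters; the vectors \<open>\<beta>h\<close>
  and \<open>\<rho>h\<close> collect the subsample estimates of the second-order parameters.\<close>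

definition amse_weights ::
    "('m::finite \<Rightarrow> nat) \<Rightarrow> ('m \<Rightarrow> nat) \<Rightarrow> ('m \<Rightarrow> nat \<Rightarrow> real) \<Rightarrow>
     real^'m \<Rightarrow> real^'m \<Rightarrow> real^'m \<Rightarrow> real^'m \<Rightarrow> real^'m \<Rightarrow> real^'m" where
  "amse_weights ns ks x \<beta>h \<rho>h \<omega>g \<omega>b \<omega>r =
     (let g = pooled_hill ns ks x \<omega>g;
          b = (\<Sum>j\<in>UNIV. \<omega>b $ j * \<beta>h $ j);
          r = (\<Sum>j\<in>UNIV. \<omega>r $ j * \<rho>h $ j)
      in amse_weights_of (bias_vector ns ks g b r) (var_matrix ks g))"

definition weight_sequence :: "'a measure \<Rightarrow> (nat \<Rightarrow> 'a \<Rightarrow> real^'m::finite) \<Rightarrow> real^'m \<Rightarrow> bool" where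
  "weight_sequence M W \<omega> \<longleftrightarrow>
     (\<forall>n. AE w in M. (\<Sum>j\<in>UNIV. W n w $ j) = 1) \<and> tendsto_in_prob M W \<omega>"


section \<open>Asymptotic mean squared relative error\<close>

text \<open>\<open>a n\<close> is the AMSE of \<open>qhat n\<close> as an estimator of \<open>quantile F (1 - p n)\<close>; it is determined
  uniquely, since \<open>\<mu>\<close> and \<open>v\<close> are determined by the limit law.\<close>

definition has_AMSE ::
    "'a measure \<Rightarrow> (real \<Rightarrow> real) \<Rightarrow> (nat \<Rightarrow> nat) \<Rightarrow> (nat \<Rightarrow> real) \<Rightarrow>
     (nat \<Rightarrow> 'a \<Rightarrow> real) \<Rightarrow> (nat \<Rightarrow> real) \<Rightarrow> bool" where
  "has_AMSE M F k p qhat a \<longleftrightarrow>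
     (\<exists>\<mu> v. v > 0 \<and>
        tendsto_in_distr M
          (\<lambda>n w. sqrt (real (k n)) / ln (real (k n) / (real n * p n)) *
                 (qhat n w / quantile F (1 - p n) - 1))
          (normal_distr \<mu> v) \<and>
        (\<forall>n. a n = (ln (real (k n) / (real n * p n)))\<^sup>2 / real (k n) * (\<mu>\<^sup>2 + v)))"

end

theory Submission
  imports Defs
begin

text \<open>
  Convergence in probability is convergence along a filter on \<open>nat \<times> 'a\<close>, so the limit calculus of the
  library applies to it directly. With \<open>E = - ln (1 - F X)\<close> the observations become standard
  exponential, and under the second-order condition with \<open>\<rho> < 0\<close> the quantile function satisfies
  \<open>ln (U (exp s)) = f\<^sub>0 + \<gamma> s - g s\<close>, where \<open>g\<close> is regularly varying with exponent \<open>\<rho>\<close> (additively) and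
  \<open>g s \<sim> - A (exp s) / \<rho>\<close>.

  At the deterministic level \<open>s = ln (n / k)\<close>, a Bahadur representation of the threshold
  \<open>E\<^bsub>n-k:n\<^esub>\<close> cancels its randomness from the Hill estimator, and
  \<open>sqrt k (\<gamma>\<^sub>n - \<gamma>) = \<gamma> / sqrt k * (\<Sum>i. (E\<^sub>i - s - 1) 1{E\<^sub>i > s}) + bias + o\<^sub>P(1)\<close>.
  Everything follows from this expansion: the central limit theorem from characteristic functions
  of the independent summands; the Weissman estimators from the delta method, since the threshold and the
  extrapolation error are of smaller order than \<open>ln (k / (n p)) / sqrt k\<close>; the equivalence with the
  combined Hill estimator from an \<open>L\<^sup>2\<close> comparison of the summands at the levels \<open>ln (n\<^sub>j / k\<^sub>j)\<close> and
  \<open>ln (n / k)\<close>. The AMSE weights converge to the minimiser of \<open>(\<omega>\<^sup>T B)\<^sup>2 + \<omega>\<^sup>T V \<omega>\<close> subject to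
  \<open>\<omega>\<^sup>T 1 = 1\<close>, and the minimum is compared with \<open>(\<lambda> / (1 - \<rho>))\<^sup>2 + \<gamma>\<^sup>2\<close>.
\<close>

section \<open>Convergence in probability as convergence along a filter\<close>

text \<open>Representing the normalised spacings of each sample by fresh exponentials would treat
  one Hill estimator at a time, whereas the equivalence compares estimators built from overlapping
  order statistics. Keeping every expansion as a sum over the same variables \<open>E i\<close> at
  deterministic levels makes them comparable in mean square; the random threshold, which destroys
  independence, is traded for a level. The second-order condition is pointwise, but the threshold is
  random and the extrapolation reaches arbitrarily far. Local uniformity comes from measurability of
  \<open>g\<close>; the global bound comes from \<rho> < 0, since geometric decay along unit steps
  gives \<open>ln (Q s) - \<gamma> * s\<close> a finite limit \<open>f0\<close> and leaves an error
  controlled by \<open>g\<close> at the intermediate level. In the last claim, the logarithmic rate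
  for the estimates of \<rho> lets the estimated power of n_j / k_j replace the true one. Numerator
  and denominator under the root in \<lambda>_0 are positive by convexity of x^\<rho> about the
  weighted mean 1 of the d_j, and by strict Cauchy-Schwarz.\<close>

definition prob_filter :: "'a measure \<Rightarrow> (nat \<times> 'a) filter" where
  "prob_filter M = Abs_filter (\<lambda>P. \<forall>\<delta>>0. \<forall>\<^sub>F n in sequentially.
     \<exists>B\<in>sets M. measure M B < \<delta> \<and> (\<forall>w\<in>space M - B. P (n, w)))"

context prob_space
begin

text \<open>Only the exceptional set \<open>B\<close> has to be measurable, so \<open>P\<close> may
  involve quantities whose measurability has not been established. Intersections are handled by
  splitting \<delta> into two halves.\<close>

lemma eventually_prob_filter:
  "eventually P (prob_filter M) \<longleftrightarrow>
     (\<forall>\<delta>>0. \<forall>\<^sub>F n in sequentially. \<exists>B\<in>sets M. measure M B < \<delta> \<and> (\<forall>w\<in>space M - B. P (n, w)))"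
proof -
  have "is_filter (\<lambda>P. \<forall>\<delta>>0. \<forall>\<^sub>F n in sequentially.
     \<exists>B\<in>sets M. measure M B < \<delta> \<and> (\<forall>w\<in>space M - B. P (n, w)))"
  proof (rule is_filter.intro, goal_cases)
    case 1
    show ?case by (auto intro!: always_eventually bexI[of _ "{}"])
  next
    case (2 P Q)
    show ?case
    proof (intro allI impI)
      fix \<delta> :: real assume "\<delta> > 0"
      then have "\<forall>\<^sub>F n in sequentially. \<exists>B\<in>sets M. measure M B < \<delta>/2 \<and> (\<forall>w\<in>space M - B. P (n, w))"
        "\<forall>\<^sub>F n in sequentially. \<exists>B\<in>sets M. measure M B < \<delta>/2 \<and> (\<forall>w\<in>space M - B. Q (n, w))"
        using 2 half_gt_zero[of \<delta>] by blast+
      then show "\<forall>\<^sub>F n in sequentially. \<exists>B\<in>sets M. measure M B < \<delta> \<and> (\<forall>w\<in>space M - B. P (n, w) \<and> Q (n, w))"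
      proof eventually_elim
        case (elim n)
        then obtain A B where "A \<in> sets M" "B \<in> sets M" "measure M A < \<delta>/2" "measure M B < \<delta>/2"
          "\<forall>w\<in>space M - A. P (n, w)" "\<forall>w\<in>space M - B. Q (n, w)" by blast
        moreover have "measure M (A \<union> B) \<le> measure M A + measure M B"
          using calculation by (intro measure_Un_le) auto
        ultimately show ?case by (intro bexI[of _ "A \<union> B"]) auto
      qed
    qed
  next
    case (3 P Q)
    then show ?case by (fastforce elim: eventually_mono)
  qed
  then show ?thesis by (simp add: prob_filter_def eventually_Abs_filter)
qed

lemma eventually_prob_filterD:
  "eventually P (prob_filter M) \<Longrightarrow> \<delta> > 0 \<Longrightarrow>
     \<forall>\<^sub>F n in sequentially. \<exists>B\<in>sets M. measure M B < \<delta> \<and> (\<forall>w\<in>space M - B. P (n, w))"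
  unfolding eventually_prob_filter by blast

text \<open>With \<delta> = 1, an exceptional set covering the whole space would have mass less than
  1. Properness makes limits along the filter unique, which is how limit weights are shown to sum to
  1.\<close>

lemma prob_filter_neq_bot: "prob_filter M \<noteq> bot"
proof
  assume "prob_filter M = bot"
  then have "eventually (\<lambda>_. False) (prob_filter M)" by simp
  then have "\<forall>\<^sub>F n in sequentially. \<exists>B\<in>sets M. measure M B < 1 \<and> space M - B = {}"
    unfolding eventually_prob_filter by (auto elim!: allE[of _ 1])
  then obtain B where "B \<in> sets M" "measure M B < 1" "space M \<subseteq> B"
    by (auto dest!: eventually_happens)
  then show False using sets.sets_into_space[of B M] prob_space by (auto dest: subset_antisym)
qed

lemma filterlim_fst_prob_filter: "filterlim fst sequentially (prob_filter M)"
  unfolding filterlim_iff eventually_prob_filter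
  by (auto elim!: eventually_mono intro!: bexI[of _ "{}"])

lemma eventually_fst_prob_filter:
  "eventually P sequentially \<Longrightarrow> eventually (\<lambda>z. P (fst z)) (prob_filter M)"
  using filterlim_fst_prob_filter by (simp add: filterlim_iff)

lemma filterlim_fst_compose:
  "filterlim f F sequentially \<Longrightarrow> filterlim (\<lambda>z. f (fst z)) F (prob_filter M)"
  using filterlim_compose filterlim_fst_prob_filter by blast

text \<open>One null set serves as exceptional set for every index and every \<delta> at
  once.\<close>

lemma eventually_prob_filter_AE:
  assumes "AE w in M. \<forall>n. P n w"
  shows "eventually (\<lambda>z. P (fst z) (snd z)) (prob_filter M)"
proof -
  obtain N where "N \<in> null_sets M" "{w\<in>space M. \<not> (\<forall>n. P n w)} \<subseteq> N"
    using assms by (auto simp: eventually_ae_filter)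
  then show ?thesis
    unfolding eventually_prob_filter
    by (auto intro!: always_eventually bexI[of _ N] simp: null_sets_def measure_def)
qed

lemma eventually_prob_filter_snd_AE:
  "AE w in M. P w \<Longrightarrow> eventually (\<lambda>z. P (snd z)) (prob_filter M)"
  using eventually_prob_filter_AE[of "\<lambda>_. P"] by simp

text \<open>Measurability stays a separate conjunct because the filter limit says nothing about it.
  Once it is given, the deviation event itself can serve as the exceptional set.\<close>

lemma tendsto_in_prob_iff:
  fixes Y :: "nat \<Rightarrow> 'a \<Rightarrow> 'b::metric_space"
  shows "tendsto_in_prob M Y c \<longleftrightarrow> (\<forall>n. Y n \<in> borel_measurable M) \<and>
    ((\<lambda>z. Y (fst z) (snd z)) \<longlongrightarrow> c) (prob_filter M)"
proof -
  { assume Y [measurable]: "\<forall>n. Y n \<in> borel_measurable M"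
    have [measurable]: "{w\<in>space M. dist (Y n w) c > e} \<in> sets M" for n and e :: real
    proof -
      have "open {y. dist y c > e}" by (intro open_Collect_less continuous_intros)
      then have "Y n -` {y. dist y c > e} \<inter> space M \<in> sets M"
        by (intro measurable_sets[of _ _ borel]) (use Y in auto)
      also have "Y n -` {y. dist y c > e} \<inter> space M = {w\<in>space M. dist (Y n w) c > e}" by auto
      finally show ?thesis .
    qed
    have "(\<forall>e>0. (\<lambda>n. measure M {w \<in> space M. dist (Y n w) c > e}) \<longlonglongrightarrow> 0) \<longleftrightarrow>
      ((\<lambda>z. Y (fst z) (snd z)) \<longlongrightarrow> c) (prob_filter M)"
    proof safe
      assume L: "\<forall>e>0. (\<lambda>n. measure M {w \<in> space M. dist (Y n w) c > e}) \<longlonglongrightarrow> 0"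
      show "((\<lambda>z. Y (fst z) (snd z)) \<longlongrightarrow> c) (prob_filter M)"
        unfolding tendsto_iff eventually_prob_filter
      proof (intro allI impI)
        fix e \<delta> :: real assume "e > 0" "\<delta> > 0"
        \<comment> \<open>Off the event that the distance exceeds \<open>e/2\<close>, the distance
          is strictly below \<open>e\<close>, as filter limits require.\<close>
        then have "(\<lambda>n. measure M {w \<in> space M. dist (Y n w) c > e/2}) \<longlonglongrightarrow> 0" using L half_gt_zero by blast
        then have "\<forall>\<^sub>F n in sequentially. measure M {w \<in> space M. dist (Y n w) c > e/2} < \<delta>"
          using \<open>\<delta> > 0\<close> by (rule order_tendstoD)
        then show "\<forall>\<^sub>F n in sequentially. \<exists>B\<in>sets M. measure M B < \<delta> \<and>
            (\<forall>w\<in>space M - B. dist (Y (fst (n, w)) (snd (n, w))) c < e)"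
        proof eventually_elim
          case (elim n)
          have "{w \<in> space M. dist (Y n w) c > e/2} \<in> sets M" by measurable
          then show ?case using elim \<open>e > 0\<close>
            by (intro bexI[of _ "{w \<in> space M. dist (Y n w) c > e/2}"] conjI ballI)
               (simp_all only: fst_conv snd_conv, auto)
        qed
      qed
    next
      fix e :: real
      assume L: "((\<lambda>z. Y (fst z) (snd z)) \<longlongrightarrow> c) (prob_filter M)" and "e > 0"
      show "(\<lambda>n. measure M {w \<in> space M. dist (Y n w) c > e}) \<longlonglongrightarrow> 0"
      proof (rule order_tendstoI)
        fix \<delta> :: real assume "0 < \<delta>"
        with L \<open>e > 0\<close> have "\<forall>\<^sub>F n in sequentially. \<exists>B\<in>sets M. measure M B < \<delta> \<and>
            (\<forall>w\<in>space M - B. dist (Y n w) c < e)"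
          unfolding tendsto_iff eventually_prob_filter by auto
        then show "\<forall>\<^sub>F n in sequentially. measure M {w \<in> space M. dist (Y n w) c > e} < \<delta>"
        proof eventually_elim
          case (elim n)
          then obtain B where B: "B \<in> sets M" "measure M B < \<delta>" "\<forall>w\<in>space M - B. dist (Y n w) c < e"
            by blast
          then have "measure M {w \<in> space M. dist (Y n w) c > e} \<le> measure M B"
            by (intro finite_measure_mono) force+
          then show ?case using B by simp
        qed
      qed (auto intro!: always_eventually less_le_trans[OF _ measure_nonneg])
    qed }
  then show ?thesis unfolding tendsto_in_prob_def by blast
qed

text \<open>Chebyshev's inequality, with exceptional set {Y^2 \<ge> e^2}. Remainders that are
  centred sums are discarded through this criterion.\<close>

lemma tendsto_0_second_moment:
  fixes Y :: "nat \<Rightarrow> 'a \<Rightarrow> real"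
  assumes "\<And>n. integrable M (\<lambda>w. (Y n w)\<^sup>2)" "\<And>n. Y n \<in> borel_measurable M"
    and "(\<lambda>n. expectation (\<lambda>w. (Y n w)\<^sup>2)) \<longlonglongrightarrow> 0"
  shows "((\<lambda>z. Y (fst z) (snd z)) \<longlongrightarrow> 0) (prob_filter M)"
  unfolding tendsto_iff eventually_prob_filter
proof (intro allI impI)
  fix e \<delta> :: real assume e: "e > 0" "\<delta> > 0"
  note assms(2)[measurable]
  have "\<forall>\<^sub>F n in sequentially. expectation (\<lambda>w. (Y n w)\<^sup>2) < \<delta> * e\<^sup>2"
    using e by (intro order_tendstoD(2)[OF assms(3)]) auto
  then show "\<forall>\<^sub>F n in sequentially. \<exists>B\<in>sets M. measure M B < \<delta> \<and>
      (\<forall>w\<in>space M - B. dist (Y (fst (n, w)) (snd (n, w))) 0 < e)"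
  proof eventually_elim
    case (elim n)
    have "prob {w\<in>space M. (Y n w)\<^sup>2 \<ge> e\<^sup>2} \<le> expectation (\<lambda>w. (Y n w)\<^sup>2) / e\<^sup>2"
      using e by (intro integral_Markov_inequality_measure[where A="{}"] assms) auto
    also have "\<dots> < \<delta>" using elim e by (simp add: field_simps)
    finally show ?case using e
      by (auto intro!: bexI[of _ "{w\<in>space M. (Y n w)\<^sup>2 \<ge> e\<^sup>2}"] simp: not_le dest: power2_less_imp_less)
         (metis abs_of_pos abs_le_square_iff linorder_not_less)
  qed
qed

text \<open>Tightness, O_P(1). The bound \<open>C\<close> may depend on \<delta>, so this is weaker
  than boundedness by one constant along \<open>prob_filter M\<close>.\<close>

definition bounded_in_prob :: "(nat \<times> 'a \<Rightarrow> real) \<Rightarrow> bool" where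
  "bounded_in_prob Y \<longleftrightarrow> (\<forall>\<delta>>0. \<exists>C. \<forall>\<^sub>F n in sequentially.
     \<exists>B\<in>sets M. measure M B < \<delta> \<and> (\<forall>w\<in>space M - B. \<bar>Y (n, w)\<bar> \<le> C))"

lemma bounded_in_probD:
  "bounded_in_prob Y \<Longrightarrow> \<delta> > 0 \<Longrightarrow> \<exists>C. \<forall>\<^sub>F n in sequentially.
     \<exists>B\<in>sets M. measure M B < \<delta>/2 \<and> (\<forall>w\<in>space M - B. \<bar>Y (n, w)\<bar> \<le> C)"
  unfolding bounded_in_prob_def using half_gt_zero by blast

lemma bounded_in_prob_comparison:
  assumes Y: "bounded_in_prob Y" and ev: "eventually (\<lambda>z. \<bar>Y' z\<bar> \<le> \<bar>Y z\<bar>) (prob_filter M)"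
  shows "bounded_in_prob Y'"
  unfolding bounded_in_prob_def
proof (intro allI impI)
  fix \<delta> :: real assume "\<delta> > 0"
  then obtain C where C: "\<forall>\<^sub>F n in sequentially.
     \<exists>B\<in>sets M. measure M B < \<delta>/2 \<and> (\<forall>w\<in>space M - B. \<bar>Y (n, w)\<bar> \<le> C)"
    using bounded_in_probD[OF Y] by blast
  have "\<forall>\<^sub>F n in sequentially. \<exists>B\<in>sets M. measure M B < \<delta>/2 \<and> (\<forall>w\<in>space M - B. \<bar>Y' (n, w)\<bar> \<le> \<bar>Y (n, w)\<bar>)"
    using \<open>\<delta> > 0\<close> by (intro eventually_prob_filterD[OF ev]) simp
  then show "\<exists>C. \<forall>\<^sub>F n in sequentially.
     \<exists>B\<in>sets M. measure M B < \<delta> \<and> (\<forall>w\<in>space M - B. \<bar>Y' (n, w)\<bar> \<le> C)"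
    using C
  proof (intro exI[of _ C], eventually_elim)
    case (elim n)
    then obtain A B where "A \<in> sets M" "B \<in> sets M" "measure M A < \<delta>/2" "measure M B < \<delta>/2"
      "\<forall>w\<in>space M - A. \<bar>Y' (n, w)\<bar> \<le> \<bar>Y (n, w)\<bar>" "\<forall>w\<in>space M - B. \<bar>Y (n, w)\<bar> \<le> C" by blast
    moreover have "measure M (A \<union> B) \<le> measure M A + measure M B"
      using calculation by (intro measure_Un_le) auto
    ultimately show ?case by (intro bexI[of _ "A \<union> B"]) (auto intro: order_trans)
  qed
qed

lemma bounded_in_prob_const: "bounded_in_prob (\<lambda>_. c)"
  unfolding bounded_in_prob_def by (auto intro!: exI[of _ "\<bar>c\<bar>"] always_eventually bexI[of _ "{}"])

lemma bounded_in_prob_tendsto: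
  assumes "(Y \<longlongrightarrow> c) (prob_filter M)"
  shows "bounded_in_prob Y"
proof (rule bounded_in_prob_comparison[OF bounded_in_prob_const])
  have "eventually (\<lambda>z. dist (Y z) c < 1) (prob_filter M)" using assms by (simp add: tendsto_iff)
  then show "eventually (\<lambda>z. \<bar>Y z\<bar> \<le> \<bar>\<bar>c\<bar> + 1\<bar>) (prob_filter M)"
    by eventually_elim (auto simp: dist_real_def)
qed

text \<open>The two bounds are first made to hold off one common exceptional set; sum and product
  then differ only in the resulting constant.\<close>

lemma bounded_in_prob_add_mult:
  assumes Y: "bounded_in_prob Y" and Y': "bounded_in_prob Y'"
  shows bounded_in_prob_add: "bounded_in_prob (\<lambda>z. Y z + Y' z)"
    and bounded_in_prob_mult: "bounded_in_prob (\<lambda>z. Y z * Y' z)"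
proof -
  { fix \<delta> :: real assume "\<delta> > 0"
    obtain C where C: "\<forall>\<^sub>F n in sequentially.
       \<exists>B\<in>sets M. measure M B < \<delta>/2 \<and> (\<forall>w\<in>space M - B. \<bar>Y (n, w)\<bar> \<le> C)"
      using bounded_in_probD[OF Y \<open>\<delta> > 0\<close>] by blast
    obtain D where "\<forall>\<^sub>F n in sequentially.
       \<exists>B\<in>sets M. measure M B < \<delta>/2 \<and> (\<forall>w\<in>space M - B. \<bar>Y' (n, w)\<bar> \<le> D)"
      using bounded_in_probD[OF Y' \<open>\<delta> > 0\<close>] by blast
    then have "\<forall>\<^sub>F n in sequentially. \<exists>B\<in>sets M. measure M B < \<delta> \<and>
       (\<forall>w\<in>space M - B. \<bar>Y (n, w)\<bar> \<le> C \<and> \<bar>Y' (n, w)\<bar> \<le> D)"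
      using C
    proof eventually_elim
      case (elim n)
      then obtain A B where "A \<in> sets M" "B \<in> sets M" "measure M A < \<delta>/2" "measure M B < \<delta>/2"
        "\<forall>w\<in>space M - A. \<bar>Y' (n, w)\<bar> \<le> D" "\<forall>w\<in>space M - B. \<bar>Y (n, w)\<bar> \<le> C" by blast
      moreover have "measure M (A \<union> B) \<le> measure M A + measure M B"
        using calculation by (intro measure_Un_le) auto
      ultimately show ?case by (intro bexI[of _ "A \<union> B"]) auto
    qed
    then have "\<exists>C D. \<forall>\<^sub>F n in sequentially. \<exists>B\<in>sets M. measure M B < \<delta> \<and>
       (\<forall>w\<in>space M - B. \<bar>Y (n, w)\<bar> \<le> C \<and> \<bar>Y' (n, w)\<bar> \<le> D)" by blast }
  note * = this
  show "bounded_in_prob (\<lambda>z. Y z + Y' z)" unfolding bounded_in_prob_def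
  proof (intro allI impI)
    fix \<delta> :: real assume "\<delta> > 0"
    from *[OF this] obtain C D where "\<forall>\<^sub>F n in sequentially. \<exists>B\<in>sets M. measure M B < \<delta> \<and>
       (\<forall>w\<in>space M - B. \<bar>Y (n, w)\<bar> \<le> C \<and> \<bar>Y' (n, w)\<bar> \<le> D)" by blast
    then show "\<exists>C. \<forall>\<^sub>F n in sequentially. \<exists>B\<in>sets M. measure M B < \<delta> \<and>
       (\<forall>w\<in>space M - B. \<bar>Y (n, w) + Y' (n, w)\<bar> \<le> C)"
    proof (intro exI[of _ "C + D"], eventually_elim)
      case (elim n)
      then obtain B where "B \<in> sets M" "measure M B < \<delta>"
        and B: "\<forall>w\<in>space M - B. \<bar>Y (n, w)\<bar> \<le> C \<and> \<bar>Y' (n, w)\<bar> \<le> D" by blast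
      moreover have "\<bar>Y (n, w) + Y' (n, w)\<bar> \<le> C + D" if "w \<in> space M - B" for w
        using bspec[OF B that] by linarith
      ultimately show ?case by blast
    qed
  qed
  show "bounded_in_prob (\<lambda>z. Y z * Y' z)" unfolding bounded_in_prob_def
  proof (intro allI impI)
    fix \<delta> :: real assume "\<delta> > 0"
    from *[OF this] obtain C D where "\<forall>\<^sub>F n in sequentially. \<exists>B\<in>sets M. measure M B < \<delta> \<and>
       (\<forall>w\<in>space M - B. \<bar>Y (n, w)\<bar> \<le> C \<and> \<bar>Y' (n, w)\<bar> \<le> D)" by blast
    then show "\<exists>C. \<forall>\<^sub>F n in sequentially. \<exists>B\<in>sets M. measure M B < \<delta> \<and>
       (\<forall>w\<in>space M - B. \<bar>Y (n, w) * Y' (n, w)\<bar> \<le> C)"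
    proof (intro exI[of _ "\<bar>C\<bar> * \<bar>D\<bar>"], eventually_elim)
      case (elim n)
      then obtain B where "B \<in> sets M" "measure M B < \<delta>"
        and B: "\<forall>w\<in>space M - B. \<bar>Y (n, w)\<bar> \<le> C \<and> \<bar>Y' (n, w)\<bar> \<le> D" by blast
      moreover have "\<bar>Y (n, w) * Y' (n, w)\<bar> \<le> \<bar>C\<bar> * \<bar>D\<bar>" if "w \<in> space M - B" for w
        unfolding abs_mult using bspec[OF B that] by (intro mult_mono) linarith+
      ultimately show ?case by blast
    qed
  qed
qed

lemma bounded_in_prob_sum:
  "(\<And>i. i \<in> I \<Longrightarrow> bounded_in_prob (Y i)) \<Longrightarrow> bounded_in_prob (\<lambda>z. \<Sum>i\<in>I. Y i z)"
  by (induction I rule: infinite_finite_induct)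
     (auto intro!: bounded_in_prob_add bounded_in_prob_const)

text \<open>The rule o_P(1) O_P(1) = o_P(1) behind most of the later expansions. Off a set of mass
  \<delta>/2 the factor \<open>Y\<close> is bounded by \<open>C\<close>, and there \<open>Z\<close>
  only has to be below e / (|C| + 1), a positive number even if C = 0.\<close>

lemma tendsto_0_mult_bounded_in_prob:
  assumes Z: "(Z \<longlongrightarrow> 0) (prob_filter M)" and Y: "bounded_in_prob Y"
  shows "((\<lambda>z. Z z * Y z) \<longlongrightarrow> 0) (prob_filter M)"
  unfolding tendsto_iff eventually_prob_filter
proof (intro allI impI)
  fix e \<delta> :: real assume e: "e > 0" "\<delta> > 0"
  then obtain C where C: "\<forall>\<^sub>F n in sequentially.
     \<exists>B\<in>sets M. measure M B < \<delta>/2 \<and> (\<forall>w\<in>space M - B. \<bar>Y (n, w)\<bar> \<le> C)"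
    using bounded_in_probD[OF Y e(2)] by blast
  have "e / (\<bar>C\<bar> + 1) > 0" using e by simp
  then have "\<forall>\<^sub>F n in sequentially. \<exists>B\<in>sets M. measure M B < \<delta>/2 \<and>
      (\<forall>w\<in>space M - B. dist (Z (n, w)) 0 < e / (\<bar>C\<bar> + 1))"
    using Z \<open>\<delta> > 0\<close> half_gt_zero[OF \<open>\<delta> > 0\<close>] unfolding tendsto_iff eventually_prob_filter by blast
  then show "\<forall>\<^sub>F n in sequentially. \<exists>B\<in>sets M. measure M B < \<delta> \<and>
      (\<forall>w\<in>space M - B. dist (Z (n, w) * Y (n, w)) 0 < e)"
    using C
  proof eventually_elim
    case (elim n)
    then obtain A B where AB: "A \<in> sets M" "B \<in> sets M" "measure M A < \<delta>/2" "measure M B < \<delta>/2"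
      "\<forall>w\<in>space M - A. dist (Z (n, w)) 0 < e / (\<bar>C\<bar> + 1)" "\<forall>w\<in>space M - B. \<bar>Y (n, w)\<bar> \<le> C" by blast
    have "\<bar>Z (n, w) * Y (n, w)\<bar> < e" if "w \<in> space M" "w \<notin> A \<union> B" for w
    proof -
      have "\<bar>Z (n, w) * Y (n, w)\<bar> \<le> \<bar>Z (n, w)\<bar> * (\<bar>C\<bar> + 1)"
        using that AB(6) by (auto simp: abs_mult intro!: mult_left_mono dest!: bspec[of _ _ w])
      also have "\<dots> < e / (\<bar>C\<bar> + 1) * (\<bar>C\<bar> + 1)"
        using that AB by (intro mult_strict_right_mono) auto
      finally show ?thesis by simp
    qed
    moreover have "measure M (A \<union> B) \<le> measure M A + measure M B"
      using AB by (intro measure_Un_le) auto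
    ultimately show ?case using AB by (intro bexI[of _ "A \<union> B"]) auto
  qed
qed

lemma bounded_in_prob_second_moment:
  fixes Y :: "nat \<Rightarrow> 'a \<Rightarrow> real"
  assumes "\<And>n. integrable M (\<lambda>w. (Y n w)\<^sup>2)" "\<And>n. Y n \<in> borel_measurable M"
    and bd: "\<forall>\<^sub>F n in sequentially. expectation (\<lambda>w. (Y n w)\<^sup>2) \<le> K"
  shows "bounded_in_prob (\<lambda>z. Y (fst z) (snd z))"
  unfolding bounded_in_prob_def
proof (intro allI impI)
  fix \<delta> :: real assume \<delta>: "\<delta> > 0"
  note assms(2)[measurable]
  \<comment> \<open>Chebyshev bounds the mass of {Y^2 \<ge> C^2} by K / C^2. This \<open>C\<close>
    makes (|K| + 1) / C^2 equal to \<delta>, and the extra 1 makes the inequality strict.\<close>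
  define C where "C = sqrt ((\<bar>K\<bar> + 1) / \<delta>)"
  have C: "C > 0" "C\<^sup>2 = (\<bar>K\<bar> + 1) / \<delta>" using \<delta> by (auto simp: C_def intro!: divide_pos_pos)
  show "\<exists>C. \<forall>\<^sub>F n in sequentially. \<exists>B\<in>sets M. prob B < \<delta> \<and>
     (\<forall>w\<in>space M - B. \<bar>Y (fst (n, w)) (snd (n, w))\<bar> \<le> C)"
    using bd
  proof (intro exI[of _ C], eventually_elim)
    case (elim n)
    have "prob {w\<in>space M. (Y n w)\<^sup>2 \<ge> C\<^sup>2} \<le> expectation (\<lambda>w. (Y n w)\<^sup>2) / C\<^sup>2"
      using C(1) by (intro integral_Markov_inequality_measure[where A="{}"] assms) auto
    also have "\<dots> \<le> K / C\<^sup>2" using elim by (intro divide_right_mono) auto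
    also have "\<dots> < (\<bar>K\<bar> + 1) / C\<^sup>2" using C(1) by (intro divide_strict_right_mono) auto
    also have "\<dots> = \<delta>" using \<delta> by (simp add: C)
    finally show "\<exists>B\<in>sets M. prob B < \<delta> \<and> (\<forall>w\<in>space M - B. \<bar>Y (fst (n, w)) (snd (n, w))\<bar> \<le> C)"
      using C(1) by (intro bexI[of _ "{w\<in>space M. (Y n w)\<^sup>2 \<ge> C\<^sup>2}"])
        (auto simp: abs_le_square_iff[symmetric])
  qed
qed

text \<open>The hypotheses compare \<open>U\<close> with \<open>V\<close> at one fixed level at a
  time. Since \<open>V\<close> stays in a compact interval up to small probability, finitely many
  levels on a grid of mesh \<open>e\<close> suffice, and off one exceptional set the grid cell of
  \<open>V\<close> also locates \<open>U\<close>.\<close>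

lemma tendsto_diff_0_of_level_crossings:
  assumes V: "bounded_in_prob V"
    and up: "\<And>x e. e > 0 \<Longrightarrow> eventually (\<lambda>z. U z \<ge> x \<longrightarrow> V z > x - e) (prob_filter M)"
    and dn: "\<And>x e. e > 0 \<Longrightarrow> eventually (\<lambda>z. U z \<le> x \<longrightarrow> V z < x + e) (prob_filter M)"
  shows "((\<lambda>z. U z - V z) \<longlongrightarrow> 0) (prob_filter M)"
  unfolding tendsto_iff eventually_prob_filter
proof (intro allI impI)
  fix e0 \<delta> :: real assume e0: "e0 > 0" "\<delta> > 0"
  \<comment> \<open>On the good event \<open>V\<close> lies in [m e, (m + 1) e) and \<open>U\<close>
    strictly between (m - 1) e and (m + 2) e, so they differ by less than 2 e, which is below
    \<open>e0\<close>.\<close>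
  define e where "e = e0 / 3"
  have e: "e > 0" using e0 by (simp add: e_def)
  obtain C where C: "\<forall>\<^sub>F n in sequentially.
     \<exists>B\<in>sets M. measure M B < \<delta>/2 \<and> (\<forall>w\<in>space M - B. \<bar>V (n, w)\<bar> \<le> C)"
    using bounded_in_probD[OF V e0(2)] by blast
  \<comment> \<open>The cell index of \<open>V\<close> exceeds |C| / e, rounded up, by at most 1 in
    absolute value; the margin 3 keeps m + 2 and m - 1 on the grid.\<close>
  define R where "R = {-(\<lceil>\<bar>C\<bar>/e\<rceil>+3)..\<lceil>\<bar>C\<bar>/e\<rceil>+3}"
  have "eventually (\<lambda>z. \<forall>m\<in>R. (U z \<ge> real_of_int m * e \<longrightarrow> V z > real_of_int m * e - e) \<and>
      (U z \<le> real_of_int m * e \<longrightarrow> V z < real_of_int m * e + e)) (prob_filter M)"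
    by (intro eventually_ball_finite ballI eventually_conj up dn e) (simp add: R_def)
  then have "\<forall>\<^sub>F n in sequentially. \<exists>B\<in>sets M. measure M B < \<delta>/2 \<and> (\<forall>w\<in>space M - B.
      \<forall>m\<in>R. (U (n, w) \<ge> real_of_int m * e \<longrightarrow> V (n, w) > real_of_int m * e - e) \<and>
      (U (n, w) \<le> real_of_int m * e \<longrightarrow> V (n, w) < real_of_int m * e + e))"
    using e0 half_gt_zero[OF e0(2)] unfolding eventually_prob_filter by blast
  then show "\<forall>\<^sub>F n in sequentially. \<exists>B\<in>sets M. measure M B < \<delta> \<and>
      (\<forall>w\<in>space M - B. dist (U (n, w) - V (n, w)) 0 < e0)"
    using C
  proof eventually_elim
    case (elim n)
    then obtain A B where AB: "A \<in> sets M" "B \<in> sets M" "measure M A < \<delta>/2" "measure M B < \<delta>/2"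
      and A: "\<forall>w\<in>space M - A.
      \<forall>m\<in>R. (U (n, w) \<ge> real_of_int m * e \<longrightarrow> V (n, w) > real_of_int m * e - e) \<and>
      (U (n, w) \<le> real_of_int m * e \<longrightarrow> V (n, w) < real_of_int m * e + e)"
      and B: "\<forall>w\<in>space M - B. \<bar>V (n, w)\<bar> \<le> C" by blast
    have "\<bar>U (n, w) - V (n, w)\<bar> < e0" if w: "w \<in> space M" "w \<notin> A \<union> B" for w
    proof -
      define m where "m = \<lfloor>V (n, w) / e\<rfloor>"
      have m: "real_of_int m * e \<le> V (n, w)" "V (n, w) < real_of_int m * e + e"
        using e floor_correct[of "V (n, w) / e"] unfolding m_def[symmetric]
        by (auto simp: field_simps)
      have "\<bar>V (n, w) / e\<bar> \<le> \<bar>C\<bar> / e" using bspec[OF B, of w] w e by (auto intro!: divide_right_mono)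
      then have "- (\<bar>C\<bar> / e) \<le> V (n, w) / e" "V (n, w) / e \<le> \<bar>C\<bar> / e" by linarith+
      then have "m \<in> {-(\<lceil>\<bar>C\<bar>/e\<rceil>+1)..\<lceil>\<bar>C\<bar>/e\<rceil>+1}"
        unfolding m_def atLeastAtMost_iff by (intro conjI; linarith)
      then have "m + 2 \<in> R" "m - 1 \<in> R" by (auto simp: R_def)
      \<comment> \<open>If \<open>U\<close> reached (m + 2) e, then \<open>V\<close> would exceed (m
        + 1) e; if \<open>U\<close> were at most (m - 1) e, then \<open>V\<close> would be below m
        e. Both contradict the choice of \<open>m\<close>.\<close>
      then have "\<not> U (n, w) \<ge> real_of_int (m + 2) * e" "\<not> U (n, w) \<le> real_of_int (m - 1) * e"
        using bspec[OF bspec[OF A, of w], of "m + 2"] bspec[OF bspec[OF A, of w], of "m - 1"] w m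
        by (auto simp: algebra_simps)
      then show ?thesis using m by (auto simp: algebra_simps e_def)
    qed
    moreover have "measure M (A \<union> B) \<le> measure M A + measure M B"
      using AB by (intro measure_Un_le) auto
    ultimately show ?case using AB by (intro bexI[of _ "A \<union> B"]) auto
  qed
qed

text \<open>Slutsky's theorem for characteristic functions: |exp(i t a) - exp(i t b)| is at most |t|
  |a - b|, used off the exceptional set, and at most 2, used on it.\<close>

lemma char_limit_perturb:
  fixes Y Y' :: "nat \<Rightarrow> 'a \<Rightarrow> real"
  assumes [measurable]: "\<And>n. Y n \<in> borel_measurable M" "\<And>n. Y' n \<in> borel_measurable M"
    and diff: "((\<lambda>z. Y' (fst z) (snd z) - Y (fst z) (snd z)) \<longlongrightarrow> 0) (prob_filter M)"
    and lim: "(\<lambda>n. char (distr M borel (Y n)) t) \<longlonglongrightarrow> c"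
  shows "(\<lambda>n. char (distr M borel (Y' n)) t) \<longlonglongrightarrow> c"
proof -
  have "(\<lambda>n. char (distr M borel (Y' n)) t - char (distr M borel (Y n)) t) \<longlonglongrightarrow> 0"
    unfolding tendsto_iff
  proof (intro allI impI)
    fix e :: real assume e: "e > 0"
    \<comment> \<open>The contribution |t| \<eta> off \<open>B\<close> is below e/2, and twice the
      mass of \<open>B\<close> is below e/2.\<close>
    define \<eta> where "\<eta> = e / (2 * (\<bar>t\<bar> + 1))"
    have \<eta>: "\<eta> > 0" "\<bar>t\<bar> * \<eta> < e / 2" using e by (auto simp: \<eta>_def field_simps)
    have "\<forall>\<^sub>F n in sequentially. \<exists>B\<in>sets M. measure M B < e/4 \<and>
      (\<forall>w\<in>space M - B. dist (Y' n w - Y n w) 0 < \<eta>)"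
      using eventually_prob_filterD[OF tendstoD[OF diff \<eta>(1)], of "e/4"] e by simp
    then show "\<forall>\<^sub>F n in sequentially. dist (char (distr M borel (Y' n)) t - char (distr M borel (Y n)) t) 0 < e"
    proof eventually_elim
      case (elim n)
      then obtain B where B[measurable]: "B \<in> sets M" and "measure M B < e/4"
        and d: "\<forall>w\<in>space M - B. dist (Y' n w - Y n w) 0 < \<eta>" by blast
      have int: "integrable M (\<lambda>w. iexp (t * Y' n w) - iexp (t * Y n w))"
        by (intro Bochner_Integration.integrable_diff integrable_iexp) auto
      have "char (distr M borel (Y' n)) t - char (distr M borel (Y n)) t
          = (CLINT w|M. iexp (t * Y' n w) - iexp (t * Y n w))"
        by (simp add: char_def integral_distr Bochner_Integration.integral_diff integrable_iexp)
      also have "norm \<dots> \<le> (LINT w|M. norm (iexp (t * Y' n w) - iexp (t * Y n w)))"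
        by (rule integral_norm_bound)
      also have "\<dots> \<le> (LINT w|M. \<bar>t\<bar> * \<eta> + 2 * indicator B w)"
      proof (rule integral_mono)
        show "integrable M (\<lambda>w. norm (iexp (t * Y' n w) - iexp (t * Y n w)))" using int by auto
        show "integrable M (\<lambda>w. \<bar>t\<bar> * \<eta> + 2 * indicator B w :: real)"
          by (intro Bochner_Integration.integrable_add integrable_mult_right integrable_real_indicator)
             (auto simp: less_top[symmetric])
        fix w assume w: "w \<in> space M"
        show "norm (iexp (t * Y' n w) - iexp (t * Y n w)) \<le> \<bar>t\<bar> * \<eta> + 2 * indicator B w"
        proof (cases "w \<in> B")
          case True
          have "norm (iexp (t * Y' n w) - iexp (t * Y n w)) \<le> 1 + 1"
            by (intro norm_triangle_le_diff add_mono) auto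
          then show ?thesis using True \<eta>(1) by simp (smt (verit) mult_nonneg_nonneg abs_ge_zero)
        next
          case False
          have "iexp (t * Y' n w) - iexp (t * Y n w) = iexp (t * Y n w) * (iexp (t * (Y' n w - Y n w)) - 1)"
            by (simp add: algebra_simps exp_add[symmetric])
          then have "norm (iexp (t * Y' n w) - iexp (t * Y n w)) = norm (iexp (t * (Y' n w - Y n w)) - 1)"
            by (simp add: norm_mult)
          also have "\<dots> \<le> \<bar>t * (Y' n w - Y n w)\<bar>"
            using iexp_approx1[of "t * (Y' n w - Y n w)" 0] by simp
          also have "\<dots> \<le> \<bar>t\<bar> * \<eta>" unfolding abs_mult using bspec[OF d, of w] w False
            by (intro mult_left_mono) (auto simp: dist_real_def)
          finally show ?thesis using False by simp
        qed
      qed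
      also have "\<dots> = \<bar>t\<bar> * \<eta> + 2 * measure M B"
        by (subst Bochner_Integration.integral_add)
           (auto simp: prob_space less_top[symmetric] intro!: integrable_mult_right integrable_real_indicator)
      also have "\<dots> < e" using \<eta> \<open>measure M B < e/4\<close> by simp
      finally show ?case by simp
    qed
  qed
  from tendsto_add[OF this lim] show ?thesis by simp
qed

end

section \<open>Order statistics\<close>

lemma sorted_order_stats:
  fixes x :: "'i \<Rightarrow> real"
  assumes "finite I"
  shows "sorted (sorted_list_of_multiset (image_mset x (mset_set I)))"
    and "length (sorted_list_of_multiset (image_mset x (mset_set I))) = card I"
    and "mset (sorted_list_of_multiset (image_mset x (mset_set I))) = image_mset x (mset_set I)"
proof -
  show *: "mset (sorted_list_of_multiset (image_mset x (mset_set I))) = image_mset x (mset_set I)" by simp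
  then show "length (sorted_list_of_multiset (image_mset x (mset_set I))) = card I"
    by (metis size_image_mset size_mset size_mset_set)
qed simp

text \<open>In the sorted list the entries at most \<open>t\<close> form an initial segment. This
  switch from positions to counts is the access to the law of the random threshold, and also gives
  measurability of order statistics.\<close>

lemma order_stat_le_iff:
  assumes I: "finite I" and r: "1 \<le> r" "r \<le> card I"
  shows "order_stat I x r \<le> t \<longleftrightarrow> r \<le> card {i\<in>I. x i \<le> t}"
proof -
  define xs where "xs = sorted_list_of_multiset (image_mset x (mset_set I))"
  note xs = sorted_order_stats[OF I, of x, folded xs_def]
  have "card {i\<in>I. x i \<le> t} = size (filter_mset (\<lambda>y. y \<le> t) (mset xs))"
    using I by (simp add: xs filter_mset_image_mset)
  also have "\<dots> = length (filter (\<lambda>y. y \<le> t) xs)" by (metis mset_filter size_mset)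
  also have "\<dots> = card {j. j < length xs \<and> xs ! j \<le> t}" by (rule length_filter_conv_card)
  finally have c: "card {i\<in>I. x i \<le> t} = card {j. j < length xs \<and> xs ! j \<le> t}" .
  show ?thesis
  proof
    assume "order_stat I x r \<le> t"
    then have "xs ! (r - 1) \<le> t" by (simp add: order_stat_def xs_def)
    have "xs ! j \<le> t" if "j < r" for j
    proof -
      have "xs ! j \<le> xs ! (r - 1)" using that r xs by (intro sorted_nth_mono) auto
      then show ?thesis using \<open>xs ! (r - 1) \<le> t\<close> by simp
    qed
    then have "{..<r} \<subseteq> {j. j < length xs \<and> xs ! j \<le> t}" using r xs by auto
    then have "card {..<r} \<le> card {j. j < length xs \<and> xs ! j \<le> t}" by (intro card_mono) auto
    then show "r \<le> card {i\<in>I. x i \<le> t}" using c by simp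
  next
    assume *: "r \<le> card {i\<in>I. x i \<le> t}"
    show "order_stat I x r \<le> t"
    proof (rule ccontr)
      assume "\<not> order_stat I x r \<le> t"
      then have "\<not> xs ! (r - 1) \<le> t" by (simp add: order_stat_def xs_def)
      then have "{j. j < length xs \<and> xs ! j \<le> t} \<subseteq> {..<r - 1}"
        using xs(1) order_trans[OF sorted_nth_mono[of xs "r - 1"]] by (auto simp: not_less[symmetric] simp del: not_less)
      then have "card {j. j < length xs \<and> xs ! j \<le> t} \<le> card {..<r - 1}" by (intro card_mono) auto
      then show False using * c r by simp
    qed
  qed
qed

lemma order_stat_greater_iff:
  assumes I: "finite I" and k: "k < card I"
  shows "t < order_stat I x (card I - k) \<longleftrightarrow> k < card {i\<in>I. t < x i}"
proof -
  have "card I = card {i\<in>I. x i \<le> t} + card {i\<in>I. t < x i}"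
    using I by (subst card_Un_disjoint[symmetric]) (auto intro!: arg_cong[where f=card])
  then show ?thesis using order_stat_le_iff[OF I, of "card I - k" x t] k by linarith
qed

lemma order_stat_mem:
  assumes "finite I" "r \<le> card I" "0 < card I"
  shows "order_stat I x r \<in> x ` I"
proof -
  define xs where "xs = sorted_list_of_multiset (image_mset x (mset_set I))"
  note xs = sorted_order_stats[OF assms(1), of x, folded xs_def]
  have "xs ! (r - 1) \<in> set xs" using xs(2) assms by (intro nth_mem) auto
  also have "set xs = set_mset (mset xs)" by simp
  also have "\<dots> = x ` I" using assms(1) by (simp only: xs(3)) simp
  finally show ?thesis by (simp add: order_stat_def xs_def)
qed

lemma order_stat_mono:
  assumes "finite I" "r \<le> r'" "1 \<le> r" "r' \<le> card I"
  shows "order_stat I x r \<le> order_stat I x r'"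
  using assms sorted_order_stats[OF assms(1), of x] unfolding order_stat_def by (intro sorted_nth_mono) auto

text \<open>Ties at the order statistic are not excluded pointwise, so besides the strict count, at
  most \<open>k\<close>, the weak count needs its own bound.\<close>

lemma card_ge_order_stat:
  assumes I: "finite I" and k: "k < card I"
  shows "k < card {i\<in>I. order_stat I x (card I - k) \<le> x i}"
proof (rule ccontr)
  let ?t = "order_stat I x (card I - k)"
  assume *: "\<not> k < card {i\<in>I. ?t \<le> x i}"
  \<comment> \<open>The largest sample value below the order statistic, or that statistic minus 1 if
    there is none. No sample value lies strictly between the two, so the strict count at
    \<open>t'\<close> is the weak count at the order statistic.\<close>
  define t' where "t' = Max (insert (?t - 1) {x i |i. i \<in> I \<and> x i < ?t})"
  have fin: "finite (insert (?t - 1) {x i |i. i \<in> I \<and> x i < ?t})" using I by auto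
  then have "t' < ?t" unfolding t'_def by (subst Max_less_iff) auto
  moreover have "x i \<le> t'" if "i \<in> I" "x i < ?t" for i
    unfolding t'_def using fin that by (intro Max_ge) auto
  ultimately have "{i\<in>I. t' < x i} = {i\<in>I. ?t \<le> x i}" by force
  then show False using order_stat_greater_iff[OF I k, of t' x] \<open>t' < ?t\<close> * by simp
qed

text \<open>A nondecreasing map keeps a sorted list sorted, even where it is constant. With the
  quantile function it carries order statistics of the exponentials to those of the
  observations.\<close>

lemma order_stat_mono_on:
  assumes "finite I" "r \<le> card I" "0 < card I" and mono: "mono_on S \<phi>" and sub: "e ` I \<subseteq> S"
  shows "order_stat I (\<lambda>i. \<phi> (e i)) r = \<phi> (order_stat I e r)"
proof -
  define xs where "xs = sorted_list_of_multiset (image_mset e (mset_set I))"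
  note xs = sorted_order_stats[OF assms(1), of e, folded xs_def]
  have "set_mset (mset xs) \<subseteq> S" using sub assms(1) by (simp only: xs) auto
  then have "set xs \<subseteq> S" by simp
  then have "sorted (map \<phi> xs)" unfolding sorted_iff_nth_mono
    using sorted_nth_mono[OF xs(1)] by (auto intro!: mono_onD[OF mono] dest: nth_mem)
  then have "map \<phi> xs = sorted_list_of_multiset (mset (map \<phi> xs))"
    by (simp only: sorted_list_of_multiset_mset sorted_sort_id)
  also have "mset (map \<phi> xs) = image_mset (\<lambda>i. \<phi> (e i)) (mset_set I)"
    by (simp add: xs multiset.map_comp comp_def)
  finally have "order_stat I (\<lambda>i. \<phi> (e i)) r = map \<phi> xs ! (r - 1)" by (simp add: order_stat_def)
  also have "\<dots> = \<phi> (xs ! (r - 1))" using assms xs(2) by (intro nth_map) auto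
  finally show ?thesis by (simp add: order_stat_def xs_def)
qed

lemma order_stat_reindex:
  "inj_on f I \<Longrightarrow> order_stat (f ` I) x r = order_stat I (\<lambda>i. x (f i)) r"
  by (simp add: order_stat_def image_mset_mset_set[symmetric] multiset.map_comp comp_def)

lemma hill_reindex: "inj_on f I \<Longrightarrow> hill (f ` I) x k = hill I (\<lambda>i. x (f i)) k"
  by (simp add: hill_def order_stat_reindex card_image)

lemma weissman_reindex: "inj_on f I \<Longrightarrow> weissman (f ` I) x k p = weissman I (\<lambda>i. x (f i)) k p"
  by (simp add: weissman_def order_stat_reindex hill_reindex card_image)

section \<open>Sums over the largest order statistics, and measurability of the estimators\<close>

lemma sum_order_stat:
  fixes \<phi> :: "real \<Rightarrow> real"
  assumes "finite I"
  shows "(\<Sum>i\<in>I. \<phi> (x i)) = (\<Sum>r=1..card I. \<phi> (order_stat I x r))"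
proof -
  define xs where "xs = sorted_list_of_multiset (image_mset x (mset_set I))"
  note xs = sorted_order_stats[OF assms(1), of x, folded xs_def]
  have "(\<Sum>i\<in>I. \<phi> (x i)) = sum_mset (image_mset \<phi> (mset xs))"
    by (simp add: xs sum_unfold_sum_mset multiset.map_comp comp_def)
  also have "\<dots> = sum_list (map \<phi> xs)" by (metis mset_map sum_mset_sum_list)
  also have "\<dots> = (\<Sum>r<card I. \<phi> (xs ! r))" by (simp add: sum_list_sum_nth xs atLeast0LessThan)
  also have "\<dots> = (\<Sum>r=1..card I. \<phi> (order_stat I x r))"
    by (rule sum.reindex_bij_witness[of _ "\<lambda>r. r - 1" Suc]) (auto simp: order_stat_def xs_def)
  finally show ?thesis .
qed

text \<open>The left side runs over the top \<open>k\<close> positions, the right side over values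
  strictly above the threshold. They differ at most by positions tied with the threshold, where
  \<open>h\<close> vanishes.\<close>

lemma sum_top_order_stats:
  fixes h :: "real \<Rightarrow> real"
  assumes I: "finite I" and k: "k < card I" and h: "h (order_stat I x (card I - k)) = 0"
  shows "(\<Sum>i=1..k. h (order_stat I x (card I - i + 1))) =
    (\<Sum>i | i \<in> I \<and> order_stat I x (card I - k) < x i. h (x i))"
proof -
  let ?t = "order_stat I x (card I - k)" and ?\<phi> = "\<lambda>y. if order_stat I x (card I - k) < y then h y else 0"
  have "(\<Sum>i | i \<in> I \<and> ?t < x i. h (x i)) = (\<Sum>i\<in>I. ?\<phi> (x i))"
    using I by (simp add: sum.If_cases Int_def)
  also have "\<dots> = (\<Sum>r=1..card I. ?\<phi> (order_stat I x r))" by (rule sum_order_stat[OF I])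
  also have "\<dots> = (\<Sum>r=card I - k + 1..card I. ?\<phi> (order_stat I x r))"
  proof (rule sum.mono_neutral_right)
    show "\<forall>i\<in>{1..card I} - {card I - k + 1..card I}. ?\<phi> (order_stat I x i) = 0"
    proof
      fix i assume "i \<in> {1..card I} - {card I - k + 1..card I}"
      then have "order_stat I x i \<le> ?t" by (intro order_stat_mono[OF I]) auto
      then show "?\<phi> (order_stat I x i) = 0" by simp
    qed
  qed auto
  also have "\<dots> = (\<Sum>r=card I - k + 1..card I. h (order_stat I x r))"
  proof (rule sum.cong[OF refl])
    fix r assume r: "r \<in> {card I - k + 1..card I}"
    then have "?t \<le> order_stat I x r" using k by (intro order_stat_mono[OF I]) auto
    then show "?\<phi> (order_stat I x r) = h (order_stat I x r)" using h
      by (metis less_eq_real_def)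
  qed
  also have "\<dots> = (\<Sum>i=1..k. h (order_stat I x (card I - i + 1)))"
    by (rule sum.reindex_bij_witness[of _ "\<lambda>i. card I - i + 1" "\<lambda>r. card I - r + 1"]) (use k in auto)
  finally show ?thesis by simp
qed

lemma order_stat_measurable:
  assumes I: "finite I" and X: "\<And>i. i \<in> I \<Longrightarrow> X i \<in> borel_measurable M" and r: "r \<le> card I \<or> I = {}"
  shows "(\<lambda>w. order_stat I (\<lambda>i. X i w) r) \<in> borel_measurable M"
proof (cases "I = {}")
  case True
  then show ?thesis by (simp add: order_stat_def)
next
  case False
  \<comment> \<open>Index 0 reads the same list position as index 1, because 0 - 1 = 0 on natural
    numbers; the counting criterion needs an index of at least 1.\<close>
  define r' where "r' = max 1 r"
  have eq: "order_stat I x r = order_stat I x r'" for x :: "'a \<Rightarrow> real"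
    by (cases r) (simp_all add: order_stat_def r'_def)
  have r': "1 \<le> r'" "r' \<le> card I" using False I r by (auto simp: r'_def Suc_le_eq card_gt_0_iff)
  have "{w \<in> space M. order_stat I (\<lambda>i. X i w) r \<le> a} \<in> sets M" for a
  proof -
    have "order_stat I (\<lambda>i. X i w) r \<le> a \<longleftrightarrow> real r' \<le> (\<Sum>i\<in>I. indicator {..a} (X i w))" for w
    proof -
      have c: "real (card {i\<in>I. X i w \<le> a}) = (\<Sum>i\<in>I. indicator {..a} (X i w))"
        using I by (simp add: indicator_def sum.If_cases Int_def)
      show ?thesis unfolding eq c[symmetric] of_nat_le_iff by (rule order_stat_le_iff[OF I r'])
    qed
    moreover have [measurable]: "(\<lambda>w. \<Sum>i\<in>I. indicator {..a} (X i w) :: real) \<in> borel_measurable M"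
      using X by (intro borel_measurable_sum) (measurable, auto)
    ultimately show ?thesis by simp
  qed
  then show ?thesis by (simp add: borel_measurable_iff_le)
qed

lemma hill_measurable:
  assumes I: "finite I" and X: "\<And>i. i \<in> I \<Longrightarrow> X i \<in> borel_measurable M"
  shows "(\<lambda>w. hill I (\<lambda>i. X i w) k) \<in> borel_measurable M"
proof -
  have [measurable]: "(\<lambda>w. order_stat I (\<lambda>i. X i w) (card I - k)) \<in> borel_measurable M"
    by (intro order_stat_measurable assms) auto
  have [measurable]: "(\<lambda>w. order_stat I (\<lambda>i. X i w) (card I - i + 1)) \<in> borel_measurable M" if "i \<in> {1..k}" for i
    using I that card_gt_0_iff[of I] by (intro order_stat_measurable assms) auto
  show ?thesis unfolding hill_def
    by (intro borel_measurable_divide borel_measurable_sum borel_measurable_ln) measurable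
qed

lemma weissman_measurable:
  assumes I: "finite I" and X: "\<And>i. i \<in> I \<Longrightarrow> X i \<in> borel_measurable M"
  shows "(\<lambda>w. weissman I (\<lambda>i. X i w) k p) \<in> borel_measurable M"
  unfolding weissman_def
  using hill_measurable[OF assms] order_stat_measurable[OF assms, where r="card I - k"] by measurable

text \<open>The log-ratio to the threshold is zero at the threshold itself, so the sum over
  positions becomes a sum over strict exceedances of \<open>e\<close>, which involves the order
  statistics only through the threshold.\<close>

lemma hill_transform:
  fixes Q :: "real \<Rightarrow> real"
  assumes I: "finite I" and k: "1 \<le> k" "k < card I"
    and mono: "mono_on S Q" and sub: "e ` I \<subseteq> S"
    and pos: "0 < Q (order_stat I e (card I - k))"
  shows "order_stat I (\<lambda>i. Q (e i)) (card I - k) = Q (order_stat I e (card I - k))"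
    and "hill I (\<lambda>i. Q (e i)) k = (\<Sum>i | i \<in> I \<and> order_stat I e (card I - k) < e i.
       ln (Q (e i)) - ln (Q (order_stat I e (card I - k)))) / k"
proof -
  let ?t = "order_stat I e (card I - k)"
  have eq: "order_stat I (\<lambda>i. Q (e i)) r = Q (order_stat I e r)" if "r \<le> card I" for r
    using I that k by (intro order_stat_mono_on[OF _ _ _ mono sub]) auto
  then show "order_stat I (\<lambda>i. Q (e i)) (card I - k) = Q ?t" by simp
  have "hill I (\<lambda>i. Q (e i)) k = (\<Sum>i=1..k. ln (Q (order_stat I e (card I - i + 1)) / Q ?t)) / k"
    unfolding hill_def by (intro arg_cong2[where f="(/)"] sum.cong) (use k in \<open>auto simp: eq\<close>)
  also have "(\<Sum>i=1..k. ln (Q (order_stat I e (card I - i + 1)) / Q ?t)) =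
      (\<Sum>i | i \<in> I \<and> ?t < e i. ln (Q (e i) / Q ?t))"
    using pos k by (intro sum_top_order_stats[OF I, where h="\<lambda>y. ln (Q y / Q ?t)"]) auto
  also have "\<dots> = (\<Sum>i | i \<in> I \<and> ?t < e i. ln (Q (e i)) - ln (Q ?t))"
  proof (rule sum.cong[OF refl])
    fix i assume i: "i \<in> {i. i \<in> I \<and> ?t < e i}"
    have "?t \<in> S" using order_stat_mem[OF I, of "card I - k" e] k sub by auto
    then have "Q ?t \<le> Q (e i)" using i sub mono by (auto simp: mono_on_def)
    then show "ln (Q (e i) / Q ?t) = ln (Q (e i)) - ln (Q ?t)" using pos by (simp add: ln_div)
  qed
  finally show "hill I (\<lambda>i. Q (e i)) k = (\<Sum>i | i \<in> I \<and> ?t < e i. ln (Q (e i)) - ln (Q ?t)) / k" .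
qed

section \<open>Regular variation\<close>

text \<open>The uniform convergence theorem for slowly varying functions, in additive form. Along a
  bad sequence, pointwise convergence holds on sets of nearly full measure; two such sets, one
  translated by the bad increment, must intersect, and a common point refutes the badness.\<close>

lemma slowly_varying_uniform:
  fixes l :: "real \<Rightarrow> real"
  assumes l [measurable]: "l \<in> borel_measurable borel"
    and lim: "\<And>y. ((\<lambda>s. l (s + y) - l s) \<longlongrightarrow> 0) at_top" and B: "B > 0" and e: "e > 0"
  shows "\<forall>\<^sub>F s in at_top. \<forall>y\<in>{0..B}. \<bar>l (s + y) - l s\<bar> < e"
proof (rule ccontr)
  assume "\<not> ?thesis"
  then have "\<exists>s y. s \<ge> real N \<and> y \<in> {0..B} \<and> \<not> \<bar>l (s + y) - l s\<bar> < e" for N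
    unfolding eventually_at_top_linorder by blast
  then obtain s y where s: "\<And>N. s N \<ge> real N" and y: "\<And>N. y N \<in> {0..B}"
    and bad: "\<And>N. \<not> \<bar>l (s N + y N) - l (s N)\<bar> < e"
    by metis
  \<comment> \<open>Points at which the increments based at \<open>a m\<close> are already small for
    all m \<ge> n. By pointwise convergence these sets increase to the whole interval.\<close>
  define V where "V a (n::nat) = {z\<in>{0..2*B}. \<forall>m\<ge>n. \<bar>l (a m + z) - l (a m)\<bar> < e/2}" for a n
  have V_lborel: "V a n \<in> sets borel" for a n
  proof -
    have aux: "(\<forall>m\<ge>n. P m) \<longleftrightarrow> (\<forall>i. P (n + i))" for P
    proof safe
      fix m assume "\<forall>i. P (n + i)" "n \<le> m"
      from this(1)[rule_format, of "m - n"] this(2) show "P m" by simp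
    qed simp
    have "V a n = {0..2*B} \<inter> (\<Inter>i. {z\<in>space borel. \<bar>l (a (n + i) + z) - l (a (n + i))\<bar> < e/2})"
      by (rule set_eqI) (simp add: V_def aux)
    also have "\<dots> \<in> sets borel"
    proof (intro sets.Int sets.countable_INT'')
      show "{z\<in>space borel. \<bar>l (a (n + i) + z) - l (a (n + i))\<bar> < e/2} \<in> sets borel" for i by measurable
    qed simp_all
    finally show ?thesis .
  qed
  have V_lmeas: "V a n \<in> lmeasurable" for a n
  proof (rule bounded_set_imp_lmeasurable)
    show "bounded (V a n)" by (rule bounded_subset[of "{0..2*B}"]) (auto simp: V_def)
    show "V a n \<in> sets lebesgue" using V_lborel[of a n] by (simp add: sets_completionI_sets)
  qed
  have V_lim: "(\<lambda>n. measure lebesgue (V a n)) \<longlonglongrightarrow> 2 * B" if a: "filterlim a at_top sequentially" for a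
  proof -
    have un: "(\<Union>n. V a n) = {0..2*B}"
    proof safe
      fix z assume z: "z \<in> {0..2*B}"
      have "((\<lambda>m. l (a m + z) - l (a m)) \<longlongrightarrow> 0) sequentially"
        by (rule filterlim_compose[OF lim a])
      from tendstoD[OF this, of "e/2"] e
      obtain n where "\<forall>m\<ge>n. \<bar>l (a m + z) - l (a m)\<bar> < e/2"
        by (auto simp: eventually_sequentially)
      then show "z \<in> (\<Union>n. V a n)" using z by (auto simp: V_def)
    qed (auto simp: V_def)
    have "(\<lambda>n. measure lebesgue (V a n)) \<longlonglongrightarrow> measure lebesgue (\<Union>n. V a n)"
    proof (rule Lim_measure_incseq)
      show "range (V a) \<subseteq> sets lebesgue" using V_lmeas by (auto simp: fmeasurable_def)
      show "incseq (V a)" by (auto simp: incseq_def V_def)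
      show "emeasure lebesgue (\<Union>n. V a n) \<noteq> \<infinity>" unfolding un using B by simp
    qed
    then show ?thesis unfolding un using B by simp
  qed
  have s_top: "filterlim s at_top sequentially"
    by (rule filterlim_at_top_mono[OF filterlim_real_sequentially]) (use s in auto)
  have sy_top: "filterlim (\<lambda>n. s n + y n) at_top sequentially"
    by (rule filterlim_at_top_mono[OF s_top]) (use y in auto)
  \<comment> \<open>Two sets of measure above 3 B / 2, both inside [0, 3 B] after the second is
    shifted by \<open>y n\<close> \<le> B, cannot be disjoint.\<close>
  have "\<forall>\<^sub>F n in sequentially. measure lebesgue (V s n) > 3/2 * B"
    by (rule order_tendstoD[OF V_lim[OF s_top]]) (use B in auto)
  moreover have "\<forall>\<^sub>F n in sequentially. measure lebesgue (V (\<lambda>n. s n + y n) n) > 3/2 * B"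
    by (rule order_tendstoD[OF V_lim[OF sy_top]]) (use B in auto)
  ultimately have "\<forall>\<^sub>F n in sequentially. measure lebesgue (V s n) > 3/2 * B \<and>
      measure lebesgue (V (\<lambda>n. s n + y n) n) > 3/2 * B" by eventually_elim auto
  then obtain n where n: "measure lebesgue (V s n) > 3/2 * B"
      "measure lebesgue (V (\<lambda>n. s n + y n) n) > 3/2 * B"
    by (auto dest!: eventually_happens)
  define W where "W = ((+) (y n)) ` V (\<lambda>n. s n + y n) n"
  have W: "W \<in> lmeasurable" "measure lebesgue W > 3/2 * B"
    using V_lmeas n by (auto simp: W_def measure_translation measurable_translation)
  have "V s n \<inter> W \<noteq> {}"
  proof
    assume disj: "V s n \<inter> W = {}"
    have "measure lebesgue (V s n \<union> W) = measure lebesgue (V s n) + measure lebesgue W"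
      using V_lmeas[of s n] W(1) disj by (intro measure_Union) (auto simp: fmeasurable_def less_top)
    moreover have "measure lebesgue (V s n \<union> W) \<le> measure lebesgue {0..3*B}"
    proof (rule measure_mono_fmeasurable)
      show "V s n \<union> W \<subseteq> {0..3*B}" using y[of n] B by (auto simp: V_def W_def)
      show "V s n \<union> W \<in> sets lebesgue" using V_lmeas[of s n] W(1) by (auto simp: fmeasurable_def)
    qed auto
    ultimately show False using W n B by simp
  qed
  \<comment> \<open>The increments from \<open>s n\<close> and from \<open>s n + y n\<close> to the
    common point \<open>s n + y n + z\<close> are both below e/2, so the bad increment between the
    two base points is below e.\<close>
  then obtain z where "y n + z \<in> V s n" "z \<in> V (\<lambda>n. s n + y n) n" by (auto simp: W_def)
  then have "\<bar>l (s n + (y n + z)) - l (s n)\<bar> < e/2" "\<bar>l (s n + y n + z) - l (s n + y n)\<bar> < e/2"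
    by (auto simp: V_def)
  then show False using bad[of n] unfolding add.assoc by linarith
qed

text \<open>The map taking t to g (ln t) is regularly varying with index \<rho> in the usual
  multiplicative sense. Measurability upgrades the pointwise ratio limits to local uniformity, and
  the constant sign makes logarithms of ratios legitimate.\<close>

locale regularly_varying =
  fixes g :: "real \<Rightarrow> real" and \<rho> :: real
  assumes g_measurable [measurable]: "g \<in> borel_measurable borel"
    and g_sign: "eventually (\<lambda>s. g s > 0) at_top \<or> eventually (\<lambda>s. g s < 0) at_top"
    and g_ratio: "\<And>y. ((\<lambda>s. g (s + y) / g s) \<longlongrightarrow> exp (\<rho> * y)) at_top"
begin

lemma eventually_shift_at_top:
  fixes c :: real
  assumes "eventually P at_top" shows "eventually (\<lambda>s. \<forall>y\<ge>c. P (s + y)) at_top"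
proof -
  obtain N where N: "\<forall>s\<ge>N. P s" using assms by (auto simp: eventually_at_top_linorder)
  then show ?thesis by (auto simp: eventually_at_top_linorder intro!: exI[of _ "N - c"])
qed

lemma g_nonzero: "eventually (\<lambda>s. g s \<noteq> 0) at_top"
  using g_sign by (auto elim: eventually_mono)

lemma ratio_pos: "eventually (\<lambda>s. \<forall>y\<ge>c. g (s + y) / g s > 0) at_top"
  using g_sign
proof
  assume *: "eventually (\<lambda>s. g s > 0) at_top"
  show ?thesis using eventually_shift_at_top[OF *, of c] * by eventually_elim auto
next
  assume *: "eventually (\<lambda>s. g s < 0) at_top"
  show ?thesis using eventually_shift_at_top[OF *, of c] * by eventually_elim (auto intro: divide_neg_neg)
qed

lemma uniform_ratio:
  assumes B: "B > 0" and e: "e > 0"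
  shows "\<forall>\<^sub>F s in at_top. \<forall>y\<in>{-B..B}. \<bar>g (s + y) / g s - exp (\<rho> * y)\<bar> < e"
proof -
  \<comment> \<open>Removing the trend \<rho> s from ln |g| leaves a function whose increments over
    fixed distances vanish in the limit, so the uniform theorem applies to it.\<close>
  define l where "l s = ln \<bar>g s\<bar> - \<rho> * s" for s
  have l_diff: "\<forall>\<^sub>F s in at_top. \<forall>y\<ge>c. g (s + y) / g s = exp (\<rho> * y + (l (s + y) - l s))" for c
    using ratio_pos[of c] g_nonzero eventually_shift_at_top[OF g_nonzero, of c]
  proof eventually_elim
    case (elim s)
    show ?case
    proof (intro allI impI)
      fix y assume "y \<ge> c"
      with elim have pos: "g (s + y) / g s > 0" "g s \<noteq> 0" "g (s + y) \<noteq> 0" by auto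
      then have "exp (l (s + y) - l s) = \<bar>g (s + y)\<bar> / \<bar>g s\<bar> * exp (- \<rho> * y)"
        by (simp add: l_def exp_diff exp_minus field_simps exp_add)
      also have "\<bar>g (s + y)\<bar> / \<bar>g s\<bar> = g (s + y) / g s" using pos by (simp flip: abs_divide)
      finally show "g (s + y) / g s = exp (\<rho> * y + (l (s + y) - l s))"
        unfolding exp_add by (simp add: exp_minus field_simps)
    qed
  qed
  have lim: "((\<lambda>s. l (s + y) - l s) \<longlongrightarrow> 0) at_top" for y
  proof -
    have "((\<lambda>s. ln (g (s + y) / g s) - \<rho> * y) \<longlongrightarrow> ln (exp (\<rho> * y)) - \<rho> * y) at_top"
      by (intro tendsto_intros g_ratio) auto
    then have "((\<lambda>s. ln (g (s + y) / g s) - \<rho> * y) \<longlongrightarrow> 0) at_top" by simp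
    then show ?thesis
      by (rule Lim_transform_eventually) (use l_diff[of y] in eventually_elim, simp)
  qed
  have [measurable]: "l \<in> borel_measurable borel" unfolding l_def by measurable
  define K where "K = exp (\<bar>\<rho>\<bar> * B)"
  have "(exp \<longlongrightarrow> exp (0::real)) (at 0)" by (intro tendsto_intros)
  moreover have eK: "e / K > 0" using e by (simp add: K_def)
  ultimately have "\<forall>\<^sub>F d in at (0::real). dist (exp d) (exp 0) < e / K" by (rule tendstoD)
  then obtain \<eta> where \<eta>0: "\<eta> > 0" "\<And>d. d \<noteq> 0 \<Longrightarrow> dist d 0 < \<eta> \<Longrightarrow> dist (exp d) (exp (0::real)) < e / K"
    unfolding eventually_at by auto
  have \<eta>: "\<eta> > 0" "\<And>d. \<bar>d\<bar> < \<eta> \<Longrightarrow> \<bar>exp d - 1\<bar> < e / K"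
    using \<eta>0 eK by (auto simp: dist_real_def) (metis abs_zero diff_self exp_zero)
  \<comment> \<open>The uniform theorem covers nonnegative increments only, so both
    \<open>l (s + y)\<close> and \<open>l s\<close> are compared with the base point s - B over
    [0, 2 B].\<close>
  have "\<forall>\<^sub>F s in at_top. \<forall>y\<in>{0..2*B}. \<bar>l (s + y) - l s\<bar> < \<eta>/2"
    using lim B \<eta>(1) by (intro slowly_varying_uniform) auto
  from eventually_shift_at_top[OF this, of "-B"]
  have "\<forall>\<^sub>F s in at_top. \<forall>y\<in>{-B..B}. \<bar>l (s + y) - l s\<bar> < \<eta>"
  proof eventually_elim
    case (elim s)
    show ?case
    proof
      fix y assume y: "y \<in> {-B..B}"
      have *: "\<bar>l (s - B + z) - l (s - B)\<bar> < \<eta>/2" if "z \<in> {0..2*B}" for z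
        using elim[THEN spec, of "-B"] that by auto
      have "\<bar>l (s + y) - l (s - B)\<bar> < \<eta>/2" "\<bar>l s - l (s - B)\<bar> < \<eta>/2"
        using *[of "y + B"] *[of B] y B by (simp_all add: algebra_simps)
      then show "\<bar>l (s + y) - l s\<bar> < \<eta>" by linarith
    qed
  qed
  with l_diff[of "-B"] show ?thesis
  proof eventually_elim
    case (elim s)
    show ?case
    proof
      fix y assume y: "y \<in> {-B..B}"
      define d where "d = l (s + y) - l s"
      have d: "\<bar>exp d - 1\<bar> < e / K" using elim y by (intro \<eta>(2)) (auto simp: d_def)
      have "g (s + y) / g s = exp (\<rho> * y + d)" using elim(1) y by (simp add: d_def)
      then have "g (s + y) / g s - exp (\<rho> * y) = exp (\<rho> * y) * (exp d - 1)"
        unfolding exp_add by (simp add: algebra_simps)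
      then have "\<bar>g (s + y) / g s - exp (\<rho> * y)\<bar> = exp (\<rho> * y) * \<bar>exp d - 1\<bar>" by (simp add: abs_mult)
      also have "\<dots> \<le> K * \<bar>exp d - 1\<bar>"
      proof -
        have "\<bar>\<rho> * y\<bar> \<le> \<bar>\<rho>\<bar> * B" unfolding abs_mult using y by (intro mult_left_mono) auto
        then have "\<rho> * y \<le> \<bar>\<rho>\<bar> * B" by linarith
        then show ?thesis unfolding K_def by (intro mult_right_mono) auto
      qed
      also have "\<dots> < K * (e / K)" using d by (intro mult_strict_left_mono) (auto simp: K_def)
      also have "\<dots> = e" by (simp add: K_def)
      finally show "\<bar>g (s + y) / g s - exp (\<rho> * y)\<bar> < e" .
    qed
  qed
qed

text \<open>The increment may itself vary along the filter, which is where local uniformity is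
  needed; in particular it may be the random offset of the threshold from a deterministic
  level.\<close>

lemma ratio_tendsto:
  assumes S: "filterlim S at_top G" and Y: "(Y \<longlongrightarrow> y) G"
  shows "((\<lambda>z. g (S z + Y z) / g (S z)) \<longlongrightarrow> exp (\<rho> * y)) G"
proof -
  have "\<forall>\<^sub>F z in G. dist (Y z) y < 1" by (rule tendstoD[OF Y]) simp
  then have ev: "\<forall>\<^sub>F z in G. \<bar>Y z\<bar> \<le> \<bar>y\<bar> + 1"
    by eventually_elim (auto simp: dist_real_def)
  have "((\<lambda>z. g (S z + Y z) / g (S z) - exp (\<rho> * Y z)) \<longlongrightarrow> 0) G"
    unfolding tendsto_iff
  proof (intro allI impI)
    fix e :: real assume "e > 0"
    then have "\<forall>\<^sub>F s in at_top. \<forall>y\<in>{-(\<bar>y\<bar> + 1)..\<bar>y\<bar> + 1}. \<bar>g (s + y) / g s - exp (\<rho> * y)\<bar> < e"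
      by (intro uniform_ratio) auto
    then have "\<forall>\<^sub>F z in G. \<forall>y\<in>{-(\<bar>y\<bar> + 1)..\<bar>y\<bar> + 1}. \<bar>g (S z + y) / g (S z) - exp (\<rho> * y)\<bar> < e"
      by (rule eventually_compose_filterlim[OF _ S])
    with ev show "\<forall>\<^sub>F z in G. dist (g (S z + Y z) / g (S z) - exp (\<rho> * Y z)) 0 < e"
      by eventually_elim (auto simp: dist_real_def abs_le_iff)
  qed
  moreover have "((\<lambda>z. exp (\<rho> * Y z)) \<longlongrightarrow> exp (\<rho> * y)) G" by (intro tendsto_intros Y)
  ultimately have "((\<lambda>z. (g (S z + Y z) / g (S z) - exp (\<rho> * Y z)) + exp (\<rho> * Y z)) \<longlongrightarrow> 0 + exp (\<rho> * y)) G"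
    by (rule tendsto_add)
  then show ?thesis by simp
qed

text \<open>A crude Potter bound. Since exp \<rho> < 1, |g| eventually does not increase over unit
  steps, and local uniformity absorbs the fractional part of \<open>y\<close>. The range starts at
  -1 because the random threshold may fall slightly below the level.\<close>

lemma ratio_bounded:
  assumes \<rho>: "\<rho> < 0"
  obtains C where "C > 0" "\<forall>\<^sub>F s in at_top. \<forall>y\<ge>-1. \<bar>g (s + y) / g s\<bar> \<le> C"
proof -
  define C where "C = exp (- \<rho>) + 1"
  have "\<forall>\<^sub>F s in at_top. \<forall>y\<in>{-1..1}. \<bar>g (s + y) / g s - exp (\<rho> * y)\<bar> < 1" by (intro uniform_ratio) auto
  then have 1: "\<forall>\<^sub>F s in at_top. \<forall>y\<in>{-1..1}. \<bar>g (s + y)\<bar> \<le> C * \<bar>g s\<bar>"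
    using g_nonzero
  proof eventually_elim
    case (elim s)
    show ?case
    proof
      fix y :: real assume y: "y \<in> {-1..1}"
      have "\<rho> * y \<le> - \<rho>" using \<rho> y mult_left_mono_neg[of "-1" y \<rho>] by simp
      then have "exp (\<rho> * y) \<le> exp (- \<rho>)" by simp
      moreover have "\<bar>g (s + y) / g s - exp (\<rho> * y)\<bar> < 1" using elim y by blast
      ultimately have "\<bar>g (s + y) / g s\<bar> \<le> C" unfolding C_def by (smt (verit) exp_gt_zero)
      then show "\<bar>g (s + y)\<bar> \<le> C * \<bar>g s\<bar>" using elim by (simp add: abs_divide field_simps)
    qed
  qed
  have "((\<lambda>s. \<bar>g (s + 1) / g s\<bar>) \<longlongrightarrow> \<bar>exp (\<rho> * 1)\<bar>) at_top" by (intro tendsto_intros g_ratio)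
  then have "\<forall>\<^sub>F s in at_top. \<bar>g (s + 1) / g s\<bar> < 1" using \<rho> by (auto dest: order_tendstoD(2)[of _ _ _ 1])
  then have 2: "\<forall>\<^sub>F s in at_top. \<bar>g (s + 1)\<bar> \<le> \<bar>g s\<bar>"
    using g_nonzero by eventually_elim (auto simp: abs_divide field_simps)
  obtain N1 where N1: "\<And>s y. s \<ge> N1 \<Longrightarrow> y \<in> {-1..1} \<Longrightarrow> \<bar>g (s + y)\<bar> \<le> C * \<bar>g s\<bar>"
    using 1 unfolding eventually_at_top_linorder by blast
  obtain N2 where N2: "\<And>s. s \<ge> N2 \<Longrightarrow> \<bar>g (s + 1)\<bar> \<le> \<bar>g s\<bar>"
    using 2 by (auto simp: eventually_at_top_linorder)
  obtain N3 where N3: "\<And>s. s \<ge> N3 \<Longrightarrow> g s \<noteq> 0"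
    using g_nonzero by (auto simp: eventually_at_top_linorder)
  have C: "C > 0" by (simp add: C_def add_pos_pos)
  have iter: "\<bar>g (s + real n)\<bar> \<le> \<bar>g s\<bar>" if "s \<ge> N2" for s n
  proof (induction n)
    case (Suc n)
    have "\<bar>g (s + real n + 1)\<bar> \<le> \<bar>g (s + real n)\<bar>" using that by (intro N2) auto
    with Suc show ?case by (simp add: algebra_simps)
  qed simp
  have "\<bar>g (s + y) / g s\<bar> \<le> C" if s: "s \<ge> max (max N1 N2) N3" and y: "y \<ge> -1" for s y
  proof -
    have "\<bar>g (s + y)\<bar> \<le> C * \<bar>g s\<bar>"
    proof (cases "y \<le> 1")
      case True then show ?thesis using N1[of s y] s y by auto
    next
      case False
      define n where "n = nat \<lfloor>y\<rfloor>"
      have n: "real n \<le> y" "y < real n + 1" using False by (auto simp: n_def)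
      have "\<bar>g (s + y)\<bar> = \<bar>g ((s + real n) + (y - real n))\<bar>" by simp
      also have "\<dots> \<le> C * \<bar>g (s + real n)\<bar>" using n s by (intro N1) auto
      also have "\<dots> \<le> C * \<bar>g s\<bar>" using C s by (intro mult_left_mono iter) auto
      finally show ?thesis .
    qed
    moreover have "g s \<noteq> 0" using N3 s by auto
    ultimately show ?thesis by (simp add: abs_divide field_simps)
  qed
  then have "\<forall>\<^sub>F s in at_top. \<forall>y\<ge>-1. \<bar>g (s + y) / g s\<bar> \<le> C"
    unfolding eventually_at_top_linorder by blast
  from that[OF C this] show thesis .
qed

end

section \<open>From increments of \<open>f\<close> on the scale \<open>a\<close> to a finite limit
  of \<open>f\<close>\<close>

lemma abs_add3_less:
  fixes x y z :: real
  assumes "\<bar>x\<bar> < a" "\<bar>y\<bar> < b" "\<bar>z\<bar> < c"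
  shows "\<bar>x + y + z\<bar> < a + b + c"
  using assms by linarith

text \<open>For \<rho> < 0 the increments of \<open>f\<close> along s, s + 1, s + 2, ... decay
  geometrically. Hence \<open>f\<close> has a finite limit \<open>L\<close>, and summing the
  increments shows that L - f is asymptotic to -a / \<rho>.\<close>

lemma extended_regular_variation_limit:
  fixes f a :: "real \<Rightarrow> real"
  assumes \<rho>: "\<rho> < 0" and a0: "(a \<longlongrightarrow> 0) at_top" and a_nz: "eventually (\<lambda>s. a s \<noteq> 0) at_top"
    and H: "\<And>y. ((\<lambda>s. (f (s + y) - f s) / a s) \<longlongrightarrow> (exp (\<rho> * y) - 1) / \<rho>) at_top"
  obtains L where "((\<lambda>s. (L - f s) / a s) \<longlongrightarrow> - 1 / \<rho>) at_top"
    and "\<And>y. ((\<lambda>s. a (s + y) / a s) \<longlongrightarrow> exp (\<rho> * y)) at_top"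
proof -
  have shift: "filterlim (\<lambda>s. s + y) at_top at_top" for y :: real
    using filterlim_tendsto_add_at_top[OF tendsto_const filterlim_ident, of y] by (simp add: add.commute)
  have H1: "(exp (\<rho> * 1) - 1) / \<rho> \<noteq> 0" using \<rho> by simp
  have a_ratio: "((\<lambda>s. a (s + y) / a s) \<longlongrightarrow> exp (\<rho> * y)) at_top" for y
  proof -
    let ?h = "\<lambda>y. (exp (\<rho> * y) - 1) / \<rho>"
    \<comment> \<open>The increment of \<open>f\<close> from s + y to s + y + 1 is measured on the
      scales \<open>a s\<close> and \<open>a (s + y)\<close>; the quotient of the two normalised
      increments is a (s + y) / a s.\<close>
    have "((\<lambda>s. ((f (s + (y + 1)) - f s) / a s - (f (s + y) - f s) / a s) /
        ((f (s + y + 1) - f (s + y)) / a (s + y))) \<longlongrightarrow> (?h (y + 1) - ?h y) / ?h 1) at_top"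
      by (intro tendsto_divide tendsto_diff H H1 filterlim_compose[OF H shift])
    also have "(?h (y + 1) - ?h y) / ?h 1 = exp (\<rho> * y)" using \<rho> by (simp add: field_simps exp_add)
    finally have "((\<lambda>s. ((f (s + (y + 1)) - f s) / a s - (f (s + y) - f s) / a s) /
        ((f (s + y + 1) - f (s + y)) / a (s + y))) \<longlongrightarrow> exp (\<rho> * y)) at_top" .
    moreover have "\<forall>\<^sub>F s in at_top. (f (s + 1) - f s) / a s \<noteq> 0"
      using tendsto_imp_eventually_ne[OF H H1] .
    then have "\<forall>\<^sub>F s in at_top. (f (s + y + 1) - f (s + y)) / a (s + y) \<noteq> 0"
      by (rule eventually_compose_filterlim[OF _ shift])
    then have "\<forall>\<^sub>F s in at_top. ((f (s + (y + 1)) - f s) / a s - (f (s + y) - f s) / a s) /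
        ((f (s + y + 1) - f (s + y)) / a (s + y)) = a (s + y) / a s"
      using a_nz by eventually_elim (auto simp: field_simps)
    ultimately show ?thesis by (rule Lim_transform_eventually)
  qed
  \<comment> \<open>Any number strictly between exp \<rho> and 1 serves as the eventual contraction
    factor of |a| over a unit step.\<close>
  define r where "r = (1 + exp \<rho>) / 2"
  have r: "0 < r" "r < 1" "exp \<rho> < r" using \<rho> by (auto simp: r_def add_pos_pos)
  define K where "K = \<bar>(exp (\<rho> * 1) - 1) / \<rho>\<bar> + 1"
  have "((\<lambda>s. \<bar>a (s + 1) / a s\<bar>) \<longlongrightarrow> \<bar>exp (\<rho> * 1)\<bar>) at_top" by (intro tendsto_intros a_ratio)
  then have "\<forall>\<^sub>F s in at_top. \<bar>a (s + 1) / a s\<bar> < r" by (rule order_tendstoD) (use r in simp)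
  moreover have "((\<lambda>s. \<bar>(f (s + 1) - f s) / a s\<bar>) \<longlongrightarrow> \<bar>(exp (\<rho> * 1) - 1) / \<rho>\<bar>) at_top"
    by (intro tendsto_intros H)
  then have "\<forall>\<^sub>F s in at_top. \<bar>(f (s + 1) - f s) / a s\<bar> < K" by (rule order_tendstoD) (simp add: K_def)
  ultimately have "\<forall>\<^sub>F s in at_top. \<bar>a (s + 1)\<bar> \<le> r * \<bar>a s\<bar> \<and> \<bar>f (s + 1) - f s\<bar> \<le> K * \<bar>a s\<bar>"
    using a_nz by eventually_elim (auto simp: abs_divide field_simps)
  then obtain N where N: "\<And>s. s \<ge> N \<Longrightarrow> \<bar>a (s + 1)\<bar> \<le> r * \<bar>a s\<bar>"
      "\<And>s. s \<ge> N \<Longrightarrow> \<bar>f (s + 1) - f s\<bar> \<le> K * \<bar>a s\<bar>"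
    by (auto simp: eventually_at_top_linorder)
  have a_geo: "\<bar>a (s + real n)\<bar> \<le> r ^ n * \<bar>a s\<bar>" if "s \<ge> N" for s n
  proof (induction n)
    case (Suc n)
    have "\<bar>a (s + real n + 1)\<bar> \<le> r * \<bar>a (s + real n)\<bar>" using that by (intro N) auto
    also have "\<dots> \<le> r * (r ^ n * \<bar>a s\<bar>)" using r Suc by (intro mult_left_mono) auto
    finally show ?case by (simp add: algebra_simps)
  qed simp
  define \<Delta> where "\<Delta> s n = f (s + real (Suc n)) - f (s + real n)" for s n
  have \<Delta>: "\<bar>\<Delta> s n\<bar> \<le> K * \<bar>a s\<bar> * r ^ n" if "s \<ge> N" for s n
  proof -
    have "\<bar>\<Delta> s n\<bar> \<le> K * \<bar>a (s + real n)\<bar>" using N(2)[of "s + real n"] that by (simp add: \<Delta>_def algebra_simps)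
    also have "\<dots> \<le> K * (r ^ n * \<bar>a s\<bar>)" using a_geo[OF that, of n] by (intro mult_left_mono) (auto simp: K_def)
    finally show ?thesis by (simp add: algebra_simps)
  qed
  have geo: "summable (\<lambda>n. K * \<bar>a s\<bar> * r ^ n)" for s using r by (intro summable_mult summable_geometric) auto
  have summ: "summable (\<Delta> s)" if "s \<ge> N" for s
    by (rule summable_comparison_test'[OF geo[of s], of 0]) (use \<Delta>[OF that] in auto)
  have lim_f: "(\<lambda>n. f (s + real n)) \<longlonglongrightarrow> f s + suminf (\<Delta> s)" if "s \<ge> N" for s
  proof -
    have "(\<lambda>n. f s + (\<Sum>i<n. \<Delta> s i)) \<longlonglongrightarrow> f s + suminf (\<Delta> s)"
      by (intro tendsto_intros summable_LIMSEQ summ that)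
    moreover have "(\<Sum>i<n. \<Delta> s i) = f (s + real n) - f s" for n
      unfolding \<Delta>_def using sum_lessThan_telescope[of "\<lambda>n. f (s + real n)" n] by simp
    ultimately show ?thesis by simp
  qed
  have tail: "\<bar>suminf (\<Delta> s)\<bar> \<le> K / (1 - r) * \<bar>a s\<bar>" if "s \<ge> N" for s
  proof -
    have "norm (suminf (\<Delta> s)) \<le> (\<Sum>n. K * \<bar>a s\<bar> * r ^ n)"
      by (rule norm_suminf_le) (use geo \<Delta>[OF that] in auto)
    also have "\<dots> = K / (1 - r) * \<bar>a s\<bar>" using r by (subst suminf_mult) (auto simp: suminf_geometric)
    finally show ?thesis by simp
  qed
  \<comment> \<open>The limit along N, N + 1, ...; the next claim shows that every other starting
    point leads to the same value, because the two sequences keep a fixed distance and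
    \<open>a\<close> tends to 0.\<close>
  define L where "L = f N + suminf (\<Delta> N)"
  have L: "L - f s = suminf (\<Delta> s)" if "s \<ge> N" for s
  proof -
    have n_top: "filterlim (\<lambda>n. N + real n) at_top sequentially"
      by (rule filterlim_tendsto_add_at_top[OF tendsto_const filterlim_real_sequentially])
    have "(\<lambda>n. (f (N + real n + (s - N)) - f (N + real n)) / a (N + real n) * a (N + real n))
        \<longlonglongrightarrow> (exp (\<rho> * (s - N)) - 1) / \<rho> * 0"
      by (intro tendsto_mult filterlim_compose[OF H n_top] filterlim_compose[OF a0 n_top])
    moreover have "\<forall>\<^sub>F n in sequentially. a (N + real n) \<noteq> 0"
      by (rule eventually_compose_filterlim[OF a_nz n_top])
    then have "\<forall>\<^sub>F n in sequentially. (f (N + real n + (s - N)) - f (N + real n)) / a (N + real n) * a (N + real n)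
        = f (s + real n) - f (N + real n)"
      by eventually_elim (simp add: add.commute)
    ultimately have "(\<lambda>n. f (s + real n) - f (N + real n)) \<longlonglongrightarrow> 0"
      by (simp add: Lim_transform_eventually)
    moreover have "(\<lambda>n. f (s + real n) - f (N + real n)) \<longlonglongrightarrow> (f s + suminf (\<Delta> s)) - L"
      unfolding L_def using that by (intro tendsto_diff lim_f) auto
    ultimately show ?thesis using LIMSEQ_unique by fastforce
  qed
  have "((\<lambda>s. (L - f s) / a s) \<longlongrightarrow> - 1 / \<rho>) at_top"
    unfolding tendsto_iff
  proof (intro allI impI)
    fix e :: real assume e: "e > 0"
    have "(\<lambda>n. exp \<rho> ^ n / (-\<rho>)) \<longlonglongrightarrow> 0 / (-\<rho>)"
      using \<rho> by (intro tendsto_divide LIMSEQ_realpow_zero tendsto_const) auto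
    then have "\<forall>\<^sub>F n in sequentially. exp \<rho> ^ n / (-\<rho>) < e/3" by (rule order_tendstoD) (use e in simp)
    moreover have "(\<lambda>n. K / (1 - r) * r ^ n) \<longlonglongrightarrow> K / (1 - r) * 0"
      using r by (intro tendsto_mult LIMSEQ_realpow_zero tendsto_const) auto
    then have "\<forall>\<^sub>F n in sequentially. K / (1 - r) * r ^ n < e/3" by (rule order_tendstoD) (use e in simp)
    ultimately have "\<forall>\<^sub>F n in sequentially. exp \<rho> ^ n / (-\<rho>) < e/3 \<and> K / (1 - r) * r ^ n < e/3"
      by (rule eventually_conj)
    \<comment> \<open>After \<open>m\<close> unit steps the rest of the series, at most K / (1 - r)
      r^m relative to |a s|, and the term exp (\<rho> m) / \<rho> are both small; \<open>m\<close>
      is fixed before \<open>s\<close> is sent to infinity.\<close>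
    then obtain m where m: "exp \<rho> ^ m / (-\<rho>) < e/3" "K / (1 - r) * r ^ m < e/3"
      by (auto dest!: eventually_happens)
    have "\<forall>\<^sub>F s in at_top. dist ((f (s + real m) - f s) / a s) ((exp (\<rho> * real m) - 1) / \<rho>) < e/3"
      using H e by (intro tendstoD) auto
    with a_nz eventually_ge_at_top[of N]
    show "\<forall>\<^sub>F s in at_top. dist ((L - f s) / a s) (- 1 / \<rho>) < e"
    proof eventually_elim
      case (elim s)
      have eq: "(L - f s) / a s - (-1 / \<rho>) = ((f (s + real m) - f s) / a s - (exp (\<rho> * real m) - 1) / \<rho>)
          + (L - f (s + real m)) / a s + exp (\<rho> * real m) / \<rho>"
        by (simp add: diff_divide_distrib)
      have 1: "\<bar>(L - f (s + real m)) / a s\<bar> < e/3"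
      proof -
        have "\<bar>L - f (s + real m)\<bar> \<le> K / (1 - r) * \<bar>a (s + real m)\<bar>"
          using L[of "s + real m"] tail[of "s + real m"] elim by simp
        also have "\<dots> \<le> K / (1 - r) * (r ^ m * \<bar>a s\<bar>)"
          using r elim a_geo[of s m] by (intro mult_left_mono) (auto simp: K_def)
        finally have "\<bar>(L - f (s + real m)) / a s\<bar> \<le> K / (1 - r) * r ^ m"
          using elim by (simp add: abs_divide field_simps)
        with m show ?thesis by linarith
      qed
      have 2: "\<bar>exp (\<rho> * real m) / \<rho>\<bar> < e/3"
      proof -
        have "\<bar>exp (\<rho> * real m) / \<rho>\<bar> = exp \<rho> ^ m / (-\<rho>)"
          using \<rho> by (simp add: abs_divide exp_of_nat_mult[symmetric] mult.commute)
        with m show ?thesis by simp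
      qed
      have 3: "\<bar>(f (s + real m) - f s) / a s - (exp (\<rho> * real m) - 1) / \<rho>\<bar> < e/3"
        using elim by (simp add: dist_real_def)
      have "\<bar>(L - f s) / a s - (-1 / \<rho>)\<bar> < e/3 + e/3 + e/3"
        unfolding eq by (rule abs_add3_less[OF 3 1 2])
      then show ?case by (simp add: dist_real_def)
    qed
  qed
  from that[OF this a_ratio] show thesis .
qed

section \<open>Quantiles of a continuous distribution\<close>

context real_distribution
begin

context
  assumes cont: "continuous_on UNIV (cdf M)"
begin

text \<open>Continuity closes the superlevel set, so the infimum is attained and the quantile and
  distribution functions form a Galois connection.\<close>

lemma quantile_le_iff:
  assumes u: "0 < u" "u < 1"
  shows "quantile (cdf M) u \<le> x \<longleftrightarrow> u \<le> cdf M x"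
proof -
  let ?A = "{x. u \<le> cdf M x}"
  have "\<forall>\<^sub>F x in at_top. u < cdf M x" by (rule order_tendstoD(1)[OF cdf_lim_at_top_prob u(2)])
  then obtain x0 where "u < cdf M x0" by (auto dest!: eventually_happens)
  then have ne: "?A \<noteq> {}" by (auto intro: less_imp_le)
  have "\<forall>\<^sub>F x in at_bot. cdf M x < u" by (rule order_tendstoD(2)[OF cdf_lim_at_bot u(1)])
  then obtain y where y: "\<And>x. x \<le> y \<Longrightarrow> cdf M x < u" by (auto simp: eventually_at_bot_linorder)
  have bdd: "bdd_below ?A"
    by (rule bdd_belowI[of _ y]) (use y in \<open>force simp: not_less[symmetric]\<close>)
  have "closed ?A" by (intro closed_Collect_le continuous_on_const cont)
  then have "Inf ?A \<in> ?A" by (intro closed_contains_Inf ne bdd)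
  then have "u \<le> cdf M (quantile (cdf M) u)" by (simp add: quantile_def)
  then show ?thesis
    using cdf_nondecreasing[of "quantile (cdf M) u" x] cInf_lower[of x ?A] bdd by (auto simp: quantile_def)
qed

lemma quantile_mono: "0 < u \<Longrightarrow> u \<le> v \<Longrightarrow> v < 1 \<Longrightarrow> quantile (cdf M) u \<le> quantile (cdf M) v"
  using quantile_le_iff[of u "quantile (cdf M) v"] quantile_le_iff[of v "quantile (cdf M) v"] by simp

lemma quantile_exp_mono: "mono_on {0<..} (\<lambda>s. quantile (cdf M) (1 - exp (- s)))"
  by (intro mono_onI quantile_mono) auto

lemma cdf_quantile:
  assumes u: "0 < u" "u < 1"
  shows "cdf M (quantile (cdf M) u) = u"
proof (rule antisym)
  have "\<forall>\<^sub>F x in at_top. u < cdf M x" by (rule order_tendstoD(1)[OF cdf_lim_at_top_prob u(2)])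
  then obtain x0 where x0: "u < cdf M x0" by (auto dest!: eventually_happens)
  have "\<forall>\<^sub>F x in at_bot. cdf M x < u" by (rule order_tendstoD(2)[OF cdf_lim_at_bot u(1)])
  then obtain y where y: "cdf M y < u" by (auto dest!: eventually_happens)
  have "y \<le> x0" using cdf_nondecreasing[of x0 y] x0 y by linarith
  then obtain x where "cdf M x = u"
    using IVT'[of "cdf M" y u x0] x0 y continuous_on_subset[OF cont] by auto
  then show "cdf M (quantile (cdf M) u) \<le> u"
    using quantile_le_iff[OF u, of x] cdf_nondecreasing[of "quantile (cdf M) u" x] by simp
qed (use quantile_le_iff[OF u, of "quantile (cdf M) u"] in simp)

lemma cdf_bounds: "0 \<le> cdf M x" "cdf M x \<le> 1"
  by (auto simp: cdf_nonneg cdf_bounded_prob)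

lemma cdf_borel [measurable]: "cdf M \<in> borel_measurable borel"
  by (intro borel_measurable_continuous_onI cont)

lemma prob_cdf_less:
  assumes u: "0 < u" "u < 1"
  shows "measure M {x. cdf M x < u} = u"
proof -
  let ?q = "quantile (cdf M) u"
  have "cdf M x < u \<longleftrightarrow> x < ?q" for x using quantile_le_iff[OF u, of x] by linarith
  then have "{x. cdf M x < u} = {..<?q}" by auto
  moreover have "measure M {?q} = 0"
    using isCont_cdf[of ?q] cont by (simp add: continuous_on_eq_continuous_at)
  moreover have "measure M {..?q} = measure M {..<?q} + measure M {?q}"
    by (subst finite_measure_Union[symmetric]) (auto intro: arg_cong[where f="measure M"])
  ultimately show ?thesis using cdf_quantile[OF u] by (simp add: cdf_def)
qed

lemma prob_cdf_le:
  assumes u: "0 \<le> u" "u < 1"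
  shows "measure M {x. cdf M x \<le> u} = u"
proof (rule antisym)
  have "measure M {x. cdf M x \<le> u} \<le> v" if "u < v" "v < 1" for v
  proof -
    have "measure M {x. cdf M x \<le> u} \<le> measure M {x. cdf M x < v}"
      by (intro finite_measure_mono) (use that in auto)
    with prob_cdf_less[of v] that u show ?thesis by simp
  qed
  then show "measure M {x. cdf M x \<le> u} \<le> u" by (intro dense_ge_bounded[OF u(2)])
  have "u \<le> measure M {x. cdf M x \<le> u}" if "u > 0"
  proof -
    have "measure M {x. cdf M x < u} \<le> measure M {x. cdf M x \<le> u}"
      by (intro finite_measure_mono) auto
    with prob_cdf_less[of u] that u show ?thesis by simp
  qed
  then show "u \<le> measure M {x. cdf M x \<le> u}" using u by (cases "u = 0") auto
qed

text \<open>Removing {F \<le> u - d}, of mass u - d, from a set of mass at most u leaves at most d.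
  The value u = 1 is included so that ln (1 - F) is finite almost surely.\<close>

lemma prob_cdf_eq:
  assumes u: "0 < u" "u \<le> 1"
  shows "measure M {x. cdf M x = u} = 0"
proof (rule antisym)
  have "measure M {x. cdf M x = u} \<le> d" if d: "0 < d" "d < u" for d
  proof -
    have "measure M {x. cdf M x = u} + measure M {x. cdf M x \<le> u - d} = measure M ({x. cdf M x = u} \<union> {x. cdf M x \<le> u - d})"
      by (subst finite_measure_Union) (use d in auto)
    also have "\<dots> \<le> measure M {x. cdf M x \<le> u}" by (intro finite_measure_mono) (use d in auto)
    also have "\<dots> \<le> u"
      using prob_cdf_le[of u] u by (cases "u = 1") auto
    also have "measure M {x. cdf M x \<le> u - d} = u - d" using d u by (intro prob_cdf_le) auto
    finally show ?thesis by simp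
  qed
  then show "measure M {x. cdf M x = u} \<le> 0" by (intro dense_ge_bounded[OF u(1)])
qed simp

text \<open>The quantile function fails to invert F only at points lying in a flat piece to the
  right of its left end. Such a point shares its F-value with a rational to its left, so countably
  many null level sets cover all of them.\<close>

lemma AE_cdf:
  "AE x in M. 0 < cdf M x \<and> cdf M x < 1 \<and> quantile (cdf M) (cdf M x) = x"
proof -
  have null: "AE x in M. \<not> P x" if "measure M {x. P x} = 0" "{x. P x} \<in> sets borel" for P
    using that by (intro AE_I[of _ _ "{x. P x}"]) (auto simp: emeasure_eq_measure)
  have "AE x in M. \<not> cdf M x \<le> 0" using prob_cdf_le[of 0] by (intro null) auto
  moreover have "AE x in M. \<not> cdf M x = 1" using prob_cdf_eq[of 1] by (intro null) auto
  moreover have "AE x in M. \<forall>r\<in>(\<rat>::real set). \<not> (0 < cdf M r \<and> cdf M x = cdf M r)"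
  proof (subst AE_ball_countable[OF countable_rat])
    show "\<forall>r\<in>(\<rat>::real set). AE x in M. \<not> (0 < cdf M r \<and> cdf M x = cdf M r)"
    proof
      fix r :: real
      show "AE x in M. \<not> (0 < cdf M r \<and> cdf M x = cdf M r)"
        using prob_cdf_eq[of "cdf M r"] cdf_bounds[of r]
        by (cases "0 < cdf M r") (auto intro!: null)
    qed
  qed
  ultimately show ?thesis
  proof eventually_elim
    case (elim x)
    have F: "0 < cdf M x" "cdf M x < 1" using elim cdf_bounds[of x] by auto
    have "quantile (cdf M) (cdf M x) \<le> x" using quantile_le_iff[OF F, of x] by simp
    moreover have "\<not> quantile (cdf M) (cdf M x) < x"
    proof
      assume "quantile (cdf M) (cdf M x) < x"
      then obtain r where r: "r \<in> \<rat>" "quantile (cdf M) (cdf M x) < r" "r < x" using Rats_dense_in_real by blast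
      then have "cdf M x \<le> cdf M r" using quantile_le_iff[OF F, of r] by simp
      moreover have "cdf M r \<le> cdf M x" using r by (intro cdf_nondecreasing) auto
      ultimately show False using elim F r by auto
    qed
    ultimately show ?case using F by simp
  qed
qed

lemma exponential_transform:
  "distributed M lborel (\<lambda>x. - ln (1 - cdf M x)) (exponential_density 1)"
proof (rule exponential_distributedI)
  fix a :: real assume a: "0 \<le> a"
  have "AE x in M. (- ln (1 - cdf M x) \<le> a) = (cdf M x \<le> 1 - exp (- a))"
    \<comment> \<open>The logarithm is monotone only where F < 1, hence an almost sure equivalence
      of events.\<close>
    using AE_cdf
  proof eventually_elim
    case (elim x)
    have "- ln (1 - cdf M x) \<le> a \<longleftrightarrow> exp (- a) \<le> 1 - cdf M x" using elim by (subst ln_ge_iff[symmetric]) auto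
    then show ?case by auto
  qed
  then have "emeasure M {x \<in> space M. - ln (1 - cdf M x) \<le> a} = emeasure M {x\<in>space M. cdf M x \<le> 1 - exp (- a)}"
    by (intro emeasure_eq_AE) auto
  also have "\<dots> = ennreal (1 - exp (- a))"
    using prob_cdf_le[of "1 - exp (- a)"] a by (simp add: emeasure_eq_measure)
  finally show "emeasure M {x \<in> space M. - ln (1 - cdf M x) \<le> a} = 1 - ennreal (exp (- a * 1))"
    using ennreal_minus[of "exp (- a)" 1] by simp
qed auto

end
end

text \<open>\<open>E\<close> is a function of \<open>X\<close>, so the exponentials live on the
  given probability space, and the observations are recovered almost surely, not merely in
  distribution.\<close>

lemma (in prob_space) exponential_representation:
  assumes X: "X \<in> borel_measurable M" and D: "distr M borel X = D" and cont: "continuous_on UNIV (cdf D)"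
  defines "E \<equiv> (\<lambda>w. - ln (1 - cdf D (X w)))"
  shows "distributed M lborel E (exponential_density 1)"
    and "AE w in M. 0 < E w \<and> quantile (cdf D) (1 - exp (- E w)) = X w"
proof -
  interpret D: real_distribution D unfolding D[symmetric] by (rule real_distribution_distr) (rule X)
  note [measurable] = X D.cdf_borel[OF cont]
  have "distr M lborel E = distr D lborel (\<lambda>x. - ln (1 - cdf D x))"
    unfolding D[symmetric] by (subst distr_distr) (auto simp: E_def comp_def D)
  with D.exponential_transform[OF cont]
  show "distributed M lborel E (exponential_density 1)"
    by (simp add: distributed_def E_def)
  have "AE x in distr M borel X. 0 < cdf D x \<and> cdf D x < 1 \<and> quantile (cdf D) (cdf D x) = x"
    unfolding D by (rule D.AE_cdf[OF cont])
  then have "AE w in M. 0 < cdf D (X w) \<and> cdf D (X w) < 1 \<and> quantile (cdf D) (cdf D (X w)) = X w"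
    by (rule AE_distrD[OF X])
  then show "AE w in M. 0 < E w \<and> quantile (cdf D) (1 - exp (- E w)) = X w"
    by eventually_elim (auto simp: E_def)
qed

text \<open>With t = exp s, the condition on ratios of tail quantiles becomes one on increments of
  ln Q (s) - \<gamma> s, to which the limit lemma applies. The remainder \<open>g\<close> inherits
  sign and regular variation from \<open>A\<close>, because g / A tends to the positive number -1 /
  \<rho>.\<close>

lemma second_order_expansion:
  fixes D :: "real measure"
  assumes "real_distribution D" and cont: "continuous_on UNIV (cdf D)"
    and C2: "second_order_cond (cdf D) \<gamma> \<rho> A" and \<rho>: "\<rho> < 0"
  obtains f0 g where "regularly_varying g \<rho>"
    and "\<forall>\<^sub>F s in at_top. 0 < quantile (cdf D) (1 - exp (- s)) \<and>
           ln (quantile (cdf D) (1 - exp (- s))) = f0 + \<gamma> * s - g s"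
    and "((\<lambda>s. g s / A (exp s)) \<longlongrightarrow> - 1 / \<rho>) at_top"
proof -
  interpret D: real_distribution D by fact
  define Q where "Q s = quantile (cdf D) (1 - exp (- s))" for s
  define a where "a s = A (exp s)" for s
  have exp_top: "filterlim (\<lambda>s::real. exp s) at_top at_top" by (rule exp_at_top)
  have Q: "tail_quantile (cdf D) (exp s) = Q s" for s
    using quantile_eq_tail_quantile[of "cdf D" "exp (- s)"] D.cdf_bounds[OF cont]
    by (simp add: Q_def exp_minus inverse_eq_divide)
  have mono_Q: "mono_on {0<..} Q" unfolding Q_def by (rule D.quantile_exp_mono[OF cont])
  have a0: "(a \<longlongrightarrow> 0) at_top"
    unfolding a_def using C2 by (intro filterlim_compose[OF _ exp_top]) (simp add: second_order_cond_def)
  have a_sign: "eventually (\<lambda>s. a s > 0) at_top \<or> eventually (\<lambda>s. a s < 0) at_top"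
    unfolding a_def using C2 eventually_compose_filterlim[OF _ exp_top] by (fastforce simp: second_order_cond_def)
  have a_nz: "eventually (\<lambda>s. a s \<noteq> 0) at_top" using a_sign by (auto elim: eventually_mono)
  have W: "((\<lambda>s. (Q (s + y) / Q s - exp (\<gamma> * y)) / a s) \<longlongrightarrow> exp (\<gamma> * y) * ((exp (\<rho> * y) - 1) / \<rho>)) at_top" for y
  proof -
    have "((\<lambda>t. 1 / A t * (tail_quantile (cdf D) (t * exp y) / tail_quantile (cdf D) t - exp y powr \<gamma>))
              \<longlongrightarrow> exp y powr \<gamma> * (if \<rho> = 0 then ln (exp y) else (exp y powr \<rho> - 1) / \<rho>)) at_top"
      using C2 by (auto simp only: second_order_cond_def exp_gt_zero)
    from filterlim_compose[OF this exp_top] show ?thesis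
      using \<rho> by (simp add: Q flip: exp_add) (simp add: powr_def a_def)
  qed
  have ratio: "((\<lambda>s. exp (- \<gamma> * y) * (Q (s + y) / Q s) - 1) \<longlongrightarrow> 0) at_top" for y
  proof -
    have "((\<lambda>s. exp (- \<gamma> * y) * ((Q (s + y) / Q s - exp (\<gamma> * y)) / a s * a s)) \<longlongrightarrow>
        exp (- \<gamma> * y) * (exp (\<gamma> * y) * ((exp (\<rho> * y) - 1) / \<rho>) * 0)) at_top"
      by (intro tendsto_mult tendsto_const W a0)
    then have "((\<lambda>s. exp (- \<gamma> * y) * ((Q (s + y) / Q s - exp (\<gamma> * y)) / a s * a s)) \<longlongrightarrow> 0) at_top" by simp
    then show ?thesis
    proof (rule Lim_transform_eventually)
      show "\<forall>\<^sub>F s in at_top. exp (- \<gamma> * y) * ((Q (s + y) / Q s - exp (\<gamma> * y)) / a s * a s)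
          = exp (- \<gamma> * y) * (Q (s + y) / Q s) - 1"
        using a_nz by eventually_elim (simp add: right_diff_distrib exp_minus)
    qed
  qed
  \<comment> \<open>The quotient Q (s + 1) / Q s tends to exp \<gamma> > 1, whereas a negative value
    of the nondecreasing \<open>Q\<close> would make it at most 1, and the value 0 would make it
    0.\<close>
  have Q_pos: "\<forall>\<^sub>F s in at_top. 0 < Q s"
  proof -
    have g: "exp (- \<gamma> * 1) - 1 < 0" using C2 by (simp add: second_order_cond_def)
    have "\<forall>\<^sub>F s in at_top. exp (- \<gamma> * 1) - 1 < exp (- \<gamma> * 1) * (Q (s + 1) / Q s) - 1"
      by (rule order_tendstoD(1)[OF ratio g])
    then show ?thesis using eventually_gt_at_top[of 0]
    proof eventually_elim
      case (elim s)
      then have "exp (- \<gamma> * 1) * 1 < exp (- \<gamma> * 1) * (Q (s + 1) / Q s)" by linarith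
      then have "1 < Q (s + 1) / Q s" by (subst (asm) mult_less_cancel_left_pos) simp_all
      moreover have "Q s \<le> Q (s + 1)" using elim by (intro mono_onD[OF mono_Q]) auto
      ultimately show ?case by (cases "Q s" "0 :: real" rule: linorder_cases) (auto simp: divide_simps)
    qed
  qed
  \<comment> \<open>ln (1 + z) / z with the singularity filled, so that
    \<open>ln (1 + z) = \<phi> z * z\<close> also holds at z = 0.\<close>
  define \<phi> where "\<phi> z = (if z = 0 then 1 else ln (1 + z) / z)" for z :: real
  have "((\<lambda>h. (ln (1 + h) - ln 1) / h) \<longlongrightarrow> 1) (at (0::real))"
    using DERIV_ln[of 1] by (simp add: DERIV_def)
  then have "isCont \<phi> 0" unfolding isCont_def \<phi>_def
    by (auto elim!: Lim_transform_eventually simp: eventually_at_filter)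
  moreover have \<phi>0: "\<phi> 0 = 1" by (simp add: \<phi>_def)
  ultimately have \<phi>_lim: "(\<phi> \<longlongrightarrow> 1) (nhds 0)"
    by (simp add: isCont_def \<phi>0 tendsto_at_iff_tendsto_nhds[of \<phi> 0, unfolded \<phi>0])
  have \<phi>: "ln (1 + z) = \<phi> z * z" for z by (simp add: \<phi>_def)
  define f where "f s = ln (Q s) - \<gamma> * s" for s
  have H: "((\<lambda>s. (f (s + y) - f s) / a s) \<longlongrightarrow> (exp (\<rho> * y) - 1) / \<rho>) at_top" for y
  proof -
    let ?z = "\<lambda>s. exp (- \<gamma> * y) * (Q (s + y) / Q s) - 1"
    have "((\<lambda>s. \<phi> (?z s) * (exp (- \<gamma> * y) * ((Q (s + y) / Q s - exp (\<gamma> * y)) / a s))) \<longlongrightarrow>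
        1 * (exp (- \<gamma> * y) * (exp (\<gamma> * y) * ((exp (\<rho> * y) - 1) / \<rho>)))) at_top"
      by (intro tendsto_mult tendsto_const W filterlim_compose[OF \<phi>_lim ratio])
    also have "1 * (exp (- \<gamma> * y) * (exp (\<gamma> * y) * ((exp (\<rho> * y) - 1) / \<rho>))) = (exp (\<rho> * y) - 1) / \<rho>"
      by (simp add: exp_minus)
    finally show ?thesis
    proof (rule Lim_transform_eventually)
      have shift: "filterlim (\<lambda>s. s + y) at_top at_top"
        using filterlim_tendsto_add_at_top[OF tendsto_const filterlim_ident, of y] by (simp add: add.commute)
      show "\<forall>\<^sub>F s in at_top. \<phi> (?z s) * (exp (- \<gamma> * y) * ((Q (s + y) / Q s - exp (\<gamma> * y)) / a s))
          = (f (s + y) - f s) / a s"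
        using a_nz Q_pos eventually_compose_filterlim[OF Q_pos shift]
      proof eventually_elim
        case (elim s)
        have "f (s + y) - f s = ln (1 + ?z s)"
          using elim by (simp add: f_def ln_mult ln_div algebra_simps)
        also have "\<dots> = \<phi> (?z s) * ?z s" by (rule \<phi>)
        finally have "f (s + y) - f s = \<phi> (?z s) * ?z s" .
        moreover have "?z s = exp (- \<gamma> * y) * (Q (s + y) / Q s - exp (\<gamma> * y))"
          by (simp add: right_diff_distrib exp_minus)
        ultimately show ?case by simp
      qed
    qed
  qed
  obtain L where L: "((\<lambda>s. (L - f s) / a s) \<longlongrightarrow> - 1 / \<rho>) at_top"
    and a_ratio: "\<And>y. ((\<lambda>s. a (s + y) / a s) \<longlongrightarrow> exp (\<rho> * y)) at_top"
    using extended_regular_variation_limit[OF \<rho> a0 a_nz H] by metis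
  \<comment> \<open>The cut-off at 1 leaves the tail unchanged and makes the inner function monotone
    on the whole line, hence \<open>g\<close> Borel measurable.\<close>
  define g where "g s = L + \<gamma> * s - ln (Q (max s 1))" for s
  have g_eq: "\<forall>\<^sub>F s in at_top. g s = L - f s"
    using eventually_ge_at_top[of 1] by eventually_elim (simp add: g_def f_def)
  have g_a: "((\<lambda>s. g s / a s) \<longlongrightarrow> - 1 / \<rho>) at_top"
    by (rule Lim_transform_eventually[OF L]) (use g_eq in eventually_elim, simp)
  have "- 1 / \<rho> > 0" using \<rho> by (simp add: divide_neg_neg)
  then have ga_pos: "\<forall>\<^sub>F s in at_top. g s / a s > 0" by (rule order_tendstoD[OF g_a])
  have "regularly_varying g \<rho>"
  proof
    have "mono (\<lambda>s. Q (max s 1))" by (intro monoI mono_onD[OF mono_Q]) auto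
    then have [measurable]: "(\<lambda>s. Q (max s 1)) \<in> borel_measurable borel" by (rule borel_measurable_mono)
    show "g \<in> borel_measurable borel" unfolding g_def by measurable
    show "eventually (\<lambda>s. g s > 0) at_top \<or> eventually (\<lambda>s. g s < 0) at_top"
      using a_sign
    proof
      assume "eventually (\<lambda>s. a s > 0) at_top"
      with ga_pos have "eventually (\<lambda>s. g s > 0) at_top"
        by eventually_elim (simp add: zero_less_divide_iff)
      then show ?thesis ..
    next
      assume "eventually (\<lambda>s. a s < 0) at_top"
      with ga_pos have "eventually (\<lambda>s. g s < 0) at_top"
        by eventually_elim (simp add: zero_less_divide_iff)
      then show ?thesis ..
    qed
    fix y :: real
    have shift: "filterlim (\<lambda>s. s + y) at_top at_top"
      using filterlim_tendsto_add_at_top[OF tendsto_const filterlim_ident, of y] by (simp add: add.commute)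
    have "((\<lambda>s. (g (s + y) / a (s + y)) * (a (s + y) / a s) / (g s / a s)) \<longlongrightarrow>
        (- 1 / \<rho>) * exp (\<rho> * y) / (- 1 / \<rho>)) at_top"
      using \<rho> by (intro tendsto_intros filterlim_compose[OF g_a shift] g_a a_ratio) auto
    also have "(- 1 / \<rho>) * exp (\<rho> * y) / (- 1 / \<rho>) = exp (\<rho> * y)" using \<rho> by simp
    finally show "((\<lambda>s. g (s + y) / g s) \<longlongrightarrow> exp (\<rho> * y)) at_top"
    proof (rule Lim_transform_eventually)
      show "\<forall>\<^sub>F s in at_top. (g (s + y) / a (s + y)) * (a (s + y) / a s) / (g s / a s) = g (s + y) / g s"
        using a_nz eventually_compose_filterlim[OF a_nz shift] by eventually_elim simp
    qed
  qed
  moreover have "\<forall>\<^sub>F s in at_top. 0 < Q s \<and> ln (Q s) = L + \<gamma> * s - g s"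
    using Q_pos g_eq by eventually_elim (simp add: f_def)
  ultimately show thesis using that[of g L] g_a unfolding Q_def a_def by blast
qed

section \<open>Sums over exponential samples\<close>

abbreviation std_exponential :: "real measure" where
  "std_exponential \<equiv> density lborel (exponential_density 1)"

interpretation std_exponential: prob_space std_exponential
  by (rule prob_space_exponential_density) simp

lemma std_exponential_moment:
  "has_bochner_integral std_exponential (\<lambda>x. x ^ i) (fact i)"
proof -
  have "distributed std_exponential lborel (\<lambda>x. x) (exponential_density 1)"
    by (simp add: distributed_def distr_id2)
  from std_exponential.has_bochner_integral_erlang_ith_moment[OF _ this, of i] show ?thesis by simp
qed

text \<open>Memorylessness: an exceedance of \<open>s\<close> has probability exp (- s), and the
  excess is again standard exponential. Moments of truncated summands reduce to untruncated ones by
  this rule.\<close>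

lemma std_exponential_shift:
  assumes s: "0 \<le> s" and h: "has_bochner_integral std_exponential h v"
  shows "has_bochner_integral std_exponential (\<lambda>y. if s < y then h (y - s) else 0) (exp (- s) * v)"
proof -
  have [measurable]: "h \<in> borel_measurable borel" using h by (auto simp: has_bochner_integral_iff dest: borel_measurable_integrable)
  let ?d = "exponential_density 1"
  have *: "has_bochner_integral std_exponential f v \<longleftrightarrow> has_bochner_integral lborel (\<lambda>x. ?d x * f x) v"
    if [measurable]: "f \<in> borel_measurable borel" for f :: "real \<Rightarrow> real" and v
    by (simp add: has_bochner_integral_iff integrable_density integral_density exponential_density_nonneg)
  have "has_bochner_integral lborel (\<lambda>x. exp (- s) * (?d x * h x)) (exp (- s) * v)"
    using h by (simp add: * has_bochner_integral_mult_right)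
  \<comment> \<open>At x = 0 the density is positive but the strict indicator fails, so the identity
    holds only off this null point.\<close>
  moreover have "AE x in lborel. exp (- s) * (?d x * h x) = ?d (s + 1 * x) * (if s < s + 1 * x then h (s + 1 * x - s) else 0)"
    using AE_lborel_singleton[of "0::real"]
    by eventually_elim (use s in \<open>auto simp: exponential_density_def exp_add[symmetric]\<close>)
  ultimately have "has_bochner_integral lborel (\<lambda>x. ?d (s + 1 * x) * (if s < s + 1 * x then h (s + 1 * x - s) else 0)) (exp (- s) * v)"
    by (subst has_bochner_integral_cong_AE[symmetric]) auto
  then have "has_bochner_integral lborel (\<lambda>x. ?d x * (if s < x then h (x - s) else 0)) (exp (- s) * v)"
    by (subst lborel_has_bochner_integral_real_affine_iff[of 1 _ _ s]) auto
  then show ?thesis by (subst *) auto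
qed

locale exponential_sample = prob_space M for M :: "'a measure" +
  fixes E :: "'i \<Rightarrow> 'a \<Rightarrow> real"
  assumes indep_E: "indep_vars (\<lambda>_. borel) E UNIV"
    and distributed_E: "\<And>i. distributed M lborel (E i) (exponential_density 1)"
begin

lemma E_measurable [measurable]: "E i \<in> borel_measurable M"
  using distributed_E[of i] by (simp add: distributed_def)

lemma has_bochner_integral_E:
  fixes \<phi> :: "real \<Rightarrow> real"
  assumes "has_bochner_integral std_exponential \<phi> v"
  shows "has_bochner_integral M (\<lambda>w. \<phi> (E i w)) v"
proof -
  have [measurable]: "\<phi> \<in> borel_measurable borel"
    using assms by (auto simp: has_bochner_integral_iff dest: borel_measurable_integrable)
  have eq: "distr M lborel (E i) = std_exponential" using distributed_E[of i] by (simp add: distributed_def)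
  have "has_bochner_integral (distr M lborel (E i)) \<phi> v" unfolding eq by (rule assms)
  then show ?thesis
    using integrable_distr_eq[of "E i" M lborel \<phi>] integral_distr[of "E i" M lborel \<phi>]
    by (simp add: has_bochner_integral_iff)
qed

text \<open>Pairwise independence removes the cross terms. The functions depend on the index, so
  that observations from different subsamples may be cut at different levels within one sum.\<close>

lemma centered_sum_second_moment:
  fixes \<phi> :: "'i \<Rightarrow> real \<Rightarrow> real"
  assumes fin: "finite I" and m1: "\<And>i. i \<in> I \<Longrightarrow> has_bochner_integral std_exponential (\<phi> i) 0"
    and m2: "\<And>i. i \<in> I \<Longrightarrow> has_bochner_integral std_exponential (\<lambda>x. (\<phi> i x)\<^sup>2) (v i)"
  shows "has_bochner_integral M (\<lambda>w. (\<Sum>i\<in>I. \<phi> i (E i w))\<^sup>2) (\<Sum>i\<in>I. v i)"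
proof -
  have meas: "\<phi> i \<in> borel_measurable borel" if "i \<in> I" for i
    using m1[OF that] by (auto simp: has_bochner_integral_iff dest: borel_measurable_integrable)
  have cross: "has_bochner_integral M (\<lambda>w. \<phi> i (E i w) * \<phi> j (E j w)) (if i = j then v i else 0)"
    if ij: "i \<in> I" "j \<in> I" for i j
  proof (cases "i = j")
    case True
    then show ?thesis using has_bochner_integral_E[OF m2[OF ij(1)], of i] by (simp add: power2_eq_square)
  next
    case False
    \<comment> \<open>Joint independence makes one variable independent of a finite sum of others; a
      sum over a singleton yields pairs.\<close>
    have "indep_var borel (E i) borel (\<lambda>w. \<Sum>l\<in>{j}. E l w)"
      using False by (intro indep_vars_sum indep_vars_subset[OF indep_E]) auto
    then have "indep_var borel (E i) borel (E j)" by simp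
    then have "indep_var borel (\<phi> i \<circ> E i) borel (\<phi> j \<circ> E j)"
      by (rule indep_var_compose) (use ij meas in auto)
    then have "indep_var borel (\<lambda>w. \<phi> i (E i w)) borel (\<lambda>w. \<phi> j (E j w))" by (simp add: comp_def)
    with has_bochner_integral_E[OF m1[OF ij(1)], of i] has_bochner_integral_E[OF m1[OF ij(2)], of j]
    show ?thesis using False
      by (auto simp: has_bochner_integral_iff indep_var_lebesgue_integral indep_var_integrable)
  qed
  have "has_bochner_integral M (\<lambda>w. \<Sum>i\<in>I. \<Sum>j\<in>I. \<phi> i (E i w) * \<phi> j (E j w)) (\<Sum>i\<in>I. \<Sum>j\<in>I. if i = j then v i else 0)"
    by (intro has_bochner_integral_sum cross)
  then show ?thesis using fin by (simp add: power2_eq_square sum_product)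
qed

end

text \<open>Tilting by exp (\<rho> z) turns the density into 1 / (1 - \<rho>) times that of an
  exponential with rate 1 - \<rho>. This is the origin of the factor 1 / (1 - \<rho>) in the
  asymptotic bias.\<close>

lemma std_exponential_exp:
  assumes "\<rho> < 1"
  shows "has_bochner_integral std_exponential (\<lambda>z. exp (\<rho> * z)) (1 / (1 - \<rho>))"
proof -
  have "has_bochner_integral lborel (exponential_density (1 - \<rho>)) 1"
    using assms nn_integral_erlang_ith_moment[of "1 - \<rho>" 0 0]
    by (intro has_bochner_integral_nn_integral) (auto simp: exponential_density_nonneg)
  then have "has_bochner_integral lborel (\<lambda>z. 1 / (1 - \<rho>) * exponential_density (1 - \<rho>) z) (1 / (1 - \<rho>) * 1)"
    by (rule has_bochner_integral_mult_right)
  moreover have "(\<lambda>z. 1 / (1 - \<rho>) * exponential_density (1 - \<rho>) z) = (\<lambda>z. exponential_density 1 z * exp (\<rho> * z))"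
  proof
    fix z :: real
    have "exp (- z * (1 - \<rho>)) = exp (- z) * exp (\<rho> * z)" by (simp add: exp_add[symmetric] algebra_simps)
    then show "1 / (1 - \<rho>) * exponential_density (1 - \<rho>) z = exponential_density 1 z * exp (\<rho> * z)"
      using assms by (simp add: exponential_density_def)
  qed
  ultimately have "has_bochner_integral lborel (\<lambda>z. exponential_density 1 z * exp (\<rho> * z)) (1 / (1 - \<rho>))"
    by (simp only: mult_1_right)
  then show ?thesis
    by (simp add: has_bochner_integral_iff integrable_density integral_density exponential_density_nonneg)
qed

lemma std_exponential_exceed:
  "0 \<le> t \<Longrightarrow> has_bochner_integral std_exponential (\<lambda>y. if t < y then 1 else 0) (exp (- t))"
  using std_exponential_shift[OF _ std_exponential_moment[of 0, simplified]] by simp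

lemma (in exponential_sample) centered_iid_sum_second_moment:
  fixes \<phi> :: "real \<Rightarrow> real" and m v :: real
  assumes J: "finite J" and m: "has_bochner_integral std_exponential \<phi> m"
    and v: "has_bochner_integral std_exponential (\<lambda>y. (\<phi> y)\<^sup>2) v"
  shows "has_bochner_integral M (\<lambda>w. ((\<Sum>i\<in>J. \<phi> (E i w)) - card J * m)\<^sup>2) (card J * (v - m\<^sup>2))"
proof -
  have c: "has_bochner_integral std_exponential (\<lambda>_. c) c" for c :: real
    using has_bochner_integral_mult_right[OF std_exponential_moment[of 0], of c] by simp
  have 1: "has_bochner_integral std_exponential (\<lambda>y. \<phi> y - m) 0"
    using has_bochner_integral_diff[OF m c[of m]] by simp
  have "has_bochner_integral std_exponential (\<lambda>y. (\<phi> y)\<^sup>2 + (- 2 * m) * \<phi> y + m\<^sup>2) (v + (- 2 * m) * m + m\<^sup>2)"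
    by (intro has_bochner_integral_add v has_bochner_integral_mult_right m c)
  then have 2: "has_bochner_integral std_exponential (\<lambda>y. (\<phi> y - m)\<^sup>2) (v - m\<^sup>2)"
    by (simp add: power2_eq_square algebra_simps)
  show ?thesis
    using centered_sum_second_moment[of J "\<lambda>_ y. \<phi> y - m" "\<lambda>_. v - m\<^sup>2", OF J 1 2]
    by (simp add: sum_subtractf)
qed

text \<open>Moving the base from \<open>s\<close> to \<open>t\<close> changes the total excess by
  the integral of the exceedance count over the interval between them. The count is monotone, and in
  between it lies between \<open>k\<close> and its value at \<open>s\<close>, whence the error
  bound.\<close>

lemma excess_sum_perturbation:
  fixes e :: "'i \<Rightarrow> real"
  assumes I: "finite I" and k: "k < card I"
  defines "t \<equiv> order_stat I e (card I - k)"
  shows "\<bar>(\<Sum>i | i \<in> I \<and> t < e i. e i - t) - ((\<Sum>i | i \<in> I \<and> s < e i. e i - s) - k * (t - s))\<bar>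
     \<le> \<bar>t - s\<bar> * \<bar>real (card {i\<in>I. s < e i}) - k\<bar>"
proof -
  have c1: "card {i\<in>I. t < e i} \<le> k" using order_stat_greater_iff[OF I k, of t e] by (simp add: t_def)
  have c2: "k \<le> card {i\<in>I. t \<le> e i}" using card_ge_order_stat[OF I k, of e] by (simp add: t_def)
  have S: "(\<Sum>i | i \<in> I \<and> P i. f i) = (\<Sum>i\<in>I. if P i then f i else 0)" for P and f :: "'i \<Rightarrow> real"
    using I by (simp add: sum.If_cases Int_def)
  have C: "real (card {i\<in>I. P i}) = (\<Sum>i\<in>I. if P i then 1 else 0)" for P
    using I by (simp add: sum.If_cases Int_def)
  show ?thesis
  proof (cases "s \<le> t")
    case True
    define m where "m i = (if s < e i then e i - s else 0) - (if t < e i then e i - t else 0)" for i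
    have "(t - s) * k \<le> (t - s) * card {i\<in>I. t \<le> e i}" using True c2 by (intro mult_left_mono) auto
    also have "\<dots> = (\<Sum>i\<in>I. (t - s) * (if t \<le> e i then 1 else 0))" by (simp only: C sum_distrib_left)
    also have "\<dots> \<le> (\<Sum>i\<in>I. m i)" using True by (intro sum_mono) (auto simp: m_def)
    finally have 1: "(t - s) * k \<le> (\<Sum>i\<in>I. m i)" .
    have "(\<Sum>i\<in>I. m i) \<le> (\<Sum>i\<in>I. (t - s) * (if s < e i then 1 else 0))" using True by (intro sum_mono) (auto simp: m_def)
    also have "\<dots> = (t - s) * card {i\<in>I. s < e i}" by (simp only: C sum_distrib_left)
    finally have 2: "(\<Sum>i\<in>I. m i) \<le> (t - s) * card {i\<in>I. s < e i}" .
    have "(\<Sum>i\<in>I. m i) = (\<Sum>i | i \<in> I \<and> s < e i. e i - s) - (\<Sum>i | i \<in> I \<and> t < e i. e i - t)"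
      unfolding m_def by (subst sum_subtractf) (simp only: S)
    then have "(\<Sum>i | i \<in> I \<and> t < e i. e i - t) - ((\<Sum>i | i \<in> I \<and> s < e i. e i - s) - k * (t - s))
        = (t - s) * k - (\<Sum>i\<in>I. m i)" by (simp add: algebra_simps)
    also have "\<bar>\<dots>\<bar> \<le> (t - s) * (card {i\<in>I. s < e i} - real k)" using 1 2 by (simp add: algebra_simps)
    also have "\<dots> \<le> \<bar>t - s\<bar> * \<bar>real (card {i\<in>I. s < e i}) - k\<bar>" by (metis abs_ge_self abs_mult)
    finally show ?thesis .
  next
    case False
    define m where "m i = (if t < e i then e i - t else 0) - (if s < e i then e i - s else 0)" for i
    have "(s - t) * card {i\<in>I. s < e i} = (\<Sum>i\<in>I. (s - t) * (if s < e i then 1 else 0))" by (simp only: C sum_distrib_left)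
    also have "\<dots> \<le> (\<Sum>i\<in>I. m i)" using False by (intro sum_mono) (auto simp: m_def)
    finally have 1: "(s - t) * card {i\<in>I. s < e i} \<le> (\<Sum>i\<in>I. m i)" .
    have "(\<Sum>i\<in>I. m i) \<le> (\<Sum>i\<in>I. (s - t) * (if t < e i then 1 else 0))" using False by (intro sum_mono) (auto simp: m_def)
    also have "\<dots> = (s - t) * card {i\<in>I. t < e i}" by (simp only: C sum_distrib_left)
    also have "\<dots> \<le> (s - t) * k" using False c1 by (intro mult_left_mono) auto
    finally have 2: "(\<Sum>i\<in>I. m i) \<le> (s - t) * k" .
    have "(\<Sum>i\<in>I. m i) = (\<Sum>i | i \<in> I \<and> t < e i. e i - t) - (\<Sum>i | i \<in> I \<and> s < e i. e i - s)"
      unfolding m_def by (subst sum_subtractf) (simp only: S)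
    then have "(\<Sum>i | i \<in> I \<and> t < e i. e i - t) - ((\<Sum>i | i \<in> I \<and> s < e i. e i - s) - k * (t - s))
        = (\<Sum>i\<in>I. m i) - (s - t) * k" by (simp add: algebra_simps)
    also have "\<bar>\<dots>\<bar> \<le> (s - t) * (k - real (card {i\<in>I. s < e i}))" using 1 2 by (simp add: algebra_simps)
    also have "\<dots> = (t - s) * (card {i\<in>I. s < e i} - real k)" by (simp add: algebra_simps)
    also have "\<dots> \<le> \<bar>t - s\<bar> * \<bar>real (card {i\<in>I. s < e i}) - k\<bar>" by (metis abs_ge_self abs_mult)
    finally show ?thesis .
  qed
qed

section \<open>Intermediate order statistics\<close>

locale intermediate_sample = exponential_sample M E for M :: "'a measure" and E :: "'i \<Rightarrow> 'a \<Rightarrow> real" +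
  fixes I :: "nat \<Rightarrow> 'i set" and k :: "nat \<Rightarrow> nat"
  assumes finite_I: "\<And>n. finite (I n)" and k_ge_1: "\<And>n. 1 \<le> k n"
    and k_top: "filterlim k at_top sequentially"
    and ratio_top: "filterlim (\<lambda>n. real (card (I n)) / real (k n)) at_top sequentially"
begin

text \<open>The level at which the expected number of exceedances, card I times exp (- lev), is
  eventually exactly k.\<close>

definition lev :: "nat \<Rightarrow> real" where "lev n = ln (real (card (I n)) / real (k n))"

definition exceed :: "real \<Rightarrow> nat \<Rightarrow> 'a \<Rightarrow> real" where
  "exceed t n w = real (card {i\<in>I n. t < E i w})"

definition threshold :: "nat \<Rightarrow> 'a \<Rightarrow> real" where
  "threshold n w = order_stat (I n) (\<lambda>i. E i w) (card (I n) - k n)"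

text \<open>Each summand is an excess minus its mean 1. By memorylessness the summands are centred,
  and the sum has variance 1, as soon as the level is positive.\<close>

definition tail_score :: "nat \<Rightarrow> 'a \<Rightarrow> real" where
  "tail_score n w = (\<Sum>i\<in>I n. if lev n < E i w then E i w - lev n - 1 else 0) / sqrt (k n)"

lemma lev_top: "filterlim lev at_top sequentially"
  unfolding lev_def by (rule filterlim_compose[OF ln_at_top ratio_top])

lemma k_less_card: "\<forall>\<^sub>F n in sequentially. k n < card (I n)"
proof -
  have "\<forall>\<^sub>F n in sequentially. 1 < real (card (I n)) / real (k n)"
    using ratio_top by (simp add: filterlim_at_top_dense)
  then show ?thesis
  proof eventually_elim
    case (elim n)
    then show ?case using k_ge_1[of n] by (simp add: less_divide_eq split: if_splits)
  qed
qed

lemma lev_pos: "\<forall>\<^sub>F n in sequentially. 0 < lev n"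
  using lev_top by (simp add: filterlim_at_top_dense)

lemma card_exp_lev: "\<forall>\<^sub>F n in sequentially. real (card (I n)) * exp (- lev n) = real (k n)"
  using k_less_card
proof eventually_elim
  case (elim n)
  then have "exp (lev n) = real (card (I n)) / real (k n)" using k_ge_1[of n] by (simp add: lev_def)
  then show ?case using elim by (simp add: exp_minus)
qed

lemma real_k_top: "filterlim (\<lambda>n. real (k n)) at_top sequentially"
  by (rule filterlim_compose[OF filterlim_real_sequentially k_top])

lemma sqrt_k_top: "filterlim (\<lambda>n. sqrt (real (k n))) at_top sequentially"
  by (rule filterlim_compose[OF sqrt_at_top real_k_top])

lemma k_pos: "0 < real (k n)" "real (k n) \<noteq> 0" "0 < sqrt (real (k n))"
  using k_ge_1[of n] by auto

lemma inverse_k: "(\<lambda>n. 1 / real (k n)) \<longlonglongrightarrow> 0"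
  using tendsto_inverse_0_at_top[OF real_k_top] by (simp add: inverse_eq_divide)

lemma inverse_sqrt_k: "(\<lambda>n. 1 / sqrt (real (k n))) \<longlonglongrightarrow> 0"
  using tendsto_inverse_0_at_top[OF sqrt_k_top] by (simp add: inverse_eq_divide)

lemma exceed_sum: "exceed t n w = (\<Sum>i\<in>I n. if t < E i w then 1 else 0)"
  using finite_I[of n] by (simp add: exceed_def sum.If_cases Int_def)

lemma threshold_greater_iff:
  "k n < card (I n) \<Longrightarrow> t < threshold n w \<longleftrightarrow> real (k n) < exceed t n w"
  unfolding threshold_def exceed_def by (simp add: order_stat_greater_iff[OF finite_I])

text \<open>A weak law for triangular arrays. In the applications only about k terms are nonzero,
  hence the division by k rather than by the sample size; the last condition makes the variance of
  the quotient vanish.\<close>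

lemma mean_lln:
  fixes \<phi> :: "nat \<Rightarrow> real \<Rightarrow> real" and m v :: "nat \<Rightarrow> real" and c :: real
  assumes m: "\<And>n. has_bochner_integral std_exponential (\<phi> n) (m n)"
    and v: "\<And>n. has_bochner_integral std_exponential (\<lambda>y. (\<phi> n y)\<^sup>2) (v n)"
    and c: "(\<lambda>n. card (I n) * m n / k n) \<longlonglongrightarrow> c" and v0: "(\<lambda>n. card (I n) * v n / (real (k n))\<^sup>2) \<longlonglongrightarrow> 0"
  shows "((\<lambda>z. (\<Sum>i\<in>I (fst z). \<phi> (fst z) (E i (snd z))) / k (fst z)) \<longlongrightarrow> c) (prob_filter M)"
proof -
  define Y where "Y n w = ((\<Sum>i\<in>I n. \<phi> n (E i w)) - card (I n) * m n) / k n" for n w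
  have [measurable]: "\<phi> n \<in> borel_measurable borel" for n
    using m[of n] by (auto simp: has_bochner_integral_iff dest: borel_measurable_integrable)
  have Y: "has_bochner_integral M (\<lambda>w. (Y n w)\<^sup>2) (card (I n) * (v n - (m n)\<^sup>2) / (real (k n))\<^sup>2)" for n
    unfolding Y_def power_divide
    by (intro has_bochner_integral_divide centered_iid_sum_second_moment finite_I m v)
  have "((\<lambda>z. Y (fst z) (snd z)) \<longlongrightarrow> 0) (prob_filter M)"
  proof (rule tendsto_0_second_moment)
    show "integrable M (\<lambda>w. (Y n w)\<^sup>2)" for n using Y by (auto simp: has_bochner_integral_iff)
    show "Y n \<in> borel_measurable M" for n unfolding Y_def by measurable
    show "(\<lambda>n. expectation (\<lambda>w. (Y n w)\<^sup>2)) \<longlonglongrightarrow> 0"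
    proof (rule tendsto_sandwich[OF _ _ tendsto_const v0])
      show "\<forall>\<^sub>F n in sequentially. expectation (\<lambda>w. (Y n w)\<^sup>2) \<le> card (I n) * v n / (real (k n))\<^sup>2"
      proof (rule always_eventually, rule allI)
        fix n
        have "expectation (\<lambda>w. (Y n w)\<^sup>2) = card (I n) * (v n - (m n)\<^sup>2) / (real (k n))\<^sup>2"
          using Y by (simp add: has_bochner_integral_iff)
        also have "\<dots> \<le> card (I n) * v n / (real (k n))\<^sup>2" by (intro divide_right_mono mult_left_mono) auto
        finally show "expectation (\<lambda>w. (Y n w)\<^sup>2) \<le> card (I n) * v n / (real (k n))\<^sup>2" .
      qed
    qed (auto intro!: always_eventually)
  qed
  from tendsto_add[OF this filterlim_fst_compose[OF c]]
  show ?thesis by (simp add: Y_def diff_divide_distrib)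
qed

lemma exceed_lln:
  assumes x: "x \<longlonglongrightarrow> x0"
  shows "((\<lambda>z. exceed (lev (fst z) + x (fst z)) (fst z) (snd z) / k (fst z)) \<longlongrightarrow> exp (- x0)) (prob_filter M)"
proof -
  \<comment> \<open>The moment rules require a nonnegative level at every index, whereas lev + x is
    positive only eventually; truncation at 0 changes finitely many indices.\<close>
  define t where "t n = max 0 (lev n + x n)" for n
  have "filterlim (\<lambda>n. x n + lev n) at_top sequentially"
    by (rule filterlim_tendsto_add_at_top[OF x lev_top])
  then have "\<forall>\<^sub>F n in sequentially. 0 < x n + lev n" by (simp add: filterlim_at_top_dense)
  then have t: "\<forall>\<^sub>F n in sequentially. t n = lev n + x n" by eventually_elim (simp add: t_def)
  have eq: "\<forall>\<^sub>F n in sequentially. real (card (I n)) * exp (- t n) = k n * exp (- x n)"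
    using t card_exp_lev by eventually_elim (simp add: exp_diff exp_minus field_simps)
  have "((\<lambda>z. (\<Sum>i\<in>I (fst z). if t (fst z) < E i (snd z) then 1 else 0) / k (fst z)) \<longlongrightarrow> exp (- x0)) (prob_filter M)"
  proof (rule mean_lln[where \<phi>="\<lambda>n y. if t n < y then 1 else 0"])
    show 1: "has_bochner_integral std_exponential (\<lambda>y. if t n < y then 1 else 0) (exp (- t n))" for n
      by (rule std_exponential_exceed) (simp add: t_def)
    then show "has_bochner_integral std_exponential (\<lambda>y. (if t n < y then 1 else 0)\<^sup>2) (exp (- t n))" for n
      by (simp add: if_distrib[of "\<lambda>x. x\<^sup>2"] cong: if_cong)
    have "(\<lambda>n. exp (- x n)) \<longlonglongrightarrow> exp (- x0)" by (intro tendsto_intros x)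
    then show lim: "(\<lambda>n. real (card (I n)) * exp (- t n) / real (k n)) \<longlonglongrightarrow> exp (- x0)"
      by (rule Lim_transform_eventually) (use eq in eventually_elim, use k_pos in simp)
    have "(\<lambda>n. real (card (I n)) * exp (- t n) / real (k n) * (1 / k n)) \<longlonglongrightarrow> exp (- x0) * 0"
      by (intro tendsto_mult lim inverse_k)
    then show "(\<lambda>n. real (card (I n)) * exp (- t n) / (real (k n))\<^sup>2) \<longlonglongrightarrow> 0"
      by (simp add: power2_eq_square)
  qed
  then show ?thesis
    by (rule Lim_transform_eventually)
       (use eventually_fst_prob_filter[OF t] in eventually_elim, simp add: exceed_sum)
qed

text \<open>The counts at lev - e/2 and lev + e/2, divided by k, converge to exp (e/2) > 1 and exp
  (- e/2) < 1. By the switch to counts the threshold is caught between the two levels.\<close>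

lemma threshold_consistent:
  "((\<lambda>z. threshold (fst z) (snd z) - lev (fst z)) \<longlongrightarrow> 0) (prob_filter M)"
  unfolding tendsto_iff
proof (intro allI impI)
  fix e :: real assume e: "e > 0"
  have "((\<lambda>z. exceed (lev (fst z) + - (e/2)) (fst z) (snd z) / k (fst z)) \<longlongrightarrow> exp (- (- (e/2)))) (prob_filter M)"
    by (rule exceed_lln) simp
  then have "\<forall>\<^sub>F z in prob_filter M. 1 < exceed (lev (fst z) + - (e/2)) (fst z) (snd z) / k (fst z)"
    by (rule order_tendstoD) (use e in simp)
  moreover have "((\<lambda>z. exceed (lev (fst z) + e/2) (fst z) (snd z) / k (fst z)) \<longlongrightarrow> exp (- (e/2))) (prob_filter M)"
    by (rule exceed_lln) simp
  then have "\<forall>\<^sub>F z in prob_filter M. exceed (lev (fst z) + e/2) (fst z) (snd z) / k (fst z) < 1"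
    by (rule order_tendstoD) (use e in simp)
  ultimately show "\<forall>\<^sub>F z in prob_filter M. dist (threshold (fst z) (snd z) - lev (fst z)) 0 < e"
    using eventually_fst_prob_filter[OF k_less_card]
  proof eventually_elim
    case (elim z)
    then have "lev (fst z) - e/2 < threshold (fst z) (snd z)" "\<not> lev (fst z) + e/2 < threshold (fst z) (snd z)"
      using k_pos[of "fst z"]
        threshold_greater_iff[OF elim(3), of "lev (fst z) + - (e/2)" "snd z"]
        threshold_greater_iff[OF elim(3), of "lev (fst z) + e/2" "snd z"]
      by (simp_all add: less_divide_eq divide_less_eq)
    then show ?case using e unfolding dist_real_def by linarith
  qed
qed

lemma threshold_top: "filterlim (\<lambda>z. threshold (fst z) (snd z)) at_top (prob_filter M)"
  using filterlim_tendsto_add_at_top[OF threshold_consistent filterlim_fst_compose[OF lev_top]] by simp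

text \<open>Over a level shift x / sqrt k the count changes by a sum whose mean is about - x sqrt k
  and whose variance is only of order sqrt k. After division by sqrt k the deterministic drift alone
  survives.\<close>

lemma exceed_increment:
  "((\<lambda>z. (exceed (lev (fst z) + x / sqrt (k (fst z))) (fst z) (snd z) - exceed (lev (fst z)) (fst z) (snd z)) / sqrt (k (fst z)))
      \<longlongrightarrow> - x) (prob_filter M)"
proof -
  define t where "t n = max 0 (lev n + x / sqrt (k n))" for n
  define l where "l n = max 0 (lev n)" for n
  define \<phi> :: "nat \<Rightarrow> real \<Rightarrow> real" where "\<phi> n y = (if t n < y then 1 else 0) - (if l n < y then 1 else 0)" for n y
  define m where "m n = exp (- t n) - exp (- l n)" for n
  have x0: "(\<lambda>n. x / sqrt (k n)) \<longlonglongrightarrow> 0" using tendsto_mult_right_zero[OF inverse_sqrt_k, of x] by simp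
  have "filterlim (\<lambda>n. x / sqrt (k n) + lev n) at_top sequentially"
    by (rule filterlim_tendsto_add_at_top[OF x0 lev_top])
  then have "\<forall>\<^sub>F n in sequentially. 0 < x / sqrt (k n) + lev n" by (simp add: filterlim_at_top_dense)
  then have t: "\<forall>\<^sub>F n in sequentially. t n = lev n + x / sqrt (k n)" by eventually_elim (simp add: t_def)
  have l: "\<forall>\<^sub>F n in sequentially. l n = lev n" using lev_pos by eventually_elim (simp add: l_def)
  have eq: "\<forall>\<^sub>F n in sequentially. real (card (I n)) * m n = k n * (exp (- (x / sqrt (k n))) - 1)"
    using t l card_exp_lev
  proof eventually_elim
    case (elim n)
    have "real (card (I n)) * m n = (real (card (I n)) * exp (- lev n)) * (exp (- (x / sqrt (k n))) - 1)"
      using elim(1,2) by (simp add: m_def exp_add exp_diff exp_minus algebra_simps divide_inverse)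
    then show ?case by (simp only: elim(3))
  qed
  have \<phi>1: "has_bochner_integral std_exponential (\<phi> n) (m n)" for n
    unfolding \<phi>_def m_def by (intro has_bochner_integral_diff std_exponential_exceed) (auto simp: t_def l_def)
  \<comment> \<open>The difference of the two indicators takes only the values 0 and 1, or only 0
    and -1, so its square is itself up to sign.\<close>
  have \<phi>2: "has_bochner_integral std_exponential (\<lambda>y. (\<phi> n y)\<^sup>2) \<bar>m n\<bar>" for n
  proof (cases "t n \<le> l n")
    case True
    then have "(\<lambda>y. (\<phi> n y)\<^sup>2) = \<phi> n" "\<bar>m n\<bar> = m n" by (auto simp: \<phi>_def m_def fun_eq_iff)
    then show ?thesis using \<phi>1[of n] by simp
  next
    case False
    then have "(\<lambda>y. (\<phi> n y)\<^sup>2) = (\<lambda>y. - \<phi> n y)" "\<bar>m n\<bar> = - m n" by (auto simp: \<phi>_def m_def fun_eq_iff)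
    then show ?thesis using has_bochner_integral_minus[OF \<phi>1[of n]] by simp
  qed
  have [measurable]: "\<phi> n \<in> borel_measurable borel" for n unfolding \<phi>_def by measurable
  define Y where "Y n w = ((\<Sum>i\<in>I n. \<phi> n (E i w)) - card (I n) * m n) / sqrt (k n)" for n w
  have Y: "has_bochner_integral M (\<lambda>w. (Y n w)\<^sup>2) (card (I n) * (\<bar>m n\<bar> - (m n)\<^sup>2) / (sqrt (k n))\<^sup>2)" for n
    unfolding Y_def power_divide
    by (intro has_bochner_integral_divide centered_iid_sum_second_moment finite_I \<phi>1 \<phi>2)
  have "((\<lambda>z. Y (fst z) (snd z)) \<longlongrightarrow> 0) (prob_filter M)"
  proof (rule tendsto_0_second_moment)
    show "integrable M (\<lambda>w. (Y n w)\<^sup>2)" for n using Y by (auto simp: has_bochner_integral_iff)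
    show "Y n \<in> borel_measurable M" for n unfolding Y_def by measurable
    have lim: "(\<lambda>n. \<bar>exp (- (x / sqrt (k n))) - 1\<bar>) \<longlonglongrightarrow> \<bar>exp (- 0) - 1\<bar>" by (intro tendsto_intros x0)
    show "(\<lambda>n. expectation (\<lambda>w. (Y n w)\<^sup>2)) \<longlonglongrightarrow> 0"
    proof (rule tendsto_sandwich[OF _ _ tendsto_const lim[simplified]])
      show "\<forall>\<^sub>F n in sequentially. expectation (\<lambda>w. (Y n w)\<^sup>2) \<le> \<bar>exp (- (x / sqrt (k n))) - 1\<bar>"
        using eq
      proof eventually_elim
        case (elim n)
        have "expectation (\<lambda>w. (Y n w)\<^sup>2) = card (I n) * (\<bar>m n\<bar> - (m n)\<^sup>2) / k n"
          using Y by (simp add: has_bochner_integral_iff)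
        also have "\<dots> \<le> card (I n) * \<bar>m n\<bar> / k n" by (intro divide_right_mono mult_left_mono) auto
        also have "\<dots> = \<bar>real (card (I n)) * m n\<bar> / k n" by (simp add: abs_mult)
        also have "\<dots> = \<bar>exp (- (x / sqrt (k n))) - 1\<bar>" unfolding elim using k_pos[of n] by (simp add: abs_mult)
        finally show ?case .
      qed
    qed (auto intro!: always_eventually)
  qed
  \<comment> \<open>The drift is the derivative of the exponential at 0; x = 0 is treated apart
    because the difference quotient is taken along a punctured neighbourhood.\<close>
  moreover have "(\<lambda>n. real (card (I n)) * m n / sqrt (k n)) \<longlonglongrightarrow> - x"
  proof (cases "x = 0")
    case True
    have "\<forall>\<^sub>F n in sequentially. - x = real (card (I n)) * m n / sqrt (k n)"
      using eq by eventually_elim (use True in simp)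
    then show ?thesis by (rule Lim_transform_eventually[OF tendsto_const])
  next
    case False
    have "((\<lambda>h. (exp (0 + h) - exp 0) / h) \<longlongrightarrow> 1) (at (0::real))"
      using DERIV_exp[of "0::real"] by (simp add: DERIV_def)
    moreover have "filterlim (\<lambda>n. - (x / sqrt (k n))) (at 0) sequentially"
      using tendsto_minus[OF x0] k_pos False by (auto simp: filterlim_at)
    ultimately have "(\<lambda>n. (exp (0 + - (x / sqrt (k n))) - exp 0) / (- (x / sqrt (k n)))) \<longlonglongrightarrow> 1"
      by (rule filterlim_compose)
    then have "(\<lambda>n. (- x) * ((exp (0 + - (x / sqrt (k n))) - exp 0) / (- (x / sqrt (k n))))) \<longlonglongrightarrow> (- x) * 1"
      by (intro tendsto_mult tendsto_const)
    then have "(\<lambda>n. (- x) * ((exp (0 + - (x / sqrt (k n))) - exp 0) / (- (x / sqrt (k n))))) \<longlonglongrightarrow> - x" by simp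
    then show ?thesis
    proof (rule Lim_transform_eventually)
      show "\<forall>\<^sub>F n in sequentially. (- x) * ((exp (0 + - (x / sqrt (k n))) - exp 0) / (- (x / sqrt (k n))))
          = real (card (I n)) * m n / sqrt (k n)"
        using eq
      proof eventually_elim
        case (elim n)
        have "real (k n) = sqrt (k n) * sqrt (k n)" by simp
        then show ?case unfolding elim using False k_pos[of n] by (simp add: field_simps)
      qed
    qed
  qed
  ultimately have "((\<lambda>z. Y (fst z) (snd z) + real (card (I (fst z))) * m (fst z) / sqrt (k (fst z))) \<longlongrightarrow> 0 + - x) (prob_filter M)"
    by (intro tendsto_add filterlim_fst_compose)
  then have "((\<lambda>z. Y (fst z) (snd z) + real (card (I (fst z))) * m (fst z) / sqrt (k (fst z))) \<longlongrightarrow> - x) (prob_filter M)" by simp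
  then show ?thesis
  proof (rule Lim_transform_eventually)
    show "\<forall>\<^sub>F z in prob_filter M. Y (fst z) (snd z) + real (card (I (fst z))) * m (fst z) / sqrt (k (fst z)) =
      (exceed (lev (fst z) + x / sqrt (k (fst z))) (fst z) (snd z) - exceed (lev (fst z)) (fst z) (snd z)) / sqrt (k (fst z))"
      using eventually_fst_prob_filter[OF t] eventually_fst_prob_filter[OF l]
      by eventually_elim (simp add: Y_def \<phi>_def exceed_sum sum_subtractf diff_divide_distrib)
  qed
qed

end

lemma std_exponential_score:
  "has_bochner_integral std_exponential (\<lambda>z. z - 1) 0"
  "has_bochner_integral std_exponential (\<lambda>z. (z - 1)\<^sup>2) 1"
proof -
  note m = std_exponential_moment[of 0, simplified] std_exponential_moment[of 1, simplified]
    std_exponential_moment[of 2, simplified]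
  show "has_bochner_integral std_exponential (\<lambda>z. z - 1) 0"
    using has_bochner_integral_diff[OF m(2) m(1)] by simp
  have "has_bochner_integral std_exponential (\<lambda>z. z\<^sup>2 + (- 2) * z + 1) (2 + (- 2) * 1 + 1)"
    by (intro has_bochner_integral_add has_bochner_integral_mult_right m)
  then show "has_bochner_integral std_exponential (\<lambda>z. (z - 1)\<^sup>2) 1"
    by (simp add: power2_eq_square algebra_simps)
qed

section \<open>Tightness, the threshold representation, and the laws for mean excess and
  bias\<close>

context intermediate_sample
begin

text \<open>A sum of independent indicators has variance at most its mean, here k, so the second
  moment is eventually at most 1.\<close>

lemma exceed_fluctuation_bounded:
  "bounded_in_prob (\<lambda>z. (exceed (lev (fst z)) (fst z) (snd z) - k (fst z)) / sqrt (k (fst z)))"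
proof -
  define l where "l n = max 0 (lev n)" for n
  have l: "\<forall>\<^sub>F n in sequentially. l n = lev n" using lev_pos by eventually_elim (simp add: l_def)
  define Y where "Y n w = ((\<Sum>i\<in>I n. if l n < E i w then 1 else 0) - card (I n) * exp (- l n)) / sqrt (k n)" for n w
  have 1: "has_bochner_integral std_exponential (\<lambda>y. if l n < y then 1 else 0) (exp (- l n))" for n
    by (rule std_exponential_exceed) (simp add: l_def)
  then have 2: "has_bochner_integral std_exponential (\<lambda>y. (if l n < y then 1 else 0)\<^sup>2) (exp (- l n))" for n
    by (simp add: if_distrib[of "\<lambda>x. x\<^sup>2"] cong: if_cong)
  have Y: "has_bochner_integral M (\<lambda>w. (Y n w)\<^sup>2) (card (I n) * (exp (- l n) - (exp (- l n))\<^sup>2) / (sqrt (k n))\<^sup>2)" for n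
    unfolding Y_def power_divide
    by (intro has_bochner_integral_divide centered_iid_sum_second_moment[where \<phi>="\<lambda>y. if l n < y then 1 else 0"] finite_I 1 2)
  have "bounded_in_prob (\<lambda>z. Y (fst z) (snd z))"
  proof (rule bounded_in_prob_second_moment)
    show "integrable M (\<lambda>w. (Y n w)\<^sup>2)" for n using Y by (auto simp: has_bochner_integral_iff)
    show "Y n \<in> borel_measurable M" for n unfolding Y_def by measurable
    show "\<forall>\<^sub>F n in sequentially. expectation (\<lambda>w. (Y n w)\<^sup>2) \<le> 1"
      using l card_exp_lev
    proof eventually_elim
      case (elim n)
      have "expectation (\<lambda>w. (Y n w)\<^sup>2) = card (I n) * (exp (- l n) - (exp (- l n))\<^sup>2) / k n"
        using Y by (simp add: has_bochner_integral_iff)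
      also have "\<dots> \<le> card (I n) * exp (- l n) / k n" by (intro divide_right_mono mult_left_mono) auto
      also have "\<dots> = 1" using elim k_pos[of n] by simp
      finally show ?case .
    qed
  qed
  then show ?thesis
    by (rule bounded_in_prob_comparison)
       (use eventually_fst_prob_filter[OF l] eventually_fst_prob_filter[OF card_exp_lev] in
         \<open>eventually_elim, simp add: Y_def exceed_sum\<close>)
qed

text \<open>Bahadur representation. Since \<open>t < threshold\<close> iff \<open>k < exceed t\<close>, it follows from the
  behaviour of \<^const>\<open>exceed\<close> at the levels \<open>lev + x / sqrt k\<close>.\<close>

lemma threshold_representation:
  "((\<lambda>z. sqrt (k (fst z)) * (threshold (fst z) (snd z) - lev (fst z)) -
      (exceed (lev (fst z)) (fst z) (snd z) - k (fst z)) / sqrt (k (fst z))) \<longlongrightarrow> 0) (prob_filter M)"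
proof (rule tendsto_diff_0_of_level_crossings[OF exceed_fluctuation_bounded])
  let ?r = "\<lambda>x z. (exceed (lev (fst z) + x / sqrt (k (fst z))) (fst z) (snd z) - exceed (lev (fst z)) (fst z) (snd z)) / sqrt (k (fst z))"
  have split: "(exceed (lev n) n w - k n) / sqrt (k n) + ?r x (n, w) =
     (exceed (lev n + x / sqrt (k n)) n w - k n) / sqrt (k n)" for n w x
    by (simp add: add_divide_distrib[symmetric])
  fix x e :: real assume e: "e > 0"
  \<comment> \<open>The switch to counts needs a strict inequality, so the level is lowered by half
    of the tolerance; the other half absorbs the error of the increment.\<close>
  define x1 where "x1 = x - e/2"
  have "\<forall>\<^sub>F z in prob_filter M. ?r x1 z < - x1 + e/2"
    by (rule order_tendstoD(2)[OF exceed_increment]) (use e in simp)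
  then show "\<forall>\<^sub>F z in prob_filter M. x \<le> sqrt (k (fst z)) * (threshold (fst z) (snd z) - lev (fst z)) \<longrightarrow>
      x - e < (exceed (lev (fst z)) (fst z) (snd z) - k (fst z)) / sqrt (k (fst z))"
    using eventually_fst_prob_filter[OF k_less_card]
  proof eventually_elim
    case (elim z)
    obtain n w where z: "z = (n, w)" by (cases z)
    show ?case unfolding z fst_conv snd_conv
    proof
      assume "x \<le> sqrt (k n) * (threshold n w - lev n)"
      then have "x / sqrt (k n) \<le> threshold n w - lev n" using k_pos(3)[of n] by (simp add: divide_le_eq mult.commute)
      moreover have "x1 / sqrt (k n) < x / sqrt (k n)"
        using e k_pos(3)[of n] by (intro divide_strict_right_mono) (auto simp: x1_def)
      ultimately have "lev n + x1 / sqrt (k n) < threshold n w" by linarith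
      then have "k n < exceed (lev n + x1 / sqrt (k n)) n w" using elim(2) by (simp add: z threshold_greater_iff)
      then have "0 < (exceed (lev n + x1 / sqrt (k n)) n w - k n) / sqrt (k n)" using k_pos(3)[of n] by simp
      then show "x - e < (exceed (lev n) n w - k n) / sqrt (k n)"
        using elim(1) split[of n w x1] unfolding z by (simp add: x1_def)
    qed
  qed
next
  let ?r = "\<lambda>x z. (exceed (lev (fst z) + x / sqrt (k (fst z))) (fst z) (snd z) - exceed (lev (fst z)) (fst z) (snd z)) / sqrt (k (fst z))"
  have split: "(exceed (lev n) n w - k n) / sqrt (k n) + ?r x (n, w) =
     (exceed (lev n + x / sqrt (k n)) n w - k n) / sqrt (k n)" for n w x
    by (simp add: add_divide_distrib[symmetric])
  fix x e :: real assume e: "e > 0"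
  have "\<forall>\<^sub>F z in prob_filter M. - x - e < ?r x z"
    by (rule order_tendstoD(1)[OF exceed_increment]) (use e in simp)
  then show "\<forall>\<^sub>F z in prob_filter M. sqrt (k (fst z)) * (threshold (fst z) (snd z) - lev (fst z)) \<le> x \<longrightarrow>
      (exceed (lev (fst z)) (fst z) (snd z) - k (fst z)) / sqrt (k (fst z)) < x + e"
    using eventually_fst_prob_filter[OF k_less_card]
  proof eventually_elim
    case (elim z)
    obtain n w where z: "z = (n, w)" by (cases z)
    show ?case unfolding z fst_conv snd_conv
    proof
      assume "sqrt (k n) * (threshold n w - lev n) \<le> x"
      then have "threshold n w - lev n \<le> x / sqrt (k n)" using k_pos(3)[of n] by (simp add: le_divide_eq mult.commute)
      then have "\<not> lev n + x / sqrt (k n) < threshold n w" by linarith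
      then have "exceed (lev n + x / sqrt (k n)) n w \<le> k n" using elim(2) by (simp add: z threshold_greater_iff)
      then have "(exceed (lev n + x / sqrt (k n)) n w - k n) / sqrt (k n) \<le> 0"
        using k_pos(3)[of n] by (simp add: divide_nonpos_pos)
      then show "(exceed (lev n) n w - k n) / sqrt (k n) < x + e"
        using elim(1) split[of n w x] unfolding z by simp
    qed
  qed
qed

lemma threshold_bounded:
  "bounded_in_prob (\<lambda>z. sqrt (k (fst z)) * (threshold (fst z) (snd z) - lev (fst z)))"
  using bounded_in_prob_add[OF bounded_in_prob_tendsto[OF threshold_representation] exceed_fluctuation_bounded]
  by simp

lemma tail_score_bounded: "bounded_in_prob (\<lambda>z. tail_score (fst z) (snd z))"
proof -
  define l where "l n = max 0 (lev n)" for n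
  have l: "\<forall>\<^sub>F n in sequentially. l n = lev n" using lev_pos by eventually_elim (simp add: l_def)
  define \<phi> :: "nat \<Rightarrow> real \<Rightarrow> real" where "\<phi> n y = (if l n < y then y - l n - 1 else 0)" for n y
  define Y where "Y n w = ((\<Sum>i\<in>I n. \<phi> n (E i w)) - real (card (I n)) * 0) / sqrt (k n)" for n w
  have \<phi>1: "has_bochner_integral std_exponential (\<phi> n) 0" for n
  proof -
    have "0 \<le> l n" by (simp add: l_def)
    from std_exponential_shift[OF this std_exponential_score(1)] show ?thesis
      unfolding \<phi>_def mult_zero_right .
  qed
  have "has_bochner_integral std_exponential (\<lambda>y. if l n < y then (y - l n - 1)\<^sup>2 else 0) (exp (- l n) * 1)" for n
    by (rule std_exponential_shift[OF _ std_exponential_score(2)]) (simp add: l_def)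
  moreover have "(\<lambda>y. if l n < y then (y - l n - 1)\<^sup>2 else 0) = (\<lambda>y. (\<phi> n y)\<^sup>2)" for n
    by (auto simp: \<phi>_def fun_eq_iff)
  ultimately have \<phi>2: "has_bochner_integral std_exponential (\<lambda>y. (\<phi> n y)\<^sup>2) (exp (- l n))" for n by simp
  have [measurable]: "\<phi> n \<in> borel_measurable borel" for n unfolding \<phi>_def by measurable
  have Y: "has_bochner_integral M (\<lambda>w. (Y n w)\<^sup>2) (card (I n) * (exp (- l n) - 0\<^sup>2) / (sqrt (k n))\<^sup>2)" for n
    unfolding Y_def power_divide
    by (intro has_bochner_integral_divide centered_iid_sum_second_moment finite_I \<phi>1 \<phi>2)
  have "bounded_in_prob (\<lambda>z. Y (fst z) (snd z))"
  proof (rule bounded_in_prob_second_moment)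
    show "integrable M (\<lambda>w. (Y n w)\<^sup>2)" for n using Y by (auto simp: has_bochner_integral_iff)
    show "Y n \<in> borel_measurable M" for n unfolding Y_def by measurable
    show "\<forall>\<^sub>F n in sequentially. expectation (\<lambda>w. (Y n w)\<^sup>2) \<le> 1"
      using l card_exp_lev
    proof eventually_elim
      case (elim n)
      have "expectation (\<lambda>w. (Y n w)\<^sup>2) = card (I n) * exp (- l n) / k n"
        using Y by (simp add: has_bochner_integral_iff)
      also have "\<dots> = 1" using elim k_pos[of n] by simp
      finally show ?case by simp
    qed
  qed
  then show ?thesis
    by (rule bounded_in_prob_comparison)
       (use eventually_fst_prob_filter[OF l] in \<open>eventually_elim, simp add: Y_def tail_score_def \<phi>_def cong: if_cong\<close>)
qed

lemma exceed_lev_ratio: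
  "((\<lambda>z. exceed (lev (fst z)) (fst z) (snd z) / k (fst z)) \<longlongrightarrow> 1) (prob_filter M)"
  using exceed_lln[of "\<lambda>_. 0" 0] by simp

lemma exceed_threshold_le: "k n < card (I n) \<Longrightarrow> exceed (threshold n w) n w \<le> k n"
  using threshold_greater_iff[of n "threshold n w" w] by simp

text \<open>At most k values exceed the threshold. With high probability the threshold is below lev
  + e/2, so the count is at least the one at that level, about k exp (- e/2), which exceeds k (1 -
  e).\<close>

lemma exceed_threshold_ratio:
  "((\<lambda>z. exceed (threshold (fst z) (snd z)) (fst z) (snd z) / k (fst z)) \<longlongrightarrow> 1) (prob_filter M)"
  unfolding tendsto_iff
proof (intro allI impI)
  fix e :: real assume e: "e > 0"
  have "((\<lambda>z. exceed (lev (fst z) + e/2) (fst z) (snd z) / k (fst z)) \<longlongrightarrow> exp (- (e/2))) (prob_filter M)"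
    by (rule exceed_lln) simp
  moreover have "1 - e < exp (- (e/2))" using exp_ge_add_one_self[of "- (e/2)"] e by linarith
  ultimately have "\<forall>\<^sub>F z in prob_filter M. 1 - e < exceed (lev (fst z) + e/2) (fst z) (snd z) / k (fst z)"
    by (rule order_tendstoD)
  moreover have "\<forall>\<^sub>F z in prob_filter M. threshold (fst z) (snd z) - lev (fst z) < e/2"
    by (rule order_tendstoD(2)[OF threshold_consistent]) (use e in simp)
  ultimately show "\<forall>\<^sub>F z in prob_filter M. dist (exceed (threshold (fst z) (snd z)) (fst z) (snd z) / k (fst z)) 1 < e"
    using eventually_fst_prob_filter[OF k_less_card]
  proof eventually_elim
    case (elim z)
    let ?n = "fst z" and ?w = "snd z"
    have "exceed (lev ?n + e/2) ?n ?w \<le> exceed (threshold ?n ?w) ?n ?w"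
      unfolding exceed_def using elim finite_I by (intro of_nat_mono card_mono) auto
    then have "exceed (lev ?n + e/2) ?n ?w / k ?n \<le> exceed (threshold ?n ?w) ?n ?w / k ?n"
      by (intro divide_right_mono) auto
    moreover have "exceed (threshold ?n ?w) ?n ?w / k ?n \<le> 1"
      using exceed_threshold_le[OF elim(3)] k_pos[of ?n] by (simp add: divide_le_eq)
    ultimately show ?case using elim e unfolding dist_real_def by linarith
  qed
qed

text \<open>Let \<open>P\<close> and \<open>T\<close> be the total excesses over threshold and
  level, \<open>K\<close> the count at the level, and \<open>\<Delta>\<close> the offset. Then P is
  about T - k \<Delta>, while the threshold representation makes k \<Delta> about K - k. Hence P - k
  is about T - K, the numerator of the tail score, in which the offset no longer occurs.\<close>

lemma mean_excess_expansion:
  "((\<lambda>z. sqrt (k (fst z)) * ((\<Sum>i | i \<in> I (fst z) \<and> threshold (fst z) (snd z) < E i (snd z).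
        E i (snd z) - threshold (fst z) (snd z)) / k (fst z) - 1) - tail_score (fst z) (snd z)) \<longlongrightarrow> 0) (prob_filter M)"
proof -
  define P where "P z = (\<Sum>i | i \<in> I (fst z) \<and> threshold (fst z) (snd z) < E i (snd z). E i (snd z) - threshold (fst z) (snd z))" for z
  define T where "T z = (\<Sum>i | i \<in> I (fst z) \<and> lev (fst z) < E i (snd z). E i (snd z) - lev (fst z))" for z
  define K where "K z = exceed (lev (fst z)) (fst z) (snd z)" for z
  define \<Delta> where "\<Delta> z = threshold (fst z) (snd z) - lev (fst z)" for z
  let ?k = "\<lambda>z. real (k (fst z))"
  have KR: "((\<lambda>z. K z / ?k z - 1) \<longlongrightarrow> 0) (prob_filter M)"
    using tendsto_diff[OF exceed_lev_ratio tendsto_const[of 1]] by (simp add: K_def)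
  \<comment> \<open>This product is the bound of the deterministic perturbation divided by sqrt k:
    one factor tends to 0, the other is tight.\<close>
  have "((\<lambda>z. (K z / ?k z - 1) * (sqrt (?k z) * \<Delta> z)) \<longlongrightarrow> 0) (prob_filter M)"
    unfolding \<Delta>_def by (rule tendsto_0_mult_bounded_in_prob[OF KR threshold_bounded])
  then have "((\<lambda>z. \<bar>(K z / ?k z - 1) * (sqrt (?k z) * \<Delta> z)\<bar>) \<longlongrightarrow> 0) (prob_filter M)"
    by (rule tendsto_rabs_zero)
  moreover have "\<forall>\<^sub>F z in prob_filter M. norm ((P z - (T z - ?k z * \<Delta> z)) / sqrt (?k z)) \<le> \<bar>(K z / ?k z - 1) * (sqrt (?k z) * \<Delta> z)\<bar>"
    using eventually_fst_prob_filter[OF k_less_card]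
  proof eventually_elim
    case (elim z)
    have "\<bar>P z - (T z - ?k z * \<Delta> z)\<bar> \<le> \<bar>\<Delta> z\<bar> * \<bar>K z - ?k z\<bar>"
      using excess_sum_perturbation[OF finite_I elim, where e="\<lambda>i. E i (snd z)" and s="lev (fst z)"]
      unfolding P_def T_def K_def \<Delta>_def threshold_def exceed_def .
    then have "\<bar>(P z - (T z - ?k z * \<Delta> z)) / sqrt (?k z)\<bar> \<le> \<bar>\<Delta> z\<bar> * \<bar>K z - ?k z\<bar> / sqrt (?k z)"
      by (simp add: abs_divide divide_right_mono)
    also have "\<dots> = \<bar>(K z / ?k z - 1) * (sqrt (?k z) * \<Delta> z)\<bar>"
    proof -
      have "K z / ?k z - 1 = (K z - ?k z) / ?k z" using k_pos[of "fst z"] by (simp add: diff_divide_distrib)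
      moreover have "sqrt (?k z) / ?k z = 1 / sqrt (?k z)" using k_pos[of "fst z"]
        by (simp add: real_div_sqrt frac_eq_eq)
      ultimately have "(K z / ?k z - 1) * (sqrt (?k z) * \<Delta> z) = (K z - ?k z) * \<Delta> z * (1 / sqrt (?k z))"
        by (simp add: divide_inverse mult_ac)
      then show ?thesis using k_pos(3)[of "fst z"] by (simp add: abs_mult mult_ac)
    qed
    finally show ?case by simp
  qed
  ultimately have R: "((\<lambda>z. (P z - (T z - ?k z * \<Delta> z)) / sqrt (?k z)) \<longlongrightarrow> 0) (prob_filter M)"
    by (rule Lim_null_comparison[rotated])
  have B: "((\<lambda>z. sqrt (?k z) * \<Delta> z - (K z - ?k z) / sqrt (?k z)) \<longlongrightarrow> 0) (prob_filter M)"
    using threshold_representation by (simp add: \<Delta>_def K_def)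
  have eq: "sqrt (?k z) * (P z / ?k z - 1) - tail_score (fst z) (snd z) =
      (P z - (T z - ?k z * \<Delta> z)) / sqrt (?k z) - (sqrt (?k z) * \<Delta> z - (K z - ?k z) / sqrt (?k z))" for z
  proof -
    have "tail_score (fst z) (snd z) = (T z - K z) / sqrt (?k z)"
      unfolding tail_score_def T_def K_def exceed_sum
      using sum.inter_filter[OF finite_I, of "\<lambda>i. E i (snd z) - lev (fst z)" "fst z" "\<lambda>i. lev (fst z) < E i (snd z)"]
      by (simp add: sum_subtractf[symmetric] if_distrib cong: if_cong)
    moreover have "sqrt (?k z) * (P z / ?k z - 1) = (P z - ?k z) / sqrt (?k z)" "sqrt (?k z) * \<Delta> z = ?k z * \<Delta> z / sqrt (?k z)"
      using k_pos(3)[of "fst z"] real_sqrt_mult_self[of "?k z"] by (auto simp: field_simps)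
    ultimately show ?thesis by (simp add: diff_divide_distrib add_divide_distrib)
  qed
  have "((\<lambda>z. sqrt (?k z) * (P z / ?k z - 1) - tail_score (fst z) (snd z)) \<longlongrightarrow> 0) (prob_filter M)"
    unfolding eq using tendsto_diff[OF R B] by simp
  then show ?thesis by (simp add: P_def)
qed

text \<open>Relative to g (lev), the threshold term contributes 1 and the terms g (E i) average to
  the integral of exp (\<rho> z) against the exponential law, 1 / (1 - \<rho>). The difference is -
  \<rho> / (1 - \<rho>).\<close>

lemma bias_lln:
  fixes g :: "real \<Rightarrow> real" and \<rho> :: real
  assumes "regularly_varying g \<rho>" and \<rho>: "\<rho> < 0"
  shows "((\<lambda>z. (\<Sum>i | i \<in> I (fst z) \<and> threshold (fst z) (snd z) < E i (snd z).
      g (threshold (fst z) (snd z)) - g (E i (snd z))) / (k (fst z) * g (lev (fst z)))) \<longlongrightarrow> - \<rho> / (1 - \<rho>)) (prob_filter M)"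
proof -
  interpret regularly_varying g \<rho> by fact
  obtain C where C: "C > 0" "\<forall>\<^sub>F s in at_top. \<forall>y\<ge>-1. \<bar>g (s + y) / g s\<bar> \<le> C"
    by (rule ratio_bounded[OF \<rho>])
  have Cl: "\<forall>\<^sub>F n in sequentially. \<forall>y\<ge>-1. \<bar>g (lev n + y) / g (lev n)\<bar> \<le> C"
    by (rule eventually_compose_filterlim[OF C(2) lev_top])
  \<comment> \<open>Clipping at the Potter bound makes \<open>h n\<close> bounded for every n, as
    the moment computations require; for z \<ge> 0 it is eventually the plain ratio.\<close>
  define h where "h n z = max (- C) (min C (g (lev n + z) / g (lev n)))" for n z
  have h_bd: "\<bar>h n z\<bar> \<le> C" for n z using C(1) by (auto simp: h_def)
  have [measurable]: "h n \<in> borel_measurable borel" for n unfolding h_def by measurable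
  have h_int: "has_bochner_integral std_exponential (h n) (integral\<^sup>L std_exponential (h n))" for n
    by (intro has_bochner_integral_integrable std_exponential.integrable_const_bound[of _ C])
       (auto simp: h_bd)
  have h2_le: "(h n z)\<^sup>2 \<le> C\<^sup>2" for n z using h_bd[of n z] C(1) by (simp add: abs_le_square_iff[symmetric])
  have h2_int: "has_bochner_integral std_exponential (\<lambda>z. (h n z)\<^sup>2) (integral\<^sup>L std_exponential (\<lambda>z. (h n z)\<^sup>2))" for n
    by (intro has_bochner_integral_integrable std_exponential.integrable_const_bound[of _ "C\<^sup>2"])
       (auto simp: h2_le)
  have h2_bd: "integral\<^sup>L std_exponential (\<lambda>z. (h n z)\<^sup>2) \<le> C\<^sup>2" for n
    using h2_int[of n] by (intro std_exponential.integral_le_const) (auto simp: has_bochner_integral_iff h2_le)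
  have h_lim: "(\<lambda>n. integral\<^sup>L std_exponential (h n)) \<longlonglongrightarrow> 1 / (1 - \<rho>)"
  proof -
    have "(\<lambda>n. integral\<^sup>L std_exponential (h n)) \<longlonglongrightarrow> integral\<^sup>L std_exponential (\<lambda>z. exp (\<rho> * z))"
    proof (rule integral_dominated_convergence[where w="\<lambda>_. C"])
      have "AE z in std_exponential. 0 \<le> z"
        by (subst AE_density) (auto simp: exponential_density_def split: if_splits)
      then show "AE z in std_exponential. (\<lambda>n. h n z) \<longlonglongrightarrow> exp (\<rho> * z)"
      proof eventually_elim
        case (elim z)
        have r: "(\<lambda>n. g (lev n + z) / g (lev n)) \<longlonglongrightarrow> exp (\<rho> * z)"
          by (rule filterlim_compose[OF g_ratio lev_top])
        have "\<forall>\<^sub>F n in sequentially. g (lev n + z) / g (lev n) \<le> C"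
          using Cl
        proof eventually_elim
          case (elim n)
          have "\<bar>g (lev n + z) / g (lev n)\<bar> \<le> C" using elim \<open>0 \<le> z\<close> by simp
          then show ?case by (rule abs_le_D1)
        qed
        then have "exp (\<rho> * z) \<le> C" by (intro tendsto_upperbound[OF r]) auto
        moreover have "(\<lambda>n. h n z) \<longlonglongrightarrow> max (- C) (min C (exp (\<rho> * z)))"
          unfolding h_def by (intro tendsto_max tendsto_min tendsto_const r)
        moreover have "- C \<le> exp (\<rho> * z)" using C(1) exp_gt_zero[of "\<rho> * z"] by linarith
        ultimately show ?case by (simp add: min_absorb2 max_absorb2)
      qed
    qed (auto simp: h_bd)
    then show ?thesis using std_exponential_exp[of \<rho>] \<rho> by (simp add: has_bochner_integral_iff)
  qed
  define l where "l n = max 0 (lev n)" for n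
  have l: "\<forall>\<^sub>F n in sequentially. l n = lev n" using lev_pos by eventually_elim (simp add: l_def)
  define \<phi> where "\<phi> n y = (if l n < y then h n (y - l n) else 0)" for n y
  have sum_lev: "((\<lambda>z. (\<Sum>i\<in>I (fst z). \<phi> (fst z) (E i (snd z))) / k (fst z)) \<longlongrightarrow> 1 / (1 - \<rho>)) (prob_filter M)"
  proof (rule mean_lln)
    show "has_bochner_integral std_exponential (\<phi> n) (exp (- l n) * integral\<^sup>L std_exponential (h n))" for n
      unfolding \<phi>_def by (rule std_exponential_shift[OF _ h_int]) (simp add: l_def)
    have "has_bochner_integral std_exponential (\<lambda>y. if l n < y then (h n (y - l n))\<^sup>2 else 0)
       (exp (- l n) * integral\<^sup>L std_exponential (\<lambda>z. (h n z)\<^sup>2))" for n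
      by (rule std_exponential_shift[OF _ h2_int]) (simp add: l_def)
    moreover have "(\<lambda>y. if l n < y then (h n (y - l n))\<^sup>2 else 0) = (\<lambda>y. (\<phi> n y)\<^sup>2)" for n
      by (auto simp: \<phi>_def fun_eq_iff)
    ultimately show "has_bochner_integral std_exponential (\<lambda>y. (\<phi> n y)\<^sup>2)
       (exp (- l n) * integral\<^sup>L std_exponential (\<lambda>z. (h n z)\<^sup>2))" for n by simp
    show "(\<lambda>n. card (I n) * (exp (- l n) * integral\<^sup>L std_exponential (h n)) / k n) \<longlonglongrightarrow> 1 / (1 - \<rho>)"
      by (rule Lim_transform_eventually[OF h_lim])
         (use l card_exp_lev in eventually_elim, use k_pos in \<open>simp add: mult.assoc[symmetric]\<close>)
    have "(\<lambda>n. C\<^sup>2 * (1 / k n)) \<longlonglongrightarrow> C\<^sup>2 * 0" by (intro tendsto_mult tendsto_const inverse_k)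
    then have lim: "(\<lambda>n. C\<^sup>2 * (1 / k n)) \<longlonglongrightarrow> 0" by simp
    show "(\<lambda>n. card (I n) * (exp (- l n) * integral\<^sup>L std_exponential (\<lambda>z. (h n z)\<^sup>2)) / (real (k n))\<^sup>2) \<longlonglongrightarrow> 0"
    proof (rule tendsto_sandwich[OF _ _ tendsto_const lim])
      show "\<forall>\<^sub>F n in sequentially. card (I n) * (exp (- l n) * integral\<^sup>L std_exponential (\<lambda>z. (h n z)\<^sup>2)) / (real (k n))\<^sup>2 \<le> C\<^sup>2 * (1 / k n)"
        using l card_exp_lev
      proof eventually_elim
        case (elim n)
        have "card (I n) * (exp (- l n) * integral\<^sup>L std_exponential (\<lambda>z. (h n z)\<^sup>2)) / (real (k n))\<^sup>2 =
           integral\<^sup>L std_exponential (\<lambda>z. (h n z)\<^sup>2) / k n"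
          using elim k_pos[of n] by (simp add: mult.assoc[symmetric] power2_eq_square)
        also have "\<dots> \<le> C\<^sup>2 / k n" by (intro divide_right_mono h2_bd) simp
        finally show ?case by simp
      qed
    qed (auto intro!: always_eventually)
  qed
  define A where "A t z = (\<Sum>i\<in>I (fst z). if t < E i (snd z) then g (E i (snd z)) / g (lev (fst z)) else 0)" for t z
  let ?th = "\<lambda>z. threshold (fst z) (snd z)" and ?k = "\<lambda>z. real (k (fst z))" and ?lev = "\<lambda>z. lev (fst z)"
  have A_lev: "((\<lambda>z. A (?lev z) z / ?k z) \<longlongrightarrow> 1 / (1 - \<rho>)) (prob_filter M)"
    using sum_lev
  proof (rule Lim_transform_eventually)
    show "\<forall>\<^sub>F z in prob_filter M. (\<Sum>i\<in>I (fst z). \<phi> (fst z) (E i (snd z))) / k (fst z) = A (?lev z) z / ?k z"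
      using eventually_fst_prob_filter[OF l] eventually_fst_prob_filter[OF Cl]
    proof eventually_elim
      case (elim z)
      have "\<phi> (fst z) (E i (snd z)) = (if ?lev z < E i (snd z) then g (E i (snd z)) / g (?lev z) else 0)" for i
      proof (cases "?lev z < E i (snd z)")
        case True
        have b: "\<bar>g (?lev z + (E i (snd z) - ?lev z)) / g (?lev z)\<bar> \<le> C"
          using elim(2)[rule_format, of "E i (snd z) - ?lev z"] True by simp
        have "h (fst z) (E i (snd z) - ?lev z) = g (?lev z + (E i (snd z) - ?lev z)) / g (?lev z)"
          using abs_le_D1[OF b] abs_le_D2[OF b] unfolding h_def by (auto simp: max_def min_def)
        then show ?thesis using True elim(1) by (simp add: \<phi>_def)
      qed (simp add: \<phi>_def elim(1))
      then show ?case by (simp add: A_def)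
    qed
  qed
  have gap: "((\<lambda>z. C * \<bar>exceed (?th z) (fst z) (snd z) / ?k z - exceed (?lev z) (fst z) (snd z) / ?k z\<bar>) \<longlongrightarrow> 0) (prob_filter M)"
  proof -
    have "((\<lambda>z. C * \<bar>exceed (?th z) (fst z) (snd z) / ?k z - exceed (?lev z) (fst z) (snd z) / ?k z\<bar>) \<longlongrightarrow> C * \<bar>1 - 1\<bar>) (prob_filter M)"
      by (intro tendsto_intros exceed_threshold_ratio exceed_lev_ratio)
    then show ?thesis by simp
  qed
  have th: "\<forall>\<^sub>F z in prob_filter M. - 1 < ?th z - ?lev z" by (rule order_tendstoD(1)[OF threshold_consistent]) simp
  have diff: "((\<lambda>z. A (?th z) z / ?k z - A (?lev z) z / ?k z) \<longlongrightarrow> 0) (prob_filter M)"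
  proof (rule Lim_null_comparison[OF _ gap])
    show "\<forall>\<^sub>F z in prob_filter M. norm (A (?th z) z / ?k z - A (?lev z) z / ?k z)
      \<le> C * \<bar>exceed (?th z) (fst z) (snd z) / ?k z - exceed (?lev z) (fst z) (snd z) / ?k z\<bar>"
      using th eventually_fst_prob_filter[OF Cl]
    proof eventually_elim
      case (elim z)
      \<comment> \<open>Marks the points between threshold and level. Its values share one sign, so
        the sum of |q| is the difference of the two counts, negligible against k, and each marked
        point costs at most \<open>C\<close>.\<close>
      define q where "q i = (if ?th z < E i (snd z) then 1 else 0) - (if ?lev z < E i (snd z) then 1 else 0 :: real)" for i
      have q: "(\<Sum>i\<in>I (fst z). q i) = exceed (?th z) (fst z) (snd z) - exceed (?lev z) (fst z) (snd z)"
        by (simp add: q_def sum_subtractf exceed_sum)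
      have absq: "(\<Sum>i\<in>I (fst z). \<bar>q i\<bar>) = \<bar>exceed (?th z) (fst z) (snd z) - exceed (?lev z) (fst z) (snd z)\<bar>"
      proof (cases "?th z \<le> ?lev z")
        case True
        then have "\<bar>q i\<bar> = q i" "0 \<le> q i" for i by (auto simp: q_def)
        then show ?thesis using sum_nonneg[of "I (fst z)" q] q by simp
      next
        case False
        then have *: "\<bar>q i\<bar> = - q i" "0 \<le> - q i" for i by (auto simp: q_def)
        then have "(\<Sum>i\<in>I (fst z). \<bar>q i\<bar>) = - (\<Sum>i\<in>I (fst z). q i)" by (simp add: sum_negf)
        moreover have "0 \<le> (\<Sum>i\<in>I (fst z). \<bar>q i\<bar>)" by (intro sum_nonneg) auto
        ultimately show ?thesis using q by simp
      qed
      have "\<bar>A (?th z) z - A (?lev z) z\<bar> = \<bar>\<Sum>i\<in>I (fst z). q i * (g (E i (snd z)) / g (?lev z))\<bar>"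
        unfolding A_def sum_subtractf[symmetric] by (intro arg_cong[where f=abs] sum.cong) (auto simp: q_def)
      also have "\<dots> \<le> (\<Sum>i\<in>I (fst z). \<bar>q i * (g (E i (snd z)) / g (?lev z))\<bar>)" by (rule sum_abs)
      also have "\<dots> \<le> (\<Sum>i\<in>I (fst z). C * \<bar>q i\<bar>)"
      proof (rule sum_mono)
        fix i assume "i \<in> I (fst z)"
        show "\<bar>q i * (g (E i (snd z)) / g (?lev z))\<bar> \<le> C * \<bar>q i\<bar>"
        proof (cases "q i = 0")
          case False
          then have "- 1 \<le> E i (snd z) - ?lev z" using elim(1) by (auto simp: q_def split: if_splits)
          then have "\<bar>g (E i (snd z)) / g (?lev z)\<bar> \<le> C" using elim(2)[rule_format, of "E i (snd z) - ?lev z"] by simp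
          then show ?thesis using mult_left_mono[of "\<bar>g (E i (snd z)) / g (?lev z)\<bar>" C "\<bar>q i\<bar>"]
            by (simp add: abs_mult mult.commute)
        qed simp
      qed
      also have "\<dots> = C * \<bar>exceed (?th z) (fst z) (snd z) - exceed (?lev z) (fst z) (snd z)\<bar>"
        by (simp only: sum_distrib_left[symmetric] absq)
      finally have "\<bar>A (?th z) z - A (?lev z) z\<bar> / ?k z \<le> C * \<bar>exceed (?th z) (fst z) (snd z) - exceed (?lev z) (fst z) (snd z)\<bar> / ?k z"
        by (rule divide_right_mono) simp
      then show ?case by (simp add: diff_divide_distrib[symmetric] abs_divide)
    qed
  qed
  have g_th: "((\<lambda>z. g (?lev z + (?th z - ?lev z)) / g (?lev z)) \<longlongrightarrow> exp (\<rho> * 0)) (prob_filter M)"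
    by (rule ratio_tendsto[OF filterlim_fst_compose[OF lev_top] threshold_consistent])
  have "((\<lambda>z. exceed (?th z) (fst z) (snd z) / ?k z * (g (?lev z + (?th z - ?lev z)) / g (?lev z)) -
      ((A (?th z) z / ?k z - A (?lev z) z / ?k z) + A (?lev z) z / ?k z)) \<longlongrightarrow>
      1 * exp (\<rho> * 0) - (0 + 1 / (1 - \<rho>))) (prob_filter M)"
    by (intro tendsto_diff tendsto_add tendsto_mult exceed_threshold_ratio g_th diff A_lev)
  also have "1 * exp (\<rho> * 0) - (0 + 1 / (1 - \<rho>)) = - \<rho> / (1 - \<rho>)" using \<rho> by (simp add: field_simps)
  also have "(\<lambda>z. exceed (?th z) (fst z) (snd z) / ?k z * (g (?lev z + (?th z - ?lev z)) / g (?lev z)) -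
      ((A (?th z) z / ?k z - A (?lev z) z / ?k z) + A (?lev z) z / ?k z)) =
    (\<lambda>z. (\<Sum>i | i \<in> I (fst z) \<and> ?th z < E i (snd z). g (?th z) - g (E i (snd z))) / (?k z * g (?lev z)))"
  proof
    fix z
    have "(\<Sum>i | i \<in> I (fst z) \<and> ?th z < E i (snd z). g (?th z) - g (E i (snd z))) / (?k z * g (?lev z)) =
      (\<Sum>i | i \<in> I (fst z) \<and> ?th z < E i (snd z). g (?th z) / g (?lev z) - g (E i (snd z)) / g (?lev z)) / ?k z"
      by (simp add: sum_divide_distrib diff_divide_distrib mult.commute)
    also have "(\<Sum>i | i \<in> I (fst z) \<and> ?th z < E i (snd z). g (?th z) / g (?lev z) - g (E i (snd z)) / g (?lev z)) =
      exceed (?th z) (fst z) (snd z) * (g (?th z) / g (?lev z)) - A (?th z) z"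
      unfolding A_def sum_subtractf sum.inter_filter[OF finite_I, symmetric] by (simp add: exceed_def)
    finally show "exceed (?th z) (fst z) (snd z) / ?k z * (g (?lev z + (?th z - ?lev z)) / g (?lev z)) -
      ((A (?th z) z / ?k z - A (?lev z) z / ?k z) + A (?lev z) z / ?k z) =
      (\<Sum>i | i \<in> I (fst z) \<and> ?th z < E i (snd z). g (?th z) - g (E i (snd z))) / (?k z * g (?lev z))"
      by (simp add: diff_divide_distrib)
  qed
  finally show ?thesis .
qed

end

text \<open>One interface for an arbitrary index family, instantiated later with each subsample and
  with the combined sample, over the same variables. \<open>\<mu>\<close> is the limiting bias on
  the scale sqrt k, measured by \<open>g\<close> at the level.\<close>

locale tail_sample = intermediate_sample M E I k + regularly_varying g \<rho>
  for M :: "'a measure" and E :: "'i \<Rightarrow> 'a \<Rightarrow> real" and I :: "nat \<Rightarrow> 'i set" and k :: "nat \<Rightarrow> nat"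
    and g :: "real \<Rightarrow> real" and \<rho> :: real +
  fixes Q :: "real \<Rightarrow> real" and \<gamma> f0 \<mu> :: real and X :: "'i \<Rightarrow> 'a \<Rightarrow> real"
  assumes \<rho>_neg: "\<rho> < 0"
    and Q_mono: "mono_on {0<..} Q"
    and Q_tail: "\<forall>\<^sub>F s in at_top. 0 < Q s \<and> ln (Q s) = f0 + \<gamma> * s - g s"
    and X_eq: "AE w in M. \<forall>i. 0 < E i w \<and> Q (E i w) = X i w"
    and bias_limit: "(\<lambda>n. sqrt (k n) * g (lev n)) \<longlonglongrightarrow> \<mu>"
begin

text \<open>Once the threshold lies where the tail formula holds, so does every exceedance, and the
  constant \<open>f0\<close> cancels from the log-spacings.\<close>

lemma sample_representation:
  "\<forall>\<^sub>F z in prob_filter M.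
     order_stat (I (fst z)) (\<lambda>i. X i (snd z)) (card (I (fst z)) - k (fst z)) = Q (threshold (fst z) (snd z)) \<and>
     0 < Q (threshold (fst z) (snd z)) \<and>
     ln (Q (threshold (fst z) (snd z))) = f0 + \<gamma> * threshold (fst z) (snd z) - g (threshold (fst z) (snd z)) \<and>
     hill (I (fst z)) (\<lambda>i. X i (snd z)) (k (fst z)) =
       \<gamma> * ((\<Sum>i | i \<in> I (fst z) \<and> threshold (fst z) (snd z) < E i (snd z). E i (snd z) - threshold (fst z) (snd z)) / k (fst z)) +
       (\<Sum>i | i \<in> I (fst z) \<and> threshold (fst z) (snd z) < E i (snd z). g (threshold (fst z) (snd z)) - g (E i (snd z))) / k (fst z)"
proof -
  obtain s0 where s0: "\<And>s. s \<ge> s0 \<Longrightarrow> 0 < Q s \<and> ln (Q s) = f0 + \<gamma> * s - g s"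
    using Q_tail by (auto simp: eventually_at_top_linorder)
  have "\<forall>\<^sub>F z in prob_filter M. s0 \<le> threshold (fst z) (snd z)"
    using threshold_top by (simp add: filterlim_at_top)
  then show ?thesis
    using eventually_prob_filter_snd_AE[OF X_eq] eventually_fst_prob_filter[OF k_less_card]
  proof eventually_elim
    case (elim z)
    obtain n w where z: "z = (n, w)" by (cases z)
    note elim = elim[unfolded z fst_conv snd_conv]
    let ?t = "threshold n w" and ?J = "{i. i \<in> I n \<and> threshold n w < E i w}"
    have t: "0 < Q ?t" "ln (Q ?t) = f0 + \<gamma> * ?t - g ?t" using s0 elim(1) by auto
    have XE: "(\<lambda>i. X i w) = (\<lambda>i. Q (E i w))" using elim(2) by auto
    have sub: "(\<lambda>i. E i w) ` I n \<subseteq> {0<..}" using elim(2) by auto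
    note tr = hill_transform[OF finite_I k_ge_1 elim(3) Q_mono sub, folded threshold_def, OF t(1)]
    have "(\<Sum>i\<in>?J. ln (Q (E i w)) - ln (Q ?t)) = (\<Sum>i\<in>?J. \<gamma> * (E i w - ?t) + (g ?t - g (E i w)))"
    proof (rule sum.cong[OF refl])
      fix i assume "i \<in> ?J"
      then have "ln (Q (E i w)) = f0 + \<gamma> * E i w - g (E i w)" using s0[of "E i w"] elim(1) by auto
      then show "ln (Q (E i w)) - ln (Q ?t) = \<gamma> * (E i w - ?t) + (g ?t - g (E i w))"
        by (simp add: t algebra_simps)
    qed
    also have "\<dots> = \<gamma> * (\<Sum>i\<in>?J. E i w - ?t) + (\<Sum>i\<in>?J. g ?t - g (E i w))"
      by (simp only: sum.distrib sum_distrib_left)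
    finally show ?case using tr t unfolding z fst_conv snd_conv XE by (simp add: add_divide_distrib)
  qed
qed

lemma hill_expansion:
  "((\<lambda>z. sqrt (k (fst z)) * (hill (I (fst z)) (\<lambda>i. X i (snd z)) (k (fst z)) - \<gamma>) - \<gamma> * tail_score (fst z) (snd z))
     \<longlongrightarrow> - \<rho> / (1 - \<rho>) * \<mu>) (prob_filter M)"
proof -
  let ?t = "\<lambda>z. threshold (fst z) (snd z)"
  define P where "P z = (\<Sum>i | i \<in> I (fst z) \<and> ?t z < E i (snd z). E i (snd z) - ?t z)" for z
  define B where "B z = (\<Sum>i | i \<in> I (fst z) \<and> ?t z < E i (snd z). g (?t z) - g (E i (snd z)))" for z
  have "((\<lambda>z. \<gamma> * (sqrt (k (fst z)) * (P z / k (fst z) - 1) - tail_score (fst z) (snd z)) +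
      B z / (k (fst z) * g (lev (fst z))) * (sqrt (k (fst z)) * g (lev (fst z)))) \<longlongrightarrow> \<gamma> * 0 + - \<rho> / (1 - \<rho>) * \<mu>) (prob_filter M)"
    unfolding P_def B_def
    by (intro tendsto_add tendsto_mult tendsto_const mean_excess_expansion bias_lln[OF regularly_varying_axioms \<rho>_neg]
          filterlim_fst_compose[OF bias_limit])
  then have "((\<lambda>z. \<gamma> * (sqrt (k (fst z)) * (P z / k (fst z) - 1) - tail_score (fst z) (snd z)) +
      B z / (k (fst z) * g (lev (fst z))) * (sqrt (k (fst z)) * g (lev (fst z)))) \<longlongrightarrow> - \<rho> / (1 - \<rho>) * \<mu>) (prob_filter M)"
    by simp
  then show ?thesis
  proof (rule Lim_transform_eventually)
    show "\<forall>\<^sub>F z in prob_filter M. \<gamma> * (sqrt (k (fst z)) * (P z / k (fst z) - 1) - tail_score (fst z) (snd z)) +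
      B z / (k (fst z) * g (lev (fst z))) * (sqrt (k (fst z)) * g (lev (fst z))) =
      sqrt (k (fst z)) * (hill (I (fst z)) (\<lambda>i. X i (snd z)) (k (fst z)) - \<gamma>) - \<gamma> * tail_score (fst z) (snd z)"
      using sample_representation eventually_fst_prob_filter[OF eventually_compose_filterlim[OF g_nonzero lev_top]]
    proof eventually_elim
      case (elim z)
      have h: "hill (I (fst z)) (\<lambda>i. X i (snd z)) (k (fst z)) = \<gamma> * (P z / k (fst z)) + B z / k (fst z)"
        using elim(1) by (simp add: P_def B_def)
      show ?case unfolding h using elim(2) by (simp add: algebra_simps)
    qed
  qed
qed

lemma hill_bounded:
  "bounded_in_prob (\<lambda>z. sqrt (k (fst z)) * (hill (I (fst z)) (\<lambda>i. X i (snd z)) (k (fst z)) - \<gamma>))"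
proof -
  have "bounded_in_prob (\<lambda>z. (sqrt (k (fst z)) * (hill (I (fst z)) (\<lambda>i. X i (snd z)) (k (fst z)) - \<gamma>) - \<gamma> * tail_score (fst z) (snd z))
     + \<gamma> * tail_score (fst z) (snd z))"
    by (intro bounded_in_prob_add bounded_in_prob_mult bounded_in_prob_const tail_score_bounded
        bounded_in_prob_tendsto[OF hill_expansion])
  then show ?thesis by simp
qed

lemma hill_consistent: "((\<lambda>z. hill (I (fst z)) (\<lambda>i. X i (snd z)) (k (fst z))) \<longlongrightarrow> \<gamma>) (prob_filter M)"
proof -
  have "((\<lambda>z. 1 / sqrt (k (fst z)) * (sqrt (k (fst z)) * (hill (I (fst z)) (\<lambda>i. X i (snd z)) (k (fst z)) - \<gamma>))) \<longlongrightarrow> 0) (prob_filter M)"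
    by (rule tendsto_0_mult_bounded_in_prob[OF filterlim_fst_compose[OF inverse_sqrt_k] hill_bounded])
  then have "((\<lambda>z. hill (I (fst z)) (\<lambda>i. X i (snd z)) (k (fst z)) - \<gamma>) \<longlongrightarrow> 0) (prob_filter M)"
    by (rule Lim_transform_eventually) (use k_pos in \<open>auto intro!: always_eventually\<close>)
  then show ?thesis by (simp add: LIM_zero_iff)
qed

text \<open>With \<tau> = - ln p and H the Hill estimator, the log error is (\<tau> - lev) (H -
  \<gamma>) + \<gamma> (threshold - lev) + g (\<tau>) - g (threshold). The last two parts are O_P(1
  / sqrt k) and vanish because r / sqrt k tends to 0. The constant \<open>c\<close> is free because
  the rate is normalised by the total k, while a subsample has its own.\<close>

lemma weissman_log_expansion:
  fixes r p :: "nat \<Rightarrow> real"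
  assumes p: "\<And>n. 0 < p n" and r0: "(\<lambda>n. r n / sqrt (k n)) \<longlonglongrightarrow> 0"
    and r1: "(\<lambda>n. r n * (- ln (p n) - lev n) / sqrt (k n)) \<longlonglongrightarrow> c"
    and lev_le: "\<forall>\<^sub>F n in sequentially. lev n \<le> - ln (p n)"
  shows "((\<lambda>z. r (fst z) * (ln (weissman (I (fst z)) (\<lambda>i. X i (snd z)) (k (fst z)) (p (fst z))) - ln (Q (- ln (p (fst z)))))
      - c * (sqrt (k (fst z)) * (hill (I (fst z)) (\<lambda>i. X i (snd z)) (k (fst z)) - \<gamma>))) \<longlongrightarrow> 0) (prob_filter M)"
    and "\<forall>\<^sub>F z in prob_filter M. 0 < weissman (I (fst z)) (\<lambda>i. X i (snd z)) (k (fst z)) (p (fst z)) \<and> 0 < Q (- ln (p (fst z)))"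
proof -
  let ?t = "\<lambda>z. threshold (fst z) (snd z)" and ?lev = "\<lambda>z. lev (fst z)" and ?sk = "\<lambda>z. sqrt (k (fst z))"
  define \<tau> where "\<tau> n = - ln (p n)" for n
  define H where "H z = hill (I (fst z)) (\<lambda>i. X i (snd z)) (k (fst z))" for z
  have \<tau>_top: "filterlim \<tau> at_top sequentially"
    by (rule filterlim_at_top_mono[OF lev_top]) (use lev_le in \<open>simp add: \<tau>_def\<close>)
  have Q\<tau>: "\<forall>\<^sub>F z in prob_filter M. 0 < Q (\<tau> (fst z)) \<and> ln (Q (\<tau> (fst z))) = f0 + \<gamma> * \<tau> (fst z) - g (\<tau> (fst z))"
    by (rule eventually_fst_prob_filter[OF eventually_compose_filterlim[OF Q_tail \<tau>_top]])
  have W: "\<forall>\<^sub>F z in prob_filter M. 0 < weissman (I (fst z)) (\<lambda>i. X i (snd z)) (k (fst z)) (p (fst z)) \<and>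
      ln (weissman (I (fst z)) (\<lambda>i. X i (snd z)) (k (fst z)) (p (fst z))) = H z * (\<tau> (fst z) - ?lev z) + f0 + \<gamma> * ?t z - g (?t z)"
    using sample_representation eventually_fst_prob_filter[OF k_less_card]
  proof eventually_elim
    case (elim z)
    have c: "0 < card (I (fst z))" by (rule le_less_trans[OF le0 \<open>k (fst z) < card (I (fst z))\<close>])
    have "ln (k (fst z) / (card (I (fst z)) * p (fst z))) = \<tau> (fst z) - ?lev z"
      using c k_pos[of "fst z"] p[of "fst z"] by (simp add: ln_div ln_mult \<tau>_def lev_def)
    moreover have "0 < k (fst z) / (card (I (fst z)) * p (fst z))"
      using c k_pos[of "fst z"] p[of "fst z"] by (intro divide_pos_pos mult_pos_pos) auto
    ultimately show ?case using elim(1) c k_ge_1[of "fst z"] by (auto simp: weissman_def H_def ln_mult)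
  qed
  show "\<forall>\<^sub>F z in prob_filter M. 0 < weissman (I (fst z)) (\<lambda>i. X i (snd z)) (k (fst z)) (p (fst z)) \<and> 0 < Q (- ln (p (fst z)))"
    using W Q\<tau> by eventually_elim (simp add: \<tau>_def)
  obtain C where C: "C > 0" "\<forall>\<^sub>F s in at_top. \<forall>y\<ge>-1. \<bar>g (s + y) / g s\<bar> \<le> C"
    by (rule ratio_bounded[OF \<rho>_neg])
  have Cl: "\<forall>\<^sub>F n in sequentially. \<forall>y\<ge>-1. \<bar>g (lev n + y) / g (lev n)\<bar> \<le> C"
    by (rule eventually_compose_filterlim[OF C(2) lev_top])
  have r0': "((\<lambda>z. r (fst z) / ?sk z) \<longlongrightarrow> 0) (prob_filter M)" by (rule filterlim_fst_compose[OF r0])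
  have "((\<lambda>z. r (fst z) * (\<tau> (fst z) - ?lev z) / ?sk z - c) \<longlongrightarrow> c - c) (prob_filter M)"
    unfolding \<tau>_def by (intro tendsto_diff tendsto_const filterlim_fst_compose[OF r1])
  then have "((\<lambda>z. r (fst z) * (\<tau> (fst z) - ?lev z) / ?sk z - c) \<longlongrightarrow> 0) (prob_filter M)" by simp
  then have 1: "((\<lambda>z. (r (fst z) * (\<tau> (fst z) - ?lev z) / ?sk z - c) * (?sk z * (H z - \<gamma>))) \<longlongrightarrow> 0) (prob_filter M)"
    unfolding H_def by (rule tendsto_0_mult_bounded_in_prob[OF _ hill_bounded])
  have 2: "((\<lambda>z. \<gamma> * (r (fst z) / ?sk z * (?sk z * (?t z - ?lev z)))) \<longlongrightarrow> \<gamma> * 0) (prob_filter M)"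
    by (intro tendsto_mult tendsto_const tendsto_0_mult_bounded_in_prob[OF r0' threshold_bounded])
  have "bounded_in_prob (\<lambda>z. (?sk z * g (?lev z)) * (g (\<tau> (fst z)) / g (?lev z) - g (?lev z + (?t z - ?lev z)) / g (?lev z)))"
  proof (rule bounded_in_prob_mult)
    show "bounded_in_prob (\<lambda>z. ?sk z * g (?lev z))"
      by (rule bounded_in_prob_tendsto[OF filterlim_fst_compose[OF bias_limit]])
    \<comment> \<open>\<open>\<tau>\<close> may be arbitrarily far above the level, out of reach of
      local uniformity; the global bound applies because \<open>lev \<le> \<tau>\<close>
      eventually.\<close>
    have "bounded_in_prob (\<lambda>z. g (\<tau> (fst z)) / g (?lev z))"
    proof (rule bounded_in_prob_comparison[OF bounded_in_prob_const[of C]])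
      show "\<forall>\<^sub>F z in prob_filter M. \<bar>g (\<tau> (fst z)) / g (?lev z)\<bar> \<le> \<bar>C\<bar>"
        using eventually_fst_prob_filter[OF Cl] eventually_fst_prob_filter[OF lev_le]
      proof eventually_elim
        case (elim z)
        have "\<bar>g (?lev z + (\<tau> (fst z) - ?lev z)) / g (?lev z)\<bar> \<le> C"
          by (rule elim(1)[rule_format]) (use elim(2) in \<open>simp add: \<tau>_def\<close>)
        then show ?case using C(1) by simp
      qed
    qed
    moreover have "bounded_in_prob (\<lambda>z. - 1 * (g (?lev z + (?t z - ?lev z)) / g (?lev z)))"
      by (intro bounded_in_prob_mult bounded_in_prob_const
            bounded_in_prob_tendsto[OF ratio_tendsto[OF filterlim_fst_compose[OF lev_top] threshold_consistent]])
    ultimately have "bounded_in_prob (\<lambda>z. g (\<tau> (fst z)) / g (?lev z) + - 1 * (g (?lev z + (?t z - ?lev z)) / g (?lev z)))"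
      by (rule bounded_in_prob_add)
    then show "bounded_in_prob (\<lambda>z. g (\<tau> (fst z)) / g (?lev z) - g (?lev z + (?t z - ?lev z)) / g (?lev z))" by simp
  qed
  then have 3: "((\<lambda>z. r (fst z) / ?sk z * ((?sk z * g (?lev z)) * (g (\<tau> (fst z)) / g (?lev z) - g (?lev z + (?t z - ?lev z)) / g (?lev z)))) \<longlongrightarrow> 0) (prob_filter M)"
    by (rule tendsto_0_mult_bounded_in_prob[OF r0'])
  have "((\<lambda>z. (r (fst z) * (\<tau> (fst z) - ?lev z) / ?sk z - c) * (?sk z * (H z - \<gamma>)) +
      \<gamma> * (r (fst z) / ?sk z * (?sk z * (?t z - ?lev z))) +
      r (fst z) / ?sk z * ((?sk z * g (?lev z)) * (g (\<tau> (fst z)) / g (?lev z) - g (?lev z + (?t z - ?lev z)) / g (?lev z)))) \<longlongrightarrow> 0 + \<gamma> * 0 + 0) (prob_filter M)"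
    by (intro tendsto_add 1 2 3)
  then have "((\<lambda>z. (r (fst z) * (\<tau> (fst z) - ?lev z) / ?sk z - c) * (?sk z * (H z - \<gamma>)) +
      \<gamma> * (r (fst z) / ?sk z * (?sk z * (?t z - ?lev z))) +
      r (fst z) / ?sk z * ((?sk z * g (?lev z)) * (g (\<tau> (fst z)) / g (?lev z) - g (?lev z + (?t z - ?lev z)) / g (?lev z)))) \<longlongrightarrow> 0) (prob_filter M)" by simp
  then show "((\<lambda>z. r (fst z) * (ln (weissman (I (fst z)) (\<lambda>i. X i (snd z)) (k (fst z)) (p (fst z))) - ln (Q (- ln (p (fst z)))))
      - c * (sqrt (k (fst z)) * (hill (I (fst z)) (\<lambda>i. X i (snd z)) (k (fst z)) - \<gamma>))) \<longlongrightarrow> 0) (prob_filter M)"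
  proof (rule Lim_transform_eventually)
    show "\<forall>\<^sub>F z in prob_filter M. (r (fst z) * (\<tau> (fst z) - ?lev z) / ?sk z - c) * (?sk z * (H z - \<gamma>)) +
      \<gamma> * (r (fst z) / ?sk z * (?sk z * (?t z - ?lev z))) +
      r (fst z) / ?sk z * ((?sk z * g (?lev z)) * (g (\<tau> (fst z)) / g (?lev z) - g (?lev z + (?t z - ?lev z)) / g (?lev z))) =
      r (fst z) * (ln (weissman (I (fst z)) (\<lambda>i. X i (snd z)) (k (fst z)) (p (fst z))) - ln (Q (- ln (p (fst z)))))
      - c * (sqrt (k (fst z)) * (hill (I (fst z)) (\<lambda>i. X i (snd z)) (k (fst z)) - \<gamma>))"
      using W Q\<tau> eventually_fst_prob_filter[OF eventually_compose_filterlim[OF g_nonzero lev_top]]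
    proof eventually_elim
      case (elim z)
      have a: "x / ?sk z * (?sk z * y) = x * y" for x y using k_pos(3)[of "fst z"] by simp
      have b: "(x / ?sk z - c) * (?sk z * y) = x * y - c * (?sk z * y)" for x y
        using k_pos(3)[of "fst z"] by (simp add: left_diff_distrib)
      have d: "?sk z * g (?lev z) * (x / g (?lev z) - y / g (?lev z)) = ?sk z * (x - y)" for x y
        using elim(3) by (simp add: right_diff_distrib)
      have e: "ln (weissman (I (fst z)) (\<lambda>i. X i (snd z)) (k (fst z)) (p (fst z))) - ln (Q (\<tau> (fst z))) =
         (\<tau> (fst z) - ?lev z) * (H z - \<gamma>) + \<gamma> * (?t z - ?lev z) + (g (\<tau> (fst z)) - g (?t z))"
        using elim(1,2) by (simp add: algebra_simps)
      show ?case unfolding a b d \<tau>_def[symmetric] H_def[symmetric] e by (simp add: algebra_simps)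
    qed
  qed
qed

end

section \<open>Central limit theorem for the tail scores\<close>

lemma exp_minus_quadratic_bound:
  assumes "0 \<le> (x::real)" shows "\<bar>exp (- x) - (1 - x)\<bar> \<le> x\<^sup>2"
proof -
  have "1 - x \<le> exp (- x)" using exp_ge_add_one_self[of "- x"] by simp
  moreover have "exp (- x) \<le> 1 - x + x\<^sup>2"
  proof -
    have q: "1 + x + x\<^sup>2 / 2 \<le> exp x" by (rule exp_lower_Taylor_quadratic[OF assms])
    have pos: "0 \<le> 1 - x + x\<^sup>2" using sum_squares_ge_zero[of "x - 1" x] assms by (simp add: power2_eq_square algebra_simps)
    \<comment> \<open>The product of 1 - x + x^2 with 1 + x + x^2 / 2 is at least 1, and the second
      factor is a lower bound for exp x.\<close>
    have "1 + (x\<^sup>2 / 2 + x ^ 3 / 2 + x ^ 4 / 2) = (1 - x + x\<^sup>2) * (1 + x + x\<^sup>2 / 2)"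
      by (simp add: power2_eq_square power3_eq_cube power4_eq_xxxx field_simps)
    then have "1 \<le> (1 - x + x\<^sup>2) * (1 + x + x\<^sup>2 / 2)" using assms by (smt (verit) zero_le_power divide_nonneg_pos)
    also have "\<dots> \<le> (1 - x + x\<^sup>2) * exp x" using q pos by (rule mult_left_mono)
    finally show ?thesis by (simp add: exp_minus field_simps)
  qed
  ultimately show ?thesis by simp
qed

definition score :: "real \<Rightarrow> real \<Rightarrow> real" where "score s y = (if s < y then y - s - 1 else 0)"

lemma score_measurable [measurable]: "score s \<in> borel_measurable borel"
  unfolding score_def by measurable

lemma score_moments:
  assumes s: "0 \<le> s"
  shows "has_bochner_integral std_exponential (score s) 0"
    and "has_bochner_integral std_exponential (\<lambda>y. (score s y)\<^sup>2) (exp (- s))"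
    and "has_bochner_integral std_exponential (\<lambda>y. \<bar>score s y\<bar> ^ 3) (exp (- s) * integral\<^sup>L std_exponential (\<lambda>z. \<bar>z - 1\<bar> ^ 3))"
proof -
  show "has_bochner_integral std_exponential (score s) 0"
    using std_exponential_shift[OF s std_exponential_score(1)] by (simp add: score_def[abs_def])
  have "(\<lambda>y. (score s y)\<^sup>2) = (\<lambda>y. if s < y then (y - s - 1)\<^sup>2 else 0)" by (auto simp: score_def fun_eq_iff)
  then show "has_bochner_integral std_exponential (\<lambda>y. (score s y)\<^sup>2) (exp (- s))"
    using std_exponential_shift[OF s std_exponential_score(2)] by simp
  \<comment> \<open>Of the third absolute moment only finiteness matters; a polynomial with known
    moments dominates it.\<close>
  have "integrable std_exponential (\<lambda>z. \<bar>z - 1\<bar> ^ 3)"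
  proof (rule Bochner_Integration.integrable_bound)
    have "has_bochner_integral std_exponential (\<lambda>z. z ^ 4 + 1) (fact 4 + fact 0)"
      using has_bochner_integral_add[OF std_exponential_moment[of 4] std_exponential_moment[of 0]] by simp
    then have "has_bochner_integral std_exponential (\<lambda>z. 16 * (z ^ 4 + 1)) (16 * (fact 4 + fact 0))"
      by (rule has_bochner_integral_mult_right)
    then show "integrable std_exponential (\<lambda>z. 16 * (z ^ 4 + 1))" by (simp add: has_bochner_integral_iff)
    have "\<bar>z - 1\<bar> ^ 3 \<le> 16 * (z ^ 4 + 1)" for z :: real
    proof -
      have *: "x ^ 3 \<le> 1 + x ^ 4" if "0 \<le> x" for x :: real
      proof (cases "x \<le> 1")
        case True
        then have "x ^ 3 \<le> 1" using that by (simp add: power_le_one)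
        then show ?thesis by (smt (verit) zero_le_power that)
      next
        case False
        then have "x ^ 3 \<le> x ^ 4" by (intro power_increasing) auto
        then show ?thesis by simp
      qed
      have "\<bar>z - 1\<bar> ^ 3 \<le> 1 + (z - 1) ^ 4" using *[of "\<bar>z - 1\<bar>"] by simp
      also have "\<dots> \<le> 16 * (z ^ 4 + 1)"
      proof -
        have "(z - 1)\<^sup>2 \<le> 2 * (z\<^sup>2 + 1)" using zero_le_power2[of "z + 1"] by (simp add: power2_eq_square algebra_simps)
        then have "((z - 1)\<^sup>2)\<^sup>2 \<le> (2 * (z\<^sup>2 + 1))\<^sup>2" by (intro power_mono) auto
        also have "\<dots> \<le> 8 * (z ^ 4 + 1)"
          using zero_le_power2[of "z\<^sup>2 - 1"] by (simp add: power2_eq_square power4_eq_xxxx algebra_simps)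
        finally have "(z - 1) ^ 4 \<le> 8 * (z ^ 4 + 1)" by simp
        moreover have "0 \<le> z ^ 4" by simp
        ultimately show ?thesis unfolding distrib_left by linarith
      qed
      finally show ?thesis .
    qed
    then show "AE z in std_exponential. norm (\<bar>z - 1\<bar> ^ 3) \<le> norm (16 * (z ^ 4 + 1))"
      by (intro AE_I2) (smt (verit) real_norm_def power_abs abs_of_nonneg zero_le_power abs_ge_zero)
  qed simp
  then have "has_bochner_integral std_exponential (\<lambda>z. \<bar>z - 1\<bar> ^ 3) (integral\<^sup>L std_exponential (\<lambda>z. \<bar>z - 1\<bar> ^ 3))"
    by (rule has_bochner_integral_integrable)
  from std_exponential_shift[OF s this]
  have "has_bochner_integral std_exponential (\<lambda>y. if s < y then \<bar>y - s - 1\<bar> ^ 3 else 0) (exp (- s) * integral\<^sup>L std_exponential (\<lambda>z. \<bar>z - 1\<bar> ^ 3))" .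
  moreover have "(\<lambda>y. \<bar>score s y\<bar> ^ 3) = (\<lambda>y. if s < y then \<bar>y - s - 1\<bar> ^ 3 else 0)" by (auto simp: score_def fun_eq_iff)
  ultimately show "has_bochner_integral std_exponential (\<lambda>y. \<bar>score s y\<bar> ^ 3) (exp (- s) * integral\<^sup>L std_exponential (\<lambda>z. \<bar>z - 1\<bar> ^ 3))"
    by simp
qed

text \<open>Lyapunov's method with one weight and one level per observation. Each factor differs
  from its Gaussian counterpart by a third-moment term and by the square of its variance, the latter
  from replacing 1 - y by exp (- y). Products of numbers in the unit disc differ by at most the sum
  of the factor differences, and the hypotheses \<open>v3\<close> and \<open>v4\<close> make both
  error sums vanish.\<close>

lemma (in exponential_sample) score_sum_char:
  fixes J :: "nat \<Rightarrow> 'i set" and a s :: "nat \<Rightarrow> 'i \<Rightarrow> real" and v t :: real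
  assumes J: "\<And>n. finite (J n)" and s: "\<And>n i. 0 \<le> s n i"
    and v: "(\<lambda>n. \<Sum>i\<in>J n. (a n i)\<^sup>2 * exp (- s n i)) \<longlonglongrightarrow> v"
    and v3: "(\<lambda>n. \<Sum>i\<in>J n. \<bar>a n i\<bar> ^ 3 * exp (- s n i)) \<longlonglongrightarrow> 0"
    and v4: "(\<lambda>n. \<Sum>i\<in>J n. ((a n i)\<^sup>2 * exp (- s n i))\<^sup>2) \<longlonglongrightarrow> 0"
  shows "(\<lambda>n. char (distr M borel (\<lambda>w. \<Sum>i\<in>J n. a n i * score (s n i) (E i w))) t) \<longlonglongrightarrow> of_real (exp (- (v * t\<^sup>2 / 2)))"
proof -
  define Y where "Y n i w = a n i * score (s n i) (E i w)" for n i w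
  define \<sigma> where "\<sigma> n i = (a n i)\<^sup>2 * exp (- s n i)" for n i
  define K where "K = integral\<^sup>L std_exponential (\<lambda>z. \<bar>z - 1\<bar> ^ 3)"
  have [measurable]: "Y n i \<in> borel_measurable M" for n i unfolding Y_def by measurable
  have Y1: "has_bochner_integral M (Y n i) 0" for n i
    using has_bochner_integral_mult_right[OF has_bochner_integral_E[OF score_moments(1)[OF s]], of "a n i" n i i]
    by (simp add: Y_def[abs_def])
  have Y2: "has_bochner_integral M (\<lambda>w. (Y n i w)\<^sup>2) (\<sigma> n i)" for n i
    using has_bochner_integral_mult_right[OF has_bochner_integral_E[OF score_moments(2)[OF s]], of "(a n i)\<^sup>2" n i i]
    by (simp add: Y_def \<sigma>_def power_mult_distrib)
  have Y3: "has_bochner_integral M (\<lambda>w. \<bar>Y n i w\<bar> ^ 3) (\<bar>a n i\<bar> ^ 3 * exp (- s n i) * K)" for n i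
    using has_bochner_integral_mult_right[OF has_bochner_integral_E[OF score_moments(3)[OF s]], of "\<bar>a n i\<bar> ^ 3" n i i]
    by (simp add: Y_def K_def power_mult_distrib abs_mult mult.assoc)
  have indep: "indep_vars (\<lambda>_. borel) (Y n) (J n)" for n
    unfolding Y_def by (rule indep_vars_compose2[OF indep_vars_subset[OF indep_E]]) auto
  have \<sigma>_nonneg: "0 \<le> \<sigma> n i" for n i by (simp add: \<sigma>_def)
  have each: "cmod (char (distr M borel (Y n i)) t - of_real (exp (- (\<sigma> n i * t\<^sup>2 / 2)))) \<le>
      (\<bar>t\<bar> ^ 3 / 6 * K) * (\<bar>a n i\<bar> ^ 3 * exp (- s n i)) + (t\<^sup>2 / 2)\<^sup>2 * (\<sigma> n i)\<^sup>2" for n i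
  proof -
    have var: "variance (Y n i) = \<sigma> n i" using Y1[of n i] Y2[of n i] by (simp add: has_bochner_integral_iff)
    have "cmod (char (distr M borel (Y n i)) t - (1 - t\<^sup>2 * \<sigma> n i / 2)) \<le>
       (t\<^sup>2 / 6) * expectation (\<lambda>w. min (6 * (Y n i w)\<^sup>2) (\<bar>t\<bar> * \<bar>Y n i w\<bar> ^ 3))"
      using Y1[of n i] Y2[of n i] by (intro char_approx3' var) (auto simp: has_bochner_integral_iff)
    also have "\<dots> \<le> (t\<^sup>2 / 6) * (\<bar>t\<bar> * (\<bar>a n i\<bar> ^ 3 * exp (- s n i) * K))"
    proof (rule mult_left_mono)
      have int3: "has_bochner_integral M (\<lambda>w. \<bar>t\<bar> * \<bar>Y n i w\<bar> ^ 3) (\<bar>t\<bar> * (\<bar>a n i\<bar> ^ 3 * exp (- s n i) * K))"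
        by (rule has_bochner_integral_mult_right[OF Y3])
      have "expectation (\<lambda>w. min (6 * (Y n i w)\<^sup>2) (\<bar>t\<bar> * \<bar>Y n i w\<bar> ^ 3)) \<le> expectation (\<lambda>w. \<bar>t\<bar> * \<bar>Y n i w\<bar> ^ 3)"
      proof (rule integral_mono)
        show "integrable M (\<lambda>w. \<bar>t\<bar> * \<bar>Y n i w\<bar> ^ 3)" using int3 by (simp add: has_bochner_integral_iff)
        then show "integrable M (\<lambda>w. min (6 * (Y n i w)\<^sup>2) (\<bar>t\<bar> * \<bar>Y n i w\<bar> ^ 3))"
          by (rule Bochner_Integration.integrable_bound) (auto intro!: AE_I2)
      qed simp
      also have "\<dots> = \<bar>t\<bar> * (\<bar>a n i\<bar> ^ 3 * exp (- s n i) * K)"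
        by (rule has_bochner_integral_integral_eq[OF int3])
      finally show "expectation (\<lambda>w. min (6 * (Y n i w)\<^sup>2) (\<bar>t\<bar> * \<bar>Y n i w\<bar> ^ 3)) \<le> \<bar>t\<bar> * (\<bar>a n i\<bar> ^ 3 * exp (- s n i) * K)" .
    qed simp
    also have "\<dots> = (\<bar>t\<bar> ^ 3 / 6 * K) * (\<bar>a n i\<bar> ^ 3 * exp (- s n i))"
      by (simp add: power2_eq_square power3_eq_cube abs_mult[symmetric] mult_ac)
    finally have 1: "cmod (char (distr M borel (Y n i)) t - (1 - t\<^sup>2 * \<sigma> n i / 2)) \<le>
       (\<bar>t\<bar> ^ 3 / 6 * K) * (\<bar>a n i\<bar> ^ 3 * exp (- s n i))" .
    define y where "y = \<sigma> n i * t\<^sup>2 / 2"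
    have "\<bar>exp (- y) - (1 - y)\<bar> \<le> y\<^sup>2" by (rule exp_minus_quadratic_bound) (simp add: y_def \<sigma>_nonneg)
    then have "cmod (of_real (exp (- y) - (1 - y))) \<le> y\<^sup>2" unfolding norm_of_real .
    then have 2: "cmod (of_real (exp (- y)) - (1 - t\<^sup>2 * \<sigma> n i / 2)) \<le> (t\<^sup>2 / 2)\<^sup>2 * (\<sigma> n i)\<^sup>2"
      by (simp add: y_def power_mult_distrib power_divide mult_ac)
    have "char (distr M borel (Y n i)) t - of_real (exp (- y)) =
       (char (distr M borel (Y n i)) t - (1 - t\<^sup>2 * \<sigma> n i / 2)) - (of_real (exp (- y)) - (1 - t\<^sup>2 * \<sigma> n i / 2))" by simp
    also have "cmod \<dots> \<le> (\<bar>t\<bar> ^ 3 / 6 * K) * (\<bar>a n i\<bar> ^ 3 * exp (- s n i)) + (t\<^sup>2 / 2)\<^sup>2 * (\<sigma> n i)\<^sup>2"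
      by (rule order_trans[OF norm_triangle_ineq4 add_mono[OF 1 2]])
    finally show ?thesis unfolding y_def .
  qed
  have "(\<lambda>n. char (distr M borel (\<lambda>w. \<Sum>i\<in>J n. Y n i w)) t - of_real (exp (- ((\<Sum>i\<in>J n. \<sigma> n i) * t\<^sup>2 / 2)))) \<longlonglongrightarrow> 0"
  proof (rule Lim_null_comparison)
    have "(\<lambda>n. (\<bar>t\<bar> ^ 3 / 6 * K) * (\<Sum>i\<in>J n. \<bar>a n i\<bar> ^ 3 * exp (- s n i)) + (t\<^sup>2 / 2)\<^sup>2 * (\<Sum>i\<in>J n. (\<sigma> n i)\<^sup>2)) \<longlonglongrightarrow>
       (\<bar>t\<bar> ^ 3 / 6 * K) * 0 + (t\<^sup>2 / 2)\<^sup>2 * 0"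
      unfolding \<sigma>_def by (intro tendsto_add tendsto_mult tendsto_const v3 v4)
    then show "(\<lambda>n. (\<bar>t\<bar> ^ 3 / 6 * K) * (\<Sum>i\<in>J n. \<bar>a n i\<bar> ^ 3 * exp (- s n i)) + (t\<^sup>2 / 2)\<^sup>2 * (\<Sum>i\<in>J n. (\<sigma> n i)\<^sup>2)) \<longlonglongrightarrow> 0"
      by simp
    show "\<forall>\<^sub>F n in sequentially. norm (char (distr M borel (\<lambda>w. \<Sum>i\<in>J n. Y n i w)) t - of_real (exp (- ((\<Sum>i\<in>J n. \<sigma> n i) * t\<^sup>2 / 2)))) \<le>
       (\<bar>t\<bar> ^ 3 / 6 * K) * (\<Sum>i\<in>J n. \<bar>a n i\<bar> ^ 3 * exp (- s n i)) + (t\<^sup>2 / 2)\<^sup>2 * (\<Sum>i\<in>J n. (\<sigma> n i)\<^sup>2)"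
    proof (rule always_eventually, rule allI)
      fix n
      have c: "char (distr M borel (\<lambda>w. \<Sum>i\<in>J n. Y n i w)) t = (\<Prod>i\<in>J n. char (distr M borel (Y n i)) t)"
        by (rule char_distr_sum[OF indep])
      have e: "complex_of_real (exp (- ((\<Sum>i\<in>J n. \<sigma> n i) * t\<^sup>2 / 2))) = (\<Prod>i\<in>J n. of_real (exp (- (\<sigma> n i * t\<^sup>2 / 2))))"
        using J[of n] by (simp add: exp_sum[symmetric] sum_distrib_right sum_divide_distrib sum_negf flip: of_real_prod)
      have "norm ((\<Prod>i\<in>J n. char (distr M borel (Y n i)) t) - (\<Prod>i\<in>J n. complex_of_real (exp (- (\<sigma> n i * t\<^sup>2 / 2)))))
        \<le> (\<Sum>i\<in>J n. norm (char (distr M borel (Y n i)) t - of_real (exp (- (\<sigma> n i * t\<^sup>2 / 2)))))"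
      proof (rule norm_prod_diff)
        fix i
        interpret Yd: real_distribution "distr M borel (Y n i)" by (rule real_distribution_distr) simp
        show "norm (char (distr M borel (Y n i)) t) \<le> 1" by (rule Yd.cmod_char_le_1)
        show "norm (complex_of_real (exp (- (\<sigma> n i * t\<^sup>2 / 2)))) \<le> 1" using \<sigma>_nonneg[of n i] by simp
      qed
      also have "\<dots> \<le> (\<Sum>i\<in>J n. (\<bar>t\<bar> ^ 3 / 6 * K) * (\<bar>a n i\<bar> ^ 3 * exp (- s n i)) + (t\<^sup>2 / 2)\<^sup>2 * (\<sigma> n i)\<^sup>2)"
        by (intro sum_mono each)
      also have "\<dots> = (\<bar>t\<bar> ^ 3 / 6 * K) * (\<Sum>i\<in>J n. \<bar>a n i\<bar> ^ 3 * exp (- s n i)) + (t\<^sup>2 / 2)\<^sup>2 * (\<Sum>i\<in>J n. (\<sigma> n i)\<^sup>2)"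
        by (simp only: sum.distrib sum_distrib_left)
      finally show "norm (char (distr M borel (\<lambda>w. \<Sum>i\<in>J n. Y n i w)) t - of_real (exp (- ((\<Sum>i\<in>J n. \<sigma> n i) * t\<^sup>2 / 2)))) \<le>
       (\<bar>t\<bar> ^ 3 / 6 * K) * (\<Sum>i\<in>J n. \<bar>a n i\<bar> ^ 3 * exp (- s n i)) + (t\<^sup>2 / 2)\<^sup>2 * (\<Sum>i\<in>J n. (\<sigma> n i)\<^sup>2)"
        unfolding c e .
    qed
  qed
  moreover have "(\<lambda>n. complex_of_real (exp (- ((\<Sum>i\<in>J n. \<sigma> n i) * t\<^sup>2 / 2)))) \<longlonglongrightarrow> of_real (exp (- (v * t\<^sup>2 / 2)))"
    unfolding \<sigma>_def by (intro tendsto_intros v) simp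
  ultimately have "(\<lambda>n. char (distr M borel (\<lambda>w. \<Sum>i\<in>J n. Y n i w)) t - of_real (exp (- ((\<Sum>i\<in>J n. \<sigma> n i) * t\<^sup>2 / 2)))
     + of_real (exp (- ((\<Sum>i\<in>J n. \<sigma> n i) * t\<^sup>2 / 2)))) \<longlonglongrightarrow> 0 + of_real (exp (- (v * t\<^sup>2 / 2)))"
    by (rule tendsto_add)
  then show ?thesis by (simp add: Y_def)
qed

text \<open>For s \<le> s' the score at s' is zero up to s' and afterwards differs from the score at
  s by the constant s' - s. So the squared difference is a linear combination of the two squares and
  one centred score, and no mixed moment has to be integrated.\<close>

lemma score_diff_second_moment:
  assumes s: "0 \<le> s" "0 \<le> s'"
  shows "has_bochner_integral std_exponential (\<lambda>y. (score s y - score s' y)\<^sup>2) \<bar>exp (- s) - exp (- s')\<bar>"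
proof -
  have *: "has_bochner_integral std_exponential (\<lambda>y. (score s y - score s' y)\<^sup>2) (exp (- s) - exp (- s'))"
    if "0 \<le> s" "s \<le> s'" for s s'
  proof -
    have "has_bochner_integral std_exponential (\<lambda>y. ((score s y)\<^sup>2 - (score s' y)\<^sup>2) - 2 * (s' - s) * score s' y)
        ((exp (- s) - exp (- s')) - 2 * (s' - s) * 0)"
      using that by (intro has_bochner_integral_diff has_bochner_integral_mult_right score_moments) auto
    moreover have "((score s y)\<^sup>2 - (score s' y)\<^sup>2) - 2 * (s' - s) * score s' y = (score s y - score s' y)\<^sup>2" for y
      using that by (auto simp: score_def power2_eq_square algebra_simps)
    ultimately show ?thesis by simp
  qed
  show ?thesis
  proof (cases "s \<le> s'")
    case True
    then show ?thesis using *[OF s(1) True] by simp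
  next
    case False
    then show ?thesis using *[of s' s] s by (simp add: power2_commute)
  qed
qed

section \<open>Gaussian limits and the delta method\<close>

lemma normal_distr_char:
  assumes v: "v > 0"
  shows "real_distribution (normal_distr m v)"
    and "char (normal_distr m v) t = iexp (t * m) * of_real (exp (- (v * t\<^sup>2 / 2)))"
proof -
  interpret N: prob_space "normal_distr m v"
    unfolding normal_distr_def using v by (intro prob_space_normal_density) simp
  show "real_distribution (normal_distr m v)"
    unfolding real_distribution_def real_distribution_axioms_def
    by (intro conjI N.prob_space_axioms) (auto simp: normal_distr_def)
  interpret S: real_distribution std_normal_distribution by (rule real_dist_normal_dist)
  have "distributed std_normal_distribution lborel (\<lambda>x. x) std_normal_density"
    by (simp add: distributed_def distr_id2)
  then have "distributed std_normal_distribution lborel (\<lambda>x. m + sqrt v * x) (normal_density (m + sqrt v * 0) (\<bar>sqrt v\<bar> * 1))"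
    using v by (intro S.normal_density_affine) auto
  then have eq: "distr std_normal_distribution lborel (\<lambda>x. m + sqrt v * x) = normal_distr m v"
    using v by (simp add: distributed_def normal_distr_def)
  have "char (normal_distr m v) t = (CLINT x|std_normal_distribution. iexp (t * (m + sqrt v * x)))"
    unfolding eq[symmetric] char_def by (subst integral_distr) auto
  also have "\<dots> = (CLINT x|std_normal_distribution. iexp (t * m) * iexp ((t * sqrt v) * x))"
    by (intro Bochner_Integration.integral_cong refl) (simp add: exp_add[symmetric] algebra_simps)
  also have "\<dots> = iexp (t * m) * char std_normal_distribution (t * sqrt v)"
    by (simp add: char_def)
  also have "\<dots> = iexp (t * m) * of_real (exp (- (v * t\<^sup>2 / 2)))"
    using v by (simp add: char_std_normal_distribution power_mult_distrib mult.commute)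
  finally show "char (normal_distr m v) t = iexp (t * m) * of_real (exp (- (v * t\<^sup>2 / 2)))" .
qed

context prob_space
begin

text \<open>The approximating \<open>S\<close> is centred and the whole bias sits in the limit
  \<open>m\<close> of the difference, so a centred characteristic-function limit followed by Levy
  continuity suffices.\<close>

lemma tendsto_in_distr_normal:
  fixes S Y :: "nat \<Rightarrow> 'a \<Rightarrow> real"
  assumes [measurable]: "\<And>n. S n \<in> borel_measurable M" "\<And>n. Y n \<in> borel_measurable M"
    and v: "v > 0"
    and char_S: "\<And>t. (\<lambda>n. char (distr M borel (S n)) t) \<longlonglongrightarrow> of_real (exp (- (v * t\<^sup>2 / 2)))"
    and diff: "((\<lambda>z. Y (fst z) (snd z) - S (fst z) (snd z)) \<longlongrightarrow> m) (prob_filter M)"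
  shows "tendsto_in_distr M Y (normal_distr m v)"
  unfolding tendsto_in_distr_def
proof (intro conjI allI)
  show "weak_conv_m (\<lambda>n. distr M borel (Y n)) (normal_distr m v)"
  proof (rule levy_continuity)
    fix t
    have "(\<lambda>n. char (distr M borel (Y n)) t) \<longlonglongrightarrow> iexp (t * m) * of_real (exp (- (v * t\<^sup>2 / 2)))"
    proof (rule char_limit_perturb)
      have "char (distr M borel (\<lambda>w. S n w + m)) t = iexp (t * m) * char (distr M borel (S n)) t" for n
      proof -
        have "char (distr M borel (\<lambda>w. S n w + m)) t = (CLINT w|M. iexp (t * (S n w + m)))"
          by (simp add: char_def integral_distr)
        also have "\<dots> = (CLINT w|M. iexp (t * m) * iexp (t * S n w))"
          by (intro Bochner_Integration.integral_cong refl) (simp add: exp_add[symmetric] algebra_simps)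
        also have "\<dots> = iexp (t * m) * (CLINT w|M. iexp (t * S n w))" by simp
        finally show ?thesis by (simp add: char_def integral_distr)
      qed
      then show "(\<lambda>n. char (distr M borel (\<lambda>w. S n w + m)) t) \<longlonglongrightarrow> iexp (t * m) * of_real (exp (- (v * t\<^sup>2 / 2)))"
        by (simp only:) (intro tendsto_mult tendsto_const char_S)
      show "((\<lambda>z. Y (fst z) (snd z) - (S (fst z) (snd z) + m)) \<longlongrightarrow> 0) (prob_filter M)"
        using tendsto_diff[OF diff tendsto_const[of m]] by (simp add: diff_diff_eq)
    qed auto
    then show "(\<lambda>n. char (distr M borel (Y n)) t) \<longlonglongrightarrow> char (normal_distr m v) t"
      by (simp only: normal_distr_char[OF v])
  qed (auto intro!: real_distribution_distr normal_distr_char v)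
qed simp

text \<open>Tightness of r Y with r tending to infinity forces Y to 0, where exp Y - 1 - Y is at
  most Y^2 in absolute value; multiplied by r this is (r Y)^2 / r.\<close>

lemma delta_method_exp:
  fixes r :: "nat \<Rightarrow> real" and Y V :: "nat \<times> 'a \<Rightarrow> real"
  assumes r: "filterlim r at_top sequentially" and V: "bounded_in_prob V"
    and lim: "((\<lambda>z. r (fst z) * Y z - V z) \<longlongrightarrow> 0) (prob_filter M)"
  shows "((\<lambda>z. r (fst z) * (exp (Y z) - 1) - V z) \<longlongrightarrow> 0) (prob_filter M)"
proof -
  have r0: "((\<lambda>z. 1 / r (fst z)) \<longlongrightarrow> 0) (prob_filter M)"
    using filterlim_fst_compose[OF tendsto_inverse_0_at_top[OF r]] by (simp add: inverse_eq_divide)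
  have "\<forall>\<^sub>F n in sequentially. 0 < r n" using r by (simp add: filterlim_at_top_dense)
  then have rpos: "\<forall>\<^sub>F z in prob_filter M. 0 < r (fst z)" by (rule eventually_fst_prob_filter)
  have "bounded_in_prob (\<lambda>z. (r (fst z) * Y z - V z) + V z)"
    by (rule bounded_in_prob_add[OF bounded_in_prob_tendsto[OF lim] V])
  then have B: "bounded_in_prob (\<lambda>z. r (fst z) * Y z)" by simp
  have "((\<lambda>z. 1 / r (fst z) * (r (fst z) * Y z)) \<longlongrightarrow> 0) (prob_filter M)"
    by (rule tendsto_0_mult_bounded_in_prob[OF r0 B])
  then have "(Y \<longlongrightarrow> 0) (prob_filter M)"
    by (rule Lim_transform_eventually) (use rpos in eventually_elim, simp)
  then have Y1: "\<forall>\<^sub>F z in prob_filter M. dist (Y z) 0 < 1" by (rule tendstoD) simp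
  have "((\<lambda>z. 1 / r (fst z) * ((r (fst z) * Y z) * (r (fst z) * Y z))) \<longlongrightarrow> 0) (prob_filter M)"
    by (rule tendsto_0_mult_bounded_in_prob[OF r0 bounded_in_prob_mult[OF B B]])
  moreover have "\<forall>\<^sub>F z in prob_filter M. norm (r (fst z) * (exp (Y z) - 1 - Y z)) \<le> 1 / r (fst z) * ((r (fst z) * Y z) * (r (fst z) * Y z))"
    using rpos Y1
  proof eventually_elim
    case (elim z)
    have "\<bar>exp (Y z) - 1 - Y z\<bar> \<le> (Y z)\<^sup>2"
    proof (cases "0 \<le> Y z")
      case True
      then have "exp (Y z) \<le> 1 + Y z + (Y z)\<^sup>2" using elim(2) by (intro exp_bound) (auto simp: dist_real_def)
      moreover have "1 + Y z \<le> exp (Y z)" "0 \<le> (Y z)\<^sup>2" by (auto simp: exp_ge_add_one_self)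
      ultimately show ?thesis by linarith
    next
      case False
      then show ?thesis using exp_minus_quadratic_bound[of "- Y z"] by (simp add: diff_diff_eq)
    qed
    then have "norm (r (fst z) * (exp (Y z) - 1 - Y z)) \<le> r (fst z) * (Y z)\<^sup>2"
      using elim(1) by (simp add: abs_mult)
    also have "\<dots> = 1 / r (fst z) * ((r (fst z) * Y z) * (r (fst z) * Y z))"
      using elim(1) by (simp add: power2_eq_square)
    finally show ?case .
  qed
  ultimately have "((\<lambda>z. r (fst z) * (exp (Y z) - 1 - Y z)) \<longlongrightarrow> 0) (prob_filter M)"
    by (rule Lim_null_comparison[rotated])
  from tendsto_add[OF this lim]
  show ?thesis by (simp add: algebra_simps)
qed

end

section \<open>Pooling subsamples\<close>

text \<open>\<open>f0\<close> and \<open>g\<close> stand for the outcome of the second-order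
  expansion. \<open>k\<close>, \<open>rate\<close> and \<open>d\<close> are parameters tied by
  equations, so that the facts proved here match the abbreviations of the final statement.\<close>

locale pooled_samples = prob_space M for M :: "'a measure" +
  fixes X :: "'m::finite \<Rightarrow> nat \<Rightarrow> 'a \<Rightarrow> real" and D :: "real measure" and \<gamma> \<rho> lam :: real
    and A :: "real \<Rightarrow> real" and ns ks :: "nat \<Rightarrow> 'm \<Rightarrow> nat" and first :: 'm and b c :: "real^'m"
    and p :: "nat \<Rightarrow> real" and f0 :: real and g :: "real \<Rightarrow> real"
    and k :: "nat \<Rightarrow> nat" and rate :: "nat \<Rightarrow> real" and d :: "real^'m"
  assumes indep: "indep_vars (\<lambda>_. borel) (\<lambda>(j, i). X j i) UNIV"
    and ident: "\<And>j i. distr M borel (X j i) = D"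
    and F_cont: "continuous_on UNIV (cdf D)"
    and \<rho>_neg: "\<rho> < 0" and \<gamma>_pos: "\<gamma> > 0"
    and n_total: "\<And>n. (\<Sum>j\<in>UNIV. ns n j) = n"
    and k_ge_1: "\<And>n j. ks n j \<ge> 1"
    and b_pos: "\<And>j. b $ j > 0" and c_pos: "\<And>j. c $ j > 0"
    and n_ratio: "\<And>j. (\<lambda>n. real (ns n first) / real (ns n j)) \<longlonglongrightarrow> b $ j"
    and k_ratio: "\<And>j. (\<lambda>n. real (ks n first) / real (ks n j)) \<longlonglongrightarrow> c $ j"
    and k_inf: "filterlim k at_top sequentially"
    and k_n: "(\<lambda>n. real (k n) / real n) \<longlonglongrightarrow> 0"
    and bias: "(\<lambda>n. sqrt (real (k n)) * A (real n / real (k n))) \<longlonglongrightarrow> lam"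
    and p_range: "\<And>n. 0 < p n \<and> p n < 1"
    and knp: "filterlim (\<lambda>n. real (k n) / (real n * p n)) at_top sequentially"
    and rate_inf: "filterlim rate at_top sequentially"
    and g_rv: "regularly_varying g \<rho>"
    and Q_tail: "\<forall>\<^sub>F s in at_top. 0 < quantile (cdf D) (1 - exp (- s)) \<and>
           ln (quantile (cdf D) (1 - exp (- s))) = f0 + \<gamma> * s - g s"
    and g_A: "((\<lambda>s. g s / A (exp s)) \<longlongrightarrow> - 1 / \<rho>) at_top"
    and k_def: "k = (\<lambda>n. \<Sum>j\<in>UNIV. ks n j)"
    and rate_def: "rate = (\<lambda>n. sqrt (real (k n)) / ln (real (k n) / (real n * p n)))"
    and d_def: "d = (\<chi> j. (c $ j / b $ j) * ((\<Sum>i\<in>UNIV. 1 / c $ i) / (\<Sum>i\<in>UNIV. 1 / b $ i)))"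
begin

definition S0 :: real where "S0 = (\<Sum>i\<in>UNIV. 1 / c $ i)"
definition XX :: "'m \<times> nat \<Rightarrow> 'a \<Rightarrow> real" where "XX i = X (fst i) (snd i)"
definition E :: "'m \<times> nat \<Rightarrow> 'a \<Rightarrow> real" where "E i w = - ln (1 - cdf D (XX i w))"
definition Q :: "real \<Rightarrow> real" where "Q s = quantile (cdf D) (1 - exp (- s))"
definition L :: "nat \<Rightarrow> real" where "L n = ln (real n / real (k n))"
text \<open>Subsamples and combined sample are index sets in one product, so that all estimators are
  functions of the single family \<open>E\<close> and can be compared pathwise.\<close>

definition sub :: "'m \<Rightarrow> nat \<Rightarrow> ('m \<times> nat) set" where "sub j n = {j} \<times> {..<ns n j}"
definition all :: "nat \<Rightarrow> ('m \<times> nat) set" where "all n = (SIGMA j:UNIV. {..<ns n j})"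

lemma S0_pos: "S0 > 0"
  unfolding S0_def using c_pos by (intro sum_pos) auto

lemma B0_pos: "(\<Sum>i\<in>UNIV. 1 / b $ i) > 0"
  using b_pos by (intro sum_pos) auto

lemma d_pos: "d $ j > 0"
  unfolding d_def using b_pos c_pos S0_pos B0_pos by (simp add: S0_def)

lemma X_measurable [measurable]: "X j i \<in> borel_measurable M"
proof -
  have "(case (j, i) of (j, i) \<Rightarrow> X j i) \<in> borel_measurable M"
    using indep unfolding indep_vars_def2 by (elim conjE) (erule bspec, simp)
  then show ?thesis by simp
qed

lemma card_sub: "finite (sub j n)" "card (sub j n) = ns n j"
  by (auto simp: sub_def card_cartesian_product)

lemma card_all: "finite (all n)" "card (all n) = n"
  using n_total[of n] by (auto simp: all_def)

lemma sum_all: "(\<Sum>i\<in>all n. f i) = (\<Sum>j\<in>UNIV. \<Sum>i\<in>sub j n. f i)"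
proof -
  have "(\<Sum>i\<in>all n. f i) = (\<Sum>j\<in>UNIV. \<Sum>i<ns n j. f (j, i))"
    by (simp add: all_def sum.Sigma)
  also have "\<dots> = (\<Sum>j\<in>UNIV. \<Sum>i\<in>sub j n. f i)"
    by (intro sum.cong refl) (simp add: sub_def sum.cartesian_product' )
  finally show ?thesis .
qed

lemma k_pos: "0 < k n"
  unfolding k_def using k_ge_1 by (intro sum_pos) (auto simp: Suc_le_eq)

lemma ks_share: "(\<lambda>n. real (ks n j) / real (k n)) \<longlonglongrightarrow> 1 / (c $ j * S0)"
proof -
  have inv: "(\<lambda>n. real (ks n i) / real (ks n first)) \<longlonglongrightarrow> 1 / c $ i" for i
    using tendsto_inverse[OF k_ratio[of i]] c_pos[of i] by (simp add: inverse_eq_divide)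
  have "(\<lambda>n. \<Sum>i\<in>UNIV. real (ks n i) / real (ks n first)) \<longlonglongrightarrow> S0"
    unfolding S0_def by (intro tendsto_sum inv)
  then have "(\<lambda>n. (real (ks n j) / real (ks n first)) / (\<Sum>i\<in>UNIV. real (ks n i) / real (ks n first))) \<longlonglongrightarrow> (1 / c $ j) / S0"
    using S0_pos by (intro tendsto_divide inv) auto
  moreover have "(real (ks n j) / real (ks n first)) / (\<Sum>i\<in>UNIV. real (ks n i) / real (ks n first)) = real (ks n j) / real (k n)" for n
    using k_ge_1[of n first] by (simp add: k_def sum_divide_distrib[symmetric])
  ultimately have "(\<lambda>n. real (ks n j) / real (k n)) \<longlonglongrightarrow> (1 / c $ j) / S0" by (simp only:)
  then show ?thesis by simp
qed

lemma ns_pos: "\<forall>\<^sub>F n in sequentially. 0 < ns n j"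
proof -
  \<comment> \<open>Division by 0 gives 0, so a quotient with positive limit eventually has a
    nonzero denominator.\<close>
  have "\<forall>\<^sub>F n in sequentially. real (ns n first) / real (ns n j) \<noteq> 0"
    using b_pos[of j] by (intro tendsto_imp_eventually_ne[OF n_ratio]) auto
  then show ?thesis by eventually_elim auto
qed

lemma ns_share: "(\<lambda>n. real (ns n j) / real n) \<longlonglongrightarrow> (1 / b $ j) / (\<Sum>i\<in>UNIV. 1 / b $ i)"
proof -
  have inv: "(\<lambda>n. real (ns n i) / real (ns n first)) \<longlonglongrightarrow> 1 / b $ i" for i
    using tendsto_inverse[OF n_ratio[of i]] b_pos[of i] by (simp add: inverse_eq_divide)
  have "(\<lambda>n. (real (ns n j) / real (ns n first)) / (\<Sum>i\<in>UNIV. real (ns n i) / real (ns n first))) \<longlonglongrightarrow> (1 / b $ j) / (\<Sum>i\<in>UNIV. 1 / b $ i)"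
    using B0_pos by (intro tendsto_divide inv tendsto_sum) auto
  then show ?thesis
  proof (rule Lim_transform_eventually)
    show "\<forall>\<^sub>F n in sequentially. (real (ns n j) / real (ns n first)) / (\<Sum>i\<in>UNIV. real (ns n i) / real (ns n first)) = real (ns n j) / real n"
      using ns_pos[of first]
    proof eventually_elim
      case (elim n)
      have "(\<Sum>i\<in>UNIV. real (ns n i)) = real n" using n_total[of n] by (metis of_nat_sum)
      then show ?case using elim by (simp add: sum_divide_distrib[symmetric])
    qed
  qed
qed

lemma n_pos: "\<forall>\<^sub>F n in sequentially. 0 < n" by (rule eventually_gt_at_top)

lemma n_over_k: "filterlim (\<lambda>n. real n / real (k n)) at_top sequentially"
proof -
  have "\<forall>\<^sub>F n in sequentially. 0 < real (k n) / real n" using n_pos by eventually_elim (simp add: k_pos)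
  with k_n have "filterlim (\<lambda>n. inverse (real (k n) / real n)) at_top sequentially"
    by (rule filterlim_inverse_at_top)
  then show ?thesis by simp
qed

lemma real_k_inf: "filterlim (\<lambda>n. real (k n)) at_top sequentially"
  by (rule filterlim_compose[OF filterlim_real_sequentially k_inf])

lemma L_inf: "filterlim L at_top sequentially"
  unfolding L_def by (rule filterlim_compose[OF ln_at_top n_over_k])

text \<open>The meaning of d_j: the limiting ratio between the inverse tail fraction of a subsample
  and that of the combined sample.\<close>

lemma relative_ratio: "(\<lambda>n. (real (ns n j) / real (ks n j)) / (real n / real (k n))) \<longlonglongrightarrow> d $ j"
proof -
  have "(\<lambda>n. (real (ns n j) / real n) / (real (ks n j) / real (k n))) \<longlonglongrightarrow> ((1 / b $ j) / (\<Sum>i\<in>UNIV. 1 / b $ i)) / (1 / (c $ j * S0))"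
    using c_pos[of j] S0_pos by (intro tendsto_divide ns_share ks_share) auto
  also have "((1 / b $ j) / (\<Sum>i\<in>UNIV. 1 / b $ i)) / (1 / (c $ j * S0)) = d $ j"
    by (simp add: d_def S0_def)
  finally show ?thesis by (simp add: divide_divide_eq_left divide_divide_eq_right mult_ac)
qed

lemma ks_inf: "filterlim (\<lambda>n. ks n j) at_top sequentially"
proof -
  have "filterlim (\<lambda>n. real (ks n j) / real (k n) * real (k n)) at_top sequentially"
    using c_pos[of j] S0_pos by (intro filterlim_tendsto_pos_mult_at_top[OF ks_share _ real_k_inf]) auto
  moreover have "real (ks n j) / real (k n) * real (k n) = real (ks n j)" for n using k_pos[of n] by simp
  ultimately have "filterlim (\<lambda>n. real (ks n j)) at_top sequentially" by simp
  then show ?thesis by (simp add: filterlim_sequentially_iff_filterlim_real)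
qed

lemma ns_over_ks: "filterlim (\<lambda>n. real (ns n j) / real (ks n j)) at_top sequentially"
proof -
  have "filterlim (\<lambda>n. ((real (ns n j) / real (ks n j)) / (real n / real (k n))) * (real n / real (k n))) at_top sequentially"
    by (rule filterlim_tendsto_pos_mult_at_top[OF relative_ratio d_pos n_over_k])
  moreover have "\<forall>\<^sub>F n in sequentially. ((real (ns n j) / real (ks n j)) / (real n / real (k n))) * (real n / real (k n)) = real (ns n j) / real (ks n j)"
    using n_pos by eventually_elim (simp add: k_pos)
  ultimately show ?thesis by (simp cong: filterlim_cong)
qed

lemma exponential_sample_E: "exponential_sample M E"
proof
  have E_eq: "E i = (\<lambda>w. - ln (1 - cdf D ((case i of (j, i) \<Rightarrow> X j i) w)))" for i
    by (simp add: E_def XX_def case_prod_beta fun_eq_iff)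
  interpret D: real_distribution D unfolding ident[of undefined undefined, symmetric] by (rule real_distribution_distr) simp
  have [measurable]: "cdf D \<in> borel_measurable borel" by (rule D.cdf_borel[OF F_cont])
  show "indep_vars (\<lambda>_. borel) E UNIV"
    unfolding E_eq by (rule indep_vars_compose2[OF indep]) measurable
  show "distributed M lborel (E i) (exponential_density 1)" for i
    using exponential_representation(1)[OF X_measurable ident F_cont, of "fst i" "snd i"]
    by (simp add: E_def[abs_def] XX_def)
qed

lemma XX_eq: "AE w in M. \<forall>i. 0 < E i w \<and> Q (E i w) = XX i w"
  using exponential_representation(2)[OF X_measurable ident F_cont]
  by (subst AE_all_countable) (auto simp: E_def XX_def Q_def)

lemma Q_mono: "mono_on {0<..} Q"
proof -
  interpret D: real_distribution D unfolding ident[of undefined undefined, symmetric] by (rule real_distribution_distr) simp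
  show ?thesis unfolding Q_def by (rule D.quantile_exp_mono[OF F_cont])
qed

sublocale exponential_sample M E by (rule exponential_sample_E)
sublocale regularly_varying g \<rho> by (rule g_rv)

lemma g_bias: "(\<lambda>n. sqrt (real (k n)) * g (L n)) \<longlonglongrightarrow> - lam / \<rho>"
proof -
  have r: "(\<lambda>n. g (L n) / A (exp (L n))) \<longlonglongrightarrow> - 1 / \<rho>" by (rule filterlim_compose[OF g_A L_inf])
  \<comment> \<open>The limit -1 / \<rho> is nonzero, so \<open>A\<close> is eventually nonzero at
    these points and cancels.\<close>
  have nz: "\<forall>\<^sub>F n in sequentially. g (L n) / A (exp (L n)) \<noteq> 0"
    using \<rho>_neg by (intro tendsto_imp_eventually_ne[OF r]) auto
  have "(\<lambda>n. (sqrt (real (k n)) * A (real n / real (k n))) * (g (L n) / A (exp (L n)))) \<longlonglongrightarrow> lam * (- 1 / \<rho>)"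
    by (intro tendsto_mult bias r)
  then have "(\<lambda>n. (sqrt (real (k n)) * A (real n / real (k n))) * (g (L n) / A (exp (L n)))) \<longlonglongrightarrow> - lam / \<rho>" by simp
  then show ?thesis
  proof (rule Lim_transform_eventually)
    show "\<forall>\<^sub>F n in sequentially. (sqrt (real (k n)) * A (real n / real (k n))) * (g (L n) / A (exp (L n))) = sqrt (real (k n)) * g (L n)"
      using nz n_pos by eventually_elim (auto simp: L_def k_pos)
  qed
qed

definition lv :: "'m \<Rightarrow> nat \<Rightarrow> real" where "lv j n = ln (real (ns n j) / real (ks n j))"

lemma lv_diff: "(\<lambda>n. lv j n - L n) \<longlonglongrightarrow> ln (d $ j)"
proof -
  have "(\<lambda>n. ln ((real (ns n j) / real (ks n j)) / (real n / real (k n)))) \<longlonglongrightarrow> ln (d $ j)"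
    using d_pos[of j] by (intro tendsto_ln relative_ratio) auto
  then show ?thesis
  proof (rule Lim_transform_eventually)
    show "\<forall>\<^sub>F n in sequentially. ln ((real (ns n j) / real (ks n j)) / (real n / real (k n))) = lv j n - L n"
      using n_pos ns_pos[of j]
    proof eventually_elim
      case (elim n)
      then show ?case unfolding lv_def L_def using k_pos[of n] k_ge_1[of n j] by (intro ln_divide_pos) auto
    qed
  qed
qed

text \<open>The subsample level differs from \<open>L n\<close> by about ln d_j, and regular
  variation turns this shift into the factor d_j^\<rho>; sqrt (k_j / k) supplies the other
  factor.\<close>

lemma g_bias_sub: "(\<lambda>n. sqrt (real (ks n j)) * g (lv j n)) \<longlonglongrightarrow> sqrt (1 / (c $ j * S0)) * (d $ j powr \<rho>) * (- lam / \<rho>)"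
proof -
  have "(\<lambda>n. g (L n + (lv j n - L n)) / g (L n)) \<longlonglongrightarrow> exp (\<rho> * ln (d $ j))"
    by (rule ratio_tendsto[OF L_inf lv_diff])
  then have r: "(\<lambda>n. g (lv j n) / g (L n)) \<longlonglongrightarrow> d $ j powr \<rho>"
    using d_pos[of j] by (simp add: powr_def)
  have "(\<lambda>n. sqrt (real (ks n j) / real (k n)) * (g (lv j n) / g (L n)) * (sqrt (real (k n)) * g (L n))) \<longlonglongrightarrow>
      sqrt (1 / (c $ j * S0)) * (d $ j powr \<rho>) * (- lam / \<rho>)"
    by (intro tendsto_mult tendsto_real_sqrt ks_share r g_bias)
  then show ?thesis
  proof (rule Lim_transform_eventually)
    show "\<forall>\<^sub>F n in sequentially. sqrt (real (ks n j) / real (k n)) * (g (lv j n) / g (L n)) * (sqrt (real (k n)) * g (L n)) = sqrt (real (ks n j)) * g (lv j n)"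
      using eventually_compose_filterlim[OF g_nonzero L_inf]
      by eventually_elim (use k_pos in \<open>simp add: real_sqrt_divide\<close>)
  qed
qed

sublocale sub: tail_sample M E "sub j" "\<lambda>n. ks n j" g \<rho> Q \<gamma> f0 "sqrt (1 / (c $ j * S0)) * (d $ j powr \<rho>) * (- lam / \<rho>)" XX for j
proof -
  have i: "intermediate_sample M E (sub j) (\<lambda>n. ks n j)"
    by unfold_locales (use card_sub k_ge_1 ks_inf ns_over_ks in auto)
  have lev: "intermediate_sample.lev (sub j) (\<lambda>n. ks n j) n = lv j n" for n
    unfolding intermediate_sample.lev_def[OF i] lv_def card_sub ..
  show "tail_sample M E (sub j) (\<lambda>n. ks n j) g \<rho> Q \<gamma> f0 (sqrt (1 / (c $ j * S0)) * (d $ j powr \<rho>) * (- lam / \<rho>)) XX"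
    by (intro tail_sample.intro i g_rv tail_sample_axioms.intro \<rho>_neg Q_mono XX_eq)
       (use Q_tail g_bias_sub in \<open>simp_all add: Q_def lev\<close>)
qed

sublocale comb: tail_sample M E all k g \<rho> Q \<gamma> f0 "- lam / \<rho>" XX
proof -
  have i: "intermediate_sample M E all k"
    by unfold_locales (use card_all k_pos k_inf n_over_k in \<open>auto simp: Suc_le_eq\<close>)
  have lev: "intermediate_sample.lev all k n = L n" for n
    unfolding intermediate_sample.lev_def[OF i] L_def card_all ..
  show "tail_sample M E all k g \<rho> Q \<gamma> f0 (- lam / \<rho>) XX"
    by (intro tail_sample.intro i g_rv tail_sample_axioms.intro \<rho>_neg Q_mono XX_eq)
       (use Q_tail g_bias in \<open>simp_all add: Q_def lev\<close>)
qed

lemma sub_lev: "sub.lev j n = lv j n" by (simp add: sub.lev_def lv_def card_sub)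
lemma comb_lev: "comb.lev n = L n" by (simp add: comb.lev_def L_def card_all)

end

section \<open>Expansions of the subsample, pooled and combined estimators on the common scale sqrt
  k\<close>

context pooled_samples
begin

text \<open>The limit of sqrt (k / k_j), which converts errors from the scale of a subsample to the
  common one.\<close>

definition \<kappa> :: "'m \<Rightarrow> real" where "\<kappa> j = sqrt (c $ j * S0)"

text \<open>The logarithmic extrapolation distance, eventually equal to the denominator of the
  rate.\<close>

definition gap :: "nat \<Rightarrow> real" where "gap n = - ln (p n) - L n"

definition x :: "'a \<Rightarrow> 'm \<Rightarrow> nat \<Rightarrow> real" where "x w j i = X j i w"

definition sub_hill :: "'m \<Rightarrow> nat \<times> 'a \<Rightarrow> real" where
  "sub_hill j z = hill (sub j (fst z)) (\<lambda>i. XX i (snd z)) (ks (fst z) j)"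

definition comb_hill :: "nat \<times> 'a \<Rightarrow> real" where
  "comb_hill z = hill (all (fst z)) (\<lambda>i. XX i (snd z)) (k (fst z))"

lemma x_eta: "x w j = (\<lambda>i. X j i w)"
  by (simp add: x_def fun_eq_iff)

lemma sub_eq_image: "sub j n = Pair j ` {..<ns n j}"
  by (auto simp: sub_def)

lemma sub_hill_eq: "hill {..<ns n j} (x w j) (ks n j) = sub_hill j (n, w)"
  unfolding sub_hill_def sub_eq_image by (subst hill_reindex) (auto simp: inj_on_def XX_def x_eta)

lemma sub_weissman_eq: "weissman {..<ns n j} (x w j) (ks n j) q = weissman (sub j n) (\<lambda>i. XX i w) (ks n j) q"
  unfolding sub_eq_image by (subst weissman_reindex) (auto simp: inj_on_def XX_def x_eta)

lemma comb_weissman_eq: "combined_weissman (ns n) (x w) (k n) q = weissman (all n) (\<lambda>i. XX i w) (k n) q"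
  by (simp add: combined_weissman_def all_def XX_def x_def case_prod_unfold)

lemma quantile_eq: "quantile (cdf D) (1 - p n) = Q (- ln (p n))"
  using p_range[of n] by (simp add: Q_def)

lemma XX_measurable [measurable]: "XX i \<in> borel_measurable M"
  by (simp add: XX_def)

lemma sqrt_share: "(\<lambda>n. sqrt (real (k n)) / sqrt (real (ks n j))) \<longlonglongrightarrow> \<kappa> j"
proof -
  have "(\<lambda>n. inverse (real (ks n j) / real (k n))) \<longlonglongrightarrow> inverse (1 / (c $ j * S0))"
    using c_pos[of j] S0_pos by (intro tendsto_inverse ks_share) auto
  then have "(\<lambda>n. sqrt (real (k n) / real (ks n j))) \<longlonglongrightarrow> sqrt (c $ j * S0)"
    by (intro tendsto_real_sqrt) simp
  then show ?thesis by (simp add: \<kappa>_def real_sqrt_divide)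
qed

lemma ln_gap: "\<forall>\<^sub>F n in sequentially. ln (real (k n) / (real n * p n)) = gap n"
  using n_pos
proof eventually_elim
  case (elim n)
  then show ?case using k_pos[of n] p_range[of n] by (simp add: gap_def L_def ln_div ln_mult)
qed

lemma gap_inf: "filterlim gap at_top sequentially"
proof -
  have "filterlim (\<lambda>n. ln (real (k n) / (real n * p n))) at_top sequentially"
    by (rule filterlim_compose[OF ln_at_top knp])
  then show ?thesis using ln_gap by (simp cong: filterlim_cong)
qed

lemma inverse_gap: "(\<lambda>n. 1 / gap n) \<longlonglongrightarrow> 0"
  using tendsto_inverse_0_at_top[OF gap_inf] by (simp add: inverse_eq_divide)

lemma gap_pos: "\<forall>\<^sub>F n in sequentially. 0 < gap n"
  using gap_inf by (simp add: filterlim_at_top_dense)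

lemma rate_gap: "\<forall>\<^sub>F n in sequentially. rate n = sqrt (real (k n)) / gap n"
  using ln_gap by eventually_elim (simp add: rate_def)

text \<open>Passing from the combined level to that of a subsample shifts the extrapolation distance
  by a convergent amount, negligible against \<open>gap\<close>.\<close>

lemma sub_rate:
  "(\<lambda>n. rate n / sqrt (real (ks n j))) \<longlonglongrightarrow> 0"
  "(\<lambda>n. rate n * (- ln (p n) - lv j n) / sqrt (real (ks n j))) \<longlonglongrightarrow> \<kappa> j"
  "\<forall>\<^sub>F n in sequentially. lv j n \<le> - ln (p n)"
proof -
  have "(\<lambda>n. sqrt (real (k n)) / sqrt (real (ks n j)) * (1 / gap n)) \<longlonglongrightarrow> \<kappa> j * 0"
    by (intro tendsto_mult sqrt_share inverse_gap)
  then show r0: "(\<lambda>n. rate n / sqrt (real (ks n j))) \<longlonglongrightarrow> 0"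
    unfolding mult_zero_right by (rule Lim_transform_eventually) (use rate_gap in eventually_elim, simp)
  have "(\<lambda>n. sqrt (real (k n)) / sqrt (real (ks n j)) - rate n / sqrt (real (ks n j)) * (lv j n - L n)) \<longlonglongrightarrow> \<kappa> j - 0 * ln (d $ j)"
    by (intro tendsto_diff tendsto_mult sqrt_share r0 lv_diff)
  then have "(\<lambda>n. sqrt (real (k n)) / sqrt (real (ks n j)) - rate n / sqrt (real (ks n j)) * (lv j n - L n)) \<longlonglongrightarrow> \<kappa> j" by simp
  then show "(\<lambda>n. rate n * (- ln (p n) - lv j n) / sqrt (real (ks n j))) \<longlonglongrightarrow> \<kappa> j"
  proof (rule Lim_transform_eventually)
    show "\<forall>\<^sub>F n in sequentially. sqrt (real (k n)) / sqrt (real (ks n j)) - rate n / sqrt (real (ks n j)) * (lv j n - L n) =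
       rate n * (- ln (p n) - lv j n) / sqrt (real (ks n j))"
      using rate_gap gap_pos
    proof eventually_elim
      case (elim n)
      have "- ln (p n) - lv j n = gap n - (lv j n - L n)" by (simp add: gap_def)
      moreover have "rate n * gap n = sqrt (real (k n))" using elim by simp
      ultimately have "rate n * (- ln (p n) - lv j n) = sqrt (real (k n)) - rate n * (lv j n - L n)"
        by (simp add: right_diff_distrib distrib_left)
      then show ?case by (simp add: diff_divide_distrib)
    qed
  qed
  have "filterlim (\<lambda>n. - (lv j n - L n) + gap n) at_top sequentially"
    by (rule filterlim_tendsto_add_at_top[OF tendsto_minus[OF lv_diff] gap_inf])
  then have "\<forall>\<^sub>F n in sequentially. 0 \<le> - (lv j n - L n) + gap n" by (simp add: filterlim_at_top)
  then show "\<forall>\<^sub>F n in sequentially. lv j n \<le> - ln (p n)" by eventually_elim (simp add: gap_def)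
qed

lemma comb_rate:
  "(\<lambda>n. rate n / sqrt (real (k n))) \<longlonglongrightarrow> 0"
  "(\<lambda>n. rate n * (- ln (p n) - L n) / sqrt (real (k n))) \<longlonglongrightarrow> 1"
  "\<forall>\<^sub>F n in sequentially. L n \<le> - ln (p n)"
proof -
  show "(\<lambda>n. rate n / sqrt (real (k n))) \<longlonglongrightarrow> 0"
    by (rule Lim_transform_eventually[OF inverse_gap]) (use rate_gap in eventually_elim, use k_pos in simp)
  show "(\<lambda>n. rate n * (- ln (p n) - L n) / sqrt (real (k n))) \<longlonglongrightarrow> 1"
    unfolding gap_def[symmetric]
    by (rule Lim_transform_eventually[OF tendsto_const])
       (use rate_gap gap_pos in eventually_elim, use k_pos in simp)
  show "\<forall>\<^sub>F n in sequentially. L n \<le> - ln (p n)" using gap_pos by eventually_elim (simp add: gap_def)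
qed

lemma sub_hill_rescale:
  "((\<lambda>z. sqrt (real (k (fst z))) * (sub_hill j z - \<gamma>) - \<kappa> j * (sqrt (real (ks (fst z) j)) * (sub_hill j z - \<gamma>))) \<longlongrightarrow> 0) (prob_filter M)"
proof -
  have "(\<lambda>n. sqrt (real (k n)) / sqrt (real (ks n j)) - \<kappa> j) \<longlonglongrightarrow> 0"
    using tendsto_diff[OF sqrt_share[of j] tendsto_const[of "\<kappa> j"]] by simp
  then have "((\<lambda>z. (sqrt (real (k (fst z))) / sqrt (real (ks (fst z) j)) - \<kappa> j) * (sqrt (real (ks (fst z) j)) * (sub_hill j z - \<gamma>))) \<longlongrightarrow> 0) (prob_filter M)"
    unfolding sub_hill_def by (intro tendsto_0_mult_bounded_in_prob[OF filterlim_fst_compose sub.hill_bounded])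
  moreover have "(sqrt (real (k (fst z))) / sqrt (real (ks (fst z) j)) - \<kappa> j) * (sqrt (real (ks (fst z) j)) * y) =
      sqrt (real (k (fst z))) * y - \<kappa> j * (sqrt (real (ks (fst z) j)) * y)" for z :: "nat \<times> 'a" and y
  proof -
    have "sqrt (real (ks (fst z) j)) \<noteq> 0" using k_ge_1[of "fst z" j] by simp
    then show ?thesis by (simp add: left_diff_distrib)
  qed
  ultimately show ?thesis by simp
qed

lemma sub_hill_bounded: "bounded_in_prob (\<lambda>z. sqrt (real (k (fst z))) * (sub_hill j z - \<gamma>))"
proof -
  have "bounded_in_prob (\<lambda>z. \<kappa> j * (sqrt (real (ks (fst z) j)) * (sub_hill j z - \<gamma>)))"
    unfolding sub_hill_def by (intro bounded_in_prob_mult[OF bounded_in_prob_const sub.hill_bounded])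
  from bounded_in_prob_add[OF bounded_in_prob_tendsto[OF sub_hill_rescale[of j]] this] show ?thesis by simp
qed

lemma sub_weissman_expansion:
  "((\<lambda>z. rate (fst z) * (ln (weissman (sub j (fst z)) (\<lambda>i. XX i (snd z)) (ks (fst z) j) (p (fst z))) - ln (Q (- ln (p (fst z)))))
      - sqrt (real (k (fst z))) * (sub_hill j z - \<gamma>)) \<longlongrightarrow> 0) (prob_filter M)"
  "\<forall>\<^sub>F z in prob_filter M. 0 < weissman (sub j (fst z)) (\<lambda>i. XX i (snd z)) (ks (fst z) j) (p (fst z)) \<and> 0 < Q (- ln (p (fst z)))"
proof -
  have *: "\<And>n. 0 < p n" "(\<lambda>n. rate n / sqrt (real (ks n j))) \<longlonglongrightarrow> 0"
    "(\<lambda>n. rate n * (- ln (p n) - sub.lev j n) / sqrt (real (ks n j))) \<longlonglongrightarrow> \<kappa> j"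
    "\<forall>\<^sub>F n in sequentially. sub.lev j n \<le> - ln (p n)"
    using p_range sub_rate[of j] by (simp_all add: sub_lev)
  note W = sub.weissman_log_expansion[OF *]
  show "\<forall>\<^sub>F z in prob_filter M. 0 < weissman (sub j (fst z)) (\<lambda>i. XX i (snd z)) (ks (fst z) j) (p (fst z)) \<and> 0 < Q (- ln (p (fst z)))"
    by (rule W(2))
  from tendsto_diff[OF W(1) sub_hill_rescale[of j]]
  show "((\<lambda>z. rate (fst z) * (ln (weissman (sub j (fst z)) (\<lambda>i. XX i (snd z)) (ks (fst z) j) (p (fst z))) - ln (Q (- ln (p (fst z)))))
      - sqrt (real (k (fst z))) * (sub_hill j z - \<gamma>)) \<longlongrightarrow> 0) (prob_filter M)"
    by (simp add: sub_hill_def)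
qed

lemma comb_weissman_expansion:
  "((\<lambda>z. rate (fst z) * (ln (weissman (all (fst z)) (\<lambda>i. XX i (snd z)) (k (fst z)) (p (fst z))) - ln (Q (- ln (p (fst z)))))
      - sqrt (real (k (fst z))) * (comb_hill z - \<gamma>)) \<longlongrightarrow> 0) (prob_filter M)"
  "\<forall>\<^sub>F z in prob_filter M. 0 < weissman (all (fst z)) (\<lambda>i. XX i (snd z)) (k (fst z)) (p (fst z)) \<and> 0 < Q (- ln (p (fst z)))"
proof -
  have *: "\<And>n. 0 < p n" "(\<lambda>n. rate n / sqrt (real (k n))) \<longlonglongrightarrow> 0"
    "(\<lambda>n. rate n * (- ln (p n) - comb.lev n) / sqrt (real (k n))) \<longlonglongrightarrow> 1"
    "\<forall>\<^sub>F n in sequentially. comb.lev n \<le> - ln (p n)"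
    using p_range comb_rate by (simp_all add: comb_lev)
  note W = comb.weissman_log_expansion[OF *]
  show "\<forall>\<^sub>F z in prob_filter M. 0 < weissman (all (fst z)) (\<lambda>i. XX i (snd z)) (k (fst z)) (p (fst z)) \<and> 0 < Q (- ln (p (fst z)))"
    by (rule W(2))
  show "((\<lambda>z. rate (fst z) * (ln (weissman (all (fst z)) (\<lambda>i. XX i (snd z)) (k (fst z)) (p (fst z))) - ln (Q (- ln (p (fst z)))))
      - sqrt (real (k (fst z))) * (comb_hill z - \<gamma>)) \<longlongrightarrow> 0) (prob_filter M)"
    using W(1) by (simp add: comb_hill_def)
qed

lemma pooled_hill_eq:
  assumes "(\<Sum>j\<in>UNIV. \<omega> $ j) = 1"
  shows "pooled_hill (ns n) (ks n) (x w) \<omega> - \<gamma> = (\<Sum>j\<in>UNIV. \<omega> $ j * (sub_hill j (n, w) - \<gamma>))"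
proof -
  have "(\<Sum>j\<in>UNIV. \<omega> $ j * (sub_hill j (n, w) - \<gamma>)) = (\<Sum>j\<in>UNIV. \<omega> $ j * sub_hill j (n, w)) - (\<Sum>j\<in>UNIV. \<omega> $ j) * \<gamma>"
    by (simp add: right_diff_distrib sum_subtractf sum_distrib_right)
  then show ?thesis using assms by (simp add: pooled_hill_def sub_hill_eq)
qed

lemma weight_limit_sum:
  fixes W :: "nat \<times> 'a \<Rightarrow> real^'m"
  assumes W: "(W \<longlongrightarrow> \<omega>) (prob_filter M)" and s: "\<forall>\<^sub>F z in prob_filter M. (\<Sum>j\<in>UNIV. W z $ j) = 1"
  shows "(\<Sum>j\<in>UNIV. \<omega> $ j) = 1"
proof -
  have 1: "((\<lambda>z. \<Sum>j\<in>UNIV. W z $ j) \<longlongrightarrow> (\<Sum>j\<in>UNIV. \<omega> $ j)) (prob_filter M)"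
    by (intro tendsto_sum tendsto_vec_nth W)
  have 2: "((\<lambda>z. \<Sum>j\<in>UNIV. W z $ j) \<longlongrightarrow> 1) (prob_filter M)"
    by (rule Lim_transform_eventually[OF tendsto_const]) (use s in eventually_elim, simp)
  show ?thesis by (rule tendsto_unique[OF prob_filter_neq_bot 1 2])
qed

text \<open>Because the weights sum to 1, the log of the pooled relative error is the weighted sum
  of the subsample log errors. Replacing random weights by their limits costs o_P(1) times a tight
  error, so consistency of the weights suffices. The delta method removes the logarithm.\<close>

lemma pooled_weissman_expansion:
  fixes W :: "nat \<Rightarrow> 'a \<Rightarrow> real^'m"
  assumes W: "((\<lambda>z. W (fst z) (snd z)) \<longlongrightarrow> \<omega>) (prob_filter M)"
    and s: "\<forall>\<^sub>F z in prob_filter M. (\<Sum>j\<in>UNIV. W (fst z) (snd z) $ j) = 1"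
  shows "((\<lambda>z. rate (fst z) * (pooled_weissman (ns (fst z)) (ks (fst z)) (x (snd z)) (p (fst z)) (W (fst z) (snd z)) / quantile (cdf D) (1 - p (fst z)) - 1)
      - sqrt (real (k (fst z))) * (pooled_hill (ns (fst z)) (ks (fst z)) (x (snd z)) \<omega> - \<gamma>)) \<longlongrightarrow> 0) (prob_filter M)"
    and "bounded_in_prob (\<lambda>z. sqrt (real (k (fst z))) * (pooled_hill (ns (fst z)) (ks (fst z)) (x (snd z)) \<omega> - \<gamma>))"
proof -
  have sum1: "(\<Sum>j\<in>UNIV. \<omega> $ j) = 1" by (rule weight_limit_sum[OF W s])
  define V where "V j z = sqrt (real (k (fst z))) * (sub_hill j z - \<gamma>)" for j z
  define wt where "wt j z = weissman (sub j (fst z)) (\<lambda>i. XX i (snd z)) (ks (fst z) j) (p (fst z))" for j z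
  define q where "q z = Q (- ln (p (fst z)))" for z :: "nat \<times> 'a"
  define Y where "Y z = (\<Sum>j\<in>UNIV. W (fst z) (snd z) $ j * (ln (wt j z) - ln (q z)))" for z
  have ph: "sqrt (real (k (fst z))) * (pooled_hill (ns (fst z)) (ks (fst z)) (x (snd z)) \<omega> - \<gamma>) = (\<Sum>j\<in>UNIV. \<omega> $ j * V j z)" for z
    using pooled_hill_eq[OF sum1, of "fst z" "snd z"] by (simp add: V_def sum_distrib_left mult_ac)
  have "bounded_in_prob (\<lambda>z. \<Sum>j\<in>UNIV. \<omega> $ j * V j z)"
    unfolding V_def by (intro bounded_in_prob_sum bounded_in_prob_mult bounded_in_prob_const sub_hill_bounded)
  then show B: "bounded_in_prob (\<lambda>z. sqrt (real (k (fst z))) * (pooled_hill (ns (fst z)) (ks (fst z)) (x (snd z)) \<omega> - \<gamma>))"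
    by (simp only: ph)
  have "((\<lambda>z. \<Sum>j\<in>UNIV. W (fst z) (snd z) $ j * (rate (fst z) * (ln (wt j z) - ln (q z)) - V j z)
       + (W (fst z) (snd z) $ j - \<omega> $ j) * V j z) \<longlongrightarrow> (\<Sum>j\<in>UNIV. \<omega> $ j * 0 + 0)) (prob_filter M)"
  proof (intro tendsto_sum tendsto_add tendsto_mult tendsto_vec_nth W)
    fix j
    show "((\<lambda>z. rate (fst z) * (ln (wt j z) - ln (q z)) - V j z) \<longlongrightarrow> 0) (prob_filter M)"
      unfolding wt_def q_def V_def by (rule sub_weissman_expansion)
    have "((\<lambda>z. W (fst z) (snd z) $ j - \<omega> $ j) \<longlongrightarrow> \<omega> $ j - \<omega> $ j) (prob_filter M)"
      by (intro tendsto_diff tendsto_vec_nth W tendsto_const)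
    then show "((\<lambda>z. (W (fst z) (snd z) $ j - \<omega> $ j) * V j z) \<longlongrightarrow> 0) (prob_filter M)"
      unfolding V_def by (intro tendsto_0_mult_bounded_in_prob sub_hill_bounded) simp
  qed
  moreover have "(\<Sum>j\<in>UNIV. W (fst z) (snd z) $ j * (rate (fst z) * (ln (wt j z) - ln (q z)) - V j z)
       + (W (fst z) (snd z) $ j - \<omega> $ j) * V j z) = rate (fst z) * Y z - (\<Sum>j\<in>UNIV. \<omega> $ j * V j z)" for z
    unfolding Y_def sum_distrib_left sum_subtractf[symmetric] by (intro sum.cong refl) (simp add: algebra_simps)
  ultimately have Ylim: "((\<lambda>z. rate (fst z) * Y z - (\<Sum>j\<in>UNIV. \<omega> $ j * V j z)) \<longlongrightarrow> 0) (prob_filter M)" by simp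
  have "((\<lambda>z. rate (fst z) * (exp (Y z) - 1) - (\<Sum>j\<in>UNIV. \<omega> $ j * V j z)) \<longlongrightarrow> 0) (prob_filter M)"
    by (rule delta_method_exp[OF rate_inf _ Ylim]) (use B in \<open>simp only: ph\<close>)
  then show "((\<lambda>z. rate (fst z) * (pooled_weissman (ns (fst z)) (ks (fst z)) (x (snd z)) (p (fst z)) (W (fst z) (snd z)) / quantile (cdf D) (1 - p (fst z)) - 1)
      - sqrt (real (k (fst z))) * (pooled_hill (ns (fst z)) (ks (fst z)) (x (snd z)) \<omega> - \<gamma>)) \<longlongrightarrow> 0) (prob_filter M)"
  proof (rule Lim_transform_eventually)
    have "\<forall>\<^sub>F z in prob_filter M. \<forall>j\<in>UNIV. 0 < wt j z \<and> 0 < q z"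
      unfolding wt_def q_def by (intro eventually_ball_finite ballI sub_weissman_expansion) simp
    then show "\<forall>\<^sub>F z in prob_filter M. rate (fst z) * (exp (Y z) - 1) - (\<Sum>j\<in>UNIV. \<omega> $ j * V j z) =
      rate (fst z) * (pooled_weissman (ns (fst z)) (ks (fst z)) (x (snd z)) (p (fst z)) (W (fst z) (snd z)) / quantile (cdf D) (1 - p (fst z)) - 1)
      - sqrt (real (k (fst z))) * (pooled_hill (ns (fst z)) (ks (fst z)) (x (snd z)) \<omega> - \<gamma>)"
      using s
    proof eventually_elim
      case (elim z)
      have "Y z = (\<Sum>j\<in>UNIV. W (fst z) (snd z) $ j * ln (wt j z)) - (\<Sum>j\<in>UNIV. W (fst z) (snd z) $ j) * ln (q z)"
        by (simp add: Y_def right_diff_distrib sum_subtractf sum_distrib_right)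
      then have "exp (Y z) = exp (\<Sum>j\<in>UNIV. W (fst z) (snd z) $ j * ln (wt j z)) / q z"
        using elim by (simp add: exp_diff)
      also have "exp (\<Sum>j\<in>UNIV. W (fst z) (snd z) $ j * ln (wt j z)) = (\<Prod>j\<in>UNIV. wt j z powr (W (fst z) (snd z) $ j))"
        unfolding exp_sum[OF finite] using elim(1) by (intro prod.cong) (auto simp: powr_def less_imp_neq[symmetric])
      also have "\<dots> = pooled_weissman (ns (fst z)) (ks (fst z)) (x (snd z)) (p (fst z)) (W (fst z) (snd z))"
        by (simp add: pooled_weissman_def sub_weissman_eq wt_def)
      finally show ?case by (simp add: ph quantile_eq q_def)
    qed
  qed
qed

lemma combined_weissman_expansion:
  "((\<lambda>z. rate (fst z) * (combined_weissman (ns (fst z)) (x (snd z)) (k (fst z)) (p (fst z)) / quantile (cdf D) (1 - p (fst z)) - 1)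
      - sqrt (real (k (fst z))) * (comb_hill z - \<gamma>)) \<longlongrightarrow> 0) (prob_filter M)"
proof -
  have "((\<lambda>z. rate (fst z) * (exp (ln (weissman (all (fst z)) (\<lambda>i. XX i (snd z)) (k (fst z)) (p (fst z))) - ln (Q (- ln (p (fst z))))) - 1)
      - sqrt (real (k (fst z))) * (comb_hill z - \<gamma>)) \<longlongrightarrow> 0) (prob_filter M)"
    by (rule delta_method_exp[OF rate_inf _ comb_weissman_expansion(1)])
       (use comb.hill_bounded in \<open>simp add: comb_hill_def\<close>)
  then show ?thesis
    by (rule Lim_transform_eventually)
       (use comb_weissman_expansion(2) in eventually_elim, simp add: comb_weissman_eq quantile_eq exp_diff)
qed

text \<open>Written as one sum over all observations, with coefficient and level depending on the
  subsample, to fit the characteristic-function limit directly; the maximum with 0 is inactive only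
  eventually.\<close>

definition pooled_score :: "real^'m \<Rightarrow> nat \<Rightarrow> 'a \<Rightarrow> real" where
  "pooled_score \<omega> n w = (\<Sum>i\<in>all n. (\<gamma> * (\<omega> $ fst i * \<kappa> (fst i)) / sqrt (real (ks n (fst i)))) * score (max 0 (lv (fst i) n)) (E i w))"

definition comb_score :: "nat \<Rightarrow> 'a \<Rightarrow> real" where
  "comb_score n w = (\<Sum>i\<in>all n. (\<gamma> / sqrt (real (k n))) * score (max 0 (L n)) (E i w))"

lemma scores_measurable [measurable]:
  "pooled_score \<omega> n \<in> borel_measurable M" "comb_score n \<in> borel_measurable M"
  unfolding pooled_score_def comb_score_def by measurable

lemma lv_pos: "\<forall>\<^sub>F n in sequentially. 0 < lv j n"
  using sub.lev_pos[of j] by (simp add: sub_lev)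

lemma L_pos: "\<forall>\<^sub>F n in sequentially. 0 < L n"
  using comb.lev_pos by (simp add: comb_lev)

lemma pooled_score_eq:
  "\<forall>\<^sub>F z in prob_filter M. pooled_score \<omega> (fst z) (snd z) = (\<Sum>j\<in>UNIV. \<omega> $ j * (\<kappa> j * (\<gamma> * sub.tail_score j (fst z) (snd z))))"
proof -
  have "\<forall>\<^sub>F n in sequentially. \<forall>j\<in>UNIV. 0 < lv j n" by (intro eventually_ball_finite ballI lv_pos) simp
  then have "\<forall>\<^sub>F z in prob_filter M. \<forall>j\<in>UNIV. 0 < lv j (fst z)" by (rule eventually_fst_prob_filter)
  then show ?thesis
  proof eventually_elim
    case (elim z)
    show ?case unfolding pooled_score_def sum_all
    proof (rule sum.cong[OF refl])
      fix j
      have lv: "max 0 (lv j (fst z)) = lv j (fst z)" using elim by (simp add: less_imp_le)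
      show "(\<Sum>i\<in>sub j (fst z). \<gamma> * (\<omega> $ fst i * \<kappa> (fst i)) / sqrt (real (ks (fst z) (fst i))) * score (max 0 (lv (fst i) (fst z))) (E i (snd z))) =
         \<omega> $ j * (\<kappa> j * (\<gamma> * sub.tail_score j (fst z) (snd z)))"
        unfolding sub.tail_score_def sub_lev score_def[symmetric] sum_divide_distrib sum_distrib_left
        by (intro sum.cong refl) (auto simp: sub_def lv)
    qed
  qed
qed

lemma comb_score_eq: "\<forall>\<^sub>F z in prob_filter M. comb_score (fst z) (snd z) = \<gamma> * comb.tail_score (fst z) (snd z)"
  using eventually_fst_prob_filter[OF L_pos]
proof eventually_elim
  case (elim z)
  then have "max 0 (L (fst z)) = L (fst z)" by simp
  then show ?case
    unfolding comb_score_def comb.tail_score_def comb_lev score_def[symmetric] sum_divide_distrib sum_distrib_left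
    by simp
qed

text \<open>The bias constant assembles from \<kappa>_j sqrt (1 / (c_j S0)) = 1 and the product of -
  \<rho> / (1 - \<rho>) with - lam / \<rho>, which is lam / (1 - \<rho>); the power of d_j comes
  from the level of the subsample.\<close>

lemma pooled_hill_expansion:
  assumes s: "(\<Sum>j\<in>UNIV. \<omega> $ j) = 1"
  shows "((\<lambda>z. sqrt (real (k (fst z))) * (pooled_hill (ns (fst z)) (ks (fst z)) (x (snd z)) \<omega> - \<gamma>) - pooled_score \<omega> (fst z) (snd z))
     \<longlongrightarrow> lam / (1 - \<rho>) * (\<Sum>j\<in>UNIV. d $ j powr \<rho> * \<omega> $ j)) (prob_filter M)"
proof -
  have \<kappa>1: "\<kappa> j * sqrt (1 / (c $ j * S0)) = 1" for j
    using c_pos[of j] S0_pos by (simp add: \<kappa>_def real_sqrt_mult[symmetric])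
  have "((\<lambda>z. \<Sum>j\<in>UNIV. \<omega> $ j * ((sqrt (real (k (fst z))) * (sub_hill j z - \<gamma>) - \<kappa> j * (sqrt (real (ks (fst z) j)) * (sub_hill j z - \<gamma>))) +
      \<kappa> j * (sqrt (real (ks (fst z) j)) * (sub_hill j z - \<gamma>) - \<gamma> * sub.tail_score j (fst z) (snd z)))) \<longlongrightarrow>
      (\<Sum>j\<in>UNIV. \<omega> $ j * (0 + \<kappa> j * (- \<rho> / (1 - \<rho>) * (sqrt (1 / (c $ j * S0)) * (d $ j powr \<rho>) * (- lam / \<rho>)))))) (prob_filter M)"
    unfolding sub_hill_def
    by (intro tendsto_sum tendsto_mult tendsto_add tendsto_const sub_hill_rescale[unfolded sub_hill_def] sub.hill_expansion)
  also have "(\<Sum>j\<in>UNIV. \<omega> $ j * (0 + \<kappa> j * (- \<rho> / (1 - \<rho>) * (sqrt (1 / (c $ j * S0)) * (d $ j powr \<rho>) * (- lam / \<rho>)))))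
      = (\<Sum>j\<in>UNIV. lam / (1 - \<rho>) * (d $ j powr \<rho> * \<omega> $ j))"
  proof (rule sum.cong[OF refl])
    fix j
    have "\<omega> $ j * (0 + \<kappa> j * (- \<rho> / (1 - \<rho>) * (sqrt (1 / (c $ j * S0)) * (d $ j powr \<rho>) * (- lam / \<rho>))))
      = (\<kappa> j * sqrt (1 / (c $ j * S0))) * (- \<rho> / (1 - \<rho>) * (- lam / \<rho>)) * (d $ j powr \<rho> * \<omega> $ j)" by (simp only: mult_ac add_0)
    also have "- \<rho> / (1 - \<rho>) * (- lam / \<rho>) = lam / (1 - \<rho>)" using \<rho>_neg by (simp add: field_simps)
    finally show "\<omega> $ j * (0 + \<kappa> j * (- \<rho> / (1 - \<rho>) * (sqrt (1 / (c $ j * S0)) * (d $ j powr \<rho>) * (- lam / \<rho>))))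
      = lam / (1 - \<rho>) * (d $ j powr \<rho> * \<omega> $ j)" unfolding \<kappa>1 by simp
  qed
  also have "\<dots> = lam / (1 - \<rho>) * (\<Sum>j\<in>UNIV. d $ j powr \<rho> * \<omega> $ j)" by (simp only: sum_distrib_left)
  finally show ?thesis
  proof (rule Lim_transform_eventually)
    show "\<forall>\<^sub>F z in prob_filter M. (\<Sum>j\<in>UNIV. \<omega> $ j * ((sqrt (real (k (fst z))) * (sub_hill j z - \<gamma>) - \<kappa> j * (sqrt (real (ks (fst z) j)) * (sub_hill j z - \<gamma>))) +
      \<kappa> j * (sqrt (real (ks (fst z) j)) * (sub_hill j z - \<gamma>) - \<gamma> * sub.tail_score j (fst z) (snd z)))) =
      sqrt (real (k (fst z))) * (pooled_hill (ns (fst z)) (ks (fst z)) (x (snd z)) \<omega> - \<gamma>) - pooled_score \<omega> (fst z) (snd z)"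
      using pooled_score_eq[of \<omega>]
    proof eventually_elim
      case (elim z)
      have ph: "pooled_hill (ns (fst z)) (ks (fst z)) (x (snd z)) \<omega> - \<gamma> = (\<Sum>j\<in>UNIV. \<omega> $ j * (sub_hill j z - \<gamma>))"
        using pooled_hill_eq[OF s, of "fst z" "snd z"] by simp
      show ?case unfolding elim ph sum_distrib_left sum_subtractf[symmetric]
        by (intro sum.cong refl) (simp add: algebra_simps)
    qed
  qed
qed

lemma comb_hill_expansion:
  "((\<lambda>z. sqrt (real (k (fst z))) * (comb_hill z - \<gamma>) - comb_score (fst z) (snd z)) \<longlongrightarrow> lam / (1 - \<rho>)) (prob_filter M)"
proof -
  have "- \<rho> / (1 - \<rho>) * (- lam / \<rho>) = lam / (1 - \<rho>)" using \<rho>_neg by (simp add: field_simps)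
  with comb.hill_expansion have "((\<lambda>z. sqrt (real (k (fst z))) * (comb_hill z - \<gamma>) - \<gamma> * comb.tail_score (fst z) (snd z)) \<longlongrightarrow> lam / (1 - \<rho>)) (prob_filter M)"
    by (simp add: comb_hill_def)
  then show ?thesis
    by (rule Lim_transform_eventually) (use comb_score_eq in eventually_elim, simp)
qed

lemma ks_exp_lv: "\<forall>\<^sub>F n in sequentially. \<forall>j. real (ns n j) * exp (- max 0 (lv j n)) = real (ks n j) \<and> 0 < ns n j"
proof -
  have "\<forall>\<^sub>F n in sequentially. \<forall>j\<in>UNIV. real (ns n j) * exp (- max 0 (lv j n)) = real (ks n j) \<and> 0 < ns n j"
  proof (intro eventually_ball_finite ballI)
    fix j
    show "\<forall>\<^sub>F n in sequentially. real (ns n j) * exp (- max 0 (lv j n)) = real (ks n j) \<and> 0 < ns n j"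
      using sub.card_exp_lev[of j] lv_pos[of j] ns_pos[of j]
      by eventually_elim (simp add: sub_lev card_sub max_absorb2)
  qed simp
  then show ?thesis by simp
qed

text \<open>A block of n_j equal terms has total exceedance mass n_j exp (- lv_j) = k_j eventually.
  With a_j = \<gamma> \<omega>_j \<kappa>_j the three Lyapunov sums are therefore a_j^2, |a_j|^3 /
  sqrt k_j and a_j^4 / n_j summed over j; the first is the variance because \<kappa>_j^2 = c_j
  S0.\<close>

lemma pooled_score_char:
  "(\<lambda>n. char (distr M borel (pooled_score \<omega> n)) t) \<longlonglongrightarrow>
     of_real (exp (- ((\<gamma>\<^sup>2 * (\<Sum>j\<in>UNIV. 1 / c $ j) * (\<Sum>j\<in>UNIV. c $ j * (\<omega> $ j)\<^sup>2)) * t\<^sup>2 / 2)))"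
  unfolding pooled_score_def[abs_def]
proof (rule score_sum_char)
  define a where "a j = \<gamma> * (\<omega> $ j * \<kappa> j)" for j
  have blk: "(\<Sum>i\<in>all n. f (fst i)) = (\<Sum>j\<in>UNIV. real (ns n j) * f j)" for n and f :: "'m \<Rightarrow> real"
  proof -
    have "(\<Sum>i\<in>sub j n. f (fst i)) = (\<Sum>i\<in>sub j n. f j)" for j
      by (intro sum.cong refl) (auto simp: sub_def)
    then show ?thesis unfolding sum_all by (simp add: card_sub)
  qed
  have blocks: "(\<lambda>n. \<Sum>i\<in>all n. f n (fst i)) = (\<lambda>n. \<Sum>j\<in>UNIV. real (ns n j) * f n j)" for f :: "nat \<Rightarrow> 'm \<Rightarrow> real"
    by (rule ext) (rule blk)
  have ev: "\<forall>\<^sub>F n in sequentially. \<gamma>\<^sup>2 * (\<Sum>j\<in>UNIV. 1 / c $ j) * (\<Sum>j\<in>UNIV. c $ j * (\<omega> $ j)\<^sup>2) =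
    (\<Sum>j\<in>UNIV. real (ns n j) * ((a j / sqrt (real (ks n j)))\<^sup>2 * exp (- max 0 (lv j n))))"
    using ks_exp_lv
  proof eventually_elim
    case (elim n)
    have "(\<Sum>j\<in>UNIV. real (ns n j) * ((a j / sqrt (real (ks n j)))\<^sup>2 * exp (- max 0 (lv j n)))) =
      (\<Sum>j\<in>UNIV. (a j)\<^sup>2 / real (ks n j) * (real (ns n j) * exp (- max 0 (lv j n))))"
      by (simp add: power_divide mult_ac)
    also have "\<dots> = (\<Sum>j\<in>UNIV. (a j)\<^sup>2)" using elim k_ge_1 by (simp add: Suc_le_eq[symmetric] not_less_eq_eq)
    also have "\<dots> = (\<Sum>j\<in>UNIV. \<gamma>\<^sup>2 * S0 * (c $ j * (\<omega> $ j)\<^sup>2))"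
      using c_pos S0_pos by (intro sum.cong refl) (simp add: a_def \<kappa>_def power_mult_distrib mult_ac less_imp_le)
    finally show ?case by (simp add: S0_def sum_distrib_left mult.assoc)
  qed
  show "(\<lambda>n. \<Sum>i\<in>all n. (\<gamma> * (\<omega> $ fst i * \<kappa> (fst i)) / sqrt (real (ks n (fst i))))\<^sup>2 * exp (- max 0 (lv (fst i) n)))
    \<longlonglongrightarrow> \<gamma>\<^sup>2 * (\<Sum>j\<in>UNIV. 1 / c $ j) * (\<Sum>j\<in>UNIV. c $ j * (\<omega> $ j)\<^sup>2)"
    unfolding a_def[symmetric] blocks[of "\<lambda>n j. (a j / sqrt (real (ks n j)))\<^sup>2 * exp (- max 0 (lv j n))"] by (rule Lim_transform_eventually[OF tendsto_const ev])
  have ks0: "(\<lambda>n. 1 / sqrt (real (ks n j))) \<longlonglongrightarrow> 0" for j by (rule sub.inverse_sqrt_k)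
  have "(\<lambda>n. \<Sum>j\<in>UNIV. \<bar>a j\<bar> ^ 3 * (1 / sqrt (real (ks n j)))) \<longlonglongrightarrow> (\<Sum>j\<in>UNIV. \<bar>a j\<bar> ^ 3 * 0)"
    by (intro tendsto_sum tendsto_mult tendsto_const ks0)
  then have l3: "(\<lambda>n. \<Sum>j\<in>UNIV. \<bar>a j\<bar> ^ 3 * (1 / sqrt (real (ks n j)))) \<longlonglongrightarrow> 0" by simp
  show "(\<lambda>n. \<Sum>i\<in>all n. \<bar>\<gamma> * (\<omega> $ fst i * \<kappa> (fst i)) / sqrt (real (ks n (fst i)))\<bar> ^ 3 * exp (- max 0 (lv (fst i) n))) \<longlonglongrightarrow> 0"
    unfolding a_def[symmetric] blocks[of "\<lambda>n j. \<bar>a j / sqrt (real (ks n j))\<bar> ^ 3 * exp (- max 0 (lv j n))"]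
  proof (rule Lim_transform_eventually[OF l3])
    show "\<forall>\<^sub>F n in sequentially. (\<Sum>j\<in>UNIV. \<bar>a j\<bar> ^ 3 * (1 / sqrt (real (ks n j)))) =
      (\<Sum>j\<in>UNIV. real (ns n j) * (\<bar>a j / sqrt (real (ks n j))\<bar> ^ 3 * exp (- max 0 (lv j n))))"
      using ks_exp_lv
    proof eventually_elim
      case (elim n)
      show ?case
      proof (rule sum.cong[OF refl])
        fix j
        have s: "sqrt (real (ks n j)) > 0" using k_ge_1[of n j] by simp
        have "real (ns n j) * (\<bar>a j / sqrt (real (ks n j))\<bar> ^ 3 * exp (- max 0 (lv j n))) =
           \<bar>a j\<bar> ^ 3 / sqrt (real (ks n j)) ^ 3 * (real (ns n j) * exp (- max 0 (lv j n)))"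
          using s by (simp add: abs_divide power_divide)
        also have "real (ns n j) * exp (- max 0 (lv j n)) = sqrt (real (ks n j)) * sqrt (real (ks n j))" using elim by simp
        also have "\<bar>a j\<bar> ^ 3 / sqrt (real (ks n j)) ^ 3 * (sqrt (real (ks n j)) * sqrt (real (ks n j))) = \<bar>a j\<bar> ^ 3 * (1 / sqrt (real (ks n j)))"
          using s unfolding power3_eq_cube by (simp del: real_sqrt_mult_self)
        finally show "\<bar>a j\<bar> ^ 3 * (1 / sqrt (real (ks n j))) = real (ns n j) * (\<bar>a j / sqrt (real (ks n j))\<bar> ^ 3 * exp (- max 0 (lv j n)))" by simp
      qed
    qed
  qed
  have ns0: "(\<lambda>n. 1 / real (ns n j)) \<longlonglongrightarrow> 0" for j
  proof -
    have "filterlim (\<lambda>n. real (ns n j) / real (ks n j) * real (ks n j)) at_top sequentially"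
      by (intro filterlim_at_top_mult_at_top ns_over_ks sub.real_k_top)
    moreover have "real (ns n j) / real (ks n j) * real (ks n j) = real (ns n j)" for n
      using k_ge_1[of n j] by simp
    ultimately have "filterlim (\<lambda>n. real (ns n j)) at_top sequentially" by simp
    from tendsto_inverse_0_at_top[OF this] show ?thesis by (simp add: inverse_eq_divide)
  qed
  have "(\<lambda>n. \<Sum>j\<in>UNIV. (a j) ^ 4 * (1 / real (ns n j))) \<longlonglongrightarrow> (\<Sum>j\<in>UNIV. (a j) ^ 4 * 0)"
    by (intro tendsto_sum tendsto_mult tendsto_const ns0)
  then have l4: "(\<lambda>n. \<Sum>j\<in>UNIV. (a j) ^ 4 * (1 / real (ns n j))) \<longlonglongrightarrow> 0" by simp
  show "(\<lambda>n. \<Sum>i\<in>all n. ((\<gamma> * (\<omega> $ fst i * \<kappa> (fst i)) / sqrt (real (ks n (fst i))))\<^sup>2 * exp (- max 0 (lv (fst i) n)))\<^sup>2) \<longlonglongrightarrow> 0"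
    unfolding a_def[symmetric] blocks[of "\<lambda>n j. ((a j / sqrt (real (ks n j)))\<^sup>2 * exp (- max 0 (lv j n)))\<^sup>2"]
  proof (rule Lim_transform_eventually[OF l4])
    show "\<forall>\<^sub>F n in sequentially. (\<Sum>j\<in>UNIV. (a j) ^ 4 * (1 / real (ns n j))) =
      (\<Sum>j\<in>UNIV. real (ns n j) * ((a j / sqrt (real (ks n j)))\<^sup>2 * exp (- max 0 (lv j n)))\<^sup>2)"
      using ks_exp_lv
    proof eventually_elim
      case (elim n)
      show ?case
      proof (rule sum.cong[OF refl])
        fix j
        have e: "exp (- max 0 (lv j n)) = real (ks n j) / real (ns n j)" and nj: "0 < ns n j"
          using elim by (auto simp: field_simps dest!: spec[of _ j])
        have "(a j / sqrt (real (ks n j)))\<^sup>2 * exp (- max 0 (lv j n)) = (a j)\<^sup>2 / real (ns n j)"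
          unfolding e using k_ge_1[of n j] by (simp add: power_divide)
        then show "(a j) ^ 4 * (1 / real (ns n j)) = real (ns n j) * ((a j / sqrt (real (ks n j)))\<^sup>2 * exp (- max 0 (lv j n)))\<^sup>2"
          using nj by (simp add: power_divide power2_eq_square power4_eq_xxxx)
      qed
    qed
  qed
qed (use card_all in auto)

lemma comb_score_char:
  "(\<lambda>n. char (distr M borel (comb_score n)) t) \<longlonglongrightarrow> of_real (exp (- (\<gamma>\<^sup>2 * t\<^sup>2 / 2)))"
  unfolding comb_score_def[abs_def]
proof (rule score_sum_char)
  have e: "\<forall>\<^sub>F n in sequentially. exp (- max 0 (L n)) = real (k n) / real n \<and> 0 < n"
    using L_pos n_pos comb.card_exp_lev
    by eventually_elim (simp add: card_all comb_lev max_absorb2 field_simps)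
  show "(\<lambda>n. \<Sum>i\<in>all n. (\<gamma> / sqrt (real (k n)))\<^sup>2 * exp (- max 0 (L n))) \<longlonglongrightarrow> \<gamma>\<^sup>2"
    by (rule Lim_transform_eventually[OF tendsto_const])
       (use e in eventually_elim, use k_pos in \<open>simp add: card_all power_divide\<close>)
  have "(\<lambda>n. \<bar>\<gamma>\<bar> ^ 3 * (1 / sqrt (real (k n)))) \<longlonglongrightarrow> \<bar>\<gamma>\<bar> ^ 3 * 0"
    by (intro tendsto_mult tendsto_const comb.inverse_sqrt_k)
  then show "(\<lambda>n. \<Sum>i\<in>all n. \<bar>\<gamma> / sqrt (real (k n))\<bar> ^ 3 * exp (- max 0 (L n))) \<longlonglongrightarrow> 0"
    unfolding mult_zero_right
  proof (rule Lim_transform_eventually)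
    show "\<forall>\<^sub>F n in sequentially. \<bar>\<gamma>\<bar> ^ 3 * (1 / sqrt (real (k n))) = (\<Sum>i\<in>all n. \<bar>\<gamma> / sqrt (real (k n))\<bar> ^ 3 * exp (- max 0 (L n)))"
      using e
    proof eventually_elim
      case (elim n)
      have s: "sqrt (real (k n)) > 0" using k_pos[of n] by simp
      have "(\<Sum>i\<in>all n. \<bar>\<gamma> / sqrt (real (k n))\<bar> ^ 3 * exp (- max 0 (L n))) = \<bar>\<gamma>\<bar> ^ 3 / sqrt (real (k n)) ^ 3 * real (k n)"
        using s elim by (simp add: card_all abs_divide power_divide)
      also have "\<dots> = \<bar>\<gamma>\<bar> ^ 3 * (1 / sqrt (real (k n)))"
      proof -
        have "y / s ^ 3 * (s * s) = y * (1 / s)" if "s > 0" for y s :: real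
          using that by (simp add: power3_eq_cube)
        from this[OF s, of "\<bar>\<gamma>\<bar> ^ 3"] show ?thesis unfolding real_sqrt_mult_self by simp
      qed
      finally show ?case by simp
    qed
  qed
  have "(\<lambda>n. \<gamma> ^ 4 * (1 / real n)) \<longlonglongrightarrow> \<gamma> ^ 4 * 0"
    by (intro tendsto_mult tendsto_const lim_1_over_n)
  then show "(\<lambda>n. \<Sum>i\<in>all n. ((\<gamma> / sqrt (real (k n)))\<^sup>2 * exp (- max 0 (L n)))\<^sup>2) \<longlonglongrightarrow> 0"
    unfolding mult_zero_right
  proof (rule Lim_transform_eventually)
    show "\<forall>\<^sub>F n in sequentially. \<gamma> ^ 4 * (1 / real n) = (\<Sum>i\<in>all n. ((\<gamma> / sqrt (real (k n)))\<^sup>2 * exp (- max 0 (L n)))\<^sup>2)"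
      using e
    proof eventually_elim
      case (elim n)
      have "(\<gamma> / sqrt (real (k n)))\<^sup>2 * exp (- max 0 (L n)) = \<gamma>\<^sup>2 / real n"
        using elim k_pos[of n] by (simp add: power_divide)
      then show ?case using elim by (simp add: card_all power_divide power2_eq_square power4_eq_xxxx)
    qed
  qed
qed (use card_all in auto)

end

section \<open>The AMSE weights\<close>

lemma diag_matrix_mult_vec: "(diag_matrix v *v y) $ j = v $ j * y $ j"
  by (simp add: diag_matrix_def matrix_vector_mult_def if_distrib[of "\<lambda>x. x * _"] cong: if_cong)

text \<open>\<open>matrix_inv\<close> is a choice among two-sided inverses, so one is exhibited
  first; the action of the chosen inverse then follows by cancelling the diagonal entries.\<close>

lemma var_matrix_inv_mult:
  fixes ks :: "'m::finite \<Rightarrow> nat"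
  assumes ks: "\<And>j. 1 \<le> ks j" and g: "g \<noteq> 0"
  shows "(matrix_inv (var_matrix ks g) *v y) $ j = real (ks j) / (real (\<Sum>i\<in>UNIV. ks i) * g\<^sup>2) * y $ j"
proof -
  let ?K = "real (\<Sum>i\<in>UNIV. ks i) * g\<^sup>2"
  have "0 < (\<Sum>i\<in>UNIV. ks i)" using ks by (intro sum_pos) (auto simp: Suc_le_eq)
  then have "0 < real (\<Sum>i\<in>UNIV. ks i)" by (simp only: of_nat_0_less_iff)
  then have K: "?K \<noteq> 0" using g by (metis less_irrefl mult_eq_0_iff power_eq_0_iff)
  let ?W = "diag_matrix (\<chi> j. real (ks j) / ?K)"
  have V: "(var_matrix ks g *v y) $ j = ?K / real (ks j) * y $ j" for y j
    by (simp add: var_matrix_def scaleR_matrix_vector_assoc[symmetric] diag_matrix_mult_vec)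
  have ks0: "(ks j = 0) = False" for j using ks[of j] by simp
  have "var_matrix ks g ** ?W = mat 1" "?W ** var_matrix ks g = mat 1"
    using K by (auto simp: matrix_eq vec_eq_iff matrix_vector_mul_assoc[symmetric] V diag_matrix_mult_vec ks0)
  then have ex: "\<exists>W. var_matrix ks g ** W = mat 1 \<and> W ** var_matrix ks g = mat 1" by blast
  have "var_matrix ks g ** matrix_inv (var_matrix ks g) = mat 1"
    using someI_ex[OF ex] by (simp add: matrix_inv_def)
  then have "(var_matrix ks g *v (matrix_inv (var_matrix ks g) *v y)) $ j = y $ j"
    by (simp add: matrix_vector_mul_assoc)
  then have "?K / real (ks j) * (matrix_inv (var_matrix ks g) *v y) $ j = y $ j" by (simp only: V)
  then show ?thesis using K ks[of j] by (simp add: field_simps)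
qed

text \<open>The AMSE weights in coordinates, with \<open>W\<close> the diagonal of the inverse
  variance matrix. As a rational expression it passes to limits without continuity of matrix
  inversion.\<close>

definition optimal_weight :: "('m::finite \<Rightarrow> real) \<Rightarrow> ('m \<Rightarrow> real) \<Rightarrow> 'm \<Rightarrow> real" where
  "optimal_weight B W j = (let q = (\<Sum>i\<in>UNIV. (B i)\<^sup>2 * W i); r = (\<Sum>i\<in>UNIV. W i * B i); w = (\<Sum>i\<in>UNIV. W i)
     in ((1 + q) * W j - r * (W j * B j)) / ((1 + q) * w - r\<^sup>2))"

lemma amse_weights_of_eq:
  fixes ks :: "'m::finite \<Rightarrow> nat" and B :: "real^'m"
  assumes ks: "\<And>j. 1 \<le> ks j" and g: "g \<noteq> 0"
  shows "amse_weights_of B (var_matrix ks g) $ j =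
     optimal_weight (($) B) (\<lambda>j. real (ks j) / (real (\<Sum>i\<in>UNIV. ks i) * g\<^sup>2)) j"
  unfolding amse_weights_of_def optimal_weight_def Let_def
  by (simp add: inner_vec_def var_matrix_inv_mult[OF ks g] power2_eq_square mult_ac)

text \<open>Cauchy-Schwarz with weights \<open>W\<close> bounds the square by the product of the two
  other sums; one further sum of \<open>W\<close> remains and is positive.\<close>

lemma optimal_weight_denominator:
  fixes B W :: "'m::finite \<Rightarrow> real"
  assumes W: "\<And>j. 0 < W j"
  shows "0 < (1 + (\<Sum>i\<in>UNIV. (B i)\<^sup>2 * W i)) * (\<Sum>i\<in>UNIV. W i) - (\<Sum>i\<in>UNIV. W i * B i)\<^sup>2"
proof -
  have "(\<Sum>i\<in>UNIV. W i * B i)\<^sup>2 = (\<Sum>i\<in>UNIV. (sqrt (W i) * B i) * sqrt (W i))\<^sup>2"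
    using W by (intro arg_cong[where f="\<lambda>x. x\<^sup>2"] sum.cong) (simp_all add: mult_ac less_imp_le flip: mult.assoc)
  also have "\<dots> \<le> (\<Sum>i\<in>UNIV. (sqrt (W i) * B i)\<^sup>2) * (\<Sum>i\<in>UNIV. (sqrt (W i))\<^sup>2)"
    by (rule Cauchy_Schwarz_ineq_sum)
  also have "\<dots> = (\<Sum>i\<in>UNIV. (B i)\<^sup>2 * W i) * (\<Sum>i\<in>UNIV. W i)"
    using W by (simp add: power_mult_distrib less_imp_le mult.commute)
  finally have "(\<Sum>i\<in>UNIV. W i * B i)\<^sup>2 \<le> (\<Sum>i\<in>UNIV. (B i)\<^sup>2 * W i) * (\<Sum>i\<in>UNIV. W i)" .
  moreover have "0 < (\<Sum>i\<in>UNIV. W i)" using W by (intro sum_pos) auto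
  ultimately show ?thesis by (simp add: distrib_right)
qed

lemma sum_optimal_weight:
  assumes W: "\<And>j. 0 < W j"
  shows "(\<Sum>j\<in>UNIV. optimal_weight B W j) = 1"
proof -
  have "(\<Sum>j\<in>UNIV. (1 + (\<Sum>i\<in>UNIV. (B i)\<^sup>2 * W i)) * W j - (\<Sum>i\<in>UNIV. W i * B i) * (W j * B j)) =
      (1 + (\<Sum>i\<in>UNIV. (B i)\<^sup>2 * W i)) * (\<Sum>i\<in>UNIV. W i) - (\<Sum>i\<in>UNIV. W i * B i)\<^sup>2"
    by (simp add: sum_subtractf sum_distrib_left power2_eq_square)
  then show ?thesis
    using optimal_weight_denominator[of W B, OF W]
    by (simp add: optimal_weight_def Let_def flip: sum_divide_distrib)
qed

text \<open>The bias part is r over the common denominator. When the variance part is added, the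
  numerator factors as 1 + q times that denominator, which cancels once.\<close>

lemma optimal_weight_value:
  fixes B W :: "'m::finite \<Rightarrow> real"
  assumes W: "\<And>j. 0 < W j"
  defines "q \<equiv> \<Sum>i\<in>UNIV. (B i)\<^sup>2 * W i" and "r \<equiv> \<Sum>i\<in>UNIV. W i * B i" and "w \<equiv> \<Sum>i\<in>UNIV. W i"
  shows "(\<Sum>j\<in>UNIV. B j * optimal_weight B W j)\<^sup>2 + (\<Sum>j\<in>UNIV. (optimal_weight B W j)\<^sup>2 / W j) = (1 + q) / ((1 + q) * w - r\<^sup>2)"
proof -
  define dn where "dn = (1 + q) * w - r\<^sup>2"
  have dn: "0 < dn" using optimal_weight_denominator[of W B, OF W] by (simp add: dn_def q_def r_def w_def)
  have ow: "optimal_weight B W j = W j * ((1 + q) - r * B j) / dn" for j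
    by (simp add: optimal_weight_def Let_def dn_def q_def r_def w_def algebra_simps)
  have "(\<Sum>j\<in>UNIV. B j * optimal_weight B W j) = (\<Sum>j\<in>UNIV. (1 + q) * (W j * B j) - r * ((B j)\<^sup>2 * W j)) / dn"
    unfolding ow sum_divide_distrib by (intro sum.cong refl) (simp add: power2_eq_square algebra_simps)
  also have "(\<Sum>j\<in>UNIV. (1 + q) * (W j * B j) - r * ((B j)\<^sup>2 * W j)) = r"
    unfolding sum_subtractf sum_distrib_left[symmetric] r_def[symmetric] q_def[symmetric] by (simp add: algebra_simps)
  finally have 1: "(\<Sum>j\<in>UNIV. B j * optimal_weight B W j) = r / dn" .
  have "(\<Sum>j\<in>UNIV. (optimal_weight B W j)\<^sup>2 / W j) =
      (\<Sum>j\<in>UNIV. (1 + q)\<^sup>2 * W j - 2 * (1 + q) * r * (W j * B j) + r\<^sup>2 * ((B j)\<^sup>2 * W j)) / dn\<^sup>2"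
    unfolding sum_divide_distrib
  proof (intro sum.cong refl)
    fix j
    have "(optimal_weight B W j)\<^sup>2 / W j = W j * ((1 + q) - r * B j)\<^sup>2 / dn\<^sup>2"
      using W[of j] by (simp add: ow power_divide power_mult_distrib power2_eq_square)
    also have "W j * ((1 + q) - r * B j)\<^sup>2 = (1 + q)\<^sup>2 * W j - 2 * (1 + q) * r * (W j * B j) + r\<^sup>2 * ((B j)\<^sup>2 * W j)"
      by (simp add: power2_eq_square algebra_simps)
    finally show "(optimal_weight B W j)\<^sup>2 / W j = ((1 + q)\<^sup>2 * W j - 2 * (1 + q) * r * (W j * B j) + r\<^sup>2 * ((B j)\<^sup>2 * W j)) / dn\<^sup>2" .
  qed
  also have "(\<Sum>j\<in>UNIV. (1 + q)\<^sup>2 * W j - 2 * (1 + q) * r * (W j * B j) + r\<^sup>2 * ((B j)\<^sup>2 * W j)) =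
      (1 + q)\<^sup>2 * w - 2 * (1 + q) * r * r + r\<^sup>2 * q"
    unfolding sum_subtractf sum.distrib sum_distrib_left[symmetric] r_def[symmetric] q_def[symmetric] w_def[symmetric] ..
  finally have 2: "(\<Sum>j\<in>UNIV. (optimal_weight B W j)\<^sup>2 / W j) = ((1 + q)\<^sup>2 * w - 2 * (1 + q) * r * r + r\<^sup>2 * q) / dn\<^sup>2" .
  have "(r / dn)\<^sup>2 + ((1 + q)\<^sup>2 * w - 2 * (1 + q) * r * r + r\<^sup>2 * q) / dn\<^sup>2 = (1 + q) * dn / dn\<^sup>2"
    unfolding power_divide add_divide_distrib[symmetric]
    by (rule arg_cong[where f="\<lambda>x. x / dn\<^sup>2"]) (simp add: dn_def power2_eq_square algebra_simps)
  also have "\<dots> = (1 + q) / dn" using dn by (simp add: power2_eq_square)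
  finally show ?thesis unfolding 1 2 dn_def .
qed

lemma optimal_weight_tendsto:
  fixes B W :: "'z \<Rightarrow> 'm::finite \<Rightarrow> real"
  assumes B: "\<And>j. ((\<lambda>z. B z j) \<longlongrightarrow> B' j) G" and W: "\<And>j. ((\<lambda>z. W z j) \<longlongrightarrow> W' j) G" and W': "\<And>j. 0 < W' j"
  shows "((\<lambda>z. optimal_weight (B z) (W z) j) \<longlongrightarrow> optimal_weight B' W' j) G"
  unfolding optimal_weight_def Let_def
  using optimal_weight_denominator[of W' B', OF W'] by (intro tendsto_intros B W) auto

text \<open>Division by \<gamma>^2 leaves three ratios: \<open>t\<close> for the squared bias,
  \<open>u\<close> for (s1 / s)^2 and \<open>y\<close> for s2 / s. The comparison factors as 0 < t
  (t (y - u) - (u - 1)). With u > 1 and y > u, the value t = 0 fails on both sides, and otherwise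
  this is a lower threshold for t.\<close>

lemma amse_threshold_algebra:
  fixes \<gamma> \<rho> lam s s1 s2 :: real
  assumes \<gamma>: "\<gamma> > 0" and \<rho>: "\<rho> < 0" and s: "0 < s" "s < s1" "s1\<^sup>2 < s * s2"
  defines "l \<equiv> lam / (1 - \<rho>)"
  defines "q \<equiv> l\<^sup>2 * s2 / (\<gamma>\<^sup>2 * s)"
  defines "r \<equiv> l * s1 / (\<gamma>\<^sup>2 * s)"
  assumes pos: "0 < (1 + q) * (1 / \<gamma>\<^sup>2) - r\<^sup>2"
  shows "(1 + q) / ((1 + q) * (1 / \<gamma>\<^sup>2) - r\<^sup>2) < l\<^sup>2 + \<gamma>\<^sup>2 \<longleftrightarrow>
    \<bar>lam\<bar> > \<gamma> * (1 - \<rho>) * sqrt ((s1\<^sup>2 - s\<^sup>2) / (s * s2 - s1\<^sup>2))"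
proof -
  define t where "t = l\<^sup>2 / \<gamma>\<^sup>2"
  define u where "u = s1\<^sup>2 / s\<^sup>2"
  define y where "y = s2 / s"
  have g2: "\<gamma>\<^sup>2 > 0" using \<gamma> by simp
  have ss: "s\<^sup>2 < s1\<^sup>2" using s by (intro power_strict_mono) auto
  have u1: "u > 1" using s ss by (simp add: u_def)
  have yu: "y > u" using s by (simp add: y_def u_def power2_eq_square field_simps)
  have t0: "t \<ge> 0" by (simp add: t_def)
  have q: "q = t * y" by (simp add: q_def t_def y_def)
  have r: "r\<^sup>2 = t * u / \<gamma>\<^sup>2" using g2 by (simp add: r_def t_def u_def power_mult_distrib power_divide power2_eq_square mult_ac)
  have l2: "l\<^sup>2 = t * \<gamma>\<^sup>2" using g2 by (simp add: t_def)
  have dn: "(1 + q) * (1 / \<gamma>\<^sup>2) - r\<^sup>2 = (1 + t * y - t * u) / \<gamma>\<^sup>2" by (simp add: q r diff_divide_distrib)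
  have dpos: "0 < 1 + t * y - t * u" using pos g2 unfolding dn by (simp add: zero_less_divide_iff)
  have "(1 + q) / ((1 + q) * (1 / \<gamma>\<^sup>2) - r\<^sup>2) < l\<^sup>2 + \<gamma>\<^sup>2 \<longleftrightarrow> (1 + t * y) / (1 + t * y - t * u) * \<gamma>\<^sup>2 < (t + 1) * \<gamma>\<^sup>2"
    unfolding dn unfolding q l2 by (simp add: algebra_simps)
  also have "\<dots> \<longleftrightarrow> (1 + t * y) / (1 + t * y - t * u) < t + 1" using g2 by (rule mult_less_cancel_right_pos)
  also have "\<dots> \<longleftrightarrow> 1 + t * y < (t + 1) * (1 + t * y - t * u)" using dpos by (simp add: pos_divide_less_eq)
  also have "\<dots> \<longleftrightarrow> 0 < t * (t * (y - u) - (u - 1))" by (simp add: algebra_simps)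
  also have "\<dots> \<longleftrightarrow> u - 1 < t * (y - u)"
    using t0 u1 by (cases "t = 0") (auto simp: zero_less_mult_iff)
  also have "\<dots> \<longleftrightarrow> (u - 1) / (y - u) < t" using yu by (simp add: pos_divide_less_eq)
  also have "(u - 1) / (y - u) = (s1\<^sup>2 - s\<^sup>2) / (s * s2 - s1\<^sup>2)"
  proof -
    have "u - 1 = (s1\<^sup>2 - s\<^sup>2) / s\<^sup>2" using s by (simp add: u_def diff_divide_distrib)
    moreover have "y - u = (s * s2 - s1\<^sup>2) / s\<^sup>2" using s by (simp add: y_def u_def diff_divide_distrib power2_eq_square)
    ultimately show ?thesis using s by simp
  qed
  also have "(s1\<^sup>2 - s\<^sup>2) / (s * s2 - s1\<^sup>2) < t \<longleftrightarrow> sqrt ((s1\<^sup>2 - s\<^sup>2) / (s * s2 - s1\<^sup>2)) < sqrt t" by simp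
  also have "sqrt t = \<bar>lam\<bar> / (\<gamma> * (1 - \<rho>))"
  proof -
    have "t = (\<bar>lam\<bar> / (\<gamma> * (1 - \<rho>)))\<^sup>2" by (simp add: t_def l_def power_divide power_mult_distrib mult.commute)
    moreover have "0 \<le> \<bar>lam\<bar> / (\<gamma> * (1 - \<rho>))" using \<gamma> \<rho> by simp
    ultimately show ?thesis by (metis abs_of_nonneg real_sqrt_abs)
  qed
  also have "sqrt ((s1\<^sup>2 - s\<^sup>2) / (s * s2 - s1\<^sup>2)) < \<bar>lam\<bar> / (\<gamma> * (1 - \<rho>)) \<longleftrightarrow>
      \<bar>lam\<bar> > \<gamma> * (1 - \<rho>) * sqrt ((s1\<^sup>2 - s\<^sup>2) / (s * s2 - s1\<^sup>2))"
    using \<gamma> \<rho> by (simp add: pos_less_divide_eq mult.commute)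
  finally show ?thesis .
qed

text \<open>Composes exp z \<ge> 1 + z with ln d \<le> d - 1, the negative \<rho> reversing the
  second; strictness comes from the logarithm.\<close>

lemma powr_neg_tangent:
  assumes "0 < (d::real)" "\<rho> < 0"
  shows "1 + \<rho> * (d - 1) \<le> d powr \<rho>" and "d \<noteq> 1 \<Longrightarrow> 1 + \<rho> * (d - 1) < d powr \<rho>"
proof -
  have e: "1 + \<rho> * ln d \<le> d powr \<rho>" using exp_ge_add_one_self[of "\<rho> * ln d"] assms by (simp add: powr_def)
  have l: "ln d \<le> d - 1" by (rule ln_le_minus_one[OF assms(1)])
  then have "\<rho> * (d - 1) \<le> \<rho> * ln d" using assms by (intro mult_left_mono_neg) auto
  with e show "1 + \<rho> * (d - 1) \<le> d powr \<rho>" by linarith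
  assume "d \<noteq> 1"
  then have "ln d < d - 1" using l ln_eq_minus_one[OF assms(1)] by fastforce
  then have "\<rho> * (d - 1) < \<rho> * ln d" using assms by (intro mult_strict_left_mono_neg) auto
  with e show "1 + \<rho> * (d - 1) < d powr \<rho>" by linarith
qed

section \<open>Normal limits, and the equivalence with the combined Hill estimator\<close>

context pooled_samples
begin

lemma pooled_weissman_measurable:
  assumes [measurable]: "\<And>j. (\<lambda>w. W w $ j) \<in> borel_measurable M"
  shows "(\<lambda>w. pooled_weissman (ns n) (ks n) (x w) q (W w)) \<in> borel_measurable M"
proof -
  have [measurable]: "(\<lambda>w. weissman {..<ns n j} (\<lambda>i. X j i w) (ks n j) q) \<in> borel_measurable M" for j
    by (rule weissman_measurable) auto
  show ?thesis unfolding pooled_weissman_def x_eta by measurable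
qed

lemma pooled_hill_measurable:
  assumes [measurable]: "\<And>j. (\<lambda>w. W w $ j) \<in> borel_measurable M"
  shows "(\<lambda>w. pooled_hill (ns n) (ks n) (x w) (W w)) \<in> borel_measurable M"
proof -
  have [measurable]: "(\<lambda>w. hill {..<ns n j} (\<lambda>i. X j i w) (ks n j)) \<in> borel_measurable M" for j
    by (rule hill_measurable) auto
  show ?thesis unfolding pooled_hill_def x_eta by measurable
qed

lemma combined_weissman_measurable: "(\<lambda>w. combined_weissman (ns n) (x w) (k n) q) \<in> borel_measurable M"
  unfolding comb_weissman_eq by (rule weissman_measurable) (auto simp: card_all)

lemma pooled_weissman_normal:
  fixes W :: "nat \<Rightarrow> 'a \<Rightarrow> real^'m"
  assumes W: "((\<lambda>z. W (fst z) (snd z)) \<longlongrightarrow> \<omega>) (prob_filter M)"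
    and s: "\<forall>\<^sub>F z in prob_filter M. (\<Sum>j\<in>UNIV. W (fst z) (snd z) $ j) = 1"
    and meas: "\<And>n j. (\<lambda>w. W n w $ j) \<in> borel_measurable M"
  shows "tendsto_in_distr M (\<lambda>n w. rate n * (pooled_weissman (ns n) (ks n) (x w) (p n) (W n w) / quantile (cdf D) (1 - p n) - 1))
     (normal_distr (lam / (1 - \<rho>) * (\<Sum>j\<in>UNIV. d $ j powr \<rho> * \<omega> $ j))
        (\<gamma>\<^sup>2 * (\<Sum>j\<in>UNIV. 1 / c $ j) * (\<Sum>j\<in>UNIV. c $ j * (\<omega> $ j)\<^sup>2)))"
    and "0 < \<gamma>\<^sup>2 * (\<Sum>j\<in>UNIV. 1 / c $ j) * (\<Sum>j\<in>UNIV. c $ j * (\<omega> $ j)\<^sup>2)"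
proof -
  have sum1: "(\<Sum>j\<in>UNIV. \<omega> $ j) = 1" by (rule weight_limit_sum[OF W s])
  \<comment> \<open>Weights with sum 1 cannot all vanish, so the limit variance is positive.\<close>
  have "\<exists>j. \<omega> $ j \<noteq> 0"
  proof (rule ccontr)
    assume "\<nexists>j. \<omega> $ j \<noteq> 0"
    then have "(\<Sum>j\<in>UNIV. \<omega> $ j) = 0" by (intro sum.neutral) auto
    with sum1 show False by simp
  qed
  then obtain j0 where "\<omega> $ j0 \<noteq> 0" by blast
  then have "0 < (\<Sum>j\<in>UNIV. c $ j * (\<omega> $ j)\<^sup>2)"
    using c_pos by (intro sum_pos2[of _ j0]) (auto simp: less_imp_le)
  then show pos: "0 < \<gamma>\<^sup>2 * (\<Sum>j\<in>UNIV. 1 / c $ j) * (\<Sum>j\<in>UNIV. c $ j * (\<omega> $ j)\<^sup>2)"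
    using \<gamma>_pos S0_pos by (simp add: S0_def)
  show "tendsto_in_distr M (\<lambda>n w. rate n * (pooled_weissman (ns n) (ks n) (x w) (p n) (W n w) / quantile (cdf D) (1 - p n) - 1))
     (normal_distr (lam / (1 - \<rho>) * (\<Sum>j\<in>UNIV. d $ j powr \<rho> * \<omega> $ j))
        (\<gamma>\<^sup>2 * (\<Sum>j\<in>UNIV. 1 / c $ j) * (\<Sum>j\<in>UNIV. c $ j * (\<omega> $ j)\<^sup>2)))"
  proof (rule tendsto_in_distr_normal[OF scores_measurable(1) _ pos pooled_score_char])
    note [measurable] = pooled_weissman_measurable[OF meas]
    show "(\<lambda>w. rate n * (pooled_weissman (ns n) (ks n) (x w) (p n) (W n w) / quantile (cdf D) (1 - p n) - 1)) \<in> borel_measurable M" for n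
      by measurable
    from tendsto_add[OF pooled_weissman_expansion(1)[OF W s] pooled_hill_expansion[OF sum1]]
    show "((\<lambda>z. rate (fst z) * (pooled_weissman (ns (fst z)) (ks (fst z)) (x (snd z)) (p (fst z)) (W (fst z) (snd z)) / quantile (cdf D) (1 - p (fst z)) - 1)
       - pooled_score \<omega> (fst z) (snd z)) \<longlongrightarrow> lam / (1 - \<rho>) * (\<Sum>j\<in>UNIV. d $ j powr \<rho> * \<omega> $ j)) (prob_filter M)"
      by simp
  qed
qed

lemma combined_weissman_normal:
  "tendsto_in_distr M (\<lambda>n w. rate n * (combined_weissman (ns n) (x w) (k n) (p n) / quantile (cdf D) (1 - p n) - 1))
     (normal_distr (lam / (1 - \<rho>)) (\<gamma>\<^sup>2))"
proof (rule tendsto_in_distr_normal[OF scores_measurable(2) _ _ comb_score_char])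
  note [measurable] = combined_weissman_measurable
  show "(\<lambda>w. rate n * (combined_weissman (ns n) (x w) (k n) (p n) / quantile (cdf D) (1 - p n) - 1)) \<in> borel_measurable M" for n
    by measurable
  from tendsto_add[OF combined_weissman_expansion comb_hill_expansion]
  show "((\<lambda>z. rate (fst z) * (combined_weissman (ns (fst z)) (x (snd z)) (k (fst z)) (p (fst z)) / quantile (cdf D) (1 - p (fst z)) - 1)
       - comb_score (fst z) (snd z)) \<longlongrightarrow> lam / (1 - \<rho>)) (prob_filter M)"
    by simp
qed (use \<gamma>_pos in simp)

lemma var_weights_limit: "(\<lambda>n. var_weights (ks n)) \<longlonglongrightarrow> (\<chi> j. 1 / (c $ j * S0))"
  unfolding var_weights_def using ks_share by (intro vec_tendstoI) (simp add: k_def)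

lemma sum_var_weights: "(\<Sum>j\<in>UNIV. var_weights (ks n) $ j) = 1"
proof -
  have "(\<Sum>j\<in>UNIV. real (ks n j)) = real (k n)" by (simp add: k_def)
  moreover have "(\<Sum>j\<in>UNIV. var_weights (ks n) $ j) = (\<Sum>j\<in>UNIV. real (ks n j)) / real (k n)"
    by (simp only: var_weights_def vec_lambda_beta k_def sum_divide_distrib)
  ultimately show ?thesis using k_pos[of n] by simp
qed

text \<open>Two replacements connect the score sums. First the limiting coefficient of each block
  gives way to sqrt (k_j / k), the block scores being tight. Then the levels lv_j become L, at a
  mean-square cost of \<gamma>^2 |k_j / k - n_j / n| per block eventually, which vanishes in the
  limit because d_j = 1.\<close>

lemma score_comparison:
  assumes d1: "\<And>j. d $ j = 1"
  shows "((\<lambda>z. pooled_score (\<chi> j. 1 / (c $ j * S0)) (fst z) (snd z) - comb_score (fst z) (snd z)) \<longlongrightarrow> 0) (prob_filter M)"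
proof -
  define \<omega> :: "real^'m" where "\<omega> = (\<chi> j. 1 / (c $ j * S0))"
  \<comment> \<open>The intermediate sum has the coefficients of the combined score and the levels
    of the subsamples.\<close>
  define mid where "mid n w = (\<Sum>i\<in>all n. (\<gamma> / sqrt (real (k n))) * score (max 0 (lv (fst i) n)) (E i w))" for n w
  have share: "((\<lambda>z. sqrt (real (ks (fst z) j)) / sqrt (real (k (fst z)))) \<longlongrightarrow> \<omega> $ j * \<kappa> j) (prob_filter M)" for j
  proof -
    have "(\<lambda>n. sqrt (real (ks n j) / real (k n))) \<longlonglongrightarrow> sqrt (1 / (c $ j * S0))"
      by (intro tendsto_real_sqrt ks_share)
    moreover have "sqrt (1 / (c $ j * S0)) = \<omega> $ j * \<kappa> j"
      using c_pos[of j] S0_pos by (simp add: \<omega>_def \<kappa>_def real_sqrt_divide real_div_sqrt field_simps)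
    ultimately show ?thesis by (intro filterlim_fst_compose) (simp add: real_sqrt_divide)
  qed
  have "((\<lambda>z. \<Sum>j\<in>UNIV. (\<omega> $ j * \<kappa> j - sqrt (real (ks (fst z) j)) / sqrt (real (k (fst z)))) * (\<gamma> * sub.tail_score j (fst z) (snd z))) \<longlongrightarrow> (\<Sum>j\<in>(UNIV :: 'm set). 0)) (prob_filter M)"
  proof (intro tendsto_sum tendsto_0_mult_bounded_in_prob)
    fix j
    show "((\<lambda>z. \<omega> $ j * \<kappa> j - sqrt (real (ks (fst z) j)) / sqrt (real (k (fst z)))) \<longlongrightarrow> 0) (prob_filter M)"
      using tendsto_diff[OF tendsto_const share[of j], of "\<omega> $ j * \<kappa> j"] by simp
    show "bounded_in_prob (\<lambda>z. \<gamma> * sub.tail_score j (fst z) (snd z))"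
      by (intro bounded_in_prob_mult bounded_in_prob_const sub.tail_score_bounded)
  qed
  then have "((\<lambda>z. \<Sum>j\<in>UNIV. (\<omega> $ j * \<kappa> j - sqrt (real (ks (fst z) j)) / sqrt (real (k (fst z)))) * (\<gamma> * sub.tail_score j (fst z) (snd z))) \<longlongrightarrow> 0) (prob_filter M)"
    by simp
  then have first_step: "((\<lambda>z. pooled_score \<omega> (fst z) (snd z) - mid (fst z) (snd z)) \<longlongrightarrow> 0) (prob_filter M)"
  proof (rule Lim_transform_eventually)
    have "\<forall>\<^sub>F n in sequentially. \<forall>j\<in>UNIV. 0 < lv j n" by (intro eventually_ball_finite ballI lv_pos) simp
    then have "\<forall>\<^sub>F z in prob_filter M. \<forall>j\<in>UNIV. 0 < lv j (fst z)" by (rule eventually_fst_prob_filter)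
    then show "\<forall>\<^sub>F z in prob_filter M. (\<Sum>j\<in>UNIV. (\<omega> $ j * \<kappa> j - sqrt (real (ks (fst z) j)) / sqrt (real (k (fst z)))) * (\<gamma> * sub.tail_score j (fst z) (snd z))) =
      pooled_score \<omega> (fst z) (snd z) - mid (fst z) (snd z)"
      using pooled_score_eq[of \<omega>]
    proof eventually_elim
      case (elim z)
      have "mid (fst z) (snd z) = (\<Sum>j\<in>UNIV. sqrt (real (ks (fst z) j)) / sqrt (real (k (fst z))) * (\<gamma> * sub.tail_score j (fst z) (snd z)))"
        unfolding mid_def sum_all
      proof (rule sum.cong[OF refl])
        fix j
        have lv: "max 0 (lv j (fst z)) = lv j (fst z)" using elim(1) by (simp add: less_imp_le)
        have k1: "sqrt (real (ks (fst z) j)) \<noteq> 0" using k_ge_1[of "fst z" j] by simp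
        have "(\<Sum>i\<in>sub j (fst z). \<gamma> / sqrt (real (k (fst z))) * score (max 0 (lv (fst i) (fst z))) (E i (snd z))) =
           (\<Sum>i\<in>sub j (fst z). \<gamma> / sqrt (real (k (fst z))) * score (lv j (fst z)) (E i (snd z)))"
          by (intro sum.cong refl) (auto simp: sub_def lv)
        also have "\<dots> = sqrt (real (ks (fst z) j)) / sqrt (real (k (fst z))) * (\<gamma> * sub.tail_score j (fst z) (snd z))"
          unfolding sub.tail_score_def sub_lev score_def[symmetric] sum_distrib_left[symmetric] using k1 by simp
        finally show "(\<Sum>i\<in>sub j (fst z). \<gamma> / sqrt (real (k (fst z))) * score (max 0 (lv (fst i) (fst z))) (E i (snd z))) =
           sqrt (real (ks (fst z) j)) / sqrt (real (k (fst z))) * (\<gamma> * sub.tail_score j (fst z) (snd z))" .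
      qed
      then show ?case unfolding elim(2) by (simp add: sum_subtractf[symmetric] algebra_simps)
    qed
  qed
  define Y where "Y n w = (\<Sum>i\<in>all n. (\<gamma> / sqrt (real (k n))) * (score (max 0 (lv (fst i) n)) (E i w) - score (max 0 (L n)) (E i w)))" for n w
  define v where "v n i = (\<gamma> / sqrt (real (k n)))\<^sup>2 * \<bar>exp (- max 0 (lv (fst i) n)) - exp (- max 0 (L n))\<bar>" for n and i :: "'m \<times> nat"
  have Y2: "has_bochner_integral M (\<lambda>w. (Y n w)\<^sup>2) (\<Sum>i\<in>all n. v n i)" for n
    unfolding Y_def
  proof (rule centered_sum_second_moment)
    fix i :: "'m \<times> nat"
    let ?a = "\<gamma> / sqrt (real (k n))" and ?s = "max 0 (lv (fst i) n)" and ?t = "max 0 (L n)"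
    show "has_bochner_integral std_exponential (\<lambda>y. ?a * (score ?s y - score ?t y)) 0"
      using has_bochner_integral_mult_right[OF has_bochner_integral_diff[OF score_moments(1)[of ?s] score_moments(1)[of ?t]], of ?a]
      by simp
    show "has_bochner_integral std_exponential (\<lambda>y. (?a * (score ?s y - score ?t y))\<^sup>2) (v n i)"
      unfolding v_def power_mult_distrib
      by (intro has_bochner_integral_mult_right score_diff_second_moment) auto
  qed (use card_all in auto)
  have "(\<lambda>n. \<Sum>j\<in>UNIV. \<gamma>\<^sup>2 * \<bar>real (ks n j) / real (k n) - real (ns n j) / real n\<bar>) \<longlonglongrightarrow> (\<Sum>j\<in>(UNIV :: 'm set). \<gamma>\<^sup>2 * \<bar>0\<bar>)"
  proof (intro tendsto_sum tendsto_mult tendsto_const tendsto_rabs)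
    fix j
    have "(1 / b $ j) / (\<Sum>i\<in>UNIV. 1 / b $ i) = d $ j * (1 / (c $ j * S0))"
      using c_pos[of j] S0_pos by (simp add: d_def S0_def[symmetric])
    then show "(\<lambda>n. real (ks n j) / real (k n) - real (ns n j) / real n) \<longlonglongrightarrow> 0"
      using tendsto_diff[OF ks_share[of j] ns_share[of j]] by (simp add: d1)
  qed
  then have lim: "(\<lambda>n. \<Sum>j\<in>UNIV. \<gamma>\<^sup>2 * \<bar>real (ks n j) / real (k n) - real (ns n j) / real n\<bar>) \<longlonglongrightarrow> 0" by simp
  have vlim: "(\<lambda>n. \<Sum>i\<in>all n. v n i) \<longlonglongrightarrow> 0"
  proof (rule Lim_transform_eventually[OF lim])
    have e: "\<forall>\<^sub>F n in sequentially. exp (- max 0 (L n)) = real (k n) / real n \<and> 0 < n"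
      using L_pos n_pos comb.card_exp_lev
      by eventually_elim (simp add: card_all comb_lev max_absorb2 field_simps)
    show "\<forall>\<^sub>F n in sequentially. (\<Sum>j\<in>UNIV. \<gamma>\<^sup>2 * \<bar>real (ks n j) / real (k n) - real (ns n j) / real n\<bar>) = (\<Sum>i\<in>all n. v n i)"
      using ks_exp_lv e
    proof eventually_elim
      case (elim n)
      show ?case unfolding sum_all
      proof (rule sum.cong[OF refl])
        fix j
        have "(\<Sum>i\<in>sub j n. v n i) = (\<Sum>i\<in>sub j n. (\<gamma> / sqrt (real (k n)))\<^sup>2 * \<bar>exp (- max 0 (lv j n)) - exp (- max 0 (L n))\<bar>)"
          by (intro sum.cong refl) (auto simp: sub_def v_def)
        also have "\<dots> = \<gamma>\<^sup>2 / real (k n) * (real (ns n j) * \<bar>exp (- max 0 (lv j n)) - exp (- max 0 (L n))\<bar>)"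
          by (simp add: card_sub power_divide)
        also have "real (ns n j) * \<bar>exp (- max 0 (lv j n)) - exp (- max 0 (L n))\<bar> =
            \<bar>real (ns n j) * exp (- max 0 (lv j n)) - real (ns n j) * exp (- max 0 (L n))\<bar>"
          by (simp add: abs_mult flip: right_diff_distrib)
        also have "\<dots> = \<bar>real (ks n j) - real (ns n j) * (real (k n) / real n)\<bar>" using elim by simp
        also have "\<gamma>\<^sup>2 / real (k n) * \<bar>real (ks n j) - real (ns n j) * (real (k n) / real n)\<bar> =
            \<gamma>\<^sup>2 * \<bar>(real (ks n j) - real (ns n j) * (real (k n) / real n)) / real (k n)\<bar>" by simp
        also have "(real (ks n j) - real (ns n j) * (real (k n) / real n)) / real (k n) = real (ks n j) / real (k n) - real (ns n j) / real n"
          using k_pos[of n] by (simp add: diff_divide_distrib)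
        finally show "\<gamma>\<^sup>2 * \<bar>real (ks n j) / real (k n) - real (ns n j) / real n\<bar> = (\<Sum>i\<in>sub j n. v n i)" by simp
      qed
    qed
  qed
  have "((\<lambda>z. Y (fst z) (snd z)) \<longlongrightarrow> 0) (prob_filter M)"
  proof (rule tendsto_0_second_moment)
    show "integrable M (\<lambda>w. (Y n w)\<^sup>2)" for n using Y2[of n] by (simp add: has_bochner_integral_iff)
    show "Y n \<in> borel_measurable M" for n unfolding Y_def by measurable
    show "(\<lambda>n. expectation (\<lambda>w. (Y n w)\<^sup>2)) \<longlonglongrightarrow> 0" using vlim Y2 by (simp add: has_bochner_integral_iff)
  qed
  moreover have "Y n w = mid n w - comb_score n w" for n w
    unfolding Y_def mid_def comb_score_def sum_subtractf[symmetric] by (simp add: right_diff_distrib)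
  ultimately have "((\<lambda>z. mid (fst z) (snd z) - comb_score (fst z) (snd z)) \<longlongrightarrow> 0) (prob_filter M)" by simp
  from tendsto_add[OF first_step this] show ?thesis by (simp add: \<omega>_def)
qed

text \<open>With all d_j = 1 the pooled bias is lam / (1 - \<rho>) times the sum of the limit
  weights, hence the combined bias; the score sums agree up to o_P(1), so the two expansions
  cancel.\<close>

lemma hill_equivalence:
  assumes d1: "\<And>j. d $ j = 1"
  shows "((\<lambda>z. rate (fst z) * (pooled_weissman (ns (fst z)) (ks (fst z)) (x (snd z)) (p (fst z)) (var_weights (ks (fst z))) / quantile (cdf D) (1 - p (fst z))
     - combined_weissman (ns (fst z)) (x (snd z)) (k (fst z)) (p (fst z)) / quantile (cdf D) (1 - p (fst z)))) \<longlongrightarrow> 0) (prob_filter M)"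
proof -
  define \<omega> :: "real^'m" where "\<omega> = (\<chi> j. 1 / (c $ j * S0))"
  have W: "((\<lambda>z. var_weights (ks (fst z))) \<longlongrightarrow> \<omega>) (prob_filter M)"
    unfolding \<omega>_def by (rule filterlim_fst_compose[OF var_weights_limit])
  have s: "\<forall>\<^sub>F z in prob_filter M. (\<Sum>j\<in>UNIV. var_weights (ks (fst z)) $ j) = 1"
    by (simp add: sum_var_weights)
  have sum1: "(\<Sum>j\<in>UNIV. \<omega> $ j) = 1" by (rule weight_limit_sum[OF W s])
  note E = pooled_weissman_expansion(1)[of "\<lambda>n w. var_weights (ks n)", OF W s] pooled_hill_expansion[OF sum1]
    score_comparison[OF d1, folded \<omega>_def] comb_hill_expansion combined_weissman_expansion
  have eq: "lam / (1 - \<rho>) * (\<Sum>j\<in>UNIV. d $ j powr \<rho> * \<omega> $ j) = lam / (1 - \<rho>)" using sum1 by (simp add: d1)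
  from tendsto_diff[OF tendsto_add[OF tendsto_add[OF E(1) E(2)] E(3)] tendsto_add[OF E(4) E(5)]]
  show ?thesis unfolding eq by (simp add: algebra_simps)
qed

end

text \<open>The chosen inverse is given by no formula when g = 0, but then bias vector and variance
  matrix are both zero and the value, whatever it is, is constant. Elsewhere the coordinate formula
  applies.\<close>

lemma amse_weights_of_measurable:
  fixes ns ks :: "'m::finite \<Rightarrow> nat" and g b r :: "'a \<Rightarrow> real"
  assumes ks: "\<And>j. 1 \<le> ks j"
    and [measurable]: "g \<in> borel_measurable M" "b \<in> borel_measurable M" "r \<in> borel_measurable M"
  shows "(\<lambda>w. amse_weights_of (bias_vector ns ks (g w) (b w) (r w)) (var_matrix ks (g w)) $ j) \<in> borel_measurable M"
proof -
  have eq: "amse_weights_of (bias_vector ns ks (g w) (b w) (r w)) (var_matrix ks (g w)) $ j =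
     (if g w = 0 then amse_weights_of 0 (var_matrix ks 0) $ j
      else optimal_weight (\<lambda>i. sqrt (real (\<Sum>i\<in>UNIV. ks i)) * (g w * b w / (1 - r w)) * (real (ns i) / real (ks i)) powr r w)
        (\<lambda>j. real (ks j) / (real (\<Sum>i\<in>UNIV. ks i) * (g w)\<^sup>2)) j)" for w
  proof (cases "g w = 0")
    case True
    then have "bias_vector ns ks (g w) (b w) (r w) = 0" by (simp add: bias_vector_def)
    with True show ?thesis by simp
  next
    case False
    have "($) (bias_vector ns ks (g w) (b w) (r w)) =
        (\<lambda>i. sqrt (real (\<Sum>i\<in>UNIV. ks i)) * (g w * b w / (1 - r w)) * (real (ns i) / real (ks i)) powr r w)"
      by (rule ext) (simp add: bias_vector_def)
    then show ?thesis by (simp only: amse_weights_of_eq[OF ks False] False if_False)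
  qed
  show ?thesis unfolding eq optimal_weight_def Let_def by measurable
qed

lemma (in prob_space) weight_sequence_limit:
  fixes W :: "nat \<Rightarrow> 'a \<Rightarrow> real^'m::finite"
  assumes W: "weight_sequence M W v"
  shows "((\<lambda>z. W (fst z) (snd z)) \<longlongrightarrow> v) (prob_filter M)"
    and "\<forall>\<^sub>F z in prob_filter M. (\<Sum>j\<in>UNIV. W (fst z) (snd z) $ j) = 1"
    and "\<And>n j. (\<lambda>w. W n w $ j) \<in> borel_measurable M"
proof -
  have P: "tendsto_in_prob M W v" and AE1: "\<And>n. AE w in M. (\<Sum>j\<in>UNIV. W n w $ j) = 1"
    using W by (auto simp: weight_sequence_def)
  show "((\<lambda>z. W (fst z) (snd z)) \<longlongrightarrow> v) (prob_filter M)" using P by (simp add: tendsto_in_prob_iff)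
  have "AE w in M. \<forall>n. (\<Sum>j\<in>UNIV. W n w $ j) = 1" using AE1 by (simp add: AE_all_countable)
  then show "\<forall>\<^sub>F z in prob_filter M. (\<Sum>j\<in>UNIV. W (fst z) (snd z) $ j) = 1"
    by (rule eventually_prob_filter_AE)
  fix n j
  have "W n \<in> borel_measurable M" using P by (simp add: tendsto_in_prob_iff)
  then show "(\<lambda>w. W n w $ j) \<in> borel_measurable M"
    by (rule measurable_compose) (intro borel_measurable_continuous_onI continuous_intros)
qed

section \<open>The limit of the estimated AMSE weights and the comparison of asymptotic
  errors\<close>

context pooled_samples
begin

context
  fixes \<beta> :: real and \<beta>h \<rho>h \<omega>g \<omega>b \<omega>r :: "nat \<Rightarrow> 'a \<Rightarrow> real^'m" and vg vb vr :: "real^'m"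
  assumes A_eq: "\<And>t. t > 0 \<Longrightarrow> A t = \<gamma> * \<beta> * t powr \<rho>"
    and \<beta>h: "\<And>j. tendsto_in_prob M (\<lambda>n w. \<beta>h n w $ j) \<beta>"
    and \<rho>h_meas: "\<And>n j. (\<lambda>w. \<rho>h n w $ j) \<in> borel_measurable M"
    and \<rho>h: "\<And>j. little_o_prob M (\<lambda>n w. (\<rho>h n w $ j - \<rho>) * ln (real (ns n j)))"
    and wg: "weight_sequence M \<omega>g vg" and wb: "weight_sequence M \<omega>b vb" and wr: "weight_sequence M \<omega>r vr"
begin

definition gh :: "nat \<Rightarrow> 'a \<Rightarrow> real" where "gh n w = pooled_hill (ns n) (ks n) (x w) (\<omega>g n w)"
definition bh :: "nat \<Rightarrow> 'a \<Rightarrow> real" where "bh n w = (\<Sum>j\<in>UNIV. \<omega>b n w $ j * \<beta>h n w $ j)"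
definition rh :: "nat \<Rightarrow> 'a \<Rightarrow> real" where "rh n w = (\<Sum>j\<in>UNIV. \<omega>r n w $ j * \<rho>h n w $ j)"

lemma amse_weights_unfold:
  "amse_weights (ns n) (ks n) (x w) (\<beta>h n w) (\<rho>h n w) (\<omega>g n w) (\<omega>b n w) (\<omega>r n w) =
   amse_weights_of (bias_vector (ns n) (ks n) (gh n w) (bh n w) (rh n w)) (var_matrix (ks n) (gh n w))"
  by (simp add: amse_weights_def Let_def gh_def bh_def rh_def)

lemma estimators_measurable [measurable]:
  "gh n \<in> borel_measurable M" "bh n \<in> borel_measurable M" "rh n \<in> borel_measurable M"
proof -
  note [measurable] = weight_sequence_limit(3)[OF wg] weight_sequence_limit(3)[OF wb] weight_sequence_limit(3)[OF wr] \<rho>h_meas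
  have [measurable]: "(\<lambda>w. \<beta>h n w $ j) \<in> borel_measurable M" for n j using \<beta>h[of j] by (simp add: tendsto_in_prob_iff)
  show "gh n \<in> borel_measurable M" unfolding gh_def by (intro pooled_hill_measurable) measurable
  show "bh n \<in> borel_measurable M" unfolding bh_def by measurable
  show "rh n \<in> borel_measurable M" unfolding rh_def by measurable
qed

lemma ln_ns_inf: "filterlim (\<lambda>n. ln (real (ns n j))) at_top sequentially"
proof -
  have "filterlim (\<lambda>n. real (ns n j) / real (ks n j) * real (ks n j)) at_top sequentially"
    by (intro filterlim_at_top_mult_at_top ns_over_ks sub.real_k_top)
  moreover have "real (ns n j) / real (ks n j) * real (ks n j) = real (ns n j)" for n
    using k_ge_1[of n j] by simp
  ultimately have "filterlim (\<lambda>n. real (ns n j)) at_top sequentially" by simp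
  then show ?thesis by (rule filterlim_compose[OF ln_at_top])
qed

lemma gh_limit: "((\<lambda>z. gh (fst z) (snd z)) \<longlongrightarrow> \<gamma>) (prob_filter M)"
proof -
  note w = weight_sequence_limit[OF wg]
  have "((\<lambda>z. \<Sum>j\<in>UNIV. \<omega>g (fst z) (snd z) $ j * sub_hill j z) \<longlongrightarrow> (\<Sum>j\<in>UNIV. vg $ j * \<gamma>)) (prob_filter M)"
    unfolding sub_hill_def by (intro tendsto_sum tendsto_mult tendsto_vec_nth w sub.hill_consistent)
  moreover have "(\<Sum>j\<in>UNIV. vg $ j * \<gamma>) = \<gamma>"
    using weight_limit_sum[OF w(1,2)] by (simp flip: sum_distrib_right)
  ultimately show ?thesis by (simp add: gh_def pooled_hill_def sub_hill_eq)
qed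

lemma bh_limit: "((\<lambda>z. bh (fst z) (snd z)) \<longlongrightarrow> \<beta>) (prob_filter M)"
proof -
  note w = weight_sequence_limit[OF wb]
  have "((\<lambda>z. bh (fst z) (snd z)) \<longlongrightarrow> (\<Sum>j\<in>UNIV. vb $ j * \<beta>)) (prob_filter M)"
    unfolding bh_def using \<beta>h by (intro tendsto_sum tendsto_mult tendsto_vec_nth w) (simp add: tendsto_in_prob_iff)
  moreover have "(\<Sum>j\<in>UNIV. vb $ j * \<beta>) = \<beta>"
    using weight_limit_sum[OF w(1,2)] by (simp flip: sum_distrib_right)
  ultimately show ?thesis by simp
qed

text \<open>Sample sizes are asymptotically proportional and their logarithms diverge. This
  transfers the rate of an estimate from subsample i, measured by ln n_i, to the level of subsample
  j.\<close>

lemma ln_ns_ratio: "(\<lambda>n. ln (real (ns n j)) / ln (real (ns n i))) \<longlonglongrightarrow> 1"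
proof -
  have sh: "(\<lambda>n. (real (ns n j) / real n) / (real (ns n i) / real n)) \<longlonglongrightarrow>
     ((1 / b $ j) / (\<Sum>i\<in>UNIV. 1 / b $ i)) / ((1 / b $ i) / (\<Sum>i\<in>UNIV. 1 / b $ i))"
    using b_pos[of i] B0_pos by (intro tendsto_divide ns_share) auto
  have "0 < ((1 / b $ j) / (\<Sum>i\<in>UNIV. 1 / b $ i)) / ((1 / b $ i) / (\<Sum>i\<in>UNIV. 1 / b $ i))"
    using b_pos B0_pos by simp
  then have l1: "(\<lambda>n. ln ((real (ns n j) / real n) / (real (ns n i) / real n))) \<longlonglongrightarrow>
     ln (((1 / b $ j) / (\<Sum>i\<in>UNIV. 1 / b $ i)) / ((1 / b $ i) / (\<Sum>i\<in>UNIV. 1 / b $ i)))"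
    by (intro tendsto_ln sh) auto
  have l2: "(\<lambda>n. inverse (ln (real (ns n i)))) \<longlonglongrightarrow> 0" by (rule tendsto_inverse_0_at_top[OF ln_ns_inf])
  have "(\<lambda>n. 1 + ln ((real (ns n j) / real n) / (real (ns n i) / real n)) * inverse (ln (real (ns n i)))) \<longlonglongrightarrow>
     1 + ln (((1 / b $ j) / (\<Sum>i\<in>UNIV. 1 / b $ i)) / ((1 / b $ i) / (\<Sum>i\<in>UNIV. 1 / b $ i))) * 0"
    by (rule tendsto_add[OF tendsto_const tendsto_mult[OF l1 l2]])
  then have l: "(\<lambda>n. 1 + ln ((real (ns n j) / real n) / (real (ns n i) / real n)) * inverse (ln (real (ns n i)))) \<longlonglongrightarrow> 1" by simp
  have "\<forall>\<^sub>F n in sequentially. 0 < ln (real (ns n i))" using ln_ns_inf[of i] by (simp add: filterlim_at_top_dense)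
  then show ?thesis
  proof (intro Lim_transform_eventually[OF l])
    show "\<forall>\<^sub>F n in sequentially. 1 + ln ((real (ns n j) / real n) / (real (ns n i) / real n)) * inverse (ln (real (ns n i))) = ln (real (ns n j)) / ln (real (ns n i))"
      using \<open>\<forall>\<^sub>F n in sequentially. 0 < ln (real (ns n i))\<close> ns_pos[of i] ns_pos[of j] n_pos
    proof eventually_elim
      case (elim n)
      have "ln ((real (ns n j) / real n) / (real (ns n i) / real n)) = ln (real (ns n j)) - ln (real (ns n i))"
        using elim by (simp add: ln_div)
      then show ?case using elim by (simp add: field_simps)
    qed
  qed
qed

text \<open>The logarithmic rate enters here: the exponent error is multiplied by ln (n_j / k_j), at
  most ln n_j because k_j \<ge> 1. Consequently n_j / k_j raised to the estimated and to the true
  exponent have quotient tending to 1.\<close>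

lemma rh_lv: "((\<lambda>z. (rh (fst z) (snd z) - \<rho>) * lv j (fst z)) \<longlongrightarrow> 0) (prob_filter M)"
proof -
  note w = weight_sequence_limit[OF wr]
  have bd: "bounded_in_prob (\<lambda>z. lv j (fst z) / ln (real (ns (fst z) i)))" for i
  proof (rule bounded_in_prob_comparison[OF bounded_in_prob_tendsto[OF filterlim_fst_compose[OF ln_ns_ratio[of j i]]]])
    have "\<forall>\<^sub>F n in sequentially. \<bar>lv j n / ln (real (ns n i))\<bar> \<le> \<bar>ln (real (ns n j)) / ln (real (ns n i))\<bar>"
      using lv_pos[of j] ns_pos[of j]
    proof eventually_elim
      case (elim n)
      have "lv j n = ln (real (ns n j)) - ln (real (ks n j))"
        using elim k_ge_1[of n j] by (simp add: lv_def ln_div)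
      then have "lv j n \<le> ln (real (ns n j))" using k_ge_1[of n j] by simp
      then show ?case using elim by (simp add: abs_divide divide_right_mono)
    qed
    then show "\<forall>\<^sub>F z in prob_filter M. \<bar>lv j (fst z) / ln (real (ns (fst z) i))\<bar> \<le> \<bar>ln (real (ns (fst z) j)) / ln (real (ns (fst z) i))\<bar>"
      by (rule eventually_fst_prob_filter)
  qed
  have "((\<lambda>z. \<Sum>i\<in>UNIV. \<omega>r (fst z) (snd z) $ i * (((\<rho>h (fst z) (snd z) $ i - \<rho>) * ln (real (ns (fst z) i))) * (lv j (fst z) / ln (real (ns (fst z) i))))) \<longlongrightarrow>
     (\<Sum>i\<in>UNIV. vr $ i * 0)) (prob_filter M)"
  proof (rule tendsto_sum)
    fix i
    have r: "((\<lambda>z. (\<rho>h (fst z) (snd z) $ i - \<rho>) * ln (real (ns (fst z) i))) \<longlongrightarrow> 0) (prob_filter M)"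
      using \<rho>h[of i] by (simp add: tendsto_in_prob_iff)
    show "((\<lambda>z. \<omega>r (fst z) (snd z) $ i * (((\<rho>h (fst z) (snd z) $ i - \<rho>) * ln (real (ns (fst z) i))) * (lv j (fst z) / ln (real (ns (fst z) i))))) \<longlongrightarrow> vr $ i * 0) (prob_filter M)"
      by (rule tendsto_mult[OF tendsto_vec_nth[OF w(1)] tendsto_0_mult_bounded_in_prob[OF r bd]])
  qed
  then have "((\<lambda>z. \<Sum>i\<in>UNIV. \<omega>r (fst z) (snd z) $ i * (((\<rho>h (fst z) (snd z) $ i - \<rho>) * ln (real (ns (fst z) i))) * (lv j (fst z) / ln (real (ns (fst z) i))))) \<longlongrightarrow> 0) (prob_filter M)"
    by simp
  then show ?thesis
  proof (rule Lim_transform_eventually)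
    have "\<forall>\<^sub>F n in sequentially. \<forall>i\<in>UNIV. 0 < ln (real (ns n i))"
      using ln_ns_inf by (intro eventually_ball_finite ballI) (simp_all add: filterlim_at_top_dense)
    then have "\<forall>\<^sub>F z in prob_filter M. \<forall>i\<in>UNIV. 0 < ln (real (ns (fst z) i))" by (rule eventually_fst_prob_filter)
    then show "\<forall>\<^sub>F z in prob_filter M. (\<Sum>i\<in>UNIV. \<omega>r (fst z) (snd z) $ i * (((\<rho>h (fst z) (snd z) $ i - \<rho>) * ln (real (ns (fst z) i))) * (lv j (fst z) / ln (real (ns (fst z) i))))) =
      (rh (fst z) (snd z) - \<rho>) * lv j (fst z)"
      using w(2)
    proof eventually_elim
      case (elim z)
      have "(\<Sum>i\<in>UNIV. \<omega>r (fst z) (snd z) $ i * (((\<rho>h (fst z) (snd z) $ i - \<rho>) * ln (real (ns (fst z) i))) * (lv j (fst z) / ln (real (ns (fst z) i))))) =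
         (\<Sum>i\<in>UNIV. \<omega>r (fst z) (snd z) $ i * (\<rho>h (fst z) (snd z) $ i - \<rho>)) * lv j (fst z)"
        unfolding sum_distrib_right
      proof (rule sum.cong[OF refl])
        fix i
        have "ln (real (ns (fst z) i)) \<noteq> 0" using elim(1) by (metis UNIV_I less_irrefl)
        then show "\<omega>r (fst z) (snd z) $ i * (((\<rho>h (fst z) (snd z) $ i - \<rho>) * ln (real (ns (fst z) i))) * (lv j (fst z) / ln (real (ns (fst z) i)))) =
          \<omega>r (fst z) (snd z) $ i * (\<rho>h (fst z) (snd z) $ i - \<rho>) * lv j (fst z)" by simp
      qed
      also have "(\<Sum>i\<in>UNIV. \<omega>r (fst z) (snd z) $ i * (\<rho>h (fst z) (snd z) $ i - \<rho>)) = rh (fst z) (snd z) - (\<Sum>i\<in>UNIV. \<omega>r (fst z) (snd z) $ i) * \<rho>"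
        by (simp add: rh_def right_diff_distrib sum_subtractf sum_distrib_right)
      finally show ?case using elim(2) by simp
    qed
  qed
qed

lemma rh_limit: "((\<lambda>z. rh (fst z) (snd z)) \<longlongrightarrow> \<rho>) (prob_filter M)"
proof -
  have lv_inf: "filterlim (lv j) at_top sequentially" for j using sub.lev_top[of j] by (simp add: sub_lev[abs_def])
  have "((\<lambda>z. (rh (fst z) (snd z) - \<rho>) * lv first (fst z) * inverse (lv first (fst z))) \<longlongrightarrow> 0 * 0) (prob_filter M)"
    by (intro tendsto_mult rh_lv filterlim_fst_compose[OF tendsto_inverse_0_at_top[OF lv_inf]])
  then have "((\<lambda>z. (rh (fst z) (snd z) - \<rho>) * lv first (fst z) * inverse (lv first (fst z))) \<longlongrightarrow> 0) (prob_filter M)" by simp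
  then have "((\<lambda>z. rh (fst z) (snd z) - \<rho>) \<longlongrightarrow> 0) (prob_filter M)"
    by (rule Lim_transform_eventually)
       (use eventually_fst_prob_filter[OF lv_pos[of first]] in eventually_elim, simp)
  then show ?thesis by (simp add: LIM_zero_iff)
qed

text \<open>If A vanished, g / A would be identically 0 by the convention for division, against the
  nonzero limit -1 / \<rho>. This permits normalising by \<gamma> \<beta> in the bias
  vector.\<close>

lemma \<beta>_nonzero: "\<beta> \<noteq> 0"
proof
  assume "\<beta> = 0"
  then have "A (exp s) = 0" for s by (simp add: A_eq)
  with g_A have "((\<lambda>s. 0) \<longlongrightarrow> - 1 / \<rho>) (at_top :: real filter)" by simp
  then have "- 1 / \<rho> = 0" by (simp add: tendsto_const_iff)
  then show False using \<rho>_neg by simp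
qed

text \<open>For A (t) = \<gamma> \<beta> t^\<rho>, the main factor is sqrt k A (n_j / k_j), with
  limit lam d_j^\<rho>; consistency and the exponent estimate take care of the other
  factors.\<close>

lemma bias_vector_limit:
  "((\<lambda>z. bias_vector (ns (fst z)) (ks (fst z)) (gh (fst z) (snd z)) (bh (fst z) (snd z)) (rh (fst z) (snd z)) $ j)
     \<longlongrightarrow> lam / (1 - \<rho>) * d $ j powr \<rho>) (prob_filter M)"
proof -
  have A1: "(\<lambda>n. sqrt (real (k n)) * (\<gamma> * \<beta> * exp (\<rho> * L n))) \<longlonglongrightarrow> lam"
  proof (rule Lim_transform_eventually[OF bias])
    show "\<forall>\<^sub>F n in sequentially. sqrt (real (k n)) * A (real n / real (k n)) = sqrt (real (k n)) * (\<gamma> * \<beta> * exp (\<rho> * L n))"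
      using n_pos by eventually_elim (use k_pos in \<open>simp add: A_eq powr_def L_def\<close>)
  qed
  have "(\<lambda>n. sqrt (real (k n)) * (\<gamma> * \<beta> * exp (\<rho> * L n)) * exp (\<rho> * (lv j n - L n))) \<longlonglongrightarrow> lam * exp (\<rho> * ln (d $ j))"
    by (intro tendsto_mult A1 tendsto_exp tendsto_const lv_diff)
  moreover have "sqrt (real (k n)) * (\<gamma> * \<beta> * exp (\<rho> * L n)) * exp (\<rho> * (lv j n - L n)) = sqrt (real (k n)) * (\<gamma> * \<beta> * exp (\<rho> * lv j n))" for n
    by (simp add: right_diff_distrib exp_diff)
  ultimately have A2: "(\<lambda>n. sqrt (real (k n)) * (\<gamma> * \<beta> * exp (\<rho> * lv j n))) \<longlonglongrightarrow> lam * d $ j powr \<rho>"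
    using d_pos[of j] by (simp add: powr_def)
  have "((\<lambda>z. sqrt (real (k (fst z))) * (\<gamma> * \<beta> * exp (\<rho> * lv j (fst z))) *
      (gh (fst z) (snd z) * bh (fst z) (snd z) / (\<gamma> * \<beta>)) / (1 - rh (fst z) (snd z)) * exp ((rh (fst z) (snd z) - \<rho>) * lv j (fst z))) \<longlongrightarrow>
      lam * d $ j powr \<rho> * (\<gamma> * \<beta> / (\<gamma> * \<beta>)) / (1 - \<rho>) * exp 0) (prob_filter M)"
    using \<gamma>_pos \<beta>_nonzero \<rho>_neg
    by (intro tendsto_mult tendsto_divide tendsto_diff tendsto_const tendsto_exp filterlim_fst_compose[OF A2] gh_limit bh_limit rh_limit rh_lv) auto
  also have "lam * d $ j powr \<rho> * (\<gamma> * \<beta> / (\<gamma> * \<beta>)) / (1 - \<rho>) * exp 0 = lam / (1 - \<rho>) * d $ j powr \<rho>"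
    using \<gamma>_pos \<beta>_nonzero by simp
  finally show ?thesis
  proof (rule Lim_transform_eventually)
    show "\<forall>\<^sub>F z in prob_filter M. sqrt (real (k (fst z))) * (\<gamma> * \<beta> * exp (\<rho> * lv j (fst z))) *
      (gh (fst z) (snd z) * bh (fst z) (snd z) / (\<gamma> * \<beta>)) / (1 - rh (fst z) (snd z)) * exp ((rh (fst z) (snd z) - \<rho>) * lv j (fst z)) =
      bias_vector (ns (fst z)) (ks (fst z)) (gh (fst z) (snd z)) (bh (fst z) (snd z)) (rh (fst z) (snd z)) $ j"
      using eventually_fst_prob_filter[OF ns_pos[of j]]
    proof eventually_elim
      case (elim z)
      have "(real (ns (fst z) j) / real (ks (fst z) j)) powr rh (fst z) (snd z) = exp (rh (fst z) (snd z) * lv j (fst z))"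
        using elim k_ge_1[of "fst z" j] by (simp add: powr_def lv_def)
      also have "\<dots> = exp (\<rho> * lv j (fst z)) * exp ((rh (fst z) (snd z) - \<rho>) * lv j (fst z))"
        by (simp add: exp_add[symmetric] algebra_simps)
      finally show ?case using \<gamma>_pos \<beta>_nonzero by (simp add: bias_vector_def k_def)
    qed
  qed
qed

text \<open>\<open>B'\<close> and \<open>W'\<close> are the limits of the estimated bias vector and
  of the diagonal of the inverse estimated variance matrix.\<close>

definition B' :: "'m \<Rightarrow> real" where "B' j = lam / (1 - \<rho>) * d $ j powr \<rho>"
definition W' :: "'m \<Rightarrow> real" where "W' j = 1 / (c $ j * S0) / \<gamma>\<^sup>2"

lemma W'_pos: "0 < W' j"
  using c_pos[of j] S0_pos \<gamma>_pos by (simp add: W'_def)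

lemma gh_nonzero: "\<forall>\<^sub>F z in prob_filter M. gh (fst z) (snd z) \<noteq> 0"
  using \<gamma>_pos by (intro tendsto_imp_eventually_ne[OF gh_limit]) auto

abbreviation Wa :: "nat \<Rightarrow> 'a \<Rightarrow> real^'m" where
  "Wa n w \<equiv> amse_weights (ns n) (ks n) (x w) (\<beta>h n w) (\<rho>h n w) (\<omega>g n w) (\<omega>b n w) (\<omega>r n w)"

lemma amse_weights_eq_optimal:
  "\<forall>\<^sub>F z in prob_filter M. \<forall>j. Wa (fst z) (snd z) $ j =
     optimal_weight (\<lambda>i. bias_vector (ns (fst z)) (ks (fst z)) (gh (fst z) (snd z)) (bh (fst z) (snd z)) (rh (fst z) (snd z)) $ i)
       (\<lambda>j. real (ks (fst z) j) / (real (k (fst z)) * (gh (fst z) (snd z))\<^sup>2)) j"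
  using gh_nonzero
  by eventually_elim (simp add: amse_weights_unfold amse_weights_of_eq[OF k_ge_1] k_def)

lemma amse_weights_limit:
  "((\<lambda>z. Wa (fst z) (snd z)) \<longlongrightarrow> (\<chi> j. optimal_weight B' W' j)) (prob_filter M)"
proof (rule vec_tendstoI)
  fix j
  have W: "((\<lambda>z. real (ks (fst z) j) / real (k (fst z)) / (gh (fst z) (snd z))\<^sup>2) \<longlongrightarrow> W' j) (prob_filter M)" for j
    unfolding W'_def using \<gamma>_pos by (intro tendsto_divide filterlim_fst_compose[OF ks_share] tendsto_power gh_limit) auto
  have "((\<lambda>z. optimal_weight (\<lambda>i. bias_vector (ns (fst z)) (ks (fst z)) (gh (fst z) (snd z)) (bh (fst z) (snd z)) (rh (fst z) (snd z)) $ i)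
       (\<lambda>j. real (ks (fst z) j) / real (k (fst z)) / (gh (fst z) (snd z))\<^sup>2) j) \<longlongrightarrow> optimal_weight B' W' j) (prob_filter M)"
    by (intro optimal_weight_tendsto W W'_pos) (unfold B'_def, rule bias_vector_limit)
  then show "((\<lambda>z. Wa (fst z) (snd z) $ j) \<longlongrightarrow> (\<chi> j. optimal_weight B' W' j) $ j) (prob_filter M)"
    unfolding vec_lambda_beta
    by (rule Lim_transform_eventually) (use amse_weights_eq_optimal in eventually_elim, simp)
qed

lemma amse_weights_sum: "\<forall>\<^sub>F z in prob_filter M. (\<Sum>j\<in>UNIV. Wa (fst z) (snd z) $ j) = 1"
  using amse_weights_eq_optimal gh_nonzero
proof eventually_elim
  case (elim z)
  have "0 < real (ks (fst z) j) / (real (k (fst z)) * (gh (fst z) (snd z))\<^sup>2)" for j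
    using elim(2) k_ge_1[of "fst z" j] k_pos[of "fst z"] by (intro divide_pos_pos mult_pos_pos) auto
  then show ?case using elim(1) by (simp add: sum_optimal_weight)
qed

lemma amse_weights_measurable: "(\<lambda>w. Wa n w $ j) \<in> borel_measurable M"
  unfolding amse_weights_unfold by (intro amse_weights_of_measurable k_ge_1 estimators_measurable)

text \<open>The threshold algebra is applied with s = S 0, s1 = S \<rho> and s2 = S (2 \<rho>). Its
  strict inequalities require that the d_j are not all equal, which is where the nontriviality
  hypothesis enters.\<close>

lemma amse_comparison:
  assumes nontrivial: "\<not> (\<forall>j. b $ j / c $ j = 1)"
  defines "S \<equiv> (\<lambda>\<alpha>. \<Sum>j\<in>UNIV. d $ j powr \<alpha> / c $ j)"
  shows "(lam / (1 - \<rho>) * (\<Sum>j\<in>UNIV. d $ j powr \<rho> * optimal_weight B' W' j))\<^sup>2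
      + \<gamma>\<^sup>2 * (\<Sum>j\<in>UNIV. 1 / c $ j) * (\<Sum>j\<in>UNIV. c $ j * (optimal_weight B' W' j)\<^sup>2)
      < (lam / (1 - \<rho>))\<^sup>2 + \<gamma>\<^sup>2 \<longleftrightarrow>
     \<bar>lam\<bar> > \<gamma> * (1 - \<rho>) * sqrt (((S \<rho>)\<^sup>2 - (S 0)\<^sup>2) / (S 0 * S (2 * \<rho>) - (S \<rho>)\<^sup>2))"
proof -
  define l where "l = lam / (1 - \<rho>)"
  have S0: "S 0 = S0" using d_pos by (simp add: S_def S0_def less_imp_neq[symmetric])
  have g2: "\<gamma>\<^sup>2 > 0" using \<gamma>_pos by simp
  have c: "c $ j \<noteq> 0" for j using c_pos[of j] by simp
  \<comment> \<open>Equal d_j would make every c_j / b_j equal to its value at \<open>first\<close>,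
    which is 1 because b and c at \<open>first\<close> are limits of ratios of a sequence to
    itself.\<close>
  have "\<exists>j. d $ j \<noteq> d $ first"
  proof (rule ccontr)
    assume "\<nexists>j. d $ j \<noteq> d $ first"
    then have deq: "d $ j = d $ first" for j by blast
    have b1: "b $ first = 1"
    proof (rule LIMSEQ_unique[OF n_ratio])
      show "(\<lambda>n. real (ns n first) / real (ns n first)) \<longlonglongrightarrow> 1"
        by (rule Lim_transform_eventually[OF tendsto_const]) (use ns_pos[of first] in eventually_elim, simp)
    qed
    have c1: "c $ first = 1"
    proof (rule LIMSEQ_unique[OF k_ratio])
      show "(\<lambda>n. real (ks n first) / real (ks n first)) \<longlonglongrightarrow> 1"
        by (rule Lim_transform_eventually[OF tendsto_const]) (use k_ge_1[of _ first] in \<open>auto intro!: always_eventually simp: Suc_le_eq\<close>)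
    qed
    have "c $ j / b $ j = c $ first / b $ first" for j
    proof -
      define K where "K = S0 / (\<Sum>i\<in>UNIV. 1 / b $ i)"
      have "K \<noteq> 0" using S0_pos B0_pos by (simp add: K_def)
      moreover have "d $ i = (c $ i / b $ i) * K" for i by (simp add: d_def S0_def K_def)
      ultimately show ?thesis using deq[of j] by (metis mult_cancel_right)
    qed
    then have "b $ j / c $ j = 1" for j using b1 c1 b_pos[of j] c_pos[of j] by (simp add: field_simps)
    with nontrivial show False by blast
  qed
  then obtain j0 where j0: "d $ j0 \<noteq> d $ first" by blast
  \<comment> \<open>In the weights 1 / c_j the d_j have mean 1, so the linear term of the tangent at
    1 drops out of the next comparison.\<close>
  have sd: "(\<Sum>j\<in>UNIV. d $ j / c $ j) = S0"
  proof -
    have "(\<Sum>j\<in>UNIV. d $ j / c $ j) = (\<Sum>j\<in>UNIV. 1 / b $ j * (S0 / (\<Sum>i\<in>UNIV. 1 / b $ i)))"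
      by (intro sum.cong refl) (simp add: d_def S0_def c)
    also have "\<dots> = (\<Sum>j\<in>UNIV. 1 / b $ j) * (S0 / (\<Sum>i\<in>UNIV. 1 / b $ i))" by (simp only: sum_distrib_right)
    also have "\<dots> = S0" using B0_pos by simp
    finally show ?thesis .
  qed
  have s1: "S0 < S \<rho>"
  proof -
    have "\<exists>j1. d $ j1 \<noteq> 1" using j0 by metis
    then obtain j1 where j1: "d $ j1 \<noteq> 1" by blast
    have "(\<Sum>j\<in>UNIV. (1 + \<rho> * (d $ j - 1)) / c $ j) < S \<rho>"
      unfolding S_def
    proof (rule sum_strict_mono_ex1)
      show "\<forall>j\<in>UNIV. (1 + \<rho> * (d $ j - 1)) / c $ j \<le> d $ j powr \<rho> / c $ j"
        by (intro ballI divide_right_mono powr_neg_tangent(1) d_pos \<rho>_neg less_imp_le[OF c_pos])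
      show "\<exists>j\<in>UNIV. (1 + \<rho> * (d $ j - 1)) / c $ j < d $ j powr \<rho> / c $ j"
        using powr_neg_tangent(2)[OF d_pos \<rho>_neg j1] c_pos[of j1] by (intro bexI[of _ j1] divide_strict_right_mono) auto
    qed simp
    also have "(\<Sum>j\<in>UNIV. (1 + \<rho> * (d $ j - 1)) / c $ j) = (\<Sum>j\<in>UNIV. 1 / c $ j + \<rho> * (d $ j / c $ j - 1 / c $ j))"
      by (intro sum.cong refl) (simp add: add_divide_distrib diff_divide_distrib right_diff_distrib)
    also have "\<dots> = S0" using sd by (simp add: sum.distrib sum_subtractf sum_distrib_left[symmetric] S0_def)
    finally show ?thesis .
  qed
  have s2: "(S \<rho>)\<^sup>2 < S0 * S (2 * \<rho>)"
  proof -
    define y where "y j = d $ j powr \<rho>" for j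
    \<comment> \<open>The weighted mean of the d_j^\<rho>. Their weighted variance is positive
      because a nonzero exponent keeps different d_j apart, and expanding it gives the strict
      Cauchy-Schwarz inequality.\<close>
    define m where "m = S \<rho> / S0"
    have y2: "(y j)\<^sup>2 = d $ j powr (2 * \<rho>)" for j
      by (simp only: y_def mult_2 powr_add power2_eq_square)
    have inj: "y j = y i \<Longrightarrow> d $ j = d $ i" for i j
      using d_pos[of i] d_pos[of j] \<rho>_neg by (simp add: y_def powr_def)
    have "\<exists>j. y j \<noteq> m"
    proof (rule ccontr)
      assume "\<nexists>j. y j \<noteq> m"
      then have "y j0 = y first" by metis
      then show False using inj j0 by blast
    qed
    then obtain j2 where j2: "y j2 \<noteq> m" by blast
    have "0 < (\<Sum>j\<in>UNIV. (y j - m)\<^sup>2 / c $ j)"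
      using j2 c_pos by (intro sum_pos2[of _ j2]) (auto simp: less_imp_le)
    also have "\<dots> = (\<Sum>j\<in>UNIV. d $ j powr (2 * \<rho>) / c $ j - 2 * m * (d $ j powr \<rho> / c $ j) + m\<^sup>2 * (1 / c $ j))"
      unfolding y2[symmetric] y_def[symmetric]
      by (intro sum.cong refl) (simp add: power2_diff add_divide_distrib diff_divide_distrib mult_ac)
    also have "\<dots> = S (2 * \<rho>) - 2 * m * S \<rho> + m\<^sup>2 * S0"
      unfolding sum.distrib sum_subtractf sum_distrib_left[symmetric] S_def S0_def ..
    also have "\<dots> = S (2 * \<rho>) - (S \<rho>)\<^sup>2 / S0"
      using S0_pos by (simp add: m_def power2_eq_square field_simps)
    finally show ?thesis using S0_pos by (simp add: pos_divide_less_eq mult.commute)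
  qed
  have q: "(\<Sum>i\<in>UNIV. (B' i)\<^sup>2 * W' i) = l\<^sup>2 * S (2 * \<rho>) / (\<gamma>\<^sup>2 * S0)"
  proof -
    have y2: "(d $ j powr \<rho>)\<^sup>2 = d $ j powr (2 * \<rho>)" for j
      by (simp only: mult_2 powr_add power2_eq_square)
    show ?thesis unfolding S_def sum_distrib_left sum_divide_distrib
      by (intro sum.cong refl) (simp add: B'_def W'_def l_def[symmetric] power_mult_distrib y2 mult_ac)
  qed
  have r: "(\<Sum>i\<in>UNIV. W' i * B' i) = l * S \<rho> / (\<gamma>\<^sup>2 * S0)"
    unfolding S_def sum_distrib_left sum_divide_distrib
    by (intro sum.cong refl) (simp add: B'_def W'_def l_def[symmetric] mult_ac)
  have w: "(\<Sum>i\<in>UNIV. W' i) = 1 / \<gamma>\<^sup>2"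
  proof -
    have "(\<Sum>i\<in>UNIV. W' i) = (\<Sum>i\<in>UNIV. 1 / c $ i) / (S0 * \<gamma>\<^sup>2)"
      unfolding sum_divide_distrib by (intro sum.cong refl) (simp add: W'_def)
    then show ?thesis using S0_pos by (simp add: S0_def)
  qed
  have m: "lam / (1 - \<rho>) * (\<Sum>j\<in>UNIV. d $ j powr \<rho> * optimal_weight B' W' j) = (\<Sum>j\<in>UNIV. B' j * optimal_weight B' W' j)"
    unfolding sum_distrib_left by (intro sum.cong refl) (simp add: B'_def)
  have v: "\<gamma>\<^sup>2 * (\<Sum>j\<in>UNIV. 1 / c $ j) * (\<Sum>j\<in>UNIV. c $ j * (optimal_weight B' W' j)\<^sup>2) = (\<Sum>j\<in>UNIV. (optimal_weight B' W' j)\<^sup>2 / W' j)"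
    unfolding sum_distrib_left S0_def[symmetric] by (intro sum.cong refl) (simp add: W'_def mult_ac)
  show ?thesis
    unfolding m v unfolding optimal_weight_value[OF W'_pos] unfolding q r w S0 l_def
  proof (rule amse_threshold_algebra[OF \<gamma>_pos \<rho>_neg S0_pos s1 s2])
    show "0 < (1 + (lam / (1 - \<rho>))\<^sup>2 * S (2 * \<rho>) / (\<gamma>\<^sup>2 * S0)) * (1 / \<gamma>\<^sup>2) - (lam / (1 - \<rho>) * S \<rho> / (\<gamma>\<^sup>2 * S0))\<^sup>2"
      using optimal_weight_denominator[of W' B', OF W'_pos] unfolding q r w l_def .
  qed
qed

end

end

theorem corollary9:
  fixes M :: "'a measure"
    and X :: "'m::finite \<Rightarrow> nat \<Rightarrow> 'a \<Rightarrow> real"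
    and D :: "real measure"
    and \<gamma> \<rho> lam :: real
    and A :: "real \<Rightarrow> real"
    and ns ks :: "nat \<Rightarrow> 'm \<Rightarrow> nat"
    and k :: "nat \<Rightarrow> nat"
    and first :: 'm
    and b c d :: "real^'m"
    and p :: "nat \<Rightarrow> real"
    and \<omega> :: "real^'m"
    and \<omega>h :: "nat \<Rightarrow> 'a \<Rightarrow> real^'m"
    and F q :: "real \<Rightarrow> real"
    and S :: "real \<Rightarrow> real"
    and lam0 :: real
    and x :: "'a \<Rightarrow> 'm \<Rightarrow> nat \<Rightarrow> real"
    and rate :: "nat \<Rightarrow> real"
  defines "F \<equiv> cdf D"
    and "q \<equiv> quantile F"
    and "k \<equiv> (\<lambda>n. \<Sum>j\<in>UNIV. ks n j)"
    and "d \<equiv> (\<chi> j. (c $ j / b $ j) * ((\<Sum>i\<in>UNIV. 1 / c $ i) / (\<Sum>i\<in>UNIV. 1 / b $ i)))"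
    and "S \<equiv> (\<lambda>\<alpha>. \<Sum>j\<in>UNIV. d $ j powr \<alpha> / c $ j)"
    and "lam0 \<equiv> \<gamma> * (1 - \<rho>) * sqrt (((S \<rho>)\<^sup>2 - (S 0)\<^sup>2) / (S 0 * S (2 * \<rho>) - (S \<rho>)\<^sup>2))"
    and "x \<equiv> (\<lambda>w j i. X j i w)"
    and "rate \<equiv> (\<lambda>n. sqrt (real (k n)) / ln (real (k n) / (real n * p n)))"
  assumes prob: "prob_space M"
    and indep: "prob_space.indep_vars M (\<lambda>_. borel) (\<lambda>(j, i). X j i) UNIV"
    and ident: "\<And>j i. distr M borel (X j i) = D"
    and F_cont: "continuous_on UNIV F"
    and C2: "second_order_cond F \<gamma> \<rho> A"
    and \<rho>_neg: "\<rho> < 0"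
    and n_total: "\<And>n. (\<Sum>j\<in>UNIV. ns n j) = n"
    and k_ge_1: "\<And>n j. ks n j \<ge> 1"
    and b_pos: "\<And>j. b $ j > 0"
    and c_pos: "\<And>j. c $ j > 0"
    and n_ratio: "\<And>j. (\<lambda>n. real (ns n first) / real (ns n j)) \<longlonglongrightarrow> b $ j"
    and k_ratio: "\<And>j. (\<lambda>n. real (ks n first) / real (ks n j)) \<longlonglongrightarrow> c $ j"
    and k_inf: "filterlim k at_top sequentially"
    and k_n: "(\<lambda>n. real (k n) / real n) \<longlonglongrightarrow> 0"
    and bias: "(\<lambda>n. sqrt (real (k n)) * A (real n / real (k n))) \<longlonglongrightarrow> lam"
    and p_range: "\<And>n. 0 < p n \<and> p n < 1"
    and p_lim: "p \<longlonglongrightarrow> 0"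
    and knp: "filterlim (\<lambda>n. real (k n) / (real n * p n)) at_top sequentially"
    and rate_inf: "filterlim rate at_top sequentially"
    and weights: "weight_sequence M \<omega>h \<omega>"
  shows
    "little_o_prob M (\<lambda>n w.
        rate n * (pooled_weissman (ns n) (ks n) (x w) (p n) (\<omega>h n w) / q (1 - p n) - 1)
        - sqrt (real (k n)) * (pooled_hill (ns n) (ks n) (x w) \<omega> - \<gamma>))
     \<and>
     tendsto_in_distr M (\<lambda>n w.
        rate n * (pooled_weissman (ns n) (ks n) (x w) (p n) (\<omega>h n w) / q (1 - p n) - 1))
       (normal_distr (lam / (1 - \<rho>) * (\<Sum>j\<in>UNIV. d $ j powr \<rho> * \<omega> $ j))
                     (\<gamma>\<^sup>2 * (\<Sum>j\<in>UNIV. 1 / c $ j) * (\<Sum>j\<in>UNIV. c $ j * (\<omega> $ j)\<^sup>2)))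
     \<and>
     ((\<forall>j. \<exists>e \<in> O(\<lambda>n. 1 / sqrt (real (k n))).
         eventually (\<lambda>n. real (ks n j) / real (ns n j) = real (k n) / real n * (1 + e n)) sequentially)
      \<longrightarrow>
      little_o_prob M (\<lambda>n w.
        rate n * (pooled_weissman (ns n) (ks n) (x w) (p n) (var_weights (ks n)) / q (1 - p n)
                  - combined_weissman (ns n) (x w) (k n) (p n) / q (1 - p n))))
     \<and>
     (\<forall>\<beta> (\<beta>h :: nat \<Rightarrow> 'a \<Rightarrow> real^'m) (\<rho>h :: nat \<Rightarrow> 'a \<Rightarrow> real^'m)
        (\<omega>g :: nat \<Rightarrow> 'a \<Rightarrow> real^'m) (\<omega>b :: nat \<Rightarrow> 'a \<Rightarrow> real^'m) (\<omega>r :: nat \<Rightarrow> 'a \<Rightarrow> real^'m).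
        \<not> (\<forall>j. b $ j / c $ j = 1) \<and>
        (\<forall>t>0. A t = \<gamma> * \<beta> * t powr \<rho>) \<and>
        (\<forall>j. tendsto_in_prob M (\<lambda>n w. \<beta>h n w $ j) \<beta>) \<and>
        (\<forall>n j. (\<lambda>w. \<rho>h n w $ j) \<in> borel_measurable M) \<and>
        (\<forall>j. little_o_prob M (\<lambda>n w. (\<rho>h n w $ j - \<rho>) * ln (real (ns n j)))) \<and>
        (\<exists>v. weight_sequence M \<omega>g v) \<and>
        (\<exists>v. weight_sequence M \<omega>b v) \<and>
        (\<exists>v. weight_sequence M \<omega>r v)
        \<longrightarrow>
        (\<exists>a1 a2.
           has_AMSE M F k p
             (\<lambda>n w. pooled_weissman (ns n) (ks n) (x w) (p n)
                (amse_weights (ns n) (ks n) (x w) (\<beta>h n w) (\<rho>h n w) (\<omega>g n w) (\<omega>b n w) (\<omega>r n w))) a1 \<and>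
           has_AMSE M F k p
             (\<lambda>n w. combined_weissman (ns n) (x w) (k n) (p n)) a2 \<and>
           (eventually (\<lambda>n. a1 n < a2 n) sequentially \<longleftrightarrow> \<bar>lam\<bar> > lam0)))"
proof -
  interpret prob_space M by (rule prob)
  have X_meas: "X j i \<in> borel_measurable M" for j i
  proof -
    have "(case (j, i) of (j, i) \<Rightarrow> X j i) \<in> borel_measurable M"
      using indep unfolding indep_vars_def2 by (elim conjE) (erule bspec, simp)
    then show ?thesis by simp
  qed
  have D: "real_distribution D"
    unfolding ident[of undefined undefined, symmetric] by (rule real_distribution_distr) (rule X_meas)
  obtain f0 g where g: "regularly_varying g \<rho>"
    and Q: "\<forall>\<^sub>F s in at_top. 0 < quantile (cdf D) (1 - exp (- s)) \<and>
           ln (quantile (cdf D) (1 - exp (- s))) = f0 + \<gamma> * s - g s"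
    and gA: "((\<lambda>s. g s / A (exp s)) \<longlongrightarrow> - 1 / \<rho>) at_top"
    by (rule second_order_expansion[OF D F_cont[unfolded F_def] C2[unfolded F_def] \<rho>_neg])
  have \<gamma>: "\<gamma> > 0" using C2 by (simp add: second_order_cond_def)
  interpret P: pooled_samples M X D \<gamma> \<rho> lam A ns ks first b c p f0 g k rate d
    by (intro pooled_samples.intro pooled_samples_axioms.intro prob indep ident F_cont[unfolded F_def]
          \<rho>_neg \<gamma> n_total k_ge_1 b_pos c_pos n_ratio k_ratio k_inf k_n bias p_range knp rate_inf g Q gA
          k_def[THEN meta_eq_to_obj_eq] rate_def[THEN meta_eq_to_obj_eq] d_def[THEN meta_eq_to_obj_eq])
  have px: "P.x = x" by (simp add: fun_eq_iff P.x_def x_def)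
  have q: "q u = quantile (cdf D) u" for u by (simp add: q_def F_def)
  note W = weight_sequence_limit[OF weights]
  have part1: "little_o_prob M (\<lambda>n w.
        rate n * (pooled_weissman (ns n) (ks n) (x w) (p n) (\<omega>h n w) / q (1 - p n) - 1)
        - sqrt (real (k n)) * (pooled_hill (ns n) (ks n) (x w) \<omega> - \<gamma>))"
    unfolding tendsto_in_prob_iff q
  proof (intro conjI allI)
    note [measurable] = P.pooled_weissman_measurable[of "\<omega>h _", OF W(3), unfolded px]
      P.pooled_hill_measurable[of "\<lambda>_. \<omega>", unfolded px]
    show "(\<lambda>w. rate n * (pooled_weissman (ns n) (ks n) (x w) (p n) (\<omega>h n w) / quantile (cdf D) (1 - p n) - 1)
        - sqrt (real (k n)) * (pooled_hill (ns n) (ks n) (x w) \<omega> - \<gamma>)) \<in> borel_measurable M" for n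
      by measurable
  qed (rule P.pooled_weissman_expansion(1)[OF W(1,2), unfolded px])
  have part1': "tendsto_in_distr M (\<lambda>n w.
        rate n * (pooled_weissman (ns n) (ks n) (x w) (p n) (\<omega>h n w) / q (1 - p n) - 1))
       (normal_distr (lam / (1 - \<rho>) * (\<Sum>j\<in>UNIV. d $ j powr \<rho> * \<omega> $ j))
                     (\<gamma>\<^sup>2 * (\<Sum>j\<in>UNIV. 1 / c $ j) * (\<Sum>j\<in>UNIV. c $ j * (\<omega> $ j)\<^sup>2)))"
    unfolding q by (rule P.pooled_weissman_normal(1)[OF W, unfolded px])
  have part2: "little_o_prob M (\<lambda>n w.
        rate n * (pooled_weissman (ns n) (ks n) (x w) (p n) (var_weights (ks n)) / q (1 - p n)
                  - combined_weissman (ns n) (x w) (k n) (p n) / q (1 - p n)))"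
    if H: "\<forall>j. \<exists>e \<in> O(\<lambda>n. 1 / sqrt (real (k n))).
         eventually (\<lambda>n. real (ks n j) / real (ns n j) = real (k n) / real n * (1 + e n)) sequentially"
  proof -
    \<comment> \<open>Sampling fractions proportional up to a relative error tending to 0 force the
      relative ratio, whose limit is d_j, to converge to 1.\<close>
    have d1: "d $ j = 1" for j
    proof (rule LIMSEQ_unique[OF P.relative_ratio])
      obtain e where e: "e \<in> O(\<lambda>n. 1 / sqrt (real (k n)))"
        and ev: "eventually (\<lambda>n. real (ks n j) / real (ns n j) = real (k n) / real n * (1 + e n)) sequentially"
        using H by blast
      obtain C where "\<forall>\<^sub>F n in sequentially. norm (e n) \<le> C * norm (1 / sqrt (real (k n)))"
        using e by (auto elim: landau_o.bigE)
      moreover have "(\<lambda>n. C * norm (1 / sqrt (real (k n)))) \<longlonglongrightarrow> 0"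
        by (intro tendsto_mult_right_zero tendsto_norm_zero P.comb.inverse_sqrt_k)
      ultimately have "e \<longlonglongrightarrow> 0" by (rule Lim_null_comparison)
      then have "(\<lambda>n. inverse (1 + e n)) \<longlonglongrightarrow> inverse (1 + 0)" by (intro tendsto_intros) auto
      then have "(\<lambda>n. inverse (1 + e n)) \<longlonglongrightarrow> 1" by simp
      then show "(\<lambda>n. (real (ns n j) / real (ks n j)) / (real n / real (k n))) \<longlonglongrightarrow> 1"
      proof (rule Lim_transform_eventually)
        show "\<forall>\<^sub>F n in sequentially. inverse (1 + e n) = (real (ns n j) / real (ks n j)) / (real n / real (k n))"
          using ev P.n_pos
        proof eventually_elim
          case (elim n)
          have "inverse (1 + e n) = (real (k n) / real n) / (real (k n) / real n * (1 + e n))"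
            using elim(2) P.k_pos[of n] by (simp add: inverse_eq_divide)
          also have "\<dots> = (real (ns n j) / real (ks n j)) / (real n / real (k n))"
            unfolding elim(1)[symmetric] by (simp add: mult.commute)
          finally show ?case .
        qed
      qed
    qed
    show ?thesis
      unfolding tendsto_in_prob_iff q
    proof (intro conjI allI)
      note [measurable] = P.pooled_weissman_measurable[of "\<lambda>_. var_weights (ks _)", unfolded px]
        P.combined_weissman_measurable[unfolded px]
      show "(\<lambda>w. rate n * (pooled_weissman (ns n) (ks n) (x w) (p n) (var_weights (ks n)) / quantile (cdf D) (1 - p n)
                  - combined_weissman (ns n) (x w) (k n) (p n) / quantile (cdf D) (1 - p n))) \<in> borel_measurable M" for n
        by measurable
    qed (rule P.hill_equivalence[OF d1, unfolded px])
  qed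
  have part3: "\<exists>a1 a2.
           has_AMSE M F k p
             (\<lambda>n w. pooled_weissman (ns n) (ks n) (x w) (p n)
                (amse_weights (ns n) (ks n) (x w) (\<beta>h n w) (\<rho>h n w) (\<omega>g n w) (\<omega>b n w) (\<omega>r n w))) a1 \<and>
           has_AMSE M F k p
             (\<lambda>n w. combined_weissman (ns n) (x w) (k n) (p n)) a2 \<and>
           (eventually (\<lambda>n. a1 n < a2 n) sequentially \<longleftrightarrow> \<bar>lam\<bar> > lam0)"
    if H: "\<not> (\<forall>j. b $ j / c $ j = 1)" "\<forall>t>0. A t = \<gamma> * \<beta> * t powr \<rho>"
      "\<forall>j. tendsto_in_prob M (\<lambda>n w. \<beta>h n w $ j) \<beta>"
      "\<forall>n j. (\<lambda>w. \<rho>h n w $ j) \<in> borel_measurable M"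
      "\<forall>j. little_o_prob M (\<lambda>n w. (\<rho>h n w $ j - \<rho>) * ln (real (ns n j)))"
      "weight_sequence M \<omega>g vg" "weight_sequence M \<omega>b vb" "weight_sequence M \<omega>r vr"
    for \<beta> \<beta>h \<rho>h \<omega>g \<omega>b \<omega>r vg vb vr
  proof -
    have hyps: "\<And>t. t > 0 \<Longrightarrow> A t = \<gamma> * \<beta> * t powr \<rho>"
      "\<And>j. tendsto_in_prob M (\<lambda>n w. \<beta>h n w $ j) \<beta>"
      "\<And>n j. (\<lambda>w. \<rho>h n w $ j) \<in> borel_measurable M"
      "\<And>j. little_o_prob M (\<lambda>n w. (\<rho>h n w $ j - \<rho>) * ln (real (ns n j)))"
      "weight_sequence M \<omega>g vg" "weight_sequence M \<omega>b vb" "weight_sequence M \<omega>r vr"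
      using H by auto
    \<comment> \<open>The limit of the estimated AMSE weights; the normal limit for random weights
      is applied with this vector in place of \<omega>.\<close>
    define \<omega>' :: "real^'m" where "\<omega>' = (\<chi> j. optimal_weight P.B' P.W' j)"
    define m where "m = lam / (1 - \<rho>) * (\<Sum>j\<in>UNIV. d $ j powr \<rho> * \<omega>' $ j)"
    define v where "v = \<gamma>\<^sup>2 * (\<Sum>j\<in>UNIV. 1 / c $ j) * (\<Sum>j\<in>UNIV. c $ j * (\<omega>' $ j)\<^sup>2)"
    \<comment> \<open>The common factor of both AMSE sequences is eventually positive, so their
      order for large n is that of the constants multiplying it.\<close>
    define fac where "fac n = (ln (real (k n) / (real n * p n)))\<^sup>2 / real (k n)" for n
    have fac: "\<forall>\<^sub>F n in sequentially. 0 < fac n"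
      using P.ln_gap P.gap_pos
      by eventually_elim (use P.k_pos in \<open>simp add: fac_def\<close>)
    note N = P.pooled_weissman_normal[OF P.amse_weights_limit[OF hyps] P.amse_weights_sum[OF hyps]
        P.amse_weights_measurable[OF hyps], unfolded px, folded \<omega>'_def, folded m_def v_def]
    have A1: "has_AMSE M F k p
             (\<lambda>n w. pooled_weissman (ns n) (ks n) (x w) (p n)
                (amse_weights (ns n) (ks n) (x w) (\<beta>h n w) (\<rho>h n w) (\<omega>g n w) (\<omega>b n w) (\<omega>r n w))) (\<lambda>n. fac n * (m\<^sup>2 + v))"
      unfolding has_AMSE_def fac_def F_def
      by (intro exI[of _ m] exI[of _ v] conjI allI refl N(2) N(1)[unfolded rate_def])
    have A2: "has_AMSE M F k p (\<lambda>n w. combined_weissman (ns n) (x w) (k n) (p n)) (\<lambda>n. fac n * ((lam / (1 - \<rho>))\<^sup>2 + \<gamma>\<^sup>2))"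
      unfolding has_AMSE_def fac_def F_def
      by (intro exI[of _ "lam / (1 - \<rho>)"] exI[of _ "\<gamma>\<^sup>2"] conjI allI refl P.combined_weissman_normal[unfolded rate_def px])
         (use \<gamma> in simp)
    have "eventually (\<lambda>n. fac n * (m\<^sup>2 + v) < fac n * ((lam / (1 - \<rho>))\<^sup>2 + \<gamma>\<^sup>2)) sequentially \<longleftrightarrow>
        m\<^sup>2 + v < (lam / (1 - \<rho>))\<^sup>2 + \<gamma>\<^sup>2"
    proof
      assume "eventually (\<lambda>n. fac n * (m\<^sup>2 + v) < fac n * ((lam / (1 - \<rho>))\<^sup>2 + \<gamma>\<^sup>2)) sequentially"
      with fac have "eventually (\<lambda>n :: nat. m\<^sup>2 + v < (lam / (1 - \<rho>))\<^sup>2 + \<gamma>\<^sup>2) sequentially"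
        by eventually_elim (simp only: mult_less_cancel_left_pos)
      then show "m\<^sup>2 + v < (lam / (1 - \<rho>))\<^sup>2 + \<gamma>\<^sup>2" by simp
    next
      assume "m\<^sup>2 + v < (lam / (1 - \<rho>))\<^sup>2 + \<gamma>\<^sup>2"
      then show "eventually (\<lambda>n. fac n * (m\<^sup>2 + v) < fac n * ((lam / (1 - \<rho>))\<^sup>2 + \<gamma>\<^sup>2)) sequentially"
        using fac by (auto elim!: eventually_mono intro: mult_strict_left_mono)
    qed
    also have "\<dots> \<longleftrightarrow> \<bar>lam\<bar> > lam0"
      using P.amse_comparison[OF hyps H(1)] by (simp add: m_def v_def \<omega>'_def lam0_def S_def)
    finally show ?thesis using A1 A2 by blast
  qed
  show ?thesis
    using part1 part1' part2 part3 by blast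
qed

end
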